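(* There is a non-increasing function $\nu:(2,\infty)\to\mathbb{R}_+$ with the following property. Let $p>2$, $B\geq 1$, and let $n,N$ be positive integers with $N\geq 2n$. Let $X$ be a centered $n$-dimensional random vector with covariance matrix $\Sigma$ whose distribution belongs to the class $\mathcal{C}(n,p,B)$. Let $X_1,X_2,\dots,X_N$ be independent copies of $X$, and let $\Sigma_N=\frac{1}{N}\sum_{i=1}^N X_iX_i^T$. Then, with probability at least $1-\frac{1}{n}$, $$\nu(p)^{-1}\frac{\|\Sigma_N-\Sigma\|_{2\to 2}}{\|\Sigma\|_{2\to 2}}\leq \frac{1}{N}\max_{i\leq N}\langle X_i,\Sigma^{-1}X_i\rangle + B^{2/p}\Bigl(\frac{n}{N}\Bigr)^{\frac{p-2}{p}}\log^4\frac{N}{n} + B^{2/p}\Bigl(\frac{n}{N}\Bigr)^{\frac{\min(p,4)-2}{\min(p,4)}}.$$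
   Context: For $p>2$ and $B\geq 1$, $\mathcal{C}(n,p,B)$ denotes the set of distributions of centered random vectors $X$ in $\mathbb{R}^n$ with covariance matrix $\Sigma=\mathbb{E}XX^T$ satisfying $\mathbb{E}|\langle X,a\rangle|^p\leq B\,\langle a,\Sigma a\rangle^{p/2}$ for all $a\in\mathbb{R}^n$. $\|\cdot\|_{2\to 2}$ is the spectral norm. $\Sigma$ is assumed invertible so that $\Sigma^{-1}$ makes sense. $\log$ is the natural logarithm. *)

theory Defs
  imports "HOL-Probability.Probability"
begin

text \<open>Vectors in R^n are functions nat => real (coordinates 0..n-1), measured with
  the product sigma-algebra PiM {..<n} (\<lambda>_. borel). Matrices are nat => nat => real,
  indexed by {..<n} x {..<n}.\<close>

definition vec_space :: "nat \<Rightarrow> (nat \<Rightarrow> real) measure" where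
  "vec_space n = PiM {..<n} (\<lambda>_. borel)"

definition inner_n :: "nat \<Rightarrow> (nat \<Rightarrow> real) \<Rightarrow> (nat \<Rightarrow> real) \<Rightarrow> real" where
  "inner_n n a x = (\<Sum>j<n. a j * x j)"

definition mat_vec :: "nat \<Rightarrow> (nat \<Rightarrow> nat \<Rightarrow> real) \<Rightarrow> (nat \<Rightarrow> real) \<Rightarrow> (nat \<Rightarrow> real)" where
  "mat_vec n A v = (\<lambda>i. \<Sum>j<n. A i j * v j)"

definition is_inverse_mat :: "nat \<Rightarrow> (nat \<Rightarrow> nat \<Rightarrow> real) \<Rightarrow> (nat \<Rightarrow> nat \<Rightarrow> real) \<Rightarrow> bool" where
  "is_inverse_mat n A T \<longleftrightarrow>
     (\<forall>i<n. \<forall>j<n. (\<Sum>k<n. A i k * T k j) = (if i = j then 1 else 0)) \<and>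
     (\<forall>i<n. \<forall>j<n. (\<Sum>k<n. T i k * A k j) = (if i = j then 1 else 0))"

definition invertible_n :: "nat \<Rightarrow> (nat \<Rightarrow> nat \<Rightarrow> real) \<Rightarrow> bool" where
  "invertible_n n A \<longleftrightarrow> (\<exists>T. is_inverse_mat n A T)"

definition inv_n :: "nat \<Rightarrow> (nat \<Rightarrow> nat \<Rightarrow> real) \<Rightarrow> (nat \<Rightarrow> nat \<Rightarrow> real)" where
  "inv_n n A = (SOME T. is_inverse_mat n A T)"

definition spec_norm :: "nat \<Rightarrow> (nat \<Rightarrow> nat \<Rightarrow> real) \<Rightarrow> real" where
  "spec_norm n A = (SUP v \<in> {v. (\<Sum>j<n. (v j)\<^sup>2) \<le> 1}. sqrt (\<Sum>i<n. (mat_vec n A v i)\<^sup>2))"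

definition cov_mat :: "(nat \<Rightarrow> real) measure \<Rightarrow> nat \<Rightarrow> nat \<Rightarrow> real" where
  "cov_mat \<mu> i j = (\<integral>x. x i * x j \<partial>\<mu>)"

definition class_C :: "nat \<Rightarrow> real \<Rightarrow> real \<Rightarrow> (nat \<Rightarrow> real) measure \<Rightarrow> bool" where
  "class_C n p B \<mu> \<longleftrightarrow>
     prob_space \<mu> \<and> sets \<mu> = sets (vec_space n) \<and>
     (\<forall>j<n. integrable \<mu> (\<lambda>x. x j) \<and> (\<integral>x. x j \<partial>\<mu>) = 0) \<and>
     (\<forall>j<n. integrable \<mu> (\<lambda>x. (x j)\<^sup>2)) \<and>
     (\<forall>a. (\<integral>\<^sup>+x. ennreal (\<bar>inner_n n a x\<bar> powr p) \<partial>\<mu>)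
            \<le> ennreal (B * (inner_n n a (mat_vec n (cov_mat \<mu>) a)) powr (p / 2)))"

definition emp_cov :: "nat \<Rightarrow> (nat \<Rightarrow> nat \<Rightarrow> real) \<Rightarrow> nat \<Rightarrow> nat \<Rightarrow> real" where
  "emp_cov N xs i j = (1 / real N) * (\<Sum>k<N. xs k i * xs k j)"

end

theory Submission
  imports Defs
begin

text \<open>Whitening turns \<open>\<Sigma>\<close> into the identity, so that one has to bound
  \<open>(\<Sum>k<N. \<langle>b, Z\<^sub>k\<rangle>\<^sup>2) - N\<close> uniformly over unit vectors \<open>b\<close>, and it suffices to do so on a net of
  \<open>exp (O(n))\<close> integer points. At a net point the squares below \<open>\<tau> = (B N / n) powr (2/p)\<close> obey a
  Bernstein bound, which produces the two powers of \<open>n / N\<close>. At most \<open>18 n\<close> of the squares exceed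
  \<open>\<tau>\<close> (Chernoff), and the sum of these is at most \<open>A\<close>, the largest value of \<open>\<bar>\<Sum>i. c\<^sub>i Z\<^sub>i\<bar>\<^sup>2\<close> over the
  unit vectors \<open>c\<close> with \<open>O(n)\<close> non-zero entries.

  The heart of the proof is the bound of \<open>A\<close> by the maximum of the \<open>\<bar>Z\<^sub>i\<bar>\<^sup>2\<close> plus
  \<open>N powr (2/p) * n powr (1 - 2/p) * ln (N / n) ^ 4\<close>. One may take the entries of \<open>c\<close> to be powers of 1/2 and
  splits the form \<open>\<Sum>i j. c\<^sub>i c\<^sub>j \<langle>Z\<^sub>i, Z\<^sub>j\<rangle>\<close> according to the level of the smaller entry. The
  contribution of a level is a sum of order statistics of \<open>\<bar>\<langle>\<Sum>i. c\<^sub>i Z\<^sub>i, Z\<^sub>j\<rangle>\<bar>\<close> in \<open>j\<close>. Random sampling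
  replaces \<open>c\<close> in the \<open>m\<close>-th order statistic by an integer vector supported on far fewer than \<open>m\<close>
  indices, and a union bound over such vectors and over sets of \<open>m\<close> indices is affordable because
  \<open>Z\<^sub>j\<close> is independent of the combination. Each order statistic is thus at most a multiple of
  \<open>sqrt A\<close> plus an error, and the resulting quadratic inequality is solved for \<open>A\<close>. Vectors \<open>Z\<^sub>i\<close> that are
  short are treated with trivial exclusions \<open>i = j\<close>; the long ones are rare, which improves the entropy of the
  union bound to a power of \<open>n\<close>, and pairs with an exceptionally large correlation are excluded.\<close>

section \<open>Restricted operator norms\<close>

text \<open>The obstacle is entropy. With p-th moments only, the event that \<open>h\<close> given
  values exceed a constant multiple of \<open>(N / h) powr (1/p)\<close> has a probability that,
  summed over the sets of \<open>h\<close> indices, is of order exp (- O(h)); a union bound over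
  vectors is affordable only if their support is shorter than about h / ln (N / h). The logarithm is
  the reason for two length scales. Put T = N powr (1/p) * n powr (1/2 - 1/p). Short vectors lose a
  factor sqrt (ln N) on each of about ln N levels, so the quadratic inequality ends with (ln N) ^ 3
  * T ^ 2. This fits under ln (N / n) ^ 4 only when N is at least of order n ^ 2. For smaller N, and
  for long vectors, the sum over the levels has to be dominated by the top level, where the
  logarithm is of order ln (N / n); this demands the finer control of the lower levels that excluded
  correlations provide. All constants depend on p only through a lower bound \<gamma>0 of 1/2 - 1/p,
  which is what makes a non-increasing \<nu> possible.\<close>

definition nrm :: "nat \<Rightarrow> (nat \<Rightarrow> real) \<Rightarrow> real" where
  "nrm n v = L2_set v {..<n}"

definition lin :: "nat \<Rightarrow> (nat \<Rightarrow> nat \<Rightarrow> real) \<Rightarrow> (nat \<Rightarrow> real) \<Rightarrow> (nat \<Rightarrow> real)" where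
  "lin N x c = (\<lambda>d. \<Sum>i<N. c i * x i d)"

lemma nrm_nonneg [simp]: "0 \<le> nrm n v"
  by (simp add: nrm_def)

lemma nrm_sq: "(nrm n v)\<^sup>2 = (\<Sum>d<n. (v d)\<^sup>2)"
  by (simp add: nrm_def L2_set_def sum_nonneg)

lemma inner_n_self: "inner_n n v v = (nrm n v)\<^sup>2"
  by (subst nrm_sq) (simp add: inner_n_def power2_eq_square)

lemma inner_n_comm: "inner_n n a b = inner_n n b a"
  by (simp add: inner_n_def mult.commute)

lemma inner_n_CS: "\<bar>inner_n n a b\<bar> \<le> nrm n a * nrm n b"
proof -
  have "\<bar>inner_n n a b\<bar> \<le> (\<Sum>j<n. \<bar>a j\<bar> * \<bar>b j\<bar>)"
    unfolding inner_n_def by (rule order_trans[OF sum_abs]) (simp add: abs_mult)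
  also have "\<dots> \<le> nrm n a * nrm n b"
    unfolding nrm_def by (rule L2_set_mult_ineq)
  finally show ?thesis .
qed

lemma nrm_triangle: "nrm n (\<lambda>d. a d + b d) \<le> nrm n a + nrm n b"
  unfolding nrm_def by (rule L2_set_triangle_ineq)

lemma nrm_scale: "nrm n (\<lambda>d. r * a d) = \<bar>r\<bar> * nrm n a"
proof -
  have "(nrm n (\<lambda>d. r * a d))\<^sup>2 = (\<bar>r\<bar> * nrm n a)\<^sup>2"
    by (simp add: nrm_sq power_mult_distrib sum_distrib_left)
  then show ?thesis by (simp add: power2_eq_iff_nonneg)
qed

lemma inner_n_lin: "inner_n n (lin N x c) b = (\<Sum>i<N. c i * inner_n n (x i) b)"
  unfolding inner_n_def lin_def
  by (simp add: sum_distrib_left sum_distrib_right, subst sum.swap) (simp add: mult.assoc)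

lemma inner_n_add_left: "inner_n n (\<lambda>d. a d + b d) c = inner_n n a c + inner_n n b c"
  by (simp add: inner_n_def distrib_right sum.distrib)

lemma inner_n_scale_left: "inner_n n (\<lambda>d. r * a d) c = r * inner_n n a c"
  by (simp add: inner_n_def sum_distrib_left mult.assoc)

lemma lin_add: "lin N x (\<lambda>i. c i + c' i) = (\<lambda>d. lin N x c d + lin N x c' d)"
  by (simp add: lin_def distrib_right sum.distrib fun_eq_iff)

lemma lin_scale: "lin N x (\<lambda>i. r * c i) = (\<lambda>d. r * lin N x c d)"
  by (simp add: lin_def sum_distrib_left mult.assoc fun_eq_iff)

lemma nrm_lin_sq: "(nrm n (lin N x c))\<^sup>2 = (\<Sum>j<N. \<Sum>i<N. c j * (c i * inner_n n (x i) (x j)))"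
proof -
  have "(nrm n (lin N x c))\<^sup>2 = (\<Sum>j<N. c j * inner_n n (x j) (lin N x c))"
    by (simp add: inner_n_self[symmetric] inner_n_lin)
  also have "\<dots> = (\<Sum>j<N. \<Sum>i<N. c j * (c i * inner_n n (x i) (x j)))"
    by (simp add: inner_n_comm[of n _ "lin N x c"] inner_n_lin sum_distrib_left)
  finally show ?thesis .
qed

text \<open>The restricted operator norm of the matrix with rows \<open>x i\<close>: the squared norm of
  a \<open>\<kappa>\<close>-sparse combination is at most \<open>A\<close> times that of its coefficients.\<close>

definition sparse_bound :: "nat \<Rightarrow> nat \<Rightarrow> nat \<Rightarrow> (nat \<Rightarrow> nat \<Rightarrow> real) \<Rightarrow> real \<Rightarrow> bool" where
  "sparse_bound n N \<kappa> x A \<longleftrightarrow>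
     (\<forall>c. card {i. i < N \<and> c i \<noteq> 0} \<le> \<kappa> \<longrightarrow> (nrm n (lin N x c))\<^sup>2 \<le> A * (\<Sum>i<N. (c i)\<^sup>2))"

text \<open>Duality of the operator norm: with the coefficients \<open>inner_n n (x i) b\<close> on
  \<open>I\<close>, the sum \<open>S\<close> in question is the inner product of the combination
  with \<open>b\<close>, so that \<open>S * S \<le> A * S * (nrm n b)\<^sup>2\<close>. It serves for
  the squares that are large in a fixed direction and for the rows of the Gram matrix.\<close>

lemma sparse_bound_dual:
  assumes sb: "sparse_bound n N \<kappa> x A" and I: "I \<subseteq> {..<N}" "card I \<le> \<kappa>" and A: "A \<ge> 0"
  shows "(\<Sum>i\<in>I. (inner_n n (x i) b)\<^sup>2) \<le> A * (nrm n b)\<^sup>2"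
proof -
  define c where "c i = (if i \<in> I then inner_n n (x i) b else 0)" for i
  define S where "S = (\<Sum>i\<in>I. (inner_n n (x i) b)\<^sup>2)"
  have S0: "S \<ge> 0" by (simp add: S_def sum_nonneg)
  have "card {i. i < N \<and> c i \<noteq> 0} \<le> card I"
    by (rule card_mono) (use I finite_subset in \<open>auto simp: c_def\<close>)
  with sb I have le: "(nrm n (lin N x c))\<^sup>2 \<le> A * (\<Sum>i<N. (c i)\<^sup>2)"
    unfolding sparse_bound_def by auto
  have cS: "(\<Sum>i<N. (c i)\<^sup>2) = S"
    unfolding S_def c_def using I
    by (subst sum.mono_neutral_cong_right[of "{..<N}" I]) auto
  have "inner_n n (lin N x c) b = S"
    unfolding S_def inner_n_lin c_def using I
    by (subst sum.mono_neutral_cong_right[of "{..<N}" I]) (auto simp: power2_eq_square)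
  then have "S \<le> nrm n (lin N x c) * nrm n b"
    using inner_n_CS[of n "lin N x c" b] by linarith
  then have "S\<^sup>2 \<le> (nrm n (lin N x c))\<^sup>2 * (nrm n b)\<^sup>2"
    using S0 power_mono[of S _ 2] by (fastforce simp: power_mult_distrib)
  also have "\<dots> \<le> A * S * (nrm n b)\<^sup>2"
    using le cS by (intro mult_right_mono) auto
  finally have "S * S \<le> S * (A * (nrm n b)\<^sup>2)"
    by (simp add: power2_eq_square mult_ac)
  then have "S \<le> A * (nrm n b)\<^sup>2"
    by (cases "S = 0") (use S0 A in \<open>auto simp: mult_le_cancel_left\<close>)
  then show ?thesis by (simp add: S_def)
qed

text \<open>Derandomised sampling: include each \<open>i\<close> independently with probability \<open>\<theta> i\<close>;
  some outcome is at most the expectation of the functional on the left.\<close>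

lemma selection:
  fixes \<theta> \<alpha> :: "'i \<Rightarrow> real" and u :: "'i \<Rightarrow> 'j \<Rightarrow> real"
  assumes "finite I" "\<And>i. i \<in> I \<Longrightarrow> 0 \<le> \<theta> i \<and> \<theta> i \<le> 1"
  shows "\<exists>\<omega>\<subseteq>I. (\<Sum>i\<in>\<omega>. \<alpha> i) + (\<Sum>j\<in>J. (e j + (\<Sum>i\<in>\<omega>. u i j) - (\<Sum>i\<in>I. \<theta> i * u i j))\<^sup>2)
      \<le> (\<Sum>i\<in>I. \<theta> i * \<alpha> i) + (\<Sum>j\<in>J. (e j)\<^sup>2 + (\<Sum>i\<in>I. \<theta> i * (1 - \<theta> i) * (u i j)\<^sup>2))"
  using assms
proof (induction I arbitrary: e rule: finite_induct)
  case empty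
  then show ?case by simp
next
  case (insert a I)
  define R where "R e = (\<Sum>i\<in>I. \<theta> i * \<alpha> i) + (\<Sum>j\<in>J. (e j)\<^sup>2 + (\<Sum>i\<in>I. \<theta> i * (1 - \<theta> i) * (u i j)\<^sup>2))" for e
  define Q where "Q \<omega> e = (\<Sum>i\<in>\<omega>. \<alpha> i) + (\<Sum>j\<in>J. (e j + (\<Sum>i\<in>\<omega>. u i j) - (\<Sum>i\<in>I. \<theta> i * u i j))\<^sup>2)" for \<omega> e
  \<comment> \<open>\<open>e\<close> carries the error accumulated so far. The decision on
    \<open>a\<close> moves it to \<open>e1\<close> (selected) or \<open>e0\<close> (omitted), whose
    average with weights \<open>\<theta> a\<close> and \<open>1 - \<theta> a\<close> is
    \<open>e\<close>; by \<open>pw\<close> the averaged square grows by the variance.\<close>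
  define e1 where "e1 j = e j + (1 - \<theta> a) * u a j" for j
  define e0 where "e0 j = e j - \<theta> a * u a j" for j
  have t: "0 \<le> \<theta> a" "\<theta> a \<le> 1" using insert.prems by auto
  let ?R = "(\<Sum>i\<in>insert a I. \<theta> i * \<alpha> i) + (\<Sum>j\<in>J. (e j)\<^sup>2 + (\<Sum>i\<in>insert a I. \<theta> i * (1 - \<theta> i) * (u i j)\<^sup>2))"
  have pw: "\<theta> a * (e1 j)\<^sup>2 + (1 - \<theta> a) * (e0 j)\<^sup>2 = (e j)\<^sup>2 + \<theta> a * (1 - \<theta> a) * (u a j)\<^sup>2" for j
    by (simp add: e1_def e0_def power2_eq_square algebra_simps)
  have eqR: "\<theta> a * (\<alpha> a + R e1) + (1 - \<theta> a) * R e0 = ?R"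
  proof -
    define W where "W j = (\<Sum>i\<in>I. \<theta> i * (1 - \<theta> i) * (u i j)\<^sup>2)" for j
    have "\<theta> a * (\<Sum>j\<in>J. (e1 j)\<^sup>2 + W j) + (1 - \<theta> a) * (\<Sum>j\<in>J. (e0 j)\<^sup>2 + W j)
        = (\<Sum>j\<in>J. (\<theta> a * (e1 j)\<^sup>2 + (1 - \<theta> a) * (e0 j)\<^sup>2) + W j)"
      by (simp add: sum_distrib_left sum.distrib[symmetric]) (rule sum.cong, auto simp: algebra_simps)
    also have "\<dots> = (\<Sum>j\<in>J. (e j)\<^sup>2 + \<theta> a * (1 - \<theta> a) * (u a j)\<^sup>2 + W j)"
      by (simp only: pw)
    finally have *: "\<theta> a * (\<Sum>j\<in>J. (e1 j)\<^sup>2 + W j) + (1 - \<theta> a) * (\<Sum>j\<in>J. (e0 j)\<^sup>2 + W j) = \<dots>" .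
    have "?R = \<theta> a * \<alpha> a + (\<Sum>i\<in>I. \<theta> i * \<alpha> i) + (\<Sum>j\<in>J. (e j)\<^sup>2 + \<theta> a * (1 - \<theta> a) * (u a j)\<^sup>2 + W j)"
      using insert.hyps by (simp add: W_def add.assoc)
    also have "\<dots> = \<theta> a * (\<alpha> a + R e1) + (1 - \<theta> a) * R e0"
      unfolding *[symmetric] R_def W_def[symmetric] by (simp add: algebra_simps)
    finally show ?thesis by simp
  qed
  have "\<alpha> a + R e1 \<le> ?R \<or> R e0 \<le> ?R"
  proof (rule ccontr)
    assume "\<not> ?thesis"
    then have c: "?R < \<alpha> a + R e1" "?R < R e0" by auto
    have "?R = \<theta> a * ?R + (1 - \<theta> a) * ?R" by (simp add: algebra_simps)
    also have "\<dots> < \<theta> a * (\<alpha> a + R e1) + (1 - \<theta> a) * R e0"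
    proof (cases "\<theta> a = 0")
      case True then show ?thesis using c by simp
    next
      case False
      then have "\<theta> a * ?R < \<theta> a * (\<alpha> a + R e1)" using c t by simp
      moreover have "(1 - \<theta> a) * ?R \<le> (1 - \<theta> a) * R e0" using c t by (intro mult_left_mono) auto
      ultimately show ?thesis by linarith
    qed
    finally show False using eqR by simp
  qed
  then show ?case
  proof
    assume le: "\<alpha> a + R e1 \<le> ?R"
    obtain \<omega> where w: "\<omega> \<subseteq> I" "Q \<omega> e1 \<le> R e1"
      using insert.IH[of e1] insert.prems unfolding Q_def R_def by auto
    have fin: "finite \<omega>" "a \<notin> \<omega>" using w insert.hyps finite_subset by auto
    have "(\<Sum>i\<in>insert a \<omega>. \<alpha> i) + (\<Sum>j\<in>J. (e j + (\<Sum>i\<in>insert a \<omega>. u i j) - (\<Sum>i\<in>insert a I. \<theta> i * u i j))\<^sup>2)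
       = \<alpha> a + Q \<omega> e1"
      unfolding Q_def e1_def using fin insert.hyps
      by (simp add: algebra_simps)
    then show ?thesis using le w by (intro exI[of _ "insert a \<omega>"]) auto
  next
    assume le: "R e0 \<le> ?R"
    obtain \<omega> where w: "\<omega> \<subseteq> I" "Q \<omega> e0 \<le> R e0"
      using insert.IH[of e0] insert.prems unfolding Q_def R_def by auto
    have "(\<Sum>i\<in>\<omega>. \<alpha> i) + (\<Sum>j\<in>J. (e j + (\<Sum>i\<in>\<omega>. u i j) - (\<Sum>i\<in>insert a I. \<theta> i * u i j))\<^sup>2)
       = Q \<omega> e0"
      unfolding Q_def e0_def using insert.hyps
      by (simp add: algebra_simps)
    then show ?thesis using le w by (intro exI[of _ "\<omega>"]) auto
  qed
qed

section \<open>Order statistics, dyadic rounding and sparsification by sampling\<close>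

text \<open>An index with \<open>f j \<le> z (card J)\<close> is removed, and the rest inherits the
  property. The hypothesis says that the m-th largest value of \<open>f\<close> on \<open>J\<close>
  is at most \<open>z m\<close>, in a form that needs no sorting.\<close>

lemma sum_le_order_statistics:
  fixes f :: "'j \<Rightarrow> real" and z :: "nat \<Rightarrow> real"
  assumes "finite J"
    and "\<And>J'. J' \<subseteq> J \<Longrightarrow> J' \<noteq> {} \<Longrightarrow> \<exists>j\<in>J'. f j \<le> z (card J')"
  shows "(\<Sum>j\<in>J. f j) \<le> (\<Sum>m=1..card J. z m)"
  using assms
proof (induction "card J" arbitrary: J)
  case 0
  then show ?case by simp
next
  case (Suc k)
  then have "J \<noteq> {}" by auto
  with Suc.prems(2)[of J] obtain j where j: "j \<in> J" "f j \<le> z (card J)" by auto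
  have "k = card (J - {j})" using Suc.hyps(2) j Suc.prems(1) by simp
  have IH: "(\<Sum>i\<in>J - {j}. f i) \<le> (\<Sum>m=1..card (J - {j}). z m)"
    by (rule Suc.hyps(1)[OF \<open>k = _\<close>]) (use Suc.prems in \<open>blast+\<close>)
  have "(\<Sum>i\<in>J. f i) = f j + (\<Sum>i\<in>J - {j}. f i)"
    using Suc.prems(1) j by (simp add: sum.remove)
  also have "\<dots> \<le> z (Suc k) + (\<Sum>m=1..k. z m)"
    using IH j Suc.hyps(2) \<open>k = card (J - {j})\<close> by simp
  finally show ?case by (simp flip: Suc.hyps(2))
qed

text \<open>Entries are rounded towards zero to a power of 1/2, with an error of at most half the
  entry, and entries below \<open>(1/2) ^ S\<close> are dropped. The squared error is at most a
  quarter of the squared norm plus \<open>\<kappa>\<close> terms \<open>(1/4) ^ S\<close>, in total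
  1/4 + 1/16; the weaker 9/16 is the square of 3/4.\<close>

lemma dyadic_approximation:
  fixes c :: "nat \<Rightarrow> real"
  assumes c1: "(\<Sum>i<N. (c i)\<^sup>2) \<le> 1" and card: "card {i. i < N \<and> c i \<noteq> 0} \<le> \<kappa>"
    and S: "16 * \<kappa> \<le> 4 ^ S"
  obtains y :: "nat \<Rightarrow> real"
  where "\<And>i. c i = 0 \<Longrightarrow> y i = 0" "\<And>i. i < N \<Longrightarrow> y i \<noteq> 0 \<Longrightarrow> \<exists>b\<le>S. \<bar>y i\<bar> = (1/2) ^ b"
    "(\<Sum>i<N. (y i)\<^sup>2) \<le> 1" "(\<Sum>i<N. (c i - y i)\<^sup>2) \<le> 9/16"
proof -
  have cle: "\<bar>c i\<bar> \<le> 1" if "i < N" for i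
  proof -
    have "(c i)\<^sup>2 \<le> (\<Sum>i<N. (c i)\<^sup>2)" using that by (intro member_le_sum) auto
    then show ?thesis using c1 abs_square_le_1 by fastforce
  qed
  have ex: "\<exists>y. (t = 0 \<longrightarrow> y = 0) \<and> (y \<noteq> 0 \<longrightarrow> (\<exists>b\<le>S. \<bar>y\<bar> = (1/2) ^ b)) \<and> \<bar>y\<bar> \<le> \<bar>t\<bar>
      \<and> (t - y)\<^sup>2 \<le> t\<^sup>2 / 4 + (if t = 0 then 0 else (1/4) ^ S)" if t: "\<bar>t\<bar> \<le> 1" for t :: real
  proof (cases "(1/2) ^ S \<le> \<bar>t\<bar>")
    case True
    define b where "b = (LEAST b. (1/2) ^ b \<le> \<bar>t\<bar>)"
    have b: "(1/2) ^ b \<le> \<bar>t\<bar>" "b \<le> S" unfolding b_def using True by (auto intro: LeastI Least_le)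
    have lt: "\<bar>t\<bar> \<le> 2 * (1/2) ^ b"
    proof (cases b)
      case 0 then show ?thesis using t by simp
    next
      case (Suc k)
      then have "\<not> (1/2) ^ k \<le> \<bar>t\<bar>" using not_less_Least[of k "\<lambda>b. (1/2) ^ b \<le> \<bar>t\<bar>"] b_def by auto
      then show ?thesis using Suc by simp
    qed
    have "0 < (1/2 :: real) ^ b" by simp
    then have t0: "t \<noteq> 0" using b(1) by linarith
    define y where "y = sgn t * (1/2) ^ b"
    have y: "\<bar>y\<bar> = (1/2) ^ b" using t0 by (simp add: y_def abs_mult)
    have "t - y = sgn t * (\<bar>t\<bar> - (1/2) ^ b)" by (simp add: y_def right_diff_distrib sgn_mult_abs)
    then have "\<bar>t - y\<bar> = \<bar>t\<bar> - (1/2) ^ b" using t0 b by (simp add: abs_mult)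
    then have "\<bar>t - y\<bar> \<le> \<bar>t / 2\<bar>" using lt by simp
    then have "(t - y)\<^sup>2 \<le> (t / 2)\<^sup>2" by (simp only: abs_le_square_iff[symmetric])
    then have "(t - y)\<^sup>2 \<le> t\<^sup>2 / 4 + (if t = 0 then 0 else (1/4) ^ S)"
      by (simp add: power_divide add_increasing2 t0)
    then show ?thesis using y b t0 by (intro exI[of _ y]) auto
  next
    case False
    then have "\<bar>t\<bar> \<le> \<bar>(1/2) ^ S\<bar>" by simp
    then have "t\<^sup>2 \<le> ((1/2) ^ S)\<^sup>2" by (simp only: abs_le_square_iff[symmetric])
    also have "\<dots> = (1/4) ^ S" by (simp add: power2_eq_square flip: power_mult_distrib)
    finally have "t\<^sup>2 \<le> t\<^sup>2 / 4 + (if t = 0 then 0 else (1/4) ^ S)" by (simp add: add_increasing)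
    then show ?thesis by (intro exI[of _ 0]) auto
  qed
  have "\<forall>i. \<exists>y. i < N \<longrightarrow> ((c i = 0 \<longrightarrow> y = 0) \<and> (y \<noteq> 0 \<longrightarrow> (\<exists>b\<le>S. \<bar>y\<bar> = (1/2) ^ b)) \<and> \<bar>y\<bar> \<le> \<bar>c i\<bar>
      \<and> (c i - y)\<^sup>2 \<le> (c i)\<^sup>2 / 4 + (if c i = 0 then 0 else (1/4) ^ S))"
    using ex[OF cle] by blast
  then obtain y0 where y0: "\<And>i. i < N \<Longrightarrow> (c i = 0 \<longrightarrow> y0 i = 0) \<and> (y0 i \<noteq> 0 \<longrightarrow> (\<exists>b\<le>S. \<bar>y0 i\<bar> = (1/2) ^ b))
      \<and> \<bar>y0 i\<bar> \<le> \<bar>c i\<bar> \<and> (c i - y0 i)\<^sup>2 \<le> (c i)\<^sup>2 / 4 + (if c i = 0 then 0 else (1/4) ^ S)"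
    by metis
  define y where "y i = (if c i = 0 then 0 else y0 i)" for i
  have y: "\<bar>y i\<bar> \<le> \<bar>c i\<bar>" "(c i - y i)\<^sup>2 \<le> (c i)\<^sup>2 / 4 + (if c i = 0 then 0 else (1/4) ^ S)"
    if "i < N" for i using y0[OF that] by (auto simp: y_def)
  have "(\<Sum>i<N. (y i)\<^sup>2) \<le> (\<Sum>i<N. (c i)\<^sup>2)"
    by (intro sum_mono) (use y in \<open>simp add: abs_le_square_iff\<close>)
  moreover have "(\<Sum>i<N. (c i - y i)\<^sup>2) \<le> 9/16"
  proof -
    have "(\<Sum>i<N. (c i - y i)\<^sup>2) \<le> (\<Sum>i<N. (c i)\<^sup>2 / 4 + (if c i = 0 then 0 else (1/4) ^ S))"
      by (intro sum_mono) (use y in auto)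
    also have "\<dots> = (\<Sum>i<N. (c i)\<^sup>2) / 4 + card {i. i < N \<and> c i \<noteq> 0} * (1/4) ^ S"
      by (simp add: sum.distrib sum_divide_distrib sum.If_cases Int_def Collect_neg_eq[symmetric] conj_commute)
    also have "\<dots> \<le> 1 / 4 + \<kappa> * (1/4) ^ S"
      using c1 card by (intro add_mono mult_right_mono) auto
    also have "\<kappa> * (1/4) ^ S \<le> (1/16 :: real)"
    proof -
      have "real (16 * \<kappa>) \<le> real (4 ^ S)" using S by (simp only: of_nat_le_iff)
      then show ?thesis by (simp add: power_divide field_simps)
    qed
    finally show ?thesis by simp
  qed
  ultimately show ?thesis
    using that[of y] y0 c1 by (force simp: y_def)
qed

text \<open>Each \<open>i\<close> is kept with probability \<open>\<theta> i\<close>, its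
  coefficient being replaced by an integer such that the mean is \<open>2 ^ r * y i\<close>; at most
  about \<open>4 ^ r\<close> indices survive. The degree bound limits the \<open>j\<close> in
  conflict with a sampled index, and Chebyshev limits the \<open>j\<close> with a large fluctuation.
  Each kind takes at most a quarter of \<open>J\<close>.\<close>

lemma sparse_sampling:
  fixes a :: "nat \<Rightarrow> nat \<Rightarrow> real" and y :: "nat \<Rightarrow> real"
  assumes fin: "finite I" "finite J" "J \<noteq> {}" and cardI: "card I \<le> 4 ^ s"
    and dy: "\<And>i. i \<in> I \<Longrightarrow> \<exists>b\<le>s. \<bar>y i\<bar> = (1/2) ^ b" and y1: "(\<Sum>i\<in>I. (y i)\<^sup>2) \<le> 1"
    and r: "r \<le> s" and deg: "\<And>i. i \<in> I \<Longrightarrow> card {j\<in>J. conf i j} \<le> D" and mD: "32 * D * 4 ^ r \<le> card J"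
    and S: "\<And>j. j \<in> J \<Longrightarrow> (\<Sum>i\<in>{i\<in>I. \<not> conf i j}. (a i j)\<^sup>2) \<le> S"
    and z: "z > 0" "128 * S \<le> 4 ^ r * z\<^sup>2"
    and big: "\<And>j. j \<in> J \<Longrightarrow> z \<le> \<bar>\<Sum>i\<in>{i\<in>I. \<not> conf i j}. y i * a i j\<bar>"
  shows "\<exists>\<zeta>::nat \<Rightarrow> int. \<exists>G\<subseteq>J. {i. \<zeta> i \<noteq> 0} \<subseteq> I \<and> card {i. \<zeta> i \<noteq> 0} \<le> 8 * 4 ^ r
     \<and> (\<Sum>i\<in>I. (\<zeta> i)\<^sup>2) \<le> (16 * 4 ^ s :: int) \<and> card J \<le> 2 * card G
     \<and> (\<forall>j\<in>G. (\<forall>i\<in>I. \<zeta> i \<noteq> 0 \<longrightarrow> \<not> conf i j) \<and> 2 ^ r * z / 2 \<le> \<bar>\<Sum>i\<in>I. \<zeta> i * a i j\<bar>)"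
proof -
  \<comment> \<open>Unbiased: \<open>\<theta> i * w i = 2 ^ r * y i\<close>. The weight
    \<open>w i\<close> is an integer because \<open>y i\<close> is a power of 1/2 up to sign: for
    \<open>b \<le> r\<close> the index is kept for certain and the modulus is
    \<open>2 ^ (r - b)\<close>, otherwise it is \<open>2 ^ (b - r)\<close>.\<close>
  define \<theta> where "\<theta> i = min 1 (4 ^ r * (y i)\<^sup>2)" for i
  define w where "w i = 2 ^ r * y i / \<theta> i" for i
  define m where "m = real (card J)"
  have m: "m > 0" using fin by (simp add: m_def card_gt_0_iff)
  define u where "u i j = (if conf i j then 0 else w i * a i j)" for i j
  define rr where "rr j = (\<Sum>i\<in>{i\<in>I. \<not> conf i j}. y i * a i j)" for j
  have y0: "y i \<noteq> 0" if "i \<in> I" for i using dy[OF that] by auto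
  have four: "((2::real) ^ k)\<^sup>2 = 4 ^ k" "(2::real) ^ k * 2 ^ k = 4 ^ k" for k
  proof -
    show *: "(2::real) ^ k * 2 ^ k = 4 ^ k" for k
    proof -
      have "(4::real) = 2 * 2" by simp
      then show ?thesis by (simp only: power_mult_distrib)
    qed
    show "((2::real) ^ k)\<^sup>2 = 4 ^ k" for k
      unfolding power2_eq_square by (rule *)
  qed
  have th: "0 < \<theta> i" "\<theta> i \<le> 1" if "i \<in> I" for i using y0[OF that] by (auto simp: \<theta>_def)
  have thw: "\<theta> i * w i = 2 ^ r * y i" if "i \<in> I" for i using th[OF that] by (simp add: w_def)
  have wint: "w i \<in> \<int> \<and> \<theta> i * (w i)\<^sup>2 \<le> 1 + 4 ^ r * (y i)\<^sup>2 \<and> \<theta> i * (1 - \<theta> i) * (w i)\<^sup>2 \<le> 1" if i: "i \<in> I" for i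
  proof -
    obtain b where b: "b \<le> s" "\<bar>y i\<bar> = (1/2) ^ b" using dy[OF i] by auto
    have sg: "sgn (y i) \<in> \<int>" by (auto simp: sgn_if)
    have yb: "y i = sgn (y i) / 2 ^ b"
    proof -
      have "y i = sgn (y i) * \<bar>y i\<bar>" by (simp only: sgn_mult_abs)
      also have "\<dots> = sgn (y i) / 2 ^ b" unfolding b(2) by (simp add: power_one_over)
      finally show ?thesis .
    qed
    have y2: "(y i)\<^sup>2 = 1 / 4 ^ b"
    proof -
      have "(y i)\<^sup>2 = ((1/2) ^ b)\<^sup>2" unfolding b(2)[symmetric] by (rule power2_abs[symmetric])
      then show ?thesis by (simp add: power_one_over power_divide four)
    qed
    show ?thesis
    proof (cases "b \<le> r")
      case True
      then have "4 ^ b \<le> (4::real) ^ r" by (intro power_increasing) auto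
      then have th1: "\<theta> i = 1" by (simp add: \<theta>_def y2)
      have "w i = sgn (y i) * 2 ^ (r - b)" using True
        unfolding w_def th1 by (subst yb) (simp add: power_diff)
      moreover have "(w i)\<^sup>2 = 4 ^ r * (y i)\<^sup>2" by (simp add: w_def th1 power_mult_distrib four)
      ultimately show ?thesis using sg by (auto simp: th1)
    next
      case False
      then have "4 ^ r \<le> (4::real) ^ b" by (intro power_increasing) auto
      then have th1: "\<theta> i = 4 ^ r / 4 ^ b" by (simp add: \<theta>_def y2)
      have wi: "w i = sgn (y i) * 2 ^ (b - r)" using False
        unfolding w_def th1 by (subst yb) (simp add: power_diff four(2)[symmetric])
      have w2: "\<theta> i * (w i)\<^sup>2 = 1"
        by (simp add: w_def th1 power_divide power_mult_distrib y2 four) (simp add: power2_eq_square)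
      have w3: "\<theta> i * (1 - \<theta> i) * (w i)\<^sup>2 = 1 - \<theta> i" using w2 by (simp add: algebra_simps)
      have "w i \<in> \<int>" unfolding wi using sg by simp
      then show ?thesis using th[OF i] unfolding w2 w3 by simp
    qed
  qed
  \<comment> \<open>Normalisation of the deviations: the total variance becomes at most 1/8, whereas
    more than \<open>m / 4\<close> deviations above \<open>2 ^ r * z / 2\<close> would make the sum
    of squares exceed 1.\<close>
  define \<beta> where "\<beta> = sqrt (16 / (m * z\<^sup>2 * 4 ^ r))"
  have b2: "\<beta>\<^sup>2 = 16 / (m * z\<^sup>2 * 4 ^ r)" using m by (simp add: \<beta>_def)
  \<comment> \<open>One outcome has to be good in three respects. \<open>\<alpha>\<close> charges
    the size of the sample in units of \<open>8 * 4 ^ r\<close> and its squared norm in units of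
    \<open>16 * 4 ^ s\<close>; since all terms are non-negative, a total of at most 1 bounds each of
    them.\<close>
  define \<alpha> where "\<alpha> i = 1 / (8 * 4 ^ r) + (w i)\<^sup>2 / (16 * 4 ^ s)" for i
  obtain \<omega> where w: "\<omega> \<subseteq> I" and Q: "(\<Sum>i\<in>\<omega>. \<alpha> i) + (\<Sum>j\<in>J. (0 + (\<Sum>i\<in>\<omega>. \<beta> * u i j) - (\<Sum>i\<in>I. \<theta> i * (\<beta> * u i j)))\<^sup>2)
      \<le> (\<Sum>i\<in>I. \<theta> i * \<alpha> i) + (\<Sum>j\<in>J. 0\<^sup>2 + (\<Sum>i\<in>I. \<theta> i * (1 - \<theta> i) * (\<beta> * u i j)\<^sup>2))"
    using selection[where I=I and \<theta>=\<theta> and \<alpha>=\<alpha> and J=J and e="\<lambda>_. 0" and u="\<lambda>i j. \<beta> * u i j"] th fin less_imp_le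
    by blast
  have thu: "(\<Sum>i\<in>I. \<theta> i * u i j) = 2 ^ r * rr j" for j
  proof -
    have "(\<Sum>i\<in>I. \<theta> i * u i j) = (\<Sum>i\<in>{i\<in>I. \<not> conf i j}. 2 ^ r * (y i * a i j))"
      using fin by (intro sum.mono_neutral_cong_right) (auto simp: u_def mult.assoc[symmetric] thw)
    then show ?thesis by (simp add: rr_def sum_distrib_left)
  qed
  define dev where "dev j = (\<Sum>i\<in>\<omega>. u i j) - 2 ^ r * rr j" for j
  have lhs: "(\<Sum>j\<in>J. (0 + (\<Sum>i\<in>\<omega>. \<beta> * u i j) - (\<Sum>i\<in>I. \<theta> i * (\<beta> * u i j)))\<^sup>2) = \<beta>\<^sup>2 * (\<Sum>j\<in>J. (dev j)\<^sup>2)"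
  proof -
    have "0 + (\<Sum>i\<in>\<omega>. \<beta> * u i j) - (\<Sum>i\<in>I. \<theta> i * (\<beta> * u i j)) = \<beta> * dev j" for j
    proof -
      have "(\<Sum>i\<in>I. \<theta> i * (\<beta> * u i j)) = \<beta> * (\<Sum>i\<in>I. \<theta> i * u i j)"
        by (simp add: sum_distrib_left mult_ac)
      then show ?thesis by (simp add: dev_def thu sum_distrib_left[symmetric] algebra_simps)
    qed
    then show ?thesis by (simp add: power_mult_distrib sum_distrib_left)
  qed
  have "(\<Sum>i\<in>I. \<theta> i * \<alpha> i) \<le> (\<Sum>i\<in>I. 4 ^ r * (y i)\<^sup>2 / (8 * 4 ^ r) + (1 + 4 ^ r * (y i)\<^sup>2) / (16 * 4 ^ s))"
  proof (intro sum_mono)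
    fix i assume i: "i \<in> I"
    have "\<theta> i / (8 * 4 ^ r) \<le> 4 ^ r * (y i)\<^sup>2 / (8 * 4 ^ r)" by (intro divide_right_mono) (auto simp: \<theta>_def)
    moreover have "\<theta> i * (w i)\<^sup>2 / (16 * 4 ^ s) \<le> (1 + 4 ^ r * (y i)\<^sup>2) / (16 * 4 ^ s)"
      using wint[OF i] by (intro divide_right_mono) auto
    ultimately show "\<theta> i * \<alpha> i \<le> 4 ^ r * (y i)\<^sup>2 / (8 * 4 ^ r) + (1 + 4 ^ r * (y i)\<^sup>2) / (16 * 4 ^ s)"
      by (simp add: \<alpha>_def distrib_left)
  qed
  also have "\<dots> = (\<Sum>i\<in>I. (y i)\<^sup>2) / 8 + (card I + 4 ^ r * (\<Sum>i\<in>I. (y i)\<^sup>2)) / (16 * 4 ^ s)"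
    by (simp add: sum.distrib sum_divide_distrib[symmetric] sum_distrib_left)
  also have "\<dots> \<le> 1 / 8 + (4 ^ s + 4 ^ s * 1) / (16 * 4 ^ s)"
  proof (intro add_mono divide_right_mono mult_mono)
    have "real (card I) \<le> real (4 ^ s)" using cardI by (simp only: of_nat_le_iff)
    then show "real (card I) \<le> 4 ^ s" by simp
  qed (use y1 r in \<open>auto simp: sum_nonneg\<close>)
  finally have t1: "(\<Sum>i\<in>I. \<theta> i * \<alpha> i) \<le> 1/4" by simp
  have "(\<Sum>j\<in>J. 0\<^sup>2 + (\<Sum>i\<in>I. \<theta> i * (1 - \<theta> i) * (\<beta> * u i j)\<^sup>2)) \<le> (\<Sum>j\<in>J. \<beta>\<^sup>2 * S)"
  proof (intro sum_mono)
    fix j assume j: "j \<in> J"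
    have "(\<Sum>i\<in>I. \<theta> i * (1 - \<theta> i) * (\<beta> * u i j)\<^sup>2) \<le> (\<Sum>i\<in>I. \<beta>\<^sup>2 * (if conf i j then 0 else (a i j)\<^sup>2))"
    proof (intro sum_mono)
      fix i assume i: "i \<in> I"
      have "\<theta> i * (1 - \<theta> i) * (w i)\<^sup>2 * (a i j)\<^sup>2 \<le> 1 * (a i j)\<^sup>2" using wint[OF i] by (intro mult_right_mono) auto
      then have "\<beta>\<^sup>2 * (\<theta> i * (1 - \<theta> i) * (w i)\<^sup>2 * (a i j)\<^sup>2) \<le> \<beta>\<^sup>2 * (1 * (a i j)\<^sup>2)" by (intro mult_left_mono) auto
      then show "\<theta> i * (1 - \<theta> i) * (\<beta> * u i j)\<^sup>2 \<le> \<beta>\<^sup>2 * (if conf i j then 0 else (a i j)\<^sup>2)"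
        by (simp add: u_def power_mult_distrib mult_ac)
    qed
    also have "\<dots> = \<beta>\<^sup>2 * (\<Sum>i\<in>{i\<in>I. \<not> conf i j}. (a i j)\<^sup>2)"
      unfolding sum_distrib_left[symmetric] using fin
      by (intro arg_cong2[where f="(*)"] refl sum.mono_neutral_cong_right) auto
    also have "\<dots> \<le> \<beta>\<^sup>2 * S" using S[OF j] by (intro mult_left_mono) auto
    finally show "0\<^sup>2 + (\<Sum>i\<in>I. \<theta> i * (1 - \<theta> i) * (\<beta> * u i j)\<^sup>2) \<le> \<beta>\<^sup>2 * S" by simp
  qed
  also have "\<dots> = 16 * S / (z\<^sup>2 * 4 ^ r)" using m by (simp add: b2 m_def[symmetric])
  also have "\<dots> \<le> 1/8" using z by (simp add: field_simps)
  finally have t2: "(\<Sum>j\<in>J. 0\<^sup>2 + (\<Sum>i\<in>I. \<theta> i * (1 - \<theta> i) * (\<beta> * u i j)\<^sup>2)) \<le> 1/8" .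
  have Q': "(\<Sum>i\<in>\<omega>. \<alpha> i) + \<beta>\<^sup>2 * (\<Sum>j\<in>J. (dev j)\<^sup>2) \<le> 1" using Q t1 t2 unfolding lhs by linarith
  have finw: "finite \<omega>" using w fin finite_subset by auto
  have al: "(\<Sum>i\<in>\<omega>. \<alpha> i) = card \<omega> / (8 * 4 ^ r) + (\<Sum>i\<in>\<omega>. (w i)\<^sup>2) / (16 * 4 ^ s)"
    by (simp add: \<alpha>_def sum.distrib sum_divide_distrib)
  have nn: "0 \<le> (\<Sum>i\<in>\<omega>. (w i)\<^sup>2) / (16 * 4 ^ s)" "0 \<le> card \<omega> / (8 * 4 ^ r)" "0 \<le> \<beta>\<^sup>2 * (\<Sum>j\<in>J. (dev j)\<^sup>2)"
    by (auto simp: sum_nonneg)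
  have "card \<omega> / (8 * 4 ^ r) \<le> 1" using Q' al nn by linarith
  then have "real (card \<omega>) \<le> real (8 * 4 ^ r)" by (simp add: field_simps)
  then have cw: "card \<omega> \<le> 8 * 4 ^ r" by (simp only: of_nat_le_iff)
  have "(\<Sum>i\<in>\<omega>. (w i)\<^sup>2) / (16 * 4 ^ s) \<le> 1" using Q' al nn by linarith
  then have sw: "(\<Sum>i\<in>\<omega>. (w i)\<^sup>2) \<le> 16 * 4 ^ s" by (simp add: field_simps)
  have al0: "(\<Sum>i\<in>\<omega>. \<alpha> i) \<ge> 0" using al nn by linarith
  have "\<beta>\<^sup>2 * (\<Sum>j\<in>J. (dev j)\<^sup>2) \<le> 3/8" using Q al0 t1 t2 unfolding lhs by linarith
  define B1 where "B1 = {j\<in>J. \<exists>i\<in>\<omega>. conf i j}"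
  define B2 where "B2 = {j\<in>J. 2 ^ r * z / 2 < \<bar>dev j\<bar>}"
  have "card B1 \<le> D * (8 * 4 ^ r)"
  proof -
    have "B1 = (\<Union>i\<in>\<omega>. {j\<in>J. conf i j})" by (auto simp: B1_def)
    then have "card B1 \<le> (\<Sum>i\<in>\<omega>. card {j\<in>J. conf i j})" using finw by (simp add: card_UN_le)
    also have "\<dots> \<le> (\<Sum>i\<in>\<omega>. D)" using deg w by (intro sum_mono) auto
    also have "\<dots> \<le> D * (8 * 4 ^ r)" using cw by (simp add: mult.commute)
    finally show ?thesis .
  qed
  then have c1: "4 * card B1 \<le> card J" using mD by linarith
  have c2: "4 * card B2 \<le> card J"
  proof -
    have "card B2 * (2 ^ r * z / 2)\<^sup>2 = (\<Sum>j\<in>B2. (2 ^ r * z / 2)\<^sup>2)" by simp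
    also have "\<dots> \<le> (\<Sum>j\<in>B2. (dev j)\<^sup>2)"
    proof (intro sum_mono)
      fix j assume "j \<in> B2"
      then have "\<bar>2 ^ r * z / 2\<bar> \<le> \<bar>dev j\<bar>" using z by (simp add: B2_def)
      then show "(2 ^ r * z / 2)\<^sup>2 \<le> (dev j)\<^sup>2" by (simp only: abs_le_square_iff[symmetric])
    qed
    also have "\<dots> \<le> (\<Sum>j\<in>J. (dev j)\<^sup>2)" using fin by (intro sum_mono2) (auto simp: B2_def)
    also have "\<dots> \<le> m * z\<^sup>2 * 4 ^ r / 16"
    proof -
      have "\<beta>\<^sup>2 * (\<Sum>j\<in>J. (dev j)\<^sup>2) \<le> 1" using Q' al0 by linarith
      then show ?thesis using m z by (simp add: b2 field_simps)
    qed
    finally have "card B2 * (z\<^sup>2 * 4 ^ r) / 4 \<le> m * (z\<^sup>2 * 4 ^ r) / 16"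
      by (simp add: power_mult_distrib power_divide four mult_ac)
    then have "real (card B2) * 4 \<le> m" using z by simp
    then have "real (4 * card B2) \<le> real (card J)" by (simp add: m_def)
    then show ?thesis by (simp only: of_nat_le_iff)
  qed
  define G where "G = J - (B1 \<union> B2)"
  have cG: "card J \<le> 2 * card G"
  proof -
    have "card J \<le> card G + card (B1 \<union> B2)"
    proof -
      have "card J \<le> card (G \<union> (B1 \<union> B2))"
        using fin by (intro card_mono) (auto simp: G_def B1_def B2_def)
      also have "\<dots> \<le> card G + card (B1 \<union> B2)" by (rule card_Un_le)
      finally show ?thesis .
    qed
    moreover have "card (B1 \<union> B2) \<le> card B1 + card B2" by (rule card_Un_le)
    ultimately show ?thesis using c1 c2 by linarith
  qed
  define \<zeta> where "\<zeta> i = (if i \<in> \<omega> then \<lfloor>w i\<rfloor> else 0)" for i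
  have zw: "of_int (\<zeta> i) = (if i \<in> \<omega> then w i else 0)" if "i \<in> I" for i
    using wint[OF that] by (auto simp: \<zeta>_def elim!: Ints_cases)
  have supp: "{i. \<zeta> i \<noteq> 0} \<subseteq> \<omega>" by (auto simp: \<zeta>_def)
  have "real_of_int (\<Sum>i\<in>I. (\<zeta> i)\<^sup>2) = (\<Sum>i\<in>\<omega>. (w i)\<^sup>2)"
    using w fin by (simp add: zw, intro sum.mono_neutral_cong_right) auto
  then have "real_of_int (\<Sum>i\<in>I. (\<zeta> i)\<^sup>2) \<le> real_of_int (16 * 4 ^ s)" using sw by simp
  then have z2: "(\<Sum>i\<in>I. (\<zeta> i)\<^sup>2) \<le> (16 * 4 ^ s :: int)" by (simp only: of_int_le_iff)
  have good: "(\<forall>i\<in>I. \<zeta> i \<noteq> 0 \<longrightarrow> \<not> conf i j) \<and> 2 ^ r * z / 2 \<le> \<bar>\<Sum>i\<in>I. \<zeta> i * a i j\<bar>" if j: "j \<in> G" for j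
  proof
    have nc: "\<not> conf i j" if "i \<in> \<omega>" for i using j that by (auto simp: G_def B1_def)
    then show "\<forall>i\<in>I. \<zeta> i \<noteq> 0 \<longrightarrow> \<not> conf i j" using supp by auto
    have "(\<Sum>i\<in>I. \<zeta> i * a i j) = (\<Sum>i\<in>\<omega>. u i j)"
      using w fin nc by (intro sum.mono_neutral_cong_right) (auto simp: zw u_def)
    then have eq: "(\<Sum>i\<in>I. \<zeta> i * a i j) = dev j + 2 ^ r * rr j" by (simp add: dev_def)
    have "2 ^ r * z \<le> 2 ^ r * \<bar>rr j\<bar>" using big[of j] j by (auto simp: G_def rr_def)
    also have "\<dots> = \<bar>2 ^ r * rr j\<bar>" by (simp add: abs_mult)
    finally have "2 ^ r * z \<le> \<bar>2 ^ r * rr j\<bar>" .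
    moreover have "\<bar>dev j\<bar> \<le> 2 ^ r * z / 2" using j by (auto simp: G_def B2_def)
    ultimately show "2 ^ r * z / 2 \<le> \<bar>\<Sum>i\<in>I. \<zeta> i * a i j\<bar>" unfolding eq by linarith
  qed
  have "card {i. \<zeta> i \<noteq> 0} \<le> 8 * 4 ^ r" using card_mono[OF finw supp] cw by linarith
  moreover have "{i. \<zeta> i \<noteq> 0} \<subseteq> I" using supp w by auto
  moreover have "G \<subseteq> J" by (auto simp: G_def)
  ultimately show ?thesis using z2 cG good by (intro exI[of _ \<zeta>] exI[of _ G] conjI ballI) auto
qed

lemma two_power_sq: "((2::real) ^ k)\<^sup>2 = 4 ^ k"
proof -
  have "((2::real) ^ k)\<^sup>2 = (2\<^sup>2) ^ k" unfolding power_mult[symmetric] by (simp only: mult.commute)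
  then show ?thesis by simp
qed

section \<open>Order statistics of the levels\<close>

text \<open>The threshold is chosen such that the probability that \<open>h\<close> given independent vectors exceed it, times the
  number of sets of \<open>h\<close> indices, is at most \<open>exp (- 7 h)\<close>. The term \<open>l * ln (\<Gamma> / l)\<close> below is the
  entropy of the integer vectors of support \<open>l\<close>.\<close>

definition thr :: "real \<Rightarrow> nat \<Rightarrow> nat \<Rightarrow> real" where
  "thr p N h = (exp 8 * real N / real h) powr (1 / p)"

definition order_event :: "nat \<Rightarrow> nat \<Rightarrow> (nat \<Rightarrow> nat \<Rightarrow> real) \<Rightarrow> real \<Rightarrow> real \<Rightarrow> nat \<Rightarrow> bool" where
  "order_event n N x p \<Gamma> K \<longleftrightarrow>
     (\<forall>l h. 1 \<le> l \<longrightarrow> l \<le> K \<longrightarrow> 1 \<le> h \<longrightarrow> real l * ln (\<Gamma> / real l) \<le> real h \<longrightarrow>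
       (\<forall>\<zeta>::nat \<Rightarrow> int. card {i. i < N \<and> \<zeta> i \<noteq> 0} \<le> l \<longrightarrow> (\<Sum>i<N. \<bar>\<zeta> i\<bar>) \<le> int K \<longrightarrow>
         (\<forall>J\<subseteq>{..<N}. card J = h \<longrightarrow> (\<forall>j\<in>J. \<zeta> j = 0) \<longrightarrow>
           (\<exists>j\<in>J. \<bar>inner_n n (lin N x (\<lambda>i. real_of_int (\<zeta> i))) (x j)\<bar>
              \<le> thr p N h * nrm n (lin N x (\<lambda>i. real_of_int (\<zeta> i)))))))"

lemma ln_le_two_fifths: "0 < w \<Longrightarrow> ln w \<le> 2 * w / (5::real)"
proof -
  assume w: "0 < w"
  have e: "5/2 \<le> exp (1::real)" using exp_lower_Taylor_quadratic[of "1::real"] by simp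
  have "ln (w / exp 1) \<le> w / exp 1 - 1" using w by (intro ln_le_minus_one) auto
  then have "ln w \<le> w / exp 1" using w by (simp add: ln_div)
  also have "\<dots> \<le> w / (5/2)" using w e by (intro divide_left_mono) auto
  finally show ?thesis by simp
qed

text \<open>With \<open>w = m / l\<close> one has
  \<open>ln (\<Gamma> / l) = ln (\<Gamma> / m) + ln w\<close>. The first summand is at most
  \<open>w / 16\<close> by the choice of \<open>l\<close>, the second at most
  \<open>2 * w / 5\<close>, together less than \<open>w / 2\<close>. This determines how far a
  combination must be sparsified.\<close>

lemma sparsity_entropy_bound:
  fixes \<Gamma> m l D :: real
  assumes "\<Gamma> > 0" "m > 0" "l > 0" and u: "ln (\<Gamma> / m) \<ge> 1" and "D \<ge> 1" and l: "l \<le> m / (16 * D * ln (\<Gamma> / m))"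
  shows "l * ln (\<Gamma> / l) \<le> m / 2"
proof -
  define u where "u = ln (\<Gamma> / m)"
  define w where "w = m / l"
  have w0: "w > 0" using assms by (simp add: w_def)
  have "16 * 1 * u \<le> 16 * D * u" using assms(5) u by (intro mult_right_mono mult_left_mono) (auto simp: u_def)
  moreover have "16 * D * u \<le> w" using l assms(2,3,5) u by (simp add: w_def u_def field_simps)
  ultimately have uw: "16 * u \<le> w" by linarith
  have "ln (\<Gamma> / l) = u + ln w" using assms(1-3) by (simp add: u_def w_def ln_div)
  also have "\<dots> \<le> w / 16 + 2 * w / 5" using uw ln_le_two_fifths[OF w0] by simp
  also have "\<dots> \<le> w / 2" using w0 by simp
  finally have "l * ln (\<Gamma> / l) \<le> l * (w / 2)" using assms(3) by (intro mult_left_mono) auto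
  then show ?thesis using assms(3) by (simp add: w_def)
qed

text \<open>The relation \<open>conf\<close> collects the pairs excluded from the form: equality for short vectors, and
  in addition large correlation for long ones.\<close>

lemma level_order_statistic:
  fixes y :: "nat \<Rightarrow> real"
  assumes sb: "sparse_bound n N \<kappa> x A" "A \<ge> 0"
    and I: "I \<subseteq> {..<N}" "card I \<le> \<kappa>" "card I \<le> 4 ^ s"
    and dy: "\<And>i. i \<in> I \<Longrightarrow> \<exists>b\<le>s. \<bar>y i\<bar> = (1/2) ^ b" and y1: "(\<Sum>i\<in>I. (y i)\<^sup>2) \<le> 1"
    and J: "J \<subseteq> {..<N}" "J \<noteq> {}" "card J \<le> 4 ^ s"
    and conf: "\<And>j. conf j j" "\<And>i. i < N \<Longrightarrow> card {j. j < N \<and> conf i j} \<le> D"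
    and S: "\<And>j. j \<in> J \<Longrightarrow> (\<Sum>i\<in>{i\<in>I. \<not> conf i j}. (inner_n n (x i) (x j))\<^sup>2) \<le> S"
    and E: "order_event n N x p \<Gamma> K" "16 * 4 ^ s \<le> K" and p: "p > 0"
    and \<Gamma>: "\<Gamma> > 0" "1 \<le> ln (\<Gamma> / real (card J))" "128 * real D * ln \<Gamma> \<le> real (card J)" and D: "D \<ge> 1"
  shows "\<exists>j\<in>J. \<bar>\<Sum>i\<in>{i\<in>I. \<not> conf i j}. y i * inner_n n (x i) (x j)\<bar>
     \<le> sqrt (512 * real D * ln (\<Gamma> / real (card J)) / real (card J)) * (12 * sqrt S + 8 * sqrt A * 2 ^ s * (2 * exp 8 * N / real (card J)) powr (1 / p))"
proof (rule ccontr)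
  define m where "m = real (card J)"
  define u where "u = ln (\<Gamma> / m)"
  define z where "z = sqrt (512 * real D * u / m) * (12 * sqrt S + 8 * sqrt A * 2 ^ s * (2 * exp 8 * N / m) powr (1 / p))"
  assume "\<not> ?thesis"
  then have big: "z < \<bar>\<Sum>i\<in>{i\<in>I. \<not> conf i j}. y i * inner_n n (x i) (x j)\<bar>" if "j \<in> J" for j
    using that by (force simp: z_def u_def m_def)
  have finJ: "finite J" and finI: "finite I" using I J finite_subset by auto
  have m1: "m \<ge> 1" using J finJ by (simp add: m_def Suc_le_eq card_gt_0_iff)
  have u1: "u \<ge> 1" using \<Gamma> by (simp add: u_def m_def)
  have D1: "real D \<ge> 1" using D by simp
  define q where "q = m / (128 * real D * u)"
  have q1: "q \<ge> 1"
  proof -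
    have "u \<le> ln \<Gamma>" unfolding u_def using m1 \<Gamma>(1) by (simp add: ln_div)
    then have *: "128 * real D * u \<le> 128 * real D * ln \<Gamma>" by (intro mult_left_mono) auto
    have "128 * real D * ln \<Gamma> \<le> m" using \<Gamma> by (simp add: m_def)
    with * have "128 * real D * u \<le> m" by (rule order_trans)
    moreover have "128 * real D * u > 0" using u1 D1 by simp
    ultimately show ?thesis by (simp add: q_def)
  qed
  have q_le: "q \<le> m"
  proof -
    have "1 * 1 \<le> (128 * real D) * u" using u1 D1 by (intro mult_mono) auto
    then have "m / (128 * real D * u) \<le> m / 1" using m1 u1 D1 by (intro divide_left_mono mult_pos_pos) auto
    then show ?thesis by (simp add: q_def)
  qed
  have "\<exists>r. 4 ^ r \<le> q \<and> q < 4 ^ Suc r"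
  proof -
    obtain k where k: "q < 4 ^ k" using real_arch_pow[of 4 q] by auto
    define k0 where "k0 = (LEAST k. q < 4 ^ k)"
    have k0: "q < 4 ^ k0" unfolding k0_def using k by (rule LeastI)
    then have "k0 \<noteq> 0" using q1 by (intro notI) simp
    then obtain r where r: "k0 = Suc r" by (cases k0) auto
    have "\<not> q < 4 ^ r" using not_less_Least[of r "\<lambda>k. q < 4 ^ k"] r k0_def by auto
    then show ?thesis using k0 r by (intro exI[of _ r]) auto
  qed
  then obtain r where r: "4 ^ r \<le> q" "q < 4 ^ Suc r" by auto
  have rs: "r \<le> s"
  proof -
    have "m \<le> real (4 ^ s)" using J unfolding m_def by (simp only: of_nat_le_iff)
    then have "m \<le> 4 ^ s" by simp
    then have "(4::real) ^ r \<le> 4 ^ s" using r q_le by linarith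
    then show ?thesis by (rule power_le_imp_le_exp[rotated]) simp
  qed
  have rq: "1 / 2 ^ r \<le> sqrt (512 * real D * u / m)"
  proof (rule real_le_rsqrt)
    have "(1 / 2 ^ r)\<^sup>2 = 1 / (4::real) ^ r"
      by (simp add: power_divide two_power_sq)
    also have "\<dots> \<le> 1 / (q / 4)" using r q1 by (intro divide_left_mono) auto
    also have "\<dots> = 512 * real D * u / m" by (simp add: q_def)
    finally show "(1 / 2 ^ r)\<^sup>2 \<le> 512 * real D * u / m" .
  qed
  show False
  proof -
    have S0: "S \<ge> 0" using S J by (meson ex_in_conv order_trans sum_nonneg zero_le_power2)
    define Y where "Y = 8 * sqrt A * 2 ^ s * (2 * exp 8 * N / m) powr (1 / p)"
    have Y0: "Y \<ge> 0" using sb by (simp add: Y_def)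
    have z1: "12 * sqrt S / 2 ^ r \<le> z"
    proof -
      have "1 / 2 ^ r * (12 * sqrt S) \<le> sqrt (512 * real D * u / m) * (12 * sqrt S + Y)"
        using rq Y0 S0 m1 u1 D1 by (intro mult_mono) auto
      then show ?thesis by (simp add: z_def Y_def)
    qed
    have z2: "Y / 2 ^ r \<le> z"
    proof -
      have "1 / 2 ^ r * Y \<le> sqrt (512 * real D * u / m) * Y"
        using rq Y0 by (intro mult_right_mono) auto
      also have "\<dots> \<le> sqrt (512 * real D * u / m) * (12 * sqrt S + Y)" using S0 m1 u1 by (intro mult_left_mono) auto
      finally show ?thesis by (simp add: z_def Y_def)
    qed
    have z: "z \<ge> 0" using z2 Y0 by (meson divide_nonneg_nonneg order_trans zero_le_numeral zero_le_power)
    \<comment> \<open>The level \<open>z\<close> may be 0, but sampling needs a positive one. The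
      minimum over the finite set \<open>J\<close> lies strictly above \<open>z\<close>.\<close>
    obtain z' where z': "z < z'" "\<And>j. j \<in> J \<Longrightarrow> z' \<le> \<bar>\<Sum>i\<in>{i\<in>I. \<not> conf i j}. y i * inner_n n (x i) (x j)\<bar>"
    proof -
      let ?f = "\<lambda>j. \<bar>\<Sum>i\<in>{i\<in>I. \<not> conf i j}. y i * inner_n n (x i) (x j)\<bar>"
      have "z < Min (?f ` J)" using finJ J big by (subst Min_gr_iff) auto
      moreover have "Min (?f ` J) \<le> ?f j" if "j \<in> J" for j using finJ that by (intro Min_le) auto
      ultimately show ?thesis using that by blast
    qed
    have "\<exists>\<zeta>::nat \<Rightarrow> int. \<exists>G\<subseteq>J. {i. \<zeta> i \<noteq> 0} \<subseteq> I \<and> card {i. \<zeta> i \<noteq> 0} \<le> 8 * 4 ^ r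
     \<and> (\<Sum>i\<in>I. (\<zeta> i)\<^sup>2) \<le> (16 * 4 ^ s :: int) \<and> card J \<le> 2 * card G
     \<and> (\<forall>j\<in>G. (\<forall>i\<in>I. \<zeta> i \<noteq> 0 \<longrightarrow> \<not> conf i j) \<and> 2 ^ r * z' / 2 \<le> \<bar>\<Sum>i\<in>I. \<zeta> i * inner_n n (x i) (x j)\<bar>)"
    proof (rule sparse_sampling[where y=y and D=D and S=S])
      fix i assume i: "i \<in> I"
      have "card {j \<in> J. conf i j} \<le> card {j. j < N \<and> conf i j}" using J by (intro card_mono) auto
      then show "card {j \<in> J. conf i j} \<le> D" using conf(2)[of i] i I by auto
    next
      have "real (32 * D * 4 ^ r) = 32 * real D * 4 ^ r" by simp
      also have "\<dots> \<le> 32 * real D * q" using r by (intro mult_left_mono) auto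
      also have "\<dots> = m / (4 * u)" using D1 u1 by (simp add: q_def field_simps)
      also have "\<dots> \<le> m / 1" using m1 u1 by (intro divide_left_mono) auto
      finally have "real (32 * D * 4 ^ r) \<le> real (card J)" by (simp add: m_def)
      then show "32 * D * 4 ^ r \<le> card J" by (simp only: of_nat_le_iff)
    next
      have "(12 * sqrt S)\<^sup>2 \<le> (2 ^ r * z')\<^sup>2"
      proof (rule power_mono)
        have "12 * sqrt S / 2 ^ r \<le> z'" using z1 z'(1) by linarith
        then show "12 * sqrt S \<le> 2 ^ r * z'" by (simp add: field_simps)
      qed (use S0 in simp)
      also have "(2 ^ r * z')\<^sup>2 = 4 ^ r * z'\<^sup>2"
        by (simp add: power_mult_distrib two_power_sq)
      finally show "128 * S \<le> 4 ^ r * z'\<^sup>2" using S0 by (simp add: power_mult_distrib)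
    qed (use I J finI finJ dy y1 rs S z z' in auto)
    then obtain \<zeta> :: "nat \<Rightarrow> int" and G where G: "G \<subseteq> J" "{i. \<zeta> i \<noteq> 0} \<subseteq> I" "card {i. \<zeta> i \<noteq> 0} \<le> 8 * 4 ^ r"
      "(\<Sum>i\<in>I. (\<zeta> i)\<^sup>2) \<le> (16 * 4 ^ s :: int)" "card J \<le> 2 * card G"
      "\<And>j. j \<in> G \<Longrightarrow> (\<forall>i\<in>I. \<zeta> i \<noteq> 0 \<longrightarrow> \<not> conf i j) \<and> 2 ^ r * z' / 2 \<le> \<bar>\<Sum>i\<in>I. \<zeta> i * inner_n n (x i) (x j)\<bar>"
      by blast
    \<comment> \<open>Half of \<open>J\<close>, rounded up, so that
      \<open>m / 2 \<le> h \<le> card G\<close>. As \<open>order_event\<close> speaks of index sets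
      of size exactly \<open>h\<close>, it is applied to a subset of \<open>G\<close>.\<close>
    define h where "h = (card J + 1) div 2"
    have h1: "1 \<le> h" using J finJ by (simp add: h_def Suc_le_eq card_gt_0_iff)
    have hG: "h \<le> card G" using G(5) by (simp add: h_def)
    have hm: "m / 2 \<le> real h" unfolding h_def m_def by linarith
    obtain G' where G': "G' \<subseteq> G" "card G' = h" using obtain_subset_with_card_n[OF hG] by auto
    define l where "l = (8 * 4 ^ r :: nat)"
    have "real l * ln (\<Gamma> / real l) \<le> m / 2"
    proof (rule sparsity_entropy_bound[where D="real D"])
      have "real l = 8 * 4 ^ r" by (simp add: l_def)
      also have "\<dots> \<le> 8 * q" using r by simp
      also have "\<dots> = m / (16 * real D * ln (\<Gamma> / m))" by (simp add: q_def u_def)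
      finally show "real l \<le> m / (16 * real D * ln (\<Gamma> / m))" .
    qed (use \<Gamma> m1 u1 D1 in \<open>auto simp: l_def u_def\<close>)
    then have ent: "real l * ln (\<Gamma> / real l) \<le> real h" using hm by linarith
    let ?v = "lin N x (\<lambda>i. real_of_int (\<zeta> i))"
    have sumI: "(\<Sum>i<N. f i) = (\<Sum>i\<in>I. f i)" if "\<And>i. \<zeta> i = 0 \<Longrightarrow> f i = 0" for f :: "nat \<Rightarrow> 'z::comm_monoid_add"
      using I G(2) that by (intro sum.mono_neutral_right) auto
    have "\<bar>k\<bar> \<le> k\<^sup>2" for k :: int
      by (metis abs_ge_zero abs_le_square_iff abs_of_nonneg int_one_le_iff_zero_less mult.right_neutral mult_left_mono order_le_less power2_abs power2_eq_square power_zero_numeral zero_le_power2)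
    then have "(\<Sum>i\<in>I. \<bar>\<zeta> i\<bar>) \<le> (\<Sum>i\<in>I. (\<zeta> i)\<^sup>2)" by (intro sum_mono)
    also have "\<dots> \<le> int (16 * 4 ^ s)" using G(4) by simp
    also have "\<dots> \<le> int K" using E(2) by (simp only: of_nat_le_iff)
    finally have sumK: "(\<Sum>i<N. \<bar>\<zeta> i\<bar>) \<le> int K" by (subst sumI) auto
    have cz: "card {i. i < N \<and> \<zeta> i \<noteq> 0} \<le> l"
    proof -
      have "card {i. i < N \<and> \<zeta> i \<noteq> 0} \<le> card {i. \<zeta> i \<noteq> 0}"
        by (rule card_mono) (use finite_subset[OF G(2) finI] in auto)
      then show ?thesis using G(3) by (simp add: l_def)
    qed
    \<comment> \<open>\<open>conf\<close> is reflexive, so a good index lies outside the support: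
      \<open>x j\<close> is not part of the combination against which it is tested.\<close>
    have disj: "\<zeta> j = 0" if "j \<in> G'" for j
      using G(6)[of j] G(2) that G' conf(1)[of j] by auto
    have lK: "l \<le> K"
    proof -
      have "(4::nat) ^ r \<le> 4 ^ s" using rs by (intro power_increasing) auto
      then have "8 * (4::nat) ^ r \<le> 16 * 4 ^ s" by linarith
      then show ?thesis using E(2) unfolding l_def by (rule order_trans)
    qed
    have "G' \<subseteq> {..<N}" using G' G(1) J(1) by blast
    then obtain j where j: "j \<in> G'" "\<bar>inner_n n ?v (x j)\<bar> \<le> thr p N h * nrm n ?v"
      using E(1)[unfolded order_event_def, rule_format, of l h \<zeta> G'] ent lK h1 sumK cz disj G'
      by (auto simp: l_def)
    have "inner_n n ?v (x j) = (\<Sum>i\<in>I. \<zeta> i * inner_n n (x i) (x j))"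
      unfolding inner_n_lin by (rule sumI) auto
    then have "2 ^ r * z' / 2 \<le> \<bar>inner_n n ?v (x j)\<bar>" using G(6)[of j] j G' by auto
    also have "\<dots> \<le> thr p N h * nrm n ?v" by (rule j)
    also have "\<dots> \<le> (2 * exp 8 * N / m) powr (1 / p) * (4 * 2 ^ s * sqrt A)"
    proof (intro mult_mono)
      have "exp 8 * real N / real h \<le> exp 8 * real N / (m / 2)" using hm m1 by (intro divide_left_mono) auto
      then show "thr p N h \<le> (2 * exp 8 * real N / m) powr (1 / p)"
        unfolding thr_def using p by (intro powr_mono2) (auto simp: mult_ac)
      have "(nrm n ?v)\<^sup>2 \<le> A * (\<Sum>i<N. (real_of_int (\<zeta> i))\<^sup>2)"
      proof -
        have "card {i. i < N \<and> real_of_int (\<zeta> i) \<noteq> 0} \<le> card I" using G(2) finI by (intro card_mono) auto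
        then show ?thesis using sb(1) I(2) unfolding sparse_bound_def by auto
      qed
      also have "\<dots> = A * real_of_int (\<Sum>i\<in>I. (\<zeta> i)\<^sup>2)" by (subst sumI) auto
      also have "\<dots> \<le> A * real_of_int (16 * 4 ^ s)" using sb(2) G(4) by (intro mult_left_mono) (simp only: of_int_le_iff, auto)
      also have "\<dots> = (4 * 2 ^ s * sqrt A)\<^sup>2" using sb(2)
        by (simp add: power_mult_distrib two_power_sq)
      finally show "nrm n ?v \<le> 4 * 2 ^ s * sqrt A" using sb(2) by (simp add: power2_le_iff_abs_le)
    qed auto
    also have "\<dots> = Y / 2" by (simp add: Y_def)
    finally have "z' \<le> Y / 2 ^ r" by (simp add: field_simps)
    then show False using z2 z'(1) by linarith
  qed
qed

lemma nrm_lin_le: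
  assumes "sparse_bound n N \<kappa> x A" "A \<ge> 0" "card {i. i < N \<and> c i \<noteq> 0} \<le> \<kappa>" "(\<Sum>i<N. (c i)\<^sup>2) \<le> 1"
  shows "nrm n (lin N x c) \<le> sqrt A"
proof (rule real_le_rsqrt)
  have "(nrm n (lin N x c))\<^sup>2 \<le> A * (\<Sum>i<N. (c i)\<^sup>2)" using assms by (auto simp: sparse_bound_def)
  also have "\<dots> \<le> A * 1" using assms by (intro mult_left_mono) auto
  finally show "(nrm n (lin N x c))\<^sup>2 \<le> A" by simp
qed

text \<open>The sum over all of \<open>I\<close> is an inner product with a sparse combination,
  hence at most \<open>sqrt A * \<tau>\<close>; at most \<open>D\<close> conflicting terms of size
  \<open>\<tau>\<^sup>2\<close> have to be taken back. This crude bound serves the few largest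
  values, for which the index set is too small for sampling.\<close>

lemma level_entry_bound:
  fixes y :: "nat \<Rightarrow> real"
  assumes sb: "sparse_bound n N \<kappa> x A" "A \<ge> 0"
    and I: "I \<subseteq> {..<N}" "card I \<le> \<kappa>" and y1: "(\<Sum>i\<in>I. (y i)\<^sup>2) \<le> 1"
    and conf: "card {i. i < N \<and> conf i j} \<le> D"
    and x: "\<And>i. i < N \<Longrightarrow> nrm n (x i) \<le> \<tau>" and j: "j < N"
  shows "\<bar>\<Sum>i\<in>{i\<in>I. \<not> conf i j}. y i * inner_n n (x i) (x j)\<bar> \<le> sqrt A * \<tau> + D * \<tau>\<^sup>2"
proof -
  have fin: "finite I" using I finite_subset by auto
  have t0: "\<tau> \<ge> 0" using x[OF j] nrm_nonneg[of n "x j"] by linarith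
  define c where "c i = (if i \<in> I then y i else 0)" for i
  let ?a = "\<lambda>i. inner_n n (x i) (x j)"
  have sumI: "(\<Sum>i<N. f (c i) i) = (\<Sum>i\<in>I. f (y i) i)" if "\<And>i. f 0 i = 0" for f :: "real \<Rightarrow> nat \<Rightarrow> real"
    using I that by (intro sum.mono_neutral_cong_right) (auto simp: c_def)
  have "inner_n n (lin N x c) (x j) = (\<Sum>i\<in>I. y i * ?a i)"
    unfolding inner_n_lin by (rule sumI) auto
  also have "\<dots> = (\<Sum>i\<in>{i\<in>I. \<not> conf i j}. y i * ?a i) + (\<Sum>i\<in>{i\<in>I. conf i j}. y i * ?a i)"
    using fin by (subst sum.union_disjoint[symmetric]) (auto intro!: sum.cong)
  finally have eq: "(\<Sum>i\<in>{i\<in>I. \<not> conf i j}. y i * ?a i)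
      = inner_n n (lin N x c) (x j) - (\<Sum>i\<in>{i\<in>I. conf i j}. y i * ?a i)" by simp
  have "card {i. i < N \<and> c i \<noteq> 0} \<le> card I"
    using fin by (intro card_mono) (auto simp: c_def)
  moreover have "(\<Sum>i<N. (c i)\<^sup>2) \<le> 1" using sumI[of "\<lambda>t _. t\<^sup>2"] y1 by simp
  ultimately have "nrm n (lin N x c) \<le> sqrt A" using I by (intro nrm_lin_le[OF sb]) auto
  then have "\<bar>inner_n n (lin N x c) (x j)\<bar> \<le> sqrt A * \<tau>"
    using inner_n_CS[of n "lin N x c" "x j"] mult_mono[of "nrm n (lin N x c)" "sqrt A" "nrm n (x j)" \<tau>] x[OF j] sb(2)
    by simp
  moreover have "\<bar>\<Sum>i\<in>{i\<in>I. conf i j}. y i * ?a i\<bar> \<le> D * \<tau>\<^sup>2"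
  proof -
    have "\<bar>\<Sum>i\<in>{i\<in>I. conf i j}. y i * ?a i\<bar> \<le> (\<Sum>i\<in>{i\<in>I. conf i j}. \<bar>y i * ?a i\<bar>)" by (rule sum_abs)
    also have "\<dots> \<le> (\<Sum>i\<in>{i\<in>I. conf i j}. \<tau>\<^sup>2)"
    proof (intro sum_mono)
      fix i assume i: "i \<in> {i\<in>I. conf i j}"
      have "(y i)\<^sup>2 \<le> (\<Sum>i\<in>I. (y i)\<^sup>2)" using i fin by (intro member_le_sum) auto
      then have "\<bar>y i\<bar> \<le> 1" using y1 abs_square_le_1 by fastforce
      moreover have "\<bar>?a i\<bar> \<le> \<tau> * \<tau>"
        using inner_n_CS[of n "x i" "x j"] mult_mono[OF x x, of i j] i I j t0 by fastforce
      ultimately have "\<bar>y i\<bar> * \<bar>?a i\<bar> \<le> 1 * (\<tau> * \<tau>)" by (intro mult_mono) auto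
      then show "\<bar>y i * ?a i\<bar> \<le> \<tau>\<^sup>2" by (simp add: abs_mult power2_eq_square)
    qed
    also have "\<dots> = card {i\<in>I. conf i j} * \<tau>\<^sup>2" by simp
    also have "\<dots> \<le> D * \<tau>\<^sup>2"
    proof (intro mult_right_mono)
      have "card {i\<in>I. conf i j} \<le> card {i. i < N \<and> conf i j}" using I by (intro card_mono) auto
      then show "real (card {i\<in>I. conf i j}) \<le> real D" using conf by simp
    qed auto
    finally show ?thesis .
  qed
  ultimately show ?thesis unfolding eq by linarith
qed

text \<open>An outer entry at level \<open>s\<close> has modulus \<open>2\<close> to the power \<open>-s\<close>, hence the factor on the right.\<close>

definition level_bound :: "nat \<Rightarrow> nat \<Rightarrow> (nat \<Rightarrow> nat \<Rightarrow> real) \<Rightarrow> nat \<Rightarrow> (nat \<Rightarrow> nat \<Rightarrow> bool) \<Rightarrow> nat \<Rightarrow> real \<Rightarrow> bool" where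
  "level_bound n N x \<kappa> conf s \<beta> \<longleftrightarrow>
     (\<forall>I J y. I \<subseteq> {..<N} \<longrightarrow> card I \<le> \<kappa> \<longrightarrow> card I \<le> 4 ^ s \<longrightarrow>
        (\<forall>i\<in>I. \<exists>b\<le>s. \<bar>y i\<bar> = (1/2) ^ b) \<longrightarrow> (\<Sum>i\<in>I. (y i)\<^sup>2) \<le> 1 \<longrightarrow>
        J \<subseteq> {..<N} \<longrightarrow> card J \<le> 4 ^ s \<longrightarrow>
        (\<Sum>j\<in>J. \<bar>\<Sum>i\<in>{i\<in>I. \<not> conf i j}. y i * inner_n n (x i) (x j)\<bar>) \<le> 2 ^ s * \<beta>)"

text \<open>The threshold \<open>m0\<close> separates two regimes: up to \<open>m0\<close> the order
  statistics are bounded by \<open>level_entry_bound\<close>, beyond it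
  \<open>level_order_statistic\<close> applies because then
  \<open>128 * D * ln \<Gamma> \<le> card J\<close>. \<open>Z\<close> leaves room for a majorant
  that is easier to sum.\<close>

lemma level_bound_order_statistics:
  fixes Z :: "nat \<Rightarrow> real"
  assumes sb: "sparse_bound n N \<kappa> x A" "A \<ge> 0"
    and conf: "\<And>j. conf j j" "\<And>i j. conf i j = conf j i" "\<And>i. i < N \<Longrightarrow> card {j. j < N \<and> conf i j} \<le> D"
    and x: "\<And>i. i < N \<Longrightarrow> nrm n (x i) \<le> \<tau>" "\<tau> \<ge> 0"
    and S: "\<And>I j. I \<subseteq> {..<N} \<Longrightarrow> card I \<le> \<kappa> \<Longrightarrow> card I \<le> 4 ^ s \<Longrightarrow> j < N \<Longrightarrow>
        (\<Sum>i\<in>{i\<in>I. \<not> conf i j}. (inner_n n (x i) (x j))\<^sup>2) \<le> S"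
    and S0: "S \<ge> 0" and E: "order_event n N x p \<Gamma> K" "16 * 4 ^ s \<le> K" and p: "p > 0"
    and \<Gamma>: "\<Gamma> > 0" "1 \<le> ln (\<Gamma> / 4 ^ s)" "128 * real D * ln \<Gamma> \<le> real m0" and D: "D \<ge> 1"
    and Z: "\<And>m::nat. 1 \<le> m \<Longrightarrow> m \<le> 4 ^ s \<Longrightarrow> sqrt (512 * real D * ln (\<Gamma> / m) / m)
        * (12 * sqrt S + 8 * sqrt A * 2 ^ s * (2 * exp 8 * N / m) powr (1 / p)) \<le> Z m"
    and \<beta>: "m0 * (sqrt A * \<tau> + D * \<tau>\<^sup>2) + (\<Sum>m=1..4 ^ s. Z m) \<le> 2 ^ s * \<beta>"
  shows "level_bound n N x \<kappa> conf s \<beta>"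
  unfolding level_bound_def
proof (intro allI impI)
  fix I J :: "nat set" and y :: "nat \<Rightarrow> real"
  assume I: "I \<subseteq> {..<N}" "card I \<le> \<kappa>" "card I \<le> 4 ^ s" and dy: "\<forall>i\<in>I. \<exists>b\<le>s. \<bar>y i\<bar> = (1/2) ^ b"
    and y1: "(\<Sum>i\<in>I. (y i)\<^sup>2) \<le> 1" and J: "J \<subseteq> {..<N}" "card J \<le> 4 ^ s"
  let ?r = "\<lambda>j. \<bar>\<Sum>i\<in>{i\<in>I. \<not> conf i j}. y i * inner_n n (x i) (x j)\<bar>"
  define T where "T = sqrt A * \<tau> + D * \<tau>\<^sup>2"
  have T0: "T \<ge> 0" using x sb by (simp add: T_def)
  have finJ: "finite J" using J finite_subset by auto
  have lnm: "1 \<le> ln (\<Gamma> / real m)" if "1 \<le> m" "m \<le> 4 ^ s" for m :: nat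
  proof -
    have "real m \<le> real (4 ^ s)" using that by (simp only: of_nat_le_iff)
    then have "\<Gamma> / 4 ^ s \<le> \<Gamma> / real m" using \<Gamma>(1) that by (intro divide_left_mono) auto
    then have "ln (\<Gamma> / 4 ^ s) \<le> ln (\<Gamma> / real m)" using \<Gamma>(1) that by simp
    then show ?thesis using \<Gamma>(2) by linarith
  qed
  have Z0: "0 \<le> Z m" if "1 \<le> m" "m \<le> 4 ^ s" for m :: nat
  proof -
    have "0 \<le> sqrt (512 * real D * ln (\<Gamma> / m) / m)
        * (12 * sqrt S + 8 * sqrt A * 2 ^ s * (2 * exp 8 * N / m) powr (1 / p))"
      using sb(2) S0 lnm[OF that] by (intro mult_nonneg_nonneg add_nonneg_nonneg) auto
    then show ?thesis using Z[OF that] by linarith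
  qed
  have "(\<Sum>j\<in>J. ?r j) \<le> (\<Sum>m=1..card J. (if m \<le> m0 then T else 0) + Z m)"
  proof (rule sum_le_order_statistics[OF finJ])
    fix J' assume J': "J' \<subseteq> J" "J' \<noteq> {}"
    have cJ: "1 \<le> card J'" "card J' \<le> 4 ^ s"
      using J' finJ J(2) card_mono[OF finJ J'(1)] finite_subset[OF J'(1) finJ] by (auto simp: Suc_le_eq card_gt_0_iff)
    show "\<exists>j\<in>J'. ?r j \<le> (if card J' \<le> m0 then T else 0) + Z (card J')"
    proof (cases "card J' \<le> m0")
      case True
      obtain j where j: "j \<in> J'" using J' by auto
      then have jN: "j < N" using J' J by auto
      have "?r j \<le> T" unfolding T_def
        by (rule level_entry_bound[OF sb I(1,2) y1 _ x(1) jN]) (use conf(3)[OF jN] conf(2)[of _ j] in auto)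
      then show ?thesis using j True Z0[OF cJ] by (intro bexI[of _ j]) auto
    next
      case False
      have "\<exists>j\<in>J'. ?r j \<le> sqrt (512 * real D * ln (\<Gamma> / real (card J')) / real (card J'))
         * (12 * sqrt S + 8 * sqrt A * 2 ^ s * (2 * exp 8 * N / real (card J')) powr (1 / p))"
      proof (rule level_order_statistic[OF sb I _ y1 _ J'(2) cJ(2) conf(1) conf(3) _ E p \<Gamma>(1) _ _ D])
        show "1 \<le> ln (\<Gamma> / real (card J'))" using lnm cJ by auto
        show "128 * real D * ln \<Gamma> \<le> real (card J')" using \<Gamma>(3) False by linarith
      qed (use dy J' J S I in auto)
      then show ?thesis using Z[OF cJ] False by force
    qed
  qed
  also have "\<dots> \<le> (\<Sum>m=1..4 ^ s. (if m \<le> m0 then T else 0) + Z m)"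
    using J(2) T0 Z0 by (intro sum_mono2) auto
  also have "\<dots> = (\<Sum>m=1..4 ^ s. (if m \<le> m0 then T else 0)) + (\<Sum>m=1..4 ^ s. Z m)"
    by (simp add: sum.distrib)
  also have "(\<Sum>m=1..4 ^ s. (if m \<le> m0 then T else 0)) \<le> (\<Sum>m\<in>{1..m0}. T)"
  proof -
    have "(\<Sum>m=1..4 ^ s. (if m \<le> m0 then T else 0)) = (\<Sum>m\<in>{1..4 ^ s} \<inter> {1..m0}. T)"
      by (rule sum.mono_neutral_cong_right) auto
    also have "\<dots> \<le> (\<Sum>m\<in>{1..m0}. T)" using T0 by (intro sum_mono2) auto
    finally show ?thesis .
  qed
  also have "(\<Sum>m\<in>{1..m0}. T) + (\<Sum>m=1..4 ^ s. Z m) \<le> 2 ^ s * \<beta>" using \<beta> by (simp add: T_def)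
  finally show "(\<Sum>j\<in>J. ?r j) \<le> 2 ^ s * \<beta>" by simp
qed

text \<open>A vector of norm at most 1 has at most \<open>4 ^ b\<close> entries of modulus at least
  \<open>(1/2) ^ b\<close>. This limits both index sets of level \<open>b\<close>: the entries of
  modulus \<open>(1/2) ^ b\<close> and their partners that are not smaller. The conflicting pairs
  are bounded separately through their degree.\<close>

lemma dyadic_form_bound:
  fixes y :: "nat \<Rightarrow> real"
  assumes conf: "\<And>i j. conf i j = conf j i" "\<And>i. i < N \<Longrightarrow> card {j. j < N \<and> conf i j} \<le> D"
    and x: "\<And>i. i < N \<Longrightarrow> nrm n (x i) \<le> \<tau>" "\<tau> \<ge> 0"
    and dy: "\<And>i. i < N \<Longrightarrow> y i \<noteq> 0 \<Longrightarrow> \<exists>b\<le>s. \<bar>y i\<bar> = (1/2) ^ b" and y1: "(\<Sum>i<N. (y i)\<^sup>2) \<le> 1"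
    and card: "card {i. i < N \<and> y i \<noteq> 0} \<le> \<kappa>"
    and lb: "\<And>b. b \<le> s \<Longrightarrow> level_bound n N x \<kappa> conf b (\<beta> b)"
  shows "(nrm n (lin N x y))\<^sup>2 \<le> D * \<tau>\<^sup>2 + 2 * (\<Sum>b\<le>s. \<beta> b)"
proof -
  let ?a = "\<lambda>i j. inner_n n (x i) (x j)"
  have a_le: "\<bar>?a i j\<bar> \<le> \<tau>\<^sup>2" if "i < N" "j < N" for i j
    using inner_n_CS[of n "x i" "x j"] mult_mono[OF x(1) x(1), of i j] that x(2) by (fastforce simp: power2_eq_square)
  define U where "U = {i. i < N \<and> y i \<noteq> 0}"
  have U: "finite U" "U \<subseteq> {..<N}" by (auto simp: U_def)
  define g where "g i j = y j * (y i * ?a i j)" for i j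
  have gsym: "g i j = g j i" for i j by (simp add: g_def inner_n_comm[of n "x i"])
  define P where "P = U \<times> U"
  have "(nrm n (lin N x y))\<^sup>2 = (\<Sum>j\<in>U. \<Sum>i\<in>U. g i j)"
  proof -
    have "(nrm n (lin N x y))\<^sup>2 = (\<Sum>j<N. \<Sum>i<N. g i j)" by (simp add: nrm_lin_sq g_def)
    also have "\<dots> = (\<Sum>j\<in>U. \<Sum>i<N. g i j)" using U by (intro sum.mono_neutral_right) (auto simp: U_def g_def)
    also have "\<dots> = (\<Sum>j\<in>U. \<Sum>i\<in>U. g i j)" using U by (intro sum.cong sum.mono_neutral_right) (auto simp: U_def g_def)
    finally show ?thesis .
  qed
  also have "\<dots> = (\<Sum>j\<in>U. (\<Sum>i\<in>{i\<in>U. conf i j}. g i j) + (\<Sum>i\<in>{i\<in>U. \<not> conf i j \<and> \<bar>y j\<bar> \<le> \<bar>y i\<bar>}. g i j)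
      + (\<Sum>i\<in>{i\<in>U. \<not> conf i j \<and> \<bar>y i\<bar> < \<bar>y j\<bar>}. g i j))"
  proof (intro sum.cong refl)
    fix j assume "j \<in> U"
    have "(\<Sum>i\<in>U. g i j) = (\<Sum>i\<in>{i\<in>U. conf i j} \<union> ({i\<in>U. \<not> conf i j \<and> \<bar>y j\<bar> \<le> \<bar>y i\<bar>} \<union> {i\<in>U. \<not> conf i j \<and> \<bar>y i\<bar> < \<bar>y j\<bar>}). g i j)"
      by (intro sum.cong) auto
    then show "(\<Sum>i\<in>U. g i j) = (\<Sum>i\<in>{i\<in>U. conf i j}. g i j) + (\<Sum>i\<in>{i\<in>U. \<not> conf i j \<and> \<bar>y j\<bar> \<le> \<bar>y i\<bar>}. g i j)
      + (\<Sum>i\<in>{i\<in>U. \<not> conf i j \<and> \<bar>y i\<bar> < \<bar>y j\<bar>}. g i j)"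
      using U by (subst (asm) sum.union_disjoint, simp, simp, blast, subst (asm) sum.union_disjoint) auto
  qed
  also have "\<dots> = (\<Sum>j\<in>U. \<Sum>i\<in>{i\<in>U. conf i j}. g i j) + (\<Sum>j\<in>U. \<Sum>i\<in>{i\<in>U. \<not> conf i j \<and> \<bar>y j\<bar> \<le> \<bar>y i\<bar>}. g i j)
     + (\<Sum>j\<in>U. \<Sum>i\<in>{i\<in>U. \<not> conf i j \<and> \<bar>y i\<bar> < \<bar>y j\<bar>}. g i j)"
    by (simp add: sum.distrib)
  also have "(\<Sum>j\<in>U. \<Sum>i\<in>{i\<in>U. \<not> conf i j \<and> \<bar>y i\<bar> < \<bar>y j\<bar>}. g i j)
     = (\<Sum>j\<in>U. \<Sum>i\<in>{i\<in>U. \<not> conf i j \<and> \<bar>y j\<bar> < \<bar>y i\<bar>}. g i j)"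
    using U by (subst sum.swap_restrict) (auto simp: conf(1) gsym intro!: sum.cong)
  finally have split: "(nrm n (lin N x y))\<^sup>2 = (\<Sum>j\<in>U. \<Sum>i\<in>{i\<in>U. conf i j}. g i j)
     + (\<Sum>j\<in>U. \<Sum>i\<in>{i\<in>U. \<not> conf i j \<and> \<bar>y j\<bar> \<le> \<bar>y i\<bar>}. g i j)
     + (\<Sum>j\<in>U. \<Sum>i\<in>{i\<in>U. \<not> conf i j \<and> \<bar>y j\<bar> < \<bar>y i\<bar>}. g i j)" .
  have sumU: "(\<Sum>j\<in>U. (y j)\<^sup>2) \<le> 1"
    using y1 U sum_mono2[of "{..<N}" U "\<lambda>i. (y i)\<^sup>2"] by simp
  \<comment> \<open>A Schur test: \<open>\<bar>y j\<bar> * \<bar>y i\<bar>\<close> is split into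
    squares, the two halves agree by the symmetry of \<open>conf\<close>, and every index has at
    most \<open>D\<close> conflicts.\<close>
  have "(\<Sum>j\<in>U. \<Sum>i\<in>{i\<in>U. conf i j}. g i j) \<le> (\<Sum>j\<in>U. \<Sum>i\<in>{i\<in>U. conf i j}. \<tau>\<^sup>2 * ((y i)\<^sup>2 / 2 + (y j)\<^sup>2 / 2))"
  proof (intro sum_mono)
    fix j i assume ij: "j \<in> U" "i \<in> {i\<in>U. conf i j}"
    have "g i j \<le> \<bar>y j\<bar> * \<bar>y i\<bar> * \<bar>?a i j\<bar>" unfolding g_def by (metis abs_ge_self abs_mult mult.assoc)
    also have "\<dots> \<le> ((y i)\<^sup>2 / 2 + (y j)\<^sup>2 / 2) * \<tau>\<^sup>2"
    proof (intro mult_mono)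
      have "0 \<le> (\<bar>y i\<bar> - \<bar>y j\<bar>)\<^sup>2" by simp
      then show "\<bar>y j\<bar> * \<bar>y i\<bar> \<le> (y i)\<^sup>2 / 2 + (y j)\<^sup>2 / 2" by (simp add: power2_diff field_simps)
    qed (use a_le ij U in auto)
    finally show "g i j \<le> \<tau>\<^sup>2 * ((y i)\<^sup>2 / 2 + (y j)\<^sup>2 / 2)" by (simp add: mult.commute)
  qed
  also have "\<dots> = (\<Sum>j\<in>U. \<Sum>i\<in>{i\<in>U. conf i j}. \<tau>\<^sup>2 * ((y i)\<^sup>2 / 2)) + (\<Sum>j\<in>U. \<Sum>i\<in>{i\<in>U. conf i j}. \<tau>\<^sup>2 * ((y j)\<^sup>2 / 2))"
    by (simp add: distrib_left sum.distrib)
  also have "(\<Sum>j\<in>U. \<Sum>i\<in>{i\<in>U. conf i j}. \<tau>\<^sup>2 * ((y i)\<^sup>2 / 2)) = (\<Sum>j\<in>U. \<Sum>i\<in>{i\<in>U. conf i j}. \<tau>\<^sup>2 * ((y j)\<^sup>2 / 2))"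
    using U by (subst sum.swap_restrict) (auto simp: conf(1) intro!: sum.cong)
  also have "\<dots> + \<dots> = (\<Sum>j\<in>U. card {i\<in>U. conf i j} * (\<tau>\<^sup>2 * (y j)\<^sup>2))"
    by (simp add: sum.distrib[symmetric] mult_ac)
  also have "\<dots> \<le> (\<Sum>j\<in>U. D * (\<tau>\<^sup>2 * (y j)\<^sup>2))"
  proof (intro sum_mono mult_right_mono)
    fix j assume "j \<in> U"
    have "card {i\<in>U. conf i j} \<le> card {i. i < N \<and> conf j i}" using U by (intro card_mono) (auto simp: conf(1))
    then show "real (card {i\<in>U. conf i j}) \<le> real D" using conf(2)[of j] \<open>j \<in> U\<close> U by auto
  qed auto
  also have "\<dots> = D * \<tau>\<^sup>2 * (\<Sum>j\<in>U. (y j)\<^sup>2)" by (simp add: sum_distrib_left mult.assoc)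
  also have "\<dots> \<le> D * \<tau>\<^sup>2 * 1" using sumU by (intro mult_left_mono) auto
  finally have diag: "(\<Sum>j\<in>U. \<Sum>i\<in>{i\<in>U. conf i j}. g i j) \<le> D * \<tau>\<^sup>2" by simp
  define L where "L b = {j\<in>U. \<bar>y j\<bar> = (1/2) ^ b}" for b
  have UL: "U = (\<Union>b\<in>{..s}. L b)" using dy by (auto simp: L_def U_def)
  have disj: "L b \<inter> L b' = {}" if "b \<noteq> b'" for b b'
    using that by (auto simp: L_def power_one_over)
  have big_card: "card {j\<in>U. (1/2) ^ b \<le> \<bar>y j\<bar>} \<le> 4 ^ b" for b
  proof -
    have "card {j\<in>U. (1/2) ^ b \<le> \<bar>y j\<bar>} * (1/4 :: real) ^ b = (\<Sum>j\<in>{j\<in>U. (1/2) ^ b \<le> \<bar>y j\<bar>}. (1/4) ^ b)" by simp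
    also have "\<dots> \<le> (\<Sum>j\<in>{j\<in>U. (1/2) ^ b \<le> \<bar>y j\<bar>}. (y j)\<^sup>2)"
    proof (intro sum_mono)
      fix j assume "j \<in> {j\<in>U. (1/2) ^ b \<le> \<bar>y j\<bar>}"
      then have "((1/2) ^ b)\<^sup>2 \<le> \<bar>y j\<bar>\<^sup>2" by (intro power_mono) auto
      then show "(1/4) ^ b \<le> (y j)\<^sup>2" by (simp add: power_divide two_power_sq)
    qed
    also have "\<dots> \<le> (\<Sum>j\<in>U. (y j)\<^sup>2)" using U by (intro sum_mono2) auto
    finally have "card {j\<in>U. (1/2) ^ b \<le> \<bar>y j\<bar>} * (1/4 :: real) ^ b \<le> 1" using sumU by linarith
    then have "real (card {j\<in>U. (1/2) ^ b \<le> \<bar>y j\<bar>}) \<le> real (4 ^ b)" by (simp add: power_one_over field_simps)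
    then show ?thesis by (simp only: of_nat_le_iff)
  qed
  \<comment> \<open>\<open>R\<close> is used both as \<open>\<le>\<close> and as \<open><\<close>:
    after exchanging the indices in the second half, the pairs of equal modulus belong to the first
    half only.\<close>
  have half: "(\<Sum>j\<in>U. \<Sum>i\<in>{i\<in>U. \<not> conf i j \<and> R \<bar>y j\<bar> \<bar>y i\<bar>}. g i j) \<le> (\<Sum>b\<le>s. \<beta> b)"
    if R: "\<And>u v. R u v \<Longrightarrow> u \<le> v" for R :: "real \<Rightarrow> real \<Rightarrow> bool"
  proof -
    have "(\<Sum>j\<in>U. \<Sum>i\<in>{i\<in>U. \<not> conf i j \<and> R \<bar>y j\<bar> \<bar>y i\<bar>}. g i j)
        = (\<Sum>b\<le>s. \<Sum>j\<in>L b. \<Sum>i\<in>{i\<in>U. \<not> conf i j \<and> R \<bar>y j\<bar> \<bar>y i\<bar>}. g i j)"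
      by (subst UL, rule sum.UNION_disjoint) (use U disj in \<open>auto simp: L_def\<close>)
    also have "\<dots> \<le> (\<Sum>b\<le>s. \<beta> b)"
    proof (intro sum_mono)
      fix b assume b: "b \<in> {..s}"
      define I where "I = {i\<in>U. R ((1/2) ^ b) \<bar>y i\<bar>}"
      have I: "I \<subseteq> {j\<in>U. (1/2) ^ b \<le> \<bar>y j\<bar>}" using R by (auto simp: I_def)
      have LbU: "L b \<subseteq> {j\<in>U. (1/2) ^ b \<le> \<bar>y j\<bar>}" by (auto simp: L_def)
      have "(\<Sum>j\<in>L b. \<Sum>i\<in>{i\<in>U. \<not> conf i j \<and> R \<bar>y j\<bar> \<bar>y i\<bar>}. g i j)
         = (\<Sum>j\<in>L b. y j * (\<Sum>i\<in>{i\<in>I. \<not> conf i j}. y i * ?a i j))"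
        unfolding sum_distrib_left g_def by (intro sum.cong) (auto simp: L_def I_def)
      also have "\<dots> \<le> (\<Sum>j\<in>L b. (1/2) ^ b * \<bar>\<Sum>i\<in>{i\<in>I. \<not> conf i j}. y i * ?a i j\<bar>)"
      proof (intro sum_mono)
        fix j assume "j \<in> L b"
        then have yj: "(1/2) ^ b = \<bar>y j\<bar>" by (simp add: L_def)
        show "y j * (\<Sum>i\<in>{i\<in>I. \<not> conf i j}. y i * ?a i j) \<le> (1/2) ^ b * \<bar>\<Sum>i\<in>{i\<in>I. \<not> conf i j}. y i * ?a i j\<bar>"
          unfolding yj abs_mult[symmetric] by (rule abs_ge_self)
      qed
      also have "\<dots> = (1/2) ^ b * (\<Sum>j\<in>L b. \<bar>\<Sum>i\<in>{i\<in>I. \<not> conf i j}. y i * ?a i j\<bar>)" by (simp add: sum_distrib_left)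
      also have "\<dots> \<le> (1/2) ^ b * (2 ^ b * \<beta> b)"
      proof (intro mult_left_mono)
        have "card I \<le> 4 ^ b" "card (L b) \<le> 4 ^ b"
          using card_mono[OF _ I] card_mono[OF _ LbU] big_card[of b] U(1) by simp_all
        moreover have "card I \<le> \<kappa>"
        proof -
          have "card I \<le> card U" using U by (intro card_mono) (auto simp: I_def)
          then show ?thesis using card by (simp add: U_def)
        qed
        moreover have "\<forall>i\<in>I. \<exists>b'\<le>b. \<bar>y i\<bar> = (1/2) ^ b'"
        proof
          fix i assume i: "i \<in> I"
          then have "i \<in> U" by (simp add: I_def)
          then obtain b' where b': "\<bar>y i\<bar> = (1/2) ^ b'" using dy[of i] by (auto simp: U_def)
          have "(1/2 :: real) ^ b \<le> (1/2) ^ b'" using i I b' by auto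
          then have "b' \<le> b" using power_decreasing_iff[of "1/2::real" b b'] by (simp del: power_one_over)
          then show "\<exists>b'\<le>b. \<bar>y i\<bar> = (1/2) ^ b'" using b' by auto
        qed
        moreover have "(\<Sum>i\<in>I. (y i)\<^sup>2) \<le> 1"
        proof -
          have "(\<Sum>i\<in>I. (y i)\<^sup>2) \<le> (\<Sum>i\<in>U. (y i)\<^sup>2)" using U by (intro sum_mono2) (auto simp: I_def)
          then show ?thesis using sumU by linarith
        qed
        moreover have "I \<subseteq> {..<N}" "L b \<subseteq> {..<N}" using U by (auto simp: I_def L_def)
        ultimately show "(\<Sum>j\<in>L b. \<bar>\<Sum>i\<in>{i\<in>I. \<not> conf i j}. y i * ?a i j\<bar>) \<le> 2 ^ b * \<beta> b"
          using lb[of b] b unfolding level_bound_def by auto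
      qed auto
      also have "\<dots> = \<beta> b" by (simp add: power_one_over)
      finally show "(\<Sum>j\<in>L b. \<Sum>i\<in>{i\<in>U. \<not> conf i j \<and> R \<bar>y j\<bar> \<bar>y i\<bar>}. g i j) \<le> \<beta> b" .
    qed
    finally show ?thesis .
  qed
  show ?thesis using split diag half[of "(\<le>)"] half[of "(<)"] by simp
qed

text \<open>Dyadic approximation loses a factor: a unit vector differs from a dyadic one by a vector of
  norm at most 3/4, and the resulting geometric series sums to 4 for norms, 16 for squares.\<close>

lemma sparse_bound_bootstrap:
  assumes conf: "\<And>i j. conf i j = conf j i" "\<And>i. i < N \<Longrightarrow> card {j. j < N \<and> conf i j} \<le> D"
    and x: "\<And>i. i < N \<Longrightarrow> nrm n (x i) \<le> \<tau>" "\<tau> \<ge> 0" and s: "16 * \<kappa> \<le> 4 ^ s"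
    and lb: "\<And>A b. A \<ge> 0 \<Longrightarrow> sparse_bound n N \<kappa> x A \<Longrightarrow> b \<le> s \<Longrightarrow> level_bound n N x \<kappa> conf b (\<beta> A b)"
  shows "\<exists>A\<ge>0. sparse_bound n N \<kappa> x A \<and> A \<le> 16 * (D * \<tau>\<^sup>2 + 2 * (\<Sum>b\<le>s. \<beta> A b))"
proof -
  define C where "C = {c :: nat \<Rightarrow> real. card {i. i < N \<and> c i \<noteq> 0} \<le> \<kappa> \<and> (\<Sum>i<N. (c i)\<^sup>2) \<le> 1}"
  define a where "a = (SUP c\<in>C. nrm n (lin N x c))"
  \<comment> \<open>Finiteness of the supremum is what allows
    \<open>a \<le> sqrt X + 3/4 * a\<close> to be solved for \<open>a\<close> below.\<close>
  have bdd: "bdd_above ((\<lambda>c. nrm n (lin N x c)) ` C)"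
  proof (rule bdd_aboveI2)
    fix c assume c: "c \<in> C"
    have "nrm n (lin N x c) \<le> (\<Sum>i<N. nrm n (\<lambda>d. c i * x i d))"
    proof (induction N)
      case 0 then show ?case by (simp add: nrm_def L2_set_def lin_def)
    next
      case (Suc N)
      have "lin (Suc N) x c = (\<lambda>d. lin N x c d + c N * x N d)" by (simp add: lin_def)
      then show ?case using nrm_triangle[of n "lin N x c" "\<lambda>d. c N * x N d"] Suc by simp
    qed
    also have "\<dots> \<le> (\<Sum>i<N. 1 * \<tau>)"
    proof (intro sum_mono)
      fix i assume i: "i \<in> {..<N}"
      have "(c i)\<^sup>2 \<le> (\<Sum>i<N. (c i)\<^sup>2)" using i by (intro member_le_sum) auto
      then have "\<bar>c i\<bar> \<le> 1" using c abs_square_le_1 by (fastforce simp: C_def)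
      then show "nrm n (\<lambda>d. c i * x i d) \<le> 1 * \<tau>" using x(1)[of i] i unfolding nrm_scale by (intro mult_mono) auto
    qed
    finally show "nrm n (lin N x c) \<le> (\<Sum>i<N. 1 * \<tau>)" .
  qed
  have ub: "nrm n (lin N x c) \<le> a" if "c \<in> C" for c
    unfolding a_def using bdd that by (intro cSUP_upper) auto
  have C0: "(\<lambda>_. 0) \<in> C" by (simp add: C_def)
  have a0: "a \<ge> 0" using ub[OF C0] nrm_nonneg order_trans by blast
  have scaled: "nrm n (lin N x c) \<le> a * sqrt (\<Sum>i<N. (c i)\<^sup>2)" if c: "card {i. i < N \<and> c i \<noteq> 0} \<le> \<kappa>" for c
  proof (cases "(\<Sum>i<N. (c i)\<^sup>2) = 0")
    case True
    then have "\<forall>i\<in>{..<N}. (c i)\<^sup>2 = 0" by (subst (asm) sum_nonneg_eq_0_iff) auto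
    then have "lin N x c = (\<lambda>d. 0)" by (auto simp: lin_def)
    then show ?thesis using True by (simp add: nrm_def L2_set_def)
  next
    case False
    define q where "q = sqrt (\<Sum>i<N. (c i)\<^sup>2)"
    have q: "q > 0" using False by (simp add: q_def less_le sum_nonneg)
    have "(\<lambda>i. (1 / q) * c i) \<in> C"
    proof -
      have "(\<Sum>i<N. ((1 / q) * c i)\<^sup>2) = (1 / q)\<^sup>2 * (\<Sum>i<N. (c i)\<^sup>2)" by (simp only: power_mult_distrib sum_distrib_left)
      also have "\<dots> = 1" using q False by (simp add: q_def power_divide sum_nonneg)
      finally show ?thesis using c q by (simp add: C_def)
    qed
    from ub[OF this] have "\<bar>1 / q\<bar> * nrm n (lin N x c) \<le> a" by (simp only: lin_scale nrm_scale)
    then show ?thesis using q by (simp add: q_def[symmetric] field_simps)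
  qed
  \<comment> \<open>The smallest possible bound. The level bounds, which depend on \<open>A\<close>,
    are used for this very value, so the outcome is an inequality between \<open>A\<close> and a
    function of \<open>A\<close>.\<close>
  define A where "A = a\<^sup>2"
  have sbA: "sparse_bound n N \<kappa> x A" unfolding sparse_bound_def
  proof (intro allI impI)
    fix c :: "nat \<Rightarrow> real" assume "card {i. i < N \<and> c i \<noteq> 0} \<le> \<kappa>"
    from power_mono[OF scaled[OF this] nrm_nonneg, of 2]
    show "(nrm n (lin N x c))\<^sup>2 \<le> A * (\<Sum>i<N. (c i)\<^sup>2)" by (simp add: A_def power_mult_distrib sum_nonneg)
  qed
  define X where "X = D * \<tau>\<^sup>2 + 2 * (\<Sum>b\<le>s. \<beta> A b)"
  have dyX: "(nrm n (lin N x y))\<^sup>2 \<le> X" if "y \<in> C" "\<And>i. i < N \<Longrightarrow> y i \<noteq> 0 \<Longrightarrow> \<exists>b\<le>s. \<bar>y i\<bar> = (1/2) ^ b" for y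
    unfolding X_def using that lb[of A] sbA
    by (intro dyadic_form_bound[OF conf x]) (auto simp: C_def A_def)
  have X0: "X \<ge> 0" using order_trans[OF zero_le_power2 dyX[OF C0]] by simp
  have "a \<le> sqrt X + 3/4 * a"
    unfolding a_def
  proof (rule cSUP_least)
    show "C \<noteq> {}" using C0 by auto
    fix c assume c: "c \<in> C"
    obtain y where y: "\<And>i. c i = 0 \<Longrightarrow> y i = 0" "\<And>i. i < N \<Longrightarrow> y i \<noteq> 0 \<Longrightarrow> \<exists>b\<le>s. \<bar>y i\<bar> = (1/2) ^ b"
      "(\<Sum>i<N. (y i)\<^sup>2) \<le> 1" "(\<Sum>i<N. (c i - y i)\<^sup>2) \<le> 9/16"
      using dyadic_approximation[of c N \<kappa> s] c s by (auto simp: C_def)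
    have cy: "card {i. i < N \<and> y i \<noteq> 0} \<le> \<kappa>" "card {i. i < N \<and> c i - y i \<noteq> 0} \<le> \<kappa>"
    proof -
      have "card {i. i < N \<and> y i \<noteq> 0} \<le> card {i. i < N \<and> c i \<noteq> 0}" "card {i. i < N \<and> c i - y i \<noteq> 0} \<le> card {i. i < N \<and> c i \<noteq> 0}"
        using y(1) by (auto intro!: card_mono)
      then show "card {i. i < N \<and> y i \<noteq> 0} \<le> \<kappa>" "card {i. i < N \<and> c i - y i \<noteq> 0} \<le> \<kappa>" using c by (auto simp: C_def)
    qed
    have "lin N x c = lin N x (\<lambda>i. y i + (c i - y i))" by simp
    then have "nrm n (lin N x c) \<le> nrm n (lin N x y) + nrm n (lin N x (\<lambda>i. c i - y i))"
      unfolding lin_add using nrm_triangle by simp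
    also have "nrm n (lin N x y) \<le> sqrt X"
      by (rule real_le_rsqrt) (use dyX[of y] y cy in \<open>auto simp: C_def\<close>)
    also have "nrm n (lin N x (\<lambda>i. c i - y i)) \<le> a * sqrt (\<Sum>i<N. (c i - y i)\<^sup>2)" by (rule scaled[OF cy(2)])
    also have "\<dots> \<le> a * (3/4)"
    proof (intro mult_left_mono a0)
      have "sqrt (\<Sum>i<N. (c i - y i)\<^sup>2) \<le> sqrt ((3/4)\<^sup>2)" using y(4) by (intro real_sqrt_le_mono) (simp add: power2_eq_square)
      then show "sqrt (\<Sum>i<N. (c i - y i)\<^sup>2) \<le> 3/4" by simp
    qed
    finally show "nrm n (lin N x c) \<le> sqrt X + 3/4 * (SUP c\<in>C. nrm n (lin N x c))" by (simp add: a_def)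
  qed
  then have "a \<le> 4 * sqrt X" by simp
  then have "a\<^sup>2 \<le> (4 * sqrt X)\<^sup>2" using a0 by (intro power_mono) auto
  then have "A \<le> 16 * X" using X0 by (simp add: A_def power_mult_distrib)
  then show ?thesis using sbA by (intro exI[of _ A]) (auto simp: X_def A_def)
qed

section \<open>Summation over the order statistics and over the levels\<close>

text \<open>Comparison with the integral of a power, by induction. The step from \<open>k\<close> to
  \<open>k + 1\<close> is Young's inequality, \<open>k powr b * (k + 1) powr (1 - b) \<le> b * k +
  (1 - b) * (k + 1)\<close>, multiplied by \<open>(k + 1) powr (b - 1)\<close>.\<close>

lemma sum_powr_le:
  fixes b :: real
  assumes b: "0 < b" "b \<le> 1"
  shows "(\<Sum>m=1..k. real m powr (b - 1)) \<le> real k powr b / b"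
proof (induction k)
  case 0
  then show ?case by simp
next
  case (Suc k)
  have step: "real k powr b + b * real (Suc k) powr (b - 1) \<le> real (Suc k) powr b"
  proof (cases "k = 0")
    case True
    then show ?thesis using b by simp
  next
    case False
    have "real k powr b * real (Suc k) powr (1 - b) \<le> b * real k + (1 - b) * real (Suc k)"
      using False b by (intro Youngs_inequality_0) auto
    then have "real k powr b * real (Suc k) powr (1 - b) * real (Suc k) powr (b - 1) \<le> (real (Suc k) - b) * real (Suc k) powr (b - 1)"
      by (intro mult_right_mono) (auto simp: algebra_simps)
    moreover have "real (Suc k) powr (1 - b) * real (Suc k) powr (b - 1) = 1"
      by (simp flip: powr_add)
    moreover have "real (Suc k) * real (Suc k) powr (b - 1) = real (Suc k) powr b"
      using powr_add[of "real (Suc k)" 1 "b - 1"] by simp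
    ultimately show ?thesis by (simp add: left_diff_distrib mult.assoc)
  qed
  have "(\<Sum>m=1..Suc k. real m powr (b - 1)) \<le> real k powr b / b + real (Suc k) powr (b - 1)"
    using Suc by simp
  also have "\<dots> = (real k powr b + b * real (Suc k) powr (b - 1)) / b"
    using b by (simp add: add_divide_distrib)
  also have "\<dots> \<le> real (Suc k) powr b / b"
    using step b by (intro divide_right_mono) auto
  finally show ?case .
qed

lemma one_add_ln_le_powr:
  fixes x b :: real
  assumes "1 \<le> x" "0 < b" "b \<le> 1"
  shows "1 + ln x \<le> x powr b / b"
proof -
  have "ln (x powr b) \<le> x powr b - 1" using assms by (intro ln_le_minus_one) auto
  then have "b * ln x \<le> x powr b - 1" using assms by (simp add: ln_powr)
  then have "b * (1 + ln x) \<le> x powr b" using assms by (simp add: distrib_left)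
  then show ?thesis using assms by (simp add: field_simps)
qed

lemma quadratic_absorb:
  fixes A a b :: real
  assumes "A \<ge> 0" "A \<le> a + b * sqrt A"
  shows "A \<le> 2 * a + b\<^sup>2"
proof -
  have "0 \<le> (sqrt A - b)\<^sup>2" by simp
  then have "2 * b * sqrt A \<le> A + b\<^sup>2" using assms(1) by (simp add: power2_diff mult_ac)
  then show ?thesis using assms(2) by linarith
qed

lemma sparse_bound_mono:
  assumes "sparse_bound n N \<kappa> x A" "A \<le> A'"
  shows "sparse_bound n N \<kappa> x A'"
  unfolding sparse_bound_def
proof (intro allI impI)
  fix c :: "nat \<Rightarrow> real" assume "card {i. i < N \<and> c i \<noteq> 0} \<le> \<kappa>"
  then have "(nrm n (lin N x c))\<^sup>2 \<le> A * (\<Sum>i<N. (c i)\<^sup>2)" using assms by (auto simp: sparse_bound_def)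
  also have "\<dots> \<le> A' * (\<Sum>i<N. (c i)\<^sup>2)" using assms by (intro mult_right_mono sum_nonneg) auto
  finally show "(nrm n (lin N x c))\<^sup>2 \<le> A' * (\<Sum>i<N. (c i)\<^sup>2)" .
qed

lemma two_power_powr: "(2::real) ^ s = (4 ^ s) powr (1/2)"
proof -
  have "sqrt ((4::real) ^ s) = sqrt ((2 ^ s)\<^sup>2)" by (simp only: two_power_sq)
  then show ?thesis by (simp add: powr_half_sqrt)
qed

text \<open>The exponent \<open>e\<close> lets the logarithm grow as \<open>m\<close> decreases:
  \<open>ln (\<Gamma> / m)\<close> is traded for \<open>W\<close> times a power of
  \<open>4 ^ s / m\<close> that is small enough to keep both sums over \<open>m\<close> dominated by
  their upper end. For \<open>e = 0\<close> one takes \<open>W = ln \<Gamma>\<close>; a positive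
  \<open>e\<close> permits a \<open>W\<close> of the order of the logarithm at
  \<open>m = 4 ^ s\<close>.\<close>

lemma level_bound_summed:
  fixes W e :: real
  assumes sb: "sparse_bound n N \<kappa> x A" "A \<ge> 0"
    and conf: "\<And>j. conf j j" "\<And>i j. conf i j = conf j i" "\<And>i. i < N \<Longrightarrow> card {j. j < N \<and> conf i j} \<le> D"
    and x: "\<And>i. i < N \<Longrightarrow> nrm n (x i) \<le> \<tau>" "\<tau> \<ge> 0"
    and S: "\<And>I j. I \<subseteq> {..<N} \<Longrightarrow> card I \<le> \<kappa> \<Longrightarrow> card I \<le> 4 ^ s \<Longrightarrow> j < N \<Longrightarrow>
        (\<Sum>i\<in>{i\<in>I. \<not> conf i j}. (inner_n n (x i) (x j))\<^sup>2) \<le> S"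
    and S0: "S \<ge> 0" and E: "order_event n N x p \<Gamma> K" "16 * 4 ^ s \<le> K" and p: "p > 2"
    and \<Gamma>: "\<Gamma> > 0" "1 \<le> ln (\<Gamma> / 4 ^ s)" "128 * real D * ln \<Gamma> \<le> real m0" and D: "D \<ge> 1"
    and e: "0 \<le> e" "e < 1/2 - 1/p"
    and W: "\<And>m::nat. 1 \<le> m \<Longrightarrow> m \<le> 4 ^ s \<Longrightarrow> ln (\<Gamma> / m) \<le> W * (4 ^ s / m) powr (2 * e)"
  shows "level_bound n N x \<kappa> conf s (m0 * (sqrt A * \<tau> + D * \<tau>\<^sup>2) / 2 ^ s
      + sqrt (512 * real D * W) * (12 * sqrt S / (1/2 - e)
          + 16 * exp 8 * sqrt A * N powr (1/p) * (4 ^ s) powr (1/2 - 1/p) / (1/2 - 1/p - e)))"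
proof -
  define k where "k = (4::real) ^ s"
  define \<gamma> where "\<gamma> = 1/2 - 1/p"
  have k1: "k \<ge> 1" by (simp add: k_def)
  have \<gamma>: "\<gamma> \<le> 1/2" "e < \<gamma>" using p e by (auto simp: \<gamma>_def)
  have W0: "W \<ge> 0"
  proof -
    have "1 \<le> ln (\<Gamma> / 4 ^ s)" by (rule \<Gamma>)
    also have "\<dots> \<le> W * (4 ^ s / real (4 ^ s)) powr (2 * e)" using W[of "4 ^ s"] by simp
    finally show ?thesis by simp
  qed
  define P where "P = 2 * exp 8 * N powr (1/p)"
  define Q where "Q = sqrt (512 * real D * W)"
  define Z where "Z m = Q * k powr e * (12 * sqrt S * real m powr ((1/2 - e) - 1) + 8 * sqrt A * 2 ^ s * P * real m powr ((\<gamma> - e) - 1))" for m :: nat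
  have P0: "P \<ge> 0" and Q0: "Q \<ge> 0" using W0 by (auto simp: P_def Q_def)
  have sums: "(\<Sum>m=1..4 ^ s. Z m) \<le> 2 ^ s * (Q * (12 * sqrt S / (1/2 - e) + 8 * sqrt A * P * k powr \<gamma> / (\<gamma> - e)))"
  proof -
    have "(\<Sum>m=1..4 ^ s. Z m) = Q * k powr e * (12 * sqrt S * (\<Sum>m=1..4 ^ s. real m powr ((1/2 - e) - 1))
        + 8 * sqrt A * 2 ^ s * P * (\<Sum>m=1..4 ^ s. real m powr ((\<gamma> - e) - 1)))"
      by (simp only: Z_def sum_distrib_left sum.distrib distrib_left mult.assoc)
    also have "\<dots> \<le> Q * k powr e * (12 * sqrt S * (k powr (1/2 - e) / (1/2 - e))
        + 8 * sqrt A * 2 ^ s * P * (k powr (\<gamma> - e) / (\<gamma> - e)))"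
    proof (intro mult_left_mono add_mono)
      show "(\<Sum>m=1..4 ^ s. real m powr ((1/2 - e) - 1)) \<le> k powr (1/2 - e) / (1/2 - e)"
        using sum_powr_le[of "1/2 - e" "4 ^ s"] \<gamma> e by (simp add: k_def)
      show "(\<Sum>m=1..4 ^ s. real m powr ((\<gamma> - e) - 1)) \<le> k powr (\<gamma> - e) / (\<gamma> - e)"
        using sum_powr_le[of "\<gamma> - e" "4 ^ s"] \<gamma> e by (simp add: k_def)
    qed (use P0 Q0 sb S0 in auto)
    also have "\<dots> = Q * (12 * sqrt S * (k powr e * k powr (1/2 - e)) / (1/2 - e)
        + 8 * sqrt A * 2 ^ s * P * (k powr e * k powr (\<gamma> - e)) / (\<gamma> - e))"
      by (simp add: algebra_simps)
    also have "\<dots> = Q * (12 * sqrt S * 2 ^ s / (1/2 - e) + 8 * sqrt A * 2 ^ s * P * k powr \<gamma> / (\<gamma> - e))"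
      unfolding powr_add[symmetric] two_power_powr by (simp add: k_def)
    also have "\<dots> = 2 ^ s * (Q * (12 * sqrt S / (1/2 - e) + 8 * sqrt A * P * k powr \<gamma> / (\<gamma> - e)))"
      by (simp add: algebra_simps)
    finally show ?thesis .
  qed
  have Z: "sqrt (512 * real D * ln (\<Gamma> / m) / m) * (12 * sqrt S + 8 * sqrt A * 2 ^ s * (2 * exp 8 * N / m) powr (1 / p)) \<le> Z m"
    if m: "1 \<le> m" "m \<le> 4 ^ s" for m :: nat
  proof -
    have m0: "real m > 0" using m by simp
    have "sqrt (512 * real D * ln (\<Gamma> / m) / m) \<le> sqrt (512 * real D * (W * (k / m) powr (2 * e)) / m)"
      using W[OF m] m0 by (intro real_sqrt_le_mono divide_right_mono mult_left_mono) (auto simp: k_def)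
    also have "\<dots> = Q * sqrt ((k / m) powr (2 * e)) * sqrt (1 / m)"
      by (simp add: Q_def mult.assoc flip: real_sqrt_mult)
    also have "sqrt ((k / m) powr (2 * e)) = (k / m) powr e"
      by (simp add: powr_powr flip: powr_half_sqrt)
    also have "sqrt (1 / m) = real m powr (-1/2)" using m0 by (simp add: powr_minus_divide real_sqrt_divide powr_half_sqrt)
    also have "(k / m) powr e = k powr e * real m powr (-e)" using m0 k1 by (simp add: powr_divide powr_minus_divide)
    finally have q: "sqrt (512 * real D * ln (\<Gamma> / m) / m) \<le> Q * k powr e * real m powr ((1/2 - e) - 1)"
      by (simp add: mult.assoc algebra_simps flip: powr_add)
    have "(2 * exp 8 * N / m) powr (1 / p) = (2 * exp 8) powr (1/p) * N powr (1/p) * real m powr (-1/p)"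
      using m0 by (simp add: powr_divide powr_mult powr_minus_divide)
    also have "\<dots> \<le> P * real m powr (-1/p)"
    proof -
      have "(1::real) \<le> exp 8" by simp
      then have "(1::real) \<le> 2 * exp 8" by linarith
      then have "(2 * exp 8 :: real) powr (1/p) \<le> (2 * exp 8) powr 1" using p by (intro powr_mono) auto
      then show ?thesis unfolding P_def by (intro mult_right_mono) auto
    qed
    finally have pp: "(2 * exp 8 * N / m) powr (1 / p) \<le> P * real m powr (-1/p)" .
    have "sqrt (512 * real D * ln (\<Gamma> / m) / m) * (12 * sqrt S + 8 * sqrt A * 2 ^ s * (2 * exp 8 * N / m) powr (1 / p))
      \<le> (Q * k powr e * real m powr ((1/2 - e) - 1)) * (12 * sqrt S + 8 * sqrt A * 2 ^ s * (P * real m powr (-1/p)))"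
      using q pp S0 sb Q0 by (intro mult_mono add_mono mult_left_mono) auto
    also have "\<dots> = Q * k powr e * (12 * sqrt S * real m powr ((1/2 - e) - 1)
        + 8 * sqrt A * 2 ^ s * P * (real m powr ((1/2 - e) - 1) * real m powr (-1/p)))"
      by (simp add: algebra_simps)
    also have "real m powr ((1/2 - e) - 1) * real m powr (-1/p) = real m powr ((\<gamma> - e) - 1)"
      unfolding powr_add[symmetric] by (simp add: \<gamma>_def algebra_simps)
    finally show ?thesis by (simp add: Z_def)
  qed
  show ?thesis
  proof (rule level_bound_order_statistics[OF sb conf x S S0 E _ \<Gamma> D Z])
    define X where "X = real m0 * (sqrt A * \<tau> + real D * \<tau>\<^sup>2)"
    define R where "R = sqrt (512 * real D * W) * (12 * sqrt S / (1/2 - e)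
          + 16 * exp 8 * sqrt A * N powr (1/p) * (4 ^ s) powr (1/2 - 1/p) / (1/2 - 1/p - e))"
    have "R = Q * (12 * sqrt S / (1/2 - e) + 8 * sqrt A * P * k powr \<gamma> / (\<gamma> - e))"
      by (simp add: R_def Q_def P_def k_def \<gamma>_def mult_ac)
    then have "(\<Sum>m=1..4 ^ s. Z m) \<le> 2 ^ s * R" using sums by simp
    moreover have "2 ^ s * (X / 2 ^ s + R) = X + 2 ^ s * R" by (simp add: distrib_left)
    ultimately show "X + (\<Sum>m = 1..4 ^ s. Z m) \<le> 2 ^ s * (X / 2 ^ s + R)" by linarith
  qed (use p in auto)
qed

lemma dyadic_level_exists:
  assumes "\<kappa> \<ge> 1"
  obtains s where "16 * \<kappa> \<le> 4 ^ s" "4 ^ s < 64 * (\<kappa>::nat)"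
proof -
  define s where "s = (LEAST s. 16 * \<kappa> \<le> 4 ^ s)"
  have "16 * \<kappa> \<le> 2 ^ (16 * \<kappa>)" by (rule less_imp_le[OF less_exp])
  also have "\<dots> \<le> 4 ^ (16 * \<kappa>)" by (rule power_mono) auto
  finally have s: "16 * \<kappa> \<le> 4 ^ s" unfolding s_def by (rule LeastI)
  then have "s \<noteq> 0" using assms by (intro notI) simp
  then obtain r where r: "s = Suc r" by (cases s) auto
  have "\<not> 16 * \<kappa> \<le> 4 ^ r" using not_less_Least[of r "\<lambda>s. 16 * \<kappa> \<le> 4 ^ s"] r s_def by auto
  then show ?thesis using s r by (intro that[of s]) auto
qed

text \<open>Since \<open>exp 1 \<le> 4\<close>, the number \<open>s + 1\<close> of levels is at most
  \<open>ln \<Gamma>\<close>. A bound that is uniform over the levels thus costs one factor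
  \<open>ln \<Gamma>\<close>.\<close>

lemma ln_ratio_levels:
  assumes s: "4 ^ s < 64 * \<kappa>" and \<Gamma>: "64 * exp 1 * real \<kappa> \<le> \<Gamma>" and \<kappa>: "\<kappa> \<ge> 1" and b: "b \<le> s"
  shows "1 \<le> ln (\<Gamma> / 4 ^ b)" "real s + 1 \<le> ln \<Gamma>"
proof -
  have "real (4 ^ s) \<le> real (64 * \<kappa>)" using s by (simp only: of_nat_le_iff)
  then have s': "(4::real) ^ s \<le> 64 * \<kappa>" by simp
  have "exp 1 * 4 ^ s \<le> exp 1 * (64 * real \<kappa>)" using s' by simp
  also have "\<dots> \<le> \<Gamma>" using \<Gamma> by (simp add: mult_ac)
  finally have *: "exp 1 * 4 ^ s \<le> \<Gamma>" .
  have "(4::real) ^ b \<le> 4 ^ s" using b by (intro power_increasing) auto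
  then have "exp 1 * 4 ^ b \<le> \<Gamma>" using * by (meson exp_ge_zero mult_left_mono order_trans)
  then have "exp 1 \<le> \<Gamma> / 4 ^ b" by (simp add: field_simps)
  then show "1 \<le> ln (\<Gamma> / 4 ^ b)" by (metis exp_gt_zero ln_exp ln_le_cancel_iff less_le_trans)
  have e4: "exp 1 \<le> (4::real)" using exp_le by linarith
  have "exp (real s + 1) = exp 1 ^ s * exp (1::real)" by (simp add: exp_add flip: exp_of_nat_mult)
  also have "\<dots> \<le> 4 ^ s * exp 1" using e4 by (intro mult_right_mono power_mono) auto
  also have "\<dots> \<le> \<Gamma>" using * by (simp add: mult.commute)
  finally show "real s + 1 \<le> ln \<Gamma>" by (metis exp_gt_zero ln_exp ln_le_cancel_iff less_le_trans)
qed

lemma level_scale_le: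
  assumes s: "4 ^ s < 64 * \<kappa>" and b: "b \<le> s" and g: "0 \<le> g" "g \<le> 1/2"
  shows "((4::real) ^ b) powr g \<le> 8 * real \<kappa> powr g"
proof -
  have "real (4 ^ s) \<le> real (64 * \<kappa>)" using s by (simp only: of_nat_le_iff)
  then have "(4::real) ^ s \<le> 64 * \<kappa>" by simp
  moreover have "(4::real) ^ b \<le> 4 ^ s" using b by (intro power_increasing) auto
  ultimately have "(4::real) ^ b \<le> 64 * \<kappa>" by (rule order_trans[rotated])
  then have "((4::real) ^ b) powr g \<le> (64 * real \<kappa>) powr g" using g by (intro powr_mono2) auto
  also have "\<dots> = 64 powr g * real \<kappa> powr g" by (simp add: powr_mult)
  also have "\<dots> \<le> 64 powr (1/2) * real \<kappa> powr g" using g by (intro mult_right_mono powr_mono) auto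
  finally show ?thesis by (simp add: powr_half_sqrt)
qed

lemma sum_inverse_two_powers_le: "(\<Sum>b\<le>s. 1 / (2::real) ^ b) \<le> 2"
proof -
  have "(\<Sum>b\<le>s. (1/2::real) ^ b) < 1 / (1 - 1/2)" by (rule geometric_sum_less) auto
  then show ?thesis by (simp add: power_one_over)
qed

section \<open>Sparse bounds for short and for long vectors\<close>

text \<open>Only the pairs \<open>i = j\<close> are excluded, and duality bounds the rows of the
  Gram matrix by \<open>A * T\<^sup>2\<close>. Up to constants and lower order terms, each of at
  most \<open>ln \<Gamma>\<close> levels contributes \<open>sqrt (ln \<Gamma>) * sqrt A * T\<close>.
  Solving the inequality for \<open>A\<close> squares this factor, whence the third power of the
  logarithm.\<close>

lemma light_sparse_bound:
  fixes \<gamma>0 :: real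
  assumes \<gamma>0: "\<gamma>0 > 0"
  shows "\<exists>C>0. \<forall>p n N x \<Gamma> \<kappa> T. p > 2 \<longrightarrow> \<gamma>0 \<le> 1/2 - 1/p \<longrightarrow> \<kappa> \<ge> 1 \<longrightarrow> 64 * exp 1 * real \<kappa> \<le> \<Gamma> \<longrightarrow>
     order_event n N x p \<Gamma> (1024 * \<kappa>) \<longrightarrow> T = real N powr (1/p) * real \<kappa> powr (1/2 - 1/p) \<longrightarrow>
     (\<forall>i<N. nrm n (x i) \<le> T) \<longrightarrow> sparse_bound n N \<kappa> x (C * (ln \<Gamma>) ^ 3 * T\<^sup>2)"
proof -
  \<comment> \<open>24 is 12 divided by 1/2, the first exponent for \<open>e = 0\<close>; 128 is 16
    times the factor 8 of \<open>level_scale_le\<close>.\<close>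
  define c1 :: real where "c1 = 24 + 128 * exp 8 / \<gamma>0"
  define C where "C = 16544 + (32 * (258 + 23 * c1))\<^sup>2"
  have c1: "c1 > 0" using \<gamma>0 by (simp add: c1_def add_pos_pos)
  show ?thesis
  proof (intro exI[of _ C] conjI allI impI)
    show "C > 0" by (simp add: C_def add_pos_nonneg)
    fix p :: real and n N :: nat and x :: "nat \<Rightarrow> nat \<Rightarrow> real" and \<Gamma> :: real and \<kappa> :: nat and T :: real
    assume p: "p > 2" and g: "\<gamma>0 \<le> 1/2 - 1/p" and \<kappa>: "\<kappa> \<ge> 1" and \<Gamma>: "64 * exp 1 * real \<kappa> \<le> \<Gamma>"
      and E: "order_event n N x p \<Gamma> (1024 * \<kappa>)" and T: "T = real N powr (1/p) * real \<kappa> powr (1/2 - 1/p)"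
      and x: "\<forall>i<N. nrm n (x i) \<le> T"
    define \<gamma> where "\<gamma> = 1/2 - 1/p"
    have \<gamma>: "0 < \<gamma>" "\<gamma> \<le> 1/2" "\<gamma>0 \<le> \<gamma>" using p g \<gamma>0 by (auto simp: \<gamma>_def)
    have T0: "T \<ge> 0" by (simp add: T)
    define \<Lambda> where "\<Lambda> = ln \<Gamma>"
    obtain s where s: "16 * \<kappa> \<le> 4 ^ s" "4 ^ s < 64 * \<kappa>" using dyadic_level_exists[OF \<kappa>] by blast
    have \<Gamma>0: "\<Gamma> > 0"
    proof -
      have "0 < 64 * exp 1 * real \<kappa>" using \<kappa> by simp
      then show ?thesis using \<Gamma> by linarith
    qed
    have ls: "real s + 1 \<le> \<Lambda>" unfolding \<Lambda>_def by (rule ln_ratio_levels[OF s(2) \<Gamma> \<kappa> order_refl])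
    then have \<Lambda>1: "\<Lambda> \<ge> 1" by simp
    define m0 where "m0 = nat \<lceil>128 * \<Lambda>\<rceil>"
    have m0: "128 * real 1 * ln \<Gamma> \<le> real m0" "real m0 \<le> 129 * \<Lambda>"
      unfolding m0_def \<Lambda>_def[symmetric] using \<Lambda>1 by linarith+
    define \<beta> where "\<beta> A b = real m0 * (sqrt A * T + real 1 * T\<^sup>2) / 2 ^ b
      + sqrt (512 * real 1 * \<Lambda>) * (12 * sqrt (A * T\<^sup>2) / (1/2 - 0)
          + 16 * exp 8 * sqrt A * real N powr (1/p) * (4 ^ b) powr (1/2 - 1/p) / (1/2 - 1/p - 0))" for A :: real and b :: nat
    have lb: "level_bound n N x \<kappa> (=) b (\<beta> A b)" if A: "A \<ge> 0" "sparse_bound n N \<kappa> x A" and b: "b \<le> s" for A b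
      unfolding \<beta>_def
    proof (rule level_bound_summed[OF A(2,1)])
      show "order_event n N x p \<Gamma> (1024 * \<kappa>)" by (rule E)
      have "4 ^ b \<le> (4::nat) ^ s" using b by (intro power_increasing) auto
      \<comment> \<open>The 1024 in the event is 16 * 64: the sampled vectors have squared norm at
        most \<open>16 * 4 ^ b\<close>, and \<open>4 ^ s < 64 * \<kappa>\<close> at the top
        level.\<close>
      then show "16 * 4 ^ b \<le> 1024 * \<kappa>" using s by linarith
      show "1 \<le> ln (\<Gamma> / 4 ^ b)" by (rule ln_ratio_levels[OF s(2) \<Gamma> \<kappa> b])
      show "ln (\<Gamma> / real m) \<le> \<Lambda> * (4 ^ b / real m) powr (2 * 0)" if "1 \<le> m" "m \<le> 4 ^ b" for m :: nat
        using that \<Gamma>0 by (simp add: \<Lambda>_def ln_div powr_zero_eq_one)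
      show "(\<Sum>i\<in>{i\<in>I. \<not> i = j}. (inner_n n (x i) (x j))\<^sup>2) \<le> A * T\<^sup>2"
        if I: "I \<subseteq> {..<N}" "card I \<le> \<kappa>" and j: "j < N" for I j
      proof -
        have "finite I" using I finite_subset by auto
        then have "(\<Sum>i\<in>{i\<in>I. \<not> i = j}. (inner_n n (x i) (x j))\<^sup>2) \<le> (\<Sum>i\<in>I. (inner_n n (x i) (x j))\<^sup>2)"
          by (intro sum_mono2) auto
        also have "\<dots> \<le> A * (nrm n (x j))\<^sup>2" by (rule sparse_bound_dual[OF A(2) I A(1)])
        also have "\<dots> \<le> A * T\<^sup>2" using A x j by (intro mult_left_mono power_mono) auto
        finally show ?thesis .
      qed
      show "card {j. j < N \<and> i = j} \<le> 1" if "i < N" for i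
        using card_mono[of "{i}" "{j. j < N \<and> i = j}"] by auto
    qed (use x T0 A \<Gamma>0 m0 p \<gamma> in \<open>auto simp: \<gamma>_def\<close>)
    obtain A where A: "A \<ge> 0" "sparse_bound n N \<kappa> x A" "A \<le> 16 * (real 1 * T\<^sup>2 + 2 * (\<Sum>b\<le>s. \<beta> A b))"
    proof -
      have "\<exists>A\<ge>0. sparse_bound n N \<kappa> x A \<and> A \<le> 16 * (real 1 * T\<^sup>2 + 2 * (\<Sum>b\<le>s. \<beta> A b))"
      proof (rule sparse_bound_bootstrap[where conf="(=)", OF _ _ _ T0 s(1) lb])
        show "card {j. j < N \<and> i = j} \<le> 1" if "i < N" for i
          using card_mono[of "{i}" "{j. j < N \<and> i = j}"] by auto
      qed (use x in auto)
      then show ?thesis using that by blast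
    qed
    define \<rho> where "\<rho> = sqrt \<Lambda>"
    have \<rho>: "\<rho>\<^sup>2 = \<Lambda>" "\<rho> \<ge> 1" using \<Lambda>1 by (auto simp: \<rho>_def)
    define M where "M = sqrt A * T"
    have M0: "M \<ge> 0" using A T0 by (simp add: M_def)
    have \<beta>le: "\<beta> A b \<le> real m0 * (M + T\<^sup>2) * (1 / 2 ^ b) + 23 * \<rho> * c1 * M" if b: "b \<le> s" for b
    proof -
      have "real N powr (1/p) * (4 ^ b) powr (1/2 - 1/p) \<le> 8 * T"
        using mult_left_mono[OF level_scale_le[OF s(2) b, of \<gamma>], of "real N powr (1/p)"] \<gamma>
        by (simp add: T \<gamma>_def mult_ac)
      then have "16 * exp 8 * sqrt A * (real N powr (1/p) * (4 ^ b) powr (1/2 - 1/p)) / (1/2 - 1/p) \<le> 16 * exp 8 * sqrt A * (8 * T) / \<gamma>0"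
        using A T0 g \<gamma>0 by (intro frac_le mult_left_mono mult_nonneg_nonneg) auto
      then have "12 * sqrt (A * T\<^sup>2) / (1/2 - 0) + 16 * exp 8 * sqrt A * real N powr (1/p) * (4 ^ b) powr (1/2 - 1/p) / (1/2 - 1/p - 0)
         \<le> 24 * M + 128 * exp 8 / \<gamma>0 * M"
        using T0 by (simp add: M_def real_sqrt_mult mult_ac)
      also have "\<dots> = c1 * M" by (simp add: c1_def algebra_simps)
      finally have 1: "12 * sqrt (A * T\<^sup>2) / (1/2 - 0) + 16 * exp 8 * sqrt A * real N powr (1/p) * (4 ^ b) powr (1/2 - 1/p) / (1/2 - 1/p - 0) \<le> c1 * M" .
      have "sqrt (512 * real 1 * \<Lambda>) \<le> sqrt (23\<^sup>2 * \<Lambda>)" using \<Lambda>1 by (intro real_sqrt_le_mono) simp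
      also have "\<dots> = 23 * \<rho>" by (simp add: real_sqrt_mult \<rho>_def)
      finally have 2: "sqrt (512 * real 1 * \<Lambda>) \<le> 23 * \<rho>" .
      have "sqrt (512 * real 1 * \<Lambda>) * (12 * sqrt (A * T\<^sup>2) / (1/2 - 0) + 16 * exp 8 * sqrt A * real N powr (1/p) * (4 ^ b) powr (1/2 - 1/p) / (1/2 - 1/p - 0))
         \<le> sqrt (512 * real 1 * \<Lambda>) * (c1 * M)" using 1 \<Lambda>1 by (intro mult_left_mono) auto
      also have "\<dots> \<le> 23 * \<rho> * (c1 * M)" using 2 c1 M0 by (intro mult_right_mono) auto
      finally show ?thesis by (simp add: \<beta>_def M_def)
    qed
    have "(\<Sum>b\<le>s. \<beta> A b) \<le> (\<Sum>b\<le>s. real m0 * (M + T\<^sup>2) * (1 / 2 ^ b) + 23 * \<rho> * c1 * M)" using \<beta>le by (intro sum_mono) auto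
    also have "\<dots> = real m0 * (M + T\<^sup>2) * (\<Sum>b\<le>s. 1 / 2 ^ b) + (real s + 1) * (23 * \<rho> * c1 * M)"
      by (simp add: sum.distrib sum_distrib_left)
    also have "\<dots> \<le> (129 * \<Lambda>) * (M + T\<^sup>2) * 2 + \<Lambda> * (23 * \<rho> * c1 * M)"
      using m0 M0 \<Lambda>1 ls c1 \<rho> sum_inverse_two_powers_le by (intro add_mono mult_mono) (auto intro!: sum_nonneg)
    finally have "A \<le> 16 * (T\<^sup>2 + 2 * ((129 * \<Lambda>) * (M + T\<^sup>2) * 2 + \<Lambda> * (23 * \<rho> * c1 * M)))" using A(3) by simp
    also have "\<dots> = 16 * T\<^sup>2 + 8256 * \<Lambda> * T\<^sup>2 + (32 * (258 * \<Lambda> + 23 * c1 * (\<Lambda> * \<rho>))) * M"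
      by (simp add: algebra_simps)
    also have "\<dots> \<le> 8272 * \<Lambda> * T\<^sup>2 + (32 * (258 * (\<Lambda> * \<rho>) + 23 * c1 * (\<Lambda> * \<rho>))) * M"
    proof -
      have "1 * T\<^sup>2 \<le> \<Lambda> * T\<^sup>2" using \<Lambda>1 by (intro mult_right_mono) auto
      moreover have "\<Lambda> * 1 \<le> \<Lambda> * \<rho>" using \<Lambda>1 \<rho> by (intro mult_left_mono) auto
      then have "(32 * (258 * \<Lambda> + 23 * c1 * (\<Lambda> * \<rho>))) * M \<le> (32 * (258 * (\<Lambda> * \<rho>) + 23 * c1 * (\<Lambda> * \<rho>))) * M"
        using M0 by (intro mult_right_mono) auto
      ultimately show ?thesis by simp
    qed
    also have "\<dots> = 8272 * \<Lambda> * T\<^sup>2 + (32 * (258 + 23 * c1) * (\<Lambda> * \<rho>) * T) * sqrt A"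
      by (simp add: M_def algebra_simps)
    finally have "A \<le> 2 * (8272 * \<Lambda> * T\<^sup>2) + (32 * (258 + 23 * c1) * (\<Lambda> * \<rho>) * T)\<^sup>2"
      by (rule quadratic_absorb[OF A(1)])
    also have "\<dots> = 16544 * \<Lambda> * T\<^sup>2 + (32 * (258 + 23 * c1))\<^sup>2 * \<Lambda> ^ 3 * T\<^sup>2"
      by (simp add: power_mult_distrib \<rho>(1) power3_eq_cube power2_eq_square[of \<Lambda>] mult_ac)
    also have "\<dots> \<le> 16544 * \<Lambda> ^ 3 * T\<^sup>2 + (32 * (258 + 23 * c1))\<^sup>2 * \<Lambda> ^ 3 * T\<^sup>2"
      using \<Lambda>1 by (intro add_right_mono mult_right_mono mult_left_mono self_le_power) auto
    also have "\<dots> = C * (ln \<Gamma>) ^ 3 * T\<^sup>2" by (simp add: C_def \<Lambda>_def algebra_simps)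
    finally show "sparse_bound n N \<kappa> x (C * (ln \<Gamma>) ^ 3 * T\<^sup>2)" by (rule sparse_bound_mono[OF A(2)])
  qed
qed

text \<open>\<open>order_event\<close> is used with \<open>l = 1\<close> and the single vector
  \<open>x j\<close> as combination: for \<open>m \<ge> ln \<Gamma>\<close> the m-th largest
  correlation with \<open>x j\<close> is at most \<open>thr p N m * \<tau>\<close>. The larger ones,
  fewer than \<open>ln \<Gamma>\<close>, are at most \<open>\<tau> * \<eta>\<close> by the
  exclusion. In contrast with duality, the result does not contain the sparse bound
  \<open>A\<close>.\<close>

lemma row_sum_bound:
  assumes E: "order_event n N x p \<Gamma> K" "1 \<le> K" and p: "p > 2" and \<Gamma>: "\<Gamma> \<ge> 1"
    and x: "\<And>i. i < N \<Longrightarrow> nrm n (x i) \<le> \<tau>" and I: "I \<subseteq> {..<N}" "card I \<le> 4 ^ s" and j: "j < N"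
    and conf: "conf j j" "\<And>i. i < N \<Longrightarrow> \<not> conf i j \<Longrightarrow> \<bar>inner_n n (x i) (x j)\<bar> \<le> \<tau> * \<eta>"
  shows "(\<Sum>i\<in>{i\<in>I. \<not> conf i j}. (inner_n n (x i) (x j))\<^sup>2)
    \<le> \<tau>\<^sup>2 * (ln \<Gamma> * \<eta>\<^sup>2 + exp 8 * (N powr (1/p) * (4 ^ s) powr (1/2 - 1/p))\<^sup>2 / (2 * (1/2 - 1/p)))"
proof -
  define \<gamma> where "\<gamma> = 1/2 - 1/p"
  have \<gamma>: "0 < \<gamma>" "\<gamma> \<le> 1/2" using p by (auto simp: \<gamma>_def)
  define B where "B = {i\<in>I. \<not> conf i j}"
  have finB: "finite B" "card B \<le> 4 ^ s" "B \<subseteq> {..<N}"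
    using I finite_subset[OF I(1)] card_mono[of I B] by (auto simp: B_def)
  have "(\<Sum>i\<in>B. (inner_n n (x i) (x j))\<^sup>2) \<le> (\<Sum>m=1..card B. (if real m < ln \<Gamma> then \<tau>\<^sup>2 * \<eta>\<^sup>2 else 0) + \<tau>\<^sup>2 * (thr p N m)\<^sup>2)"
  proof (rule sum_le_order_statistics[OF finB(1)])
    fix J assume J: "J \<subseteq> B" "J \<noteq> {}"
    show "\<exists>i\<in>J. (inner_n n (x i) (x j))\<^sup>2 \<le> (if real (card J) < ln \<Gamma> then \<tau>\<^sup>2 * \<eta>\<^sup>2 else 0) + \<tau>\<^sup>2 * (thr p N (card J))\<^sup>2"
    proof (cases "real (card J) < ln \<Gamma>")
      case True
      obtain i where i: "i \<in> J" using J by auto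
      then have "\<bar>inner_n n (x i) (x j)\<bar> \<le> \<tau> * \<eta>" using J finB by (intro conf(2)) (auto simp: B_def)
      then have "\<bar>inner_n n (x i) (x j)\<bar>\<^sup>2 \<le> (\<tau> * \<eta>)\<^sup>2" by (intro power_mono) auto
      then show ?thesis using True i by (intro bexI[of _ i]) (auto simp: power_mult_distrib add_increasing2)
    next
      case False
      define \<zeta> :: "nat \<Rightarrow> int" where "\<zeta> = (\<lambda>i. if i = j then 1 else 0)"
      have supp: "{i. i < N \<and> \<zeta> i \<noteq> 0} = {j}" using j by (auto simp: \<zeta>_def)
      have cJ: "1 \<le> card J" using J finB finite_subset[OF J(1)] by (simp add: Suc_le_eq card_gt_0_iff)
      have sub: "J \<subseteq> {..<N}" using J finB by auto
      have jJ: "\<forall>i\<in>J. \<zeta> i = 0" using J conf(1) by (auto simp: \<zeta>_def B_def)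
      have sz: "(\<Sum>i<N. \<bar>\<zeta> i\<bar>) \<le> int K"
      proof -
        have "(\<Sum>i<N. \<bar>\<zeta> i\<bar>) = (\<Sum>i<N. if i = j then 1 else 0)" by (intro sum.cong) (auto simp: \<zeta>_def)
        then show ?thesis using E(2) j by simp
      qed
      have lin: "lin N x (\<lambda>i. real_of_int (\<zeta> i)) = x j"
      proof
        fix d
        have "lin N x (\<lambda>i. real_of_int (\<zeta> i)) d = (\<Sum>i<N. if i = j then x i d else 0)"
          unfolding lin_def by (intro sum.cong) (auto simp: \<zeta>_def)
        then show "lin N x (\<lambda>i. real_of_int (\<zeta> i)) d = x j d" using j by simp
      qed
      have "\<exists>i\<in>J. \<bar>inner_n n (lin N x (\<lambda>i. real_of_int (\<zeta> i))) (x i)\<bar> \<le> thr p N (card J) * nrm n (lin N x (\<lambda>i. real_of_int (\<zeta> i)))"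
        by (rule E(1)[unfolded order_event_def, rule_format, of 1 "card J" \<zeta> J]) (use False supp sz cJ sub jJ E(2) in auto)
      then obtain i where i: "i \<in> J" "\<bar>inner_n n (x j) (x i)\<bar> \<le> thr p N (card J) * nrm n (x j)"
        unfolding lin by blast
      have "thr p N (card J) * nrm n (x j) \<le> thr p N (card J) * \<tau>" using x[OF j] by (intro mult_left_mono) (auto simp: thr_def)
      then have "\<bar>inner_n n (x i) (x j)\<bar>\<^sup>2 \<le> (thr p N (card J) * \<tau>)\<^sup>2" using i by (intro power_mono) (auto simp: inner_n_comm)
      then show ?thesis using False i by (intro bexI[of _ i]) (auto simp: power_mult_distrib mult.commute)
    qed
  qed
  also have "\<dots> \<le> (\<Sum>m=1..4 ^ s. (if real m < ln \<Gamma> then \<tau>\<^sup>2 * \<eta>\<^sup>2 else 0) + \<tau>\<^sup>2 * (thr p N m)\<^sup>2)"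
    using finB(2) by (intro sum_mono2) auto
  also have "\<dots> = (\<Sum>m=1..4 ^ s. if real m < ln \<Gamma> then \<tau>\<^sup>2 * \<eta>\<^sup>2 else 0) + \<tau>\<^sup>2 * (\<Sum>m=1..4 ^ s. (thr p N m)\<^sup>2)"
    by (simp add: sum.distrib sum_distrib_left)
  also have "(\<Sum>m=1..4 ^ s. if real m < ln \<Gamma> then \<tau>\<^sup>2 * \<eta>\<^sup>2 else 0) \<le> ln \<Gamma> * (\<tau>\<^sup>2 * \<eta>\<^sup>2)"
  proof -
    have "(\<Sum>m=1..4 ^ s. if real m < ln \<Gamma> then \<tau>\<^sup>2 * \<eta>\<^sup>2 else 0) = (\<Sum>m\<in>{m\<in>{1..4 ^ s}. real m < ln \<Gamma>}. \<tau>\<^sup>2 * \<eta>\<^sup>2)"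
      by (intro sum.mono_neutral_cong_right) auto
    also have "\<dots> = card {m\<in>{1..4 ^ s}. real m < ln \<Gamma>} * (\<tau>\<^sup>2 * \<eta>\<^sup>2)" by simp
    also have "\<dots> \<le> ln \<Gamma> * (\<tau>\<^sup>2 * \<eta>\<^sup>2)"
    proof (intro mult_right_mono)
      have "card {m\<in>{1..4 ^ s}. real m < ln \<Gamma>} \<le> card {1..nat \<lfloor>ln \<Gamma>\<rfloor>}"
        by (intro card_mono) (auto simp: le_nat_floor)
      then have "real (card {m\<in>{1..4 ^ s}. real m < ln \<Gamma>}) \<le> real (nat \<lfloor>ln \<Gamma>\<rfloor>)" by simp
      also have "\<dots> \<le> ln \<Gamma>" using \<Gamma> by simp
      finally show "real (card {m\<in>{1..4 ^ s}. real m < ln \<Gamma>}) \<le> ln \<Gamma>" .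
    qed simp
    finally show ?thesis .
  qed
  finally have 1: "(\<Sum>i\<in>B. (inner_n n (x i) (x j))\<^sup>2) \<le> ln \<Gamma> * (\<tau>\<^sup>2 * \<eta>\<^sup>2) + \<tau>\<^sup>2 * (\<Sum>m=1..4 ^ s. (thr p N m)\<^sup>2)" by simp
  have 2: "(\<Sum>m=1..4 ^ s. (thr p N m)\<^sup>2) \<le> exp 8 * (N powr (1/p) * (4 ^ s) powr \<gamma>)\<^sup>2 / (2 * \<gamma>)"
  proof -
    have pw: "(a powr b)\<^sup>2 = a powr (2 * b)" for a b :: real
      by (simp only: power2_eq_square mult_2 powr_add)
    have "(\<Sum>m=1..4 ^ s. (thr p N m)\<^sup>2) \<le> (\<Sum>m=1..4 ^ s. exp 8 * N powr (2/p) * real m powr (2 * \<gamma> - 1))"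
    proof (intro sum_mono)
      fix m :: nat assume m: "m \<in> {1..4 ^ s}"
      have "(thr p N m)\<^sup>2 = exp 8 powr (2/p) * N powr (2/p) * real m powr (2 * \<gamma> - 1)"
        using m by (simp add: thr_def pw powr_mult powr_divide power_mult_distrib power_divide \<gamma>_def powr_minus_divide)
      also have "exp 8 powr (2/p) \<le> exp (8::real) powr 1" using p by (intro powr_mono) auto
      finally show "(thr p N m)\<^sup>2 \<le> exp 8 * N powr (2/p) * real m powr (2 * \<gamma> - 1)"
        by (simp add: mult_right_mono)
    qed
    also have "\<dots> = exp 8 * N powr (2/p) * (\<Sum>m=1..4 ^ s. real m powr (2 * \<gamma> - 1))" by (simp add: sum_distrib_left)
    also have "\<dots> \<le> exp 8 * N powr (2/p) * ((4 ^ s) powr (2 * \<gamma>) / (2 * \<gamma>))"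
      using sum_powr_le[of "2 * \<gamma>" "4 ^ s"] \<gamma> by (intro mult_left_mono) auto
    finally show ?thesis by (simp add: power_mult_distrib pw)
  qed
  have "\<tau>\<^sup>2 * (\<Sum>m=1..4 ^ s. (thr p N m)\<^sup>2) \<le> \<tau>\<^sup>2 * (exp 8 * (N powr (1/p) * (4 ^ s) powr \<gamma>)\<^sup>2 / (2 * \<gamma>))"
    using 2 by (intro mult_left_mono) auto
  with 1 have "(\<Sum>i\<in>B. (inner_n n (x i) (x j))\<^sup>2)
      \<le> \<tau>\<^sup>2 * (ln \<Gamma> * \<eta>\<^sup>2 + exp 8 * (N powr (1/p) * (4 ^ s) powr \<gamma>)\<^sup>2 / (2 * \<gamma>))"
    by (simp add: distrib_left mult_ac)
  then show ?thesis by (simp only: B_def \<gamma>_def)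
qed

text \<open>By Cauchy-Schwarz the moduli of the coefficients have sum at most \<open>2 ^ b\<close>.
  This is for the lowest levels of the long vectors, on which the first \<open>m0\<close> order
  statistics would be too expensive, their cost being divided by \<open>2 ^ b\<close> only.\<close>

lemma level_bound_trivial:
  assumes E: "\<And>i j. i < N \<Longrightarrow> j < N \<Longrightarrow> \<not> conf i j \<Longrightarrow> \<bar>inner_n n (x i) (x j)\<bar> \<le> E" and E0: "E \<ge> 0"
  shows "level_bound n N x \<kappa> conf b (4 ^ b * E)"
  unfolding level_bound_def
proof (intro allI impI)
  fix I J :: "nat set" and y :: "nat \<Rightarrow> real"
  assume I: "I \<subseteq> {..<N}" "card I \<le> 4 ^ b" and y1: "(\<Sum>i\<in>I. (y i)\<^sup>2) \<le> 1" and J: "J \<subseteq> {..<N}" "card J \<le> 4 ^ b"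
  have fin: "finite I" using I finite_subset by auto
  have "(\<Sum>i\<in>I. \<bar>y i\<bar> * \<bar>1\<bar>) \<le> L2_set y I * L2_set (\<lambda>_. 1) I" by (rule L2_set_mult_ineq)
  also have "\<dots> \<le> 1 * 2 ^ b"
  proof (intro mult_mono)
    show "L2_set y I \<le> 1" using y1 by (simp add: L2_set_def)
    have "real (card I) \<le> real (4 ^ b)" using I(2) by (simp only: of_nat_le_iff)
    then have "sqrt (real (card I)) \<le> sqrt ((2 ^ b)\<^sup>2)" unfolding two_power_sq by (intro real_sqrt_le_mono) simp
    then show "L2_set (\<lambda>_. 1) I \<le> 2 ^ b" by (simp add: L2_set_constant)
  qed auto
  finally have ysum: "(\<Sum>i\<in>I. \<bar>y i\<bar>) \<le> 2 ^ b" by simp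
  have "(\<Sum>j\<in>J. \<bar>\<Sum>i\<in>{i\<in>I. \<not> conf i j}. y i * inner_n n (x i) (x j)\<bar>) \<le> (\<Sum>j\<in>J. 2 ^ b * E)"
  proof (intro sum_mono)
    fix j assume j: "j \<in> J"
    have "\<bar>\<Sum>i\<in>{i\<in>I. \<not> conf i j}. y i * inner_n n (x i) (x j)\<bar> \<le> (\<Sum>i\<in>{i\<in>I. \<not> conf i j}. \<bar>y i\<bar> * E)"
      using I J j E by (intro order_trans[OF sum_abs] sum_mono) (auto simp: abs_mult intro!: mult_left_mono)
    also have "\<dots> \<le> (\<Sum>i\<in>I. \<bar>y i\<bar> * E)" using fin E0 by (intro sum_mono2) auto
    also have "\<dots> \<le> 2 ^ b * E" using ysum E0 by (simp add: sum_distrib_right[symmetric] mult_right_mono)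
    finally show "\<bar>\<Sum>i\<in>{i\<in>I. \<not> conf i j}. y i * inner_n n (x i) (x j)\<bar> \<le> 2 ^ b * E" .
  qed
  also have "\<dots> = real (card J) * (2 ^ b * E)" by simp
  also have "\<dots> \<le> real (4 ^ b) * (2 ^ b * E)" using J(2) E0 by (intro mult_right_mono) (simp_all only: of_nat_le_iff, auto)
  finally show "(\<Sum>j\<in>J. \<bar>\<Sum>i\<in>{i\<in>I. \<not> conf i j}. y i * inner_n n (x i) (x j)\<bar>) \<le> 2 ^ b * (4 ^ b * E)" by (simp add: mult_ac)
qed

text \<open>A geometric sum is governed by its last term. The constant depends on \<open>g0\<close>
  alone, which keeps it uniform in all \<open>p\<close> with \<open>1/2 - 1/p\<close> at least
  \<open>\<gamma>0\<close>.\<close>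

lemma sum_powers_le_last:
  fixes g g0 :: real
  assumes "1 < g0" "g0 \<le> g"
  shows "(\<Sum>b\<le>s. g ^ b) \<le> g0 / (g0 - 1) * g ^ s"
proof (induction s)
  case 0
  then show ?case using assms by simp
next
  case (Suc s)
  define c where "c = g0 / (g0 - 1)"
  have c: "c / g0 + 1 = c" "c \<ge> 0" using assms by (simp_all add: c_def field_simps)
  have "(\<Sum>b\<le>Suc s. g ^ b) \<le> c * g ^ s + g ^ Suc s" using Suc by (simp add: c_def)
  also have "\<dots> = (c / g + 1) * g ^ Suc s" using assms by (simp add: distrib_right)
  also have "\<dots> \<le> (c / g0 + 1) * g ^ Suc s"
    using assms c by (intro mult_right_mono add_right_mono divide_left_mono) auto
  finally show ?case unfolding c by (simp add: c_def)
qed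

text \<open>No power of \<open>ln \<Gamma>\<close> survives. The lowest levels,
  \<open>4 ^ b \<le> \<kappa> powr (\<gamma>0 / 4)\<close>, are treated trivially; on the others the
  powers of \<open>ln \<Gamma>\<close>, each at most a small power of \<open>\<kappa>\<close>, are
  absorbed by \<open>1 / 2 ^ b\<close> or by the gap between
  \<open>\<kappa> powr (\<gamma>0 / 4)\<close> and \<open>\<kappa> powr (1/2 - 1/p)\<close>. The
  main term grows geometrically with the level, so that only the logarithm of the top level counts,
  and this one is contained in \<open>\<tau>\<close>.\<close>

lemma heavy_sparse_bound:
  fixes \<gamma>0 CL :: real and D :: nat
  assumes \<gamma>0: "\<gamma>0 > 0" and CL: "CL > 0" and D: "D \<ge> 1"
  shows "\<exists>C>0. \<forall>p n N x \<Gamma> \<kappa> \<tau>. p > 2 \<longrightarrow> \<gamma>0 \<le> 1/2 - 1/p \<longrightarrow> \<kappa> \<ge> 1 \<longrightarrow> 64 * exp 1 * real \<kappa> \<le> \<Gamma> \<longrightarrow>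
     ln \<Gamma> \<le> CL * real \<kappa> powr (\<gamma>0 / 32) \<longrightarrow> order_event n N x p \<Gamma> (1024 * \<kappa>) \<longrightarrow>
     real N powr (1/p) * real \<kappa> powr (1/2 - 1/p) * sqrt (ln (\<Gamma> / real \<kappa>)) \<le> \<tau> \<longrightarrow>
     (\<forall>i<N. nrm n (x i) \<le> \<tau>) \<longrightarrow>
     (\<forall>i<N. card {j. j < N \<and> (i = j \<or> \<tau> * (real N powr (1/p) * real \<kappa> powr (\<gamma>0 / 4)) < \<bar>inner_n n (x i) (x j)\<bar>)} \<le> D) \<longrightarrow>
     sparse_bound n N \<kappa> x (C * \<tau>\<^sup>2)"
proof -
  \<comment> \<open>The budget of exponents: \<open>ln \<Gamma>\<close> costs
    \<open>\<kappa> powr (\<delta> / 8)\<close>, the low levels and the correlation threshold cost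
    \<open>\<kappa> powr \<delta>\<close> each, and \<open>4 * \<delta> \<le> 1/2 - 1/p\<close> is
    available.\<close>
  define \<delta> where "\<delta> = \<gamma>0 / 4"
  define c2 where "c2 = sqrt (exp 8 / (2 * \<gamma>0))"
  define c3 where "c3 = 32 * exp 8 / \<gamma>0"
  define c4 where "c4 = sqrt (256 * real D / \<delta>)"
  define g0 where "g0 = (4::real) powr (3 * \<delta>)"
  define c5 where "c5 = g0 / (g0 - 1)"
  define c8 where "c8 = 8 * c5 / sqrt (2 * \<delta>)"
  define c6 where "c6 = CL + 129 * real D * real D * CL\<^sup>2 + 32 * c4 * CL\<^sup>2 + c4 * (32 * c2) * c8"
  define c7 where "c7 = 129 * real D * CL\<^sup>2 + c4 * c3 * c8"
  define C where "C = 32 * (real D + 2 * c6) + (32 * c7)\<^sup>2"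
  have \<delta>: "\<delta> > 0" using \<gamma>0 by (simp add: \<delta>_def)
  have g0: "g0 > 1" using \<delta> by (simp add: g0_def)
  have cpos: "c2 \<ge> 0" "c3 \<ge> 0" "c4 \<ge> 0" "c5 \<ge> 0" "c8 \<ge> 0"
    using \<gamma>0 \<delta> g0 by (auto simp: c2_def c3_def c4_def c5_def c8_def)
  then have c67: "c6 \<ge> 0" "c7 \<ge> 0" using CL by (auto simp: c6_def c7_def)
  show ?thesis
  proof (intro exI[of _ C] conjI allI impI)
    show "C > 0" using D c67 by (simp add: C_def add_pos_nonneg)
    fix p :: real and n N :: nat and x :: "nat \<Rightarrow> nat \<Rightarrow> real" and \<Gamma> :: real and \<kappa> :: nat and \<tau> :: real
    assume p: "p > 2" and g: "\<gamma>0 \<le> 1/2 - 1/p" and \<kappa>: "\<kappa> \<ge> 1" and \<Gamma>: "64 * exp 1 * real \<kappa> \<le> \<Gamma>"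
      and lnG: "ln \<Gamma> \<le> CL * real \<kappa> powr (\<gamma>0 / 32)"
      and E: "order_event n N x p \<Gamma> (1024 * \<kappa>)"
      and T\<tau>: "real N powr (1/p) * real \<kappa> powr (1/2 - 1/p) * sqrt (ln (\<Gamma> / real \<kappa>)) \<le> \<tau>"
      and x: "\<forall>i<N. nrm n (x i) \<le> \<tau>"
      and deg: "\<forall>i<N. card {j. j < N \<and> (i = j \<or> \<tau> * (real N powr (1/p) * real \<kappa> powr (\<gamma>0 / 4)) < \<bar>inner_n n (x i) (x j)\<bar>)} \<le> D"
    define \<gamma> where "\<gamma> = 1/2 - 1/p"
    have "1 / p > 0" using p by simp
    then have \<gamma>: "0 < \<gamma>" "\<gamma> \<le> 1/2" "\<gamma>0 \<le> \<gamma>" "4 * \<delta> \<le> \<gamma>" "\<delta> \<le> 1/8"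
      unfolding \<gamma>_def \<delta>_def using g \<gamma>0 by linarith+
    define R where "R = real N powr (1/p)"
    define T where "T = R * real \<kappa> powr \<gamma>"
    define \<eta> where "\<eta> = R * real \<kappa> powr \<delta>"
    define k0 where "k0 = real \<kappa> powr \<delta>"
    define \<Lambda> where "\<Lambda> = ln \<Gamma>"
    define uu where "uu = ln (\<Gamma> / real \<kappa>)"
    have R0: "R \<ge> 0" by (simp add: R_def)
    have k0: "k0 \<ge> 1" using \<kappa> \<delta> by (simp add: k0_def ge_one_powr_ge_zero)
    have T0: "T \<ge> 0" "\<eta> \<ge> 0" using R0 by (auto simp: T_def \<eta>_def)
    obtain s where s: "16 * \<kappa> \<le> 4 ^ s" "4 ^ s < 64 * \<kappa>" using dyadic_level_exists[OF \<kappa>] by blast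
    have \<Gamma>0: "\<Gamma> > 0"
    proof -
      have "0 < 64 * exp 1 * real \<kappa>" using \<kappa> by simp
      then show ?thesis using \<Gamma> by linarith
    qed
    have ls: "real s + 1 \<le> \<Lambda>" unfolding \<Lambda>_def by (rule ln_ratio_levels[OF s(2) \<Gamma> \<kappa> order_refl])
    then have \<Lambda>1: "\<Lambda> \<ge> 1" by simp
    have \<Gamma>1: "\<Gamma> \<ge> 1"
    proof (rule ccontr)
      assume "\<not> 1 \<le> \<Gamma>"
      then have "ln \<Gamma> < 0" using \<Gamma>0 by (simp add: ln_less_zero)
      then show False using \<Lambda>1 by (simp add: \<Lambda>_def)
    qed
    \<comment> \<open>The logarithm at level \<open>b\<close>. Going down from the top level it
      grows at most like \<open>(4 ^ s / 4 ^ b) powr (2 * \<delta>)\<close> (see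
      \<open>u_grow\<close>). After the square root this lowers the exponent of \<open>4 ^ b\<close>
      in the main term from \<open>\<gamma>\<close> to \<open>\<gamma> - \<delta>\<close>, which is
      still positive.\<close>
    define u where "u b = ln (\<Gamma> / 4 ^ b)" for b :: nat
    have u1: "1 \<le> u b" if "b \<le> s" for b unfolding u_def by (rule ln_ratio_levels[OF s(2) \<Gamma> \<kappa> that])
    have u\<Lambda>: "u b \<le> \<Lambda>" for b using \<Gamma>0 by (simp add: u_def \<Lambda>_def ln_div)
    have us: "u s \<le> uu"
    proof -
      have "real \<kappa> \<le> real (4 ^ s)" using s(1) by (simp only: of_nat_le_iff)
      then have "\<Gamma> / 4 ^ s \<le> \<Gamma> / real \<kappa>" using \<Gamma>0 \<kappa> by (intro divide_left_mono) auto
      then show ?thesis using \<Gamma>0 \<kappa> by (simp add: u_def uu_def)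
    qed
    have uu1: "uu \<ge> 1" using us u1[of s] by simp
    have Tuu: "T * sqrt uu \<le> \<tau>" using T\<tau> by (simp add: T_def R_def uu_def \<gamma>_def)
    have T\<tau>1: "T \<le> \<tau>"
    proof -
      have "T * 1 \<le> T * sqrt uu" using T0 uu1 by (intro mult_left_mono) auto
      then show ?thesis using Tuu by linarith
    qed
    have \<tau>0: "\<tau> \<ge> 0" using T0 T\<tau>1 by linarith
    have grow: "v * (1 + ln (4 ^ c / r)) \<le> v * ((4 ^ c / r) powr (2 * \<delta>) / (2 * \<delta>))" if "v \<ge> 0" "r > 0" "r \<le> 4 ^ c" for v r :: real and c :: nat
      using that \<delta> \<gamma> by (intro mult_left_mono one_add_ln_le_powr) auto
    have W: "ln (\<Gamma> / real m) \<le> (u b / (2 * \<delta>)) * (4 ^ b / real m) powr (2 * \<delta>)" if "1 \<le> m" "m \<le> 4 ^ b" "b \<le> s" for m b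
    proof -
      have mr: "real m > 0" using that by simp
      have mb: "real m \<le> 4 ^ b" using that(2) by (metis numeral_power_le_of_nat_cancel_iff of_nat_le_iff of_nat_numeral of_nat_power)
      have "ln (4 ^ b / real m) \<ge> 0" using mr mb by simp
      then have "1 * ln (4 ^ b / real m) \<le> u b * ln (4 ^ b / real m)" using u1[OF that(3)] by (intro mult_right_mono) auto
      moreover have "ln (\<Gamma> / real m) = u b + ln (4 ^ b / real m)" using \<Gamma>0 mr by (simp add: u_def ln_div)
      ultimately have "ln (\<Gamma> / real m) \<le> u b * (1 + ln (4 ^ b / real m))" by (simp add: distrib_left)
      also have "\<dots> \<le> u b * ((4 ^ b / real m) powr (2 * \<delta>) / (2 * \<delta>))" using u1[OF that(3)] mr mb by (intro grow) auto
      finally show ?thesis by simp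
    qed
    have u_grow: "u b \<le> uu / (2 * \<delta>) * (4 ^ s / 4 ^ b) powr (2 * \<delta>)" if b: "b \<le> s" for b
    proof -
      have bs: "(4::real) ^ b \<le> 4 ^ s" using b by (intro power_increasing) auto
      then have "ln ((4::real) ^ s / 4 ^ b) \<ge> 0" by simp
      then have "1 * ln (4 ^ s / 4 ^ b) \<le> u s * ln ((4::real) ^ s / 4 ^ b)" using u1[of s] by (intro mult_right_mono) auto
      moreover have "u b = u s + ln (4 ^ s / 4 ^ b)" using \<Gamma>0 by (simp add: u_def ln_div)
      ultimately have "u b \<le> u s * (1 + ln (4 ^ s / 4 ^ b))" by (simp add: distrib_left)
      also have "\<dots> \<le> u s * ((4 ^ s / 4 ^ b) powr (2 * \<delta>) / (2 * \<delta>))" using u1[of s] bs by (intro grow) auto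
      also have "\<dots> \<le> uu * ((4 ^ s / 4 ^ b) powr (2 * \<delta>) / (2 * \<delta>))" using us \<delta> by (intro mult_right_mono) auto
      finally show ?thesis by simp
    qed
    define conf where "conf i j \<longleftrightarrow> i = j \<or> \<tau> * \<eta> < \<bar>inner_n n (x i) (x j)\<bar>" for i j
    have conf: "conf j j" "conf i j = conf j i" for i j by (auto simp: conf_def inner_n_comm[of n "x i"])
    have deg': "card {j. j < N \<and> conf i j} \<le> D" if "i < N" for i
      using deg that by (simp add: conf_def \<eta>_def R_def \<delta>_def)
    have nconf: "\<not> conf i j \<Longrightarrow> \<bar>inner_n n (x i) (x j)\<bar> \<le> \<tau> * \<eta>" for i j by (simp add: conf_def)
    define m0 where "m0 = nat \<lceil>128 * real D * \<Lambda>\<rceil>"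
    have "128 * real D * \<Lambda> \<ge> 0" using \<Lambda>1 by simp
    moreover have "1 * 1 \<le> real D * \<Lambda>" using \<Lambda>1 D by (intro mult_mono) auto
    ultimately have m0: "128 * real D * ln \<Gamma> \<le> real m0" "real m0 \<le> 129 * real D * \<Lambda>"
      unfolding m0_def \<Lambda>_def[symmetric] by linarith+
    define S where "S b = \<tau>\<^sup>2 * (ln \<Gamma> * \<eta>\<^sup>2 + exp 8 * (real N powr (1/p) * (4 ^ b) powr (1/2 - 1/p))\<^sup>2 / (2 * (1/2 - 1/p)))" for b :: nat
    have S0: "S b \<ge> 0" for b using \<Lambda>1 \<gamma> by (simp add: S_def \<Lambda>_def \<gamma>_def)
    define G where "G A b = real m0 * (sqrt A * \<tau> + real D * \<tau>\<^sup>2) / 2 ^ b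
      + sqrt (512 * real D * (u b / (2 * \<delta>))) * (12 * sqrt (S b) / (1/2 - \<delta>)
          + 16 * exp 8 * sqrt A * real N powr (1/p) * (4 ^ b) powr (1/2 - 1/p) / (1/2 - 1/p - \<delta>))" for A :: real and b :: nat
    define \<beta> where "\<beta> A b = (if 4 ^ b \<le> k0 then 4 ^ b * (\<tau> * \<eta>) else G A b)" for A :: real and b :: nat
    have lb: "level_bound n N x \<kappa> conf b (\<beta> A b)" if A: "A \<ge> 0" "sparse_bound n N \<kappa> x A" and b: "b \<le> s" for A b
    proof (cases "4 ^ b \<le> k0")
      case True
      have "level_bound n N x \<kappa> conf b (4 ^ b * (\<tau> * \<eta>))"
        using nconf \<tau>0 T0 by (intro level_bound_trivial) auto
      then show ?thesis using True by (simp add: \<beta>_def)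
    next
      case False
      have "level_bound n N x \<kappa> conf b (G A b)"
        unfolding G_def
      proof (rule level_bound_summed[OF A(2,1)])
        show "order_event n N x p \<Gamma> (1024 * \<kappa>)" by (rule E)
        have "4 ^ b \<le> (4::nat) ^ s" using b by (intro power_increasing) auto
        then show "16 * 4 ^ b \<le> 1024 * \<kappa>" using s by linarith
        show "1 \<le> ln (\<Gamma> / 4 ^ b)" by (rule ln_ratio_levels[OF s(2) \<Gamma> \<kappa> b])
        show "(\<Sum>i\<in>{i\<in>I. \<not> conf i j}. (inner_n n (x i) (x j))\<^sup>2) \<le> S b"
          if I: "I \<subseteq> {..<N}" "card I \<le> 4 ^ b" and j: "j < N" for I j
          unfolding S_def by (rule row_sum_bound[OF E _ p \<Gamma>1 _ I j conf(1)]) (use x nconf \<kappa> in auto)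
        show "\<delta> < 1/2 - 1/p" using \<gamma> \<delta> by (simp add: \<gamma>_def)
      qed (use x \<tau>0 A \<Gamma>0 m0 p \<gamma> \<delta> conf deg' S0 D W[OF _ _ b] in auto)
      then show ?thesis using False by (simp add: \<beta>_def)
    qed
    obtain A where A: "A \<ge> 0" "sparse_bound n N \<kappa> x A" "A \<le> 16 * (real D * \<tau>\<^sup>2 + 2 * (\<Sum>b\<le>s. \<beta> A b))"
    proof -
      have "\<exists>A\<ge>0. sparse_bound n N \<kappa> x A \<and> A \<le> 16 * (real D * \<tau>\<^sup>2 + 2 * (\<Sum>b\<le>s. \<beta> A b))"
        by (rule sparse_bound_bootstrap[where conf=conf, OF conf(2) deg' _ \<tau>0 s(1) lb]) (use x in auto)
      then show ?thesis using that by blast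
    qed
    define M where "M = sqrt A * \<tau>"
    have M0: "M \<ge> 0" using A \<tau>0 by (simp add: M_def)
    \<comment> \<open>\<open>X1\<close> is for the trivial levels, \<open>X2\<close> for the first
      \<open>m0\<close> order statistics, \<open>X3\<close> for the few large entries of a row;
      \<open>V\<close> is the factor of the geometric main term.\<close>
    define X1 where "X1 = k0 * (\<tau> * \<eta>)"
    define X2 where "X2 = real m0 * (M + real D * \<tau>\<^sup>2) / sqrt k0"
    define X3 where "X3 = c4 * 32 * \<tau> * \<Lambda> * \<eta>"
    define V where "V = c4 * (32 * c2 * \<tau> + c3 * sqrt A) * sqrt (uu / (2 * \<delta>)) * R * (4 ^ s) powr \<delta>"
    have X0: "X1 \<ge> 0" "X2 \<ge> 0" "X3 \<ge> 0" "V \<ge> 0"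
      using k0 \<tau>0 T0 M0 cpos \<Lambda>1 R0 uu1 \<delta> A by (auto simp: X1_def X2_def X3_def V_def)
    have \<beta>le: "\<beta> A b \<le> X1 + X2 + X3 + V * (4 ^ b) powr (\<gamma> - \<delta>)" if b: "b \<le> s" for b
    proof (cases "4 ^ b \<le> k0")
      case True
      then have "\<beta> A b \<le> X1" using \<tau>0 T0 by (auto simp: \<beta>_def X1_def intro!: mult_right_mono)
      moreover have "V * (4 ^ b) powr (\<gamma> - \<delta>) \<ge> 0" using X0 by simp
      ultimately show ?thesis using X0 by linarith
    next
      case False
      define Q where "Q = R * (4 ^ b) powr \<gamma>"
      have Q0: "Q \<ge> 0" using R0 by (simp add: Q_def)
      have "sqrt k0 \<le> sqrt (4 ^ b)" using False by simp
      then have "sqrt k0 \<le> 2 ^ b" by (simp add: two_power_powr powr_half_sqrt)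
      then have 1: "real m0 * (sqrt A * \<tau> + real D * \<tau>\<^sup>2) / 2 ^ b \<le> X2"
        unfolding X2_def M_def using k0 M0 by (intro divide_left_mono) (auto simp: M_def)
      have 2: "sqrt (512 * real D * (u b / (2 * \<delta>))) = c4 * sqrt (u b)"
        by (simp add: c4_def real_sqrt_mult[symmetric] mult_ac)
      have 3: "sqrt (S b) \<le> \<tau> * (sqrt \<Lambda> * \<eta> + c2 * Q)"
      proof (rule real_le_lsqrt)
        have "exp 8 * Q\<^sup>2 / (2 * \<gamma>) \<le> exp 8 * Q\<^sup>2 / (2 * \<gamma>0)" using \<gamma> \<gamma>0 by (intro divide_left_mono) auto
        also have "\<dots> = (c2 * Q)\<^sup>2" using \<gamma>0 by (simp add: c2_def power_mult_distrib)
        finally have "S b \<le> \<tau>\<^sup>2 * ((sqrt \<Lambda> * \<eta>)\<^sup>2 + (c2 * Q)\<^sup>2)"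
          unfolding S_def using \<Lambda>1 by (intro mult_left_mono) (auto simp: Q_def R_def \<gamma>_def \<Lambda>_def power_mult_distrib)
        also have "\<dots> \<le> \<tau>\<^sup>2 * (sqrt \<Lambda> * \<eta> + c2 * Q)\<^sup>2"
          using \<Lambda>1 T0 cpos Q0 by (intro mult_left_mono) (auto simp: power2_sum)
        finally show "S b \<le> (\<tau> * (sqrt \<Lambda> * \<eta> + c2 * Q))\<^sup>2" by (simp add: power_mult_distrib)
      qed (use \<tau>0 \<Lambda>1 T0 cpos Q0 in auto)
      have 4: "12 * sqrt (S b) / (1/2 - \<delta>) \<le> 32 * \<tau> * (sqrt \<Lambda> * \<eta> + c2 * Q)"
      proof -
        have "12 * sqrt (S b) / (1/2 - \<delta>) \<le> 12 * sqrt (S b) / (3/8)" using \<gamma> S0[of b] by (intro divide_left_mono) auto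
        then show ?thesis using 3 by simp
      qed
      have 5: "16 * exp 8 * sqrt A * real N powr (1/p) * (4 ^ b) powr (1/2 - 1/p) / (1/2 - 1/p - \<delta>) \<le> c3 * sqrt A * Q"
      proof -
        have "16 * exp 8 * sqrt A * Q / (\<gamma> - \<delta>) \<le> 16 * exp 8 * sqrt A * Q / (\<gamma>0 / 2)"
          using \<gamma> \<gamma>0 A Q0 by (intro divide_left_mono) (auto simp: \<delta>_def)
        then show ?thesis by (simp add: c3_def Q_def R_def \<gamma>_def mult_ac)
      qed
      have 6: "sqrt (u b) * sqrt \<Lambda> \<le> \<Lambda>"
      proof -
        have "sqrt (u b) * sqrt \<Lambda> \<le> sqrt \<Lambda> * sqrt \<Lambda>" using u\<Lambda>[of b] \<Lambda>1 by (intro mult_right_mono) auto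
        then show ?thesis using \<Lambda>1 by simp
      qed
      have 7: "sqrt (u b) * Q \<le> sqrt (uu / (2 * \<delta>)) * R * (4 ^ s) powr \<delta> * (4 ^ b) powr (\<gamma> - \<delta>)"
      proof -
        have "sqrt (u b) \<le> sqrt (uu / (2 * \<delta>) * (4 ^ s / 4 ^ b) powr (2 * \<delta>))" using u_grow[OF b] by simp
        also have "\<dots> = sqrt (uu / (2 * \<delta>)) * (4 ^ s / 4 ^ b) powr \<delta>"
          unfolding real_sqrt_mult by (simp add: powr_powr flip: powr_half_sqrt)
        finally have "sqrt (u b) * Q \<le> sqrt (uu / (2 * \<delta>)) * (4 ^ s / 4 ^ b) powr \<delta> * Q" using Q0 by (intro mult_right_mono)
        also have "\<dots> = sqrt (uu / (2 * \<delta>)) * R * (4 ^ s) powr \<delta> * (4 ^ b) powr (\<gamma> - \<delta>)"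
          by (simp add: Q_def powr_divide powr_diff)
        finally show ?thesis .
      qed
      have "G A b \<le> X2 + c4 * sqrt (u b) * (32 * \<tau> * (sqrt \<Lambda> * \<eta> + c2 * Q) + c3 * sqrt A * Q)"
        unfolding G_def 2 using 1 4 5 cpos u1[OF b] by (intro add_mono mult_left_mono) auto
      also have "\<dots> = X2 + c4 * 32 * \<tau> * \<eta> * (sqrt (u b) * sqrt \<Lambda>) + c4 * (32 * c2 * \<tau> + c3 * sqrt A) * (sqrt (u b) * Q)"
        by (simp add: algebra_simps)
      also have "\<dots> \<le> X2 + c4 * 32 * \<tau> * \<eta> * \<Lambda> + c4 * (32 * c2 * \<tau> + c3 * sqrt A) * (sqrt (uu / (2 * \<delta>)) * R * (4 ^ s) powr \<delta> * (4 ^ b) powr (\<gamma> - \<delta>))"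
        using 6 7 cpos \<tau>0 T0 A by (intro add_mono mult_left_mono) auto
      also have "\<dots> = X2 + X3 + V * (4 ^ b) powr (\<gamma> - \<delta>)" by (simp add: X3_def V_def mult_ac)
      finally show ?thesis using False X0 by (simp add: \<beta>_def)
    qed
    have \<kappa>1: "real \<kappa> \<ge> 1" using \<kappa> by simp
    have \<Lambda>le: "\<Lambda> \<le> CL * real \<kappa> powr (\<delta> / 8)" using lnG by (simp add: \<Lambda>_def \<delta>_def)
    have \<Lambda>2: "\<Lambda>\<^sup>2 \<le> CL\<^sup>2 * real \<kappa> powr (\<delta> / 4)"
    proof -
      have "\<Lambda>\<^sup>2 \<le> (CL * real \<kappa> powr (\<delta> / 8))\<^sup>2" using \<Lambda>le \<Lambda>1 by (intro power_mono) auto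
      also have "\<dots> = CL\<^sup>2 * real \<kappa> powr (\<delta> / 4)" by (simp add: power_mult_distrib power2_eq_square[of "_ powr _"] flip: powr_add)
      finally show ?thesis .
    qed
    have s1: "(real s + 1) * X1 \<le> CL * \<tau>\<^sup>2"
    proof -
      have "(real s + 1) * X1 \<le> (CL * real \<kappa> powr (\<delta> / 8)) * X1" using ls \<Lambda>le X0 by (intro mult_right_mono) auto
      also have "\<dots> = CL * \<tau> * R * (real \<kappa> powr (\<delta> / 8) * real \<kappa> powr \<delta> * real \<kappa> powr \<delta>)" by (simp add: X1_def k0_def \<eta>_def mult_ac)
      also have "\<dots> \<le> CL * \<tau> * R * real \<kappa> powr \<gamma>" unfolding powr_add[symmetric]
        using CL \<tau>0 R0 \<gamma> \<delta> \<kappa>1 by (intro mult_left_mono powr_mono) auto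
      also have "\<dots> = CL * \<tau> * T" by (simp add: T_def)
      also have "\<dots> \<le> CL * \<tau> * \<tau>" using T\<tau>1 CL \<tau>0 by (intro mult_left_mono) auto
      finally show ?thesis by (simp add: power2_eq_square)
    qed
    have s2: "(real s + 1) * X2 \<le> 129 * real D * CL\<^sup>2 * (M + real D * \<tau>\<^sup>2)"
    proof -
      have k0s: "sqrt k0 = real \<kappa> powr (\<delta> / 2)" by (simp add: k0_def powr_powr flip: powr_half_sqrt)
      have "(real s + 1) * X2 \<le> \<Lambda> * (129 * real D * \<Lambda> * (M + real D * \<tau>\<^sup>2) / sqrt k0)"
        using ls m0 M0 \<Lambda>1 k0 X0 unfolding X2_def by (intro mult_mono divide_right_mono mult_right_mono) auto
      also have "\<dots> = 129 * real D * (M + real D * \<tau>\<^sup>2) * (\<Lambda>\<^sup>2 / sqrt k0)" by (simp add: power2_eq_square)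
      also have "\<dots> \<le> 129 * real D * (M + real D * \<tau>\<^sup>2) * CL\<^sup>2"
      proof (intro mult_left_mono)
        have "CL\<^sup>2 * real \<kappa> powr (\<delta> / 4) \<le> CL\<^sup>2 * real \<kappa> powr (\<delta> / 2)"
          using \<kappa>1 \<delta> by (intro mult_left_mono powr_mono) auto
        with \<Lambda>2 have "\<Lambda>\<^sup>2 \<le> CL\<^sup>2 * real \<kappa> powr (\<delta> / 2)" by (rule order_trans)
        then show "\<Lambda>\<^sup>2 / sqrt k0 \<le> CL\<^sup>2" unfolding k0s using \<kappa>1 by (simp add: field_simps)
      qed (use M0 in auto)
      finally show ?thesis by (simp add: mult_ac)
    qed
    have s3: "(real s + 1) * X3 \<le> 32 * c4 * CL\<^sup>2 * \<tau>\<^sup>2"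
    proof -
      have "(real s + 1) * X3 \<le> \<Lambda> * X3" using ls X0 by (intro mult_right_mono) auto
      also have "\<dots> = 32 * c4 * \<tau> * \<eta> * \<Lambda>\<^sup>2" by (simp add: X3_def power2_eq_square)
      also have "\<dots> \<le> 32 * c4 * \<tau> * \<eta> * (CL\<^sup>2 * real \<kappa> powr (\<delta> / 4))"
        using \<Lambda>2 cpos \<tau>0 T0 by (intro mult_left_mono) auto
      also have "\<dots> = 32 * c4 * \<tau> * CL\<^sup>2 * (R * (real \<kappa> powr \<delta> * real \<kappa> powr (\<delta> / 4)))" by (simp add: \<eta>_def mult_ac)
      also have "\<dots> \<le> 32 * c4 * \<tau> * CL\<^sup>2 * (R * real \<kappa> powr \<gamma>)" unfolding powr_add[symmetric]
        using cpos \<tau>0 R0 \<gamma> \<delta> \<kappa>1 by (intro mult_left_mono powr_mono) auto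
      also have "\<dots> \<le> 32 * c4 * \<tau> * CL\<^sup>2 * \<tau>" using T\<tau>1 cpos \<tau>0 unfolding T_def by (intro mult_left_mono) auto
      finally show ?thesis by (simp add: power2_eq_square mult_ac)
    qed
    have s4: "V * (\<Sum>b\<le>s. (4 ^ b) powr (\<gamma> - \<delta>)) \<le> c4 * (32 * c2 * \<tau> + c3 * sqrt A) * c8 * \<tau>"
    proof -
      define gg where "gg = (4::real) powr (\<gamma> - \<delta>)"
      have gpow: "((4::real) ^ b) powr (\<gamma> - \<delta>) = gg ^ b" for b :: nat
      proof -
        have "((4::real) ^ b) powr (\<gamma> - \<delta>) = (4 powr real b) powr (\<gamma> - \<delta>)" by (simp add: powr_realpow)
        also have "\<dots> = gg powr real b" by (simp add: gg_def powr_powr mult.commute)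
        also have "\<dots> = gg ^ b" by (rule powr_realpow) (simp add: gg_def)
        finally show ?thesis .
      qed
      have "g0 \<le> gg" unfolding g0_def gg_def using \<gamma> by (intro powr_mono) auto
      then have "(\<Sum>b\<le>s. (4 ^ b) powr (\<gamma> - \<delta>)) \<le> c5 * (4 ^ s) powr (\<gamma> - \<delta>)"
        unfolding gpow c5_def by (rule sum_powers_le_last[OF g0])
      then have "V * (\<Sum>b\<le>s. (4 ^ b) powr (\<gamma> - \<delta>)) \<le> V * (c5 * (4 ^ s) powr (\<gamma> - \<delta>))" using X0 by (intro mult_left_mono) auto
      also have "\<dots> = c4 * (32 * c2 * \<tau> + c3 * sqrt A) * sqrt (uu / (2 * \<delta>)) * c5 * (R * (4 ^ s) powr \<gamma>)"
        by (simp add: V_def powr_diff)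
      also have "\<dots> \<le> c4 * (32 * c2 * \<tau> + c3 * sqrt A) * sqrt (uu / (2 * \<delta>)) * c5 * (R * (8 * real \<kappa> powr \<gamma>))"
        using level_scale_le[OF s(2) order_refl, of \<gamma>] \<gamma> cpos \<tau>0 A uu1 \<delta> R0 by (intro mult_left_mono mult_nonneg_nonneg add_nonneg_nonneg) auto
      also have "\<dots> = c4 * (32 * c2 * \<tau> + c3 * sqrt A) * c8 * (T * sqrt uu)"
        by (simp add: c8_def T_def real_sqrt_divide)
      also have "\<dots> \<le> c4 * (32 * c2 * \<tau> + c3 * sqrt A) * c8 * \<tau>"
        using Tuu cpos \<tau>0 A by (intro mult_left_mono mult_nonneg_nonneg add_nonneg_nonneg) auto
      finally show ?thesis .
    qed
    have "(\<Sum>b\<le>s. \<beta> A b) \<le> (\<Sum>b\<le>s. X1 + X2 + X3 + V * (4 ^ b) powr (\<gamma> - \<delta>))" using \<beta>le by (intro sum_mono) auto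
    also have "\<dots> = (real s + 1) * X1 + (real s + 1) * X2 + (real s + 1) * X3 + V * (\<Sum>b\<le>s. (4 ^ b) powr (\<gamma> - \<delta>))"
      by (simp add: sum.distrib sum_distrib_left algebra_simps)
    also have "\<dots> \<le> CL * \<tau>\<^sup>2 + 129 * real D * CL\<^sup>2 * (M + real D * \<tau>\<^sup>2) + 32 * c4 * CL\<^sup>2 * \<tau>\<^sup>2 + c4 * (32 * c2 * \<tau> + c3 * sqrt A) * c8 * \<tau>"
      using s1 s2 s3 s4 by linarith
    also have "\<dots> = c6 * \<tau>\<^sup>2 + c7 * M"
      by (simp add: c6_def c7_def M_def algebra_simps power2_eq_square)
    finally have "A \<le> 16 * (real D * \<tau>\<^sup>2 + 2 * (c6 * \<tau>\<^sup>2 + c7 * M))" using A(3) by simp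
    also have "\<dots> = 16 * (real D + 2 * c6) * \<tau>\<^sup>2 + (32 * c7 * \<tau>) * sqrt A" by (simp add: M_def algebra_simps)
    finally have "A \<le> 2 * (16 * (real D + 2 * c6) * \<tau>\<^sup>2) + (32 * c7 * \<tau>)\<^sup>2" by (rule quadratic_absorb[OF A(1)])
    also have "\<dots> = C * \<tau>\<^sup>2" by (simp add: C_def algebra_simps power2_eq_square)
    finally show "sparse_bound n N \<kappa> x (C * \<tau>\<^sup>2)" by (rule sparse_bound_mono[OF A(2)])
  qed
qed

section \<open>Probability of the exceptional events\<close>

text \<open>The probability that the vector is non-zero enters the union bound: it is 1, except for the restriction to
  long vectors, where it is of order \<open>\<kappa>\<^sup>2 / N\<close>.\<close>

locale tail_vector = prob_space \<mu> for \<mu> :: "'a measure" +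
  fixes \<phi> :: "'a \<Rightarrow> nat \<Rightarrow> real" and n :: nat and p \<pi> :: real
  assumes meas [measurable]: "d < n \<Longrightarrow> (\<lambda>x. \<phi> x d) \<in> borel_measurable \<mu>"
    and tail: "t > 0 \<Longrightarrow> emeasure \<mu> {x \<in> space \<mu>. t * nrm n b < \<bar>inner_n n b (\<phi> x)\<bar>} \<le> ennreal (t powr (-p))"
    and nonzero: "emeasure \<mu> {x \<in> space \<mu>. nrm n (\<phi> x) \<noteq> 0} \<le> ennreal \<pi>"
    and \<pi>0: "\<pi> \<ge> 0" and p2: "p > 2"
begin

text \<open>Requiring \<open>\<phi>\<close> to be non-zero on the support of \<open>\<zeta>\<close> weights \<open>\<zeta>\<close> by the probability of
  that event, and costs nothing since coefficients of zero vectors can be deleted.\<close>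

definition bad_event :: "nat \<Rightarrow> (nat \<Rightarrow> int) \<Rightarrow> nat set \<Rightarrow> real \<Rightarrow> (nat \<Rightarrow> 'a) set" where
  "bad_event N \<zeta> J t = {xs \<in> space (PiM {..<N} (\<lambda>_. \<mu>)).
     (\<forall>i\<in>{i. i < N \<and> \<zeta> i \<noteq> 0}. nrm n (\<phi> (xs i)) \<noteq> 0) \<and>
     (\<forall>j\<in>J. t * nrm n (lin N (\<lambda>i. \<phi> (xs i)) (\<lambda>i. real_of_int (\<zeta> i)))
        < \<bar>inner_n n (lin N (\<lambda>i. \<phi> (xs i)) (\<lambda>i. real_of_int (\<zeta> i))) (\<phi> (xs j))\<bar>)}"

lemma coord_measurable [measurable]:
  "i \<in> I \<Longrightarrow> d < n \<Longrightarrow> (\<lambda>xs. \<phi> (xs i) d) \<in> borel_measurable (PiM I (\<lambda>_. \<mu>))"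
  using measurable_compose[of "\<lambda>xs. xs i" "PiM I (\<lambda>_. \<mu>)" \<mu> "\<lambda>x. \<phi> x d" borel] measurable_component_singleton[of i I "\<lambda>_. \<mu>"] meas[of d]
  by blast

lemma lin_measurable:
  assumes "\<And>i. i < N \<Longrightarrow> c i \<noteq> 0 \<Longrightarrow> i \<in> I" "d < n"
  shows "(\<lambda>xs. lin N (\<lambda>i. \<phi> (xs i)) c d) \<in> borel_measurable (PiM I (\<lambda>_. \<mu>))"
  unfolding lin_def
proof (rule borel_measurable_sum)
  fix i assume "i \<in> {..<N}"
  then show "(\<lambda>xs. c i * \<phi> (xs i) d) \<in> borel_measurable (PiM I (\<lambda>_. \<mu>))"
    using assms by (cases "c i = 0") (auto intro!: borel_measurable_times coord_measurable)
qed

lemma bad_event_sets [measurable]: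
  assumes J: "J \<subseteq> {..<N}"
  shows "bad_event N \<zeta> J t \<in> sets (PiM {..<N} (\<lambda>_. \<mu>))"
proof -
  have [measurable]: "(\<lambda>xs. lin N (\<lambda>i. \<phi> (xs i)) (\<lambda>i. real_of_int (\<zeta> i)) d) \<in> borel_measurable (PiM {..<N} (\<lambda>_. \<mu>))" if "d < n" for d
    using that by (intro lin_measurable) auto
  have [measurable]: "(\<lambda>xs. nrm n (lin N (\<lambda>i. \<phi> (xs i)) (\<lambda>i. real_of_int (\<zeta> i)))) \<in> borel_measurable (PiM {..<N} (\<lambda>_. \<mu>))"
    unfolding nrm_def L2_set_def by measurable
  have [measurable]: "(\<lambda>xs. inner_n n (lin N (\<lambda>i. \<phi> (xs i)) (\<lambda>i. real_of_int (\<zeta> i))) (\<phi> (xs j))) \<in> borel_measurable (PiM {..<N} (\<lambda>_. \<mu>))" if "j \<in> J" for j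
    unfolding inner_n_def using that J by (auto intro!: borel_measurable_sum borel_measurable_times coord_measurable)
  have [measurable]: "(\<lambda>xs. nrm n (\<phi> (xs i))) \<in> borel_measurable (PiM {..<N} (\<lambda>_. \<mu>))" if "i < N" for i
    unfolding nrm_def L2_set_def using that by (auto intro!: borel_measurable_sqrt borel_measurable_sum borel_measurable_power coord_measurable)
  have fin: "finite {i. i < N \<and> \<zeta> i \<noteq> 0}" "finite J" using J finite_subset by auto
  show ?thesis unfolding bad_event_def using fin by (measurable; auto)
qed

text \<open>Fubini over the coordinates in \<open>J\<close>: as \<open>\<zeta>\<close> vanishes
  there, the combination depends on the other coordinates only and is a fixed vector in the inner
  integral. The events for \<open>j \<in> J\<close> are then independent with probability at most
  \<open>t powr (-p)\<close>, and the condition on the support gives one factor \<open>\<pi>\<close>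
  per index.\<close>

lemma emeasure_bad_event_le:
  assumes J: "J \<subseteq> {..<N}" "\<And>j. j \<in> J \<Longrightarrow> \<zeta> j = 0" and t: "t > 0"
  shows "emeasure (PiM {..<N} (\<lambda>_. \<mu>)) (bad_event N \<zeta> J t) \<le> ennreal (\<pi> ^ card {i. i < N \<and> \<zeta> i \<noteq> 0} * (t powr (-p)) ^ card J)"
proof -
  interpret PS: product_sigma_finite "\<lambda>_::nat. \<mu>" by standard
  define S where "S = {i. i < N \<and> \<zeta> i \<noteq> 0}"
  define I where "I = {..<N} - J"
  have fin: "finite I" "finite J" "finite S" using J finite_subset by (auto simp: I_def S_def)
  have IJ: "I \<inter> J = {}" "I \<union> J = {..<N}" using J by (auto simp: I_def)
  have SI: "S \<subseteq> I" using J by (auto simp: S_def I_def)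
  define Z where "Z = {x \<in> space \<mu>. nrm n (\<phi> x) \<noteq> 0}"
  have Z[measurable]: "Z \<in> sets \<mu>" unfolding Z_def nrm_def L2_set_def by measurable
  let ?v = "\<lambda>xs. lin N (\<lambda>i. \<phi> (xs i)) (\<lambda>i. real_of_int (\<zeta> i))"
  define T where "T xs = {y \<in> space \<mu>. t * nrm n (?v xs) < \<bar>inner_n n (?v xs) (\<phi> y)\<bar>}" for xs
  have [measurable]: "T xs \<in> sets \<mu>" for xs unfolding T_def inner_n_def by measurable
  have vm: "?v (merge I J (x, y)) = ?v x" for x y
    unfolding lin_def using SI by (intro ext sum.cong) (auto simp: merge_def S_def I_def)
  have "emeasure (PiM {..<N} (\<lambda>_. \<mu>)) (bad_event N \<zeta> J t) = (\<integral>\<^sup>+ xs. indicator (bad_event N \<zeta> J t) xs \<partial>PiM (I \<union> J) (\<lambda>_. \<mu>))"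
    using J by (simp add: IJ)
  also have "\<dots> = (\<integral>\<^sup>+ x. (\<integral>\<^sup>+ y. indicator (bad_event N \<zeta> J t) (merge I J (x, y)) \<partial>PiM J (\<lambda>_. \<mu>)) \<partial>PiM I (\<lambda>_. \<mu>))"
    using J by (intro PS.product_nn_integral_fold IJ fin) (simp add: IJ)
  also have "\<dots> \<le> (\<integral>\<^sup>+ x. (\<integral>\<^sup>+ y. (\<Prod>i\<in>S. indicator Z (x i)) * (\<Prod>j\<in>J. indicator (T x) (y j)) \<partial>PiM J (\<lambda>_. \<mu>)) \<partial>PiM I (\<lambda>_. \<mu>))"
  proof (intro nn_integral_mono)
    fix x y assume x: "x \<in> space (PiM I (\<lambda>_. \<mu>))" and y: "y \<in> space (PiM J (\<lambda>_. \<mu>))"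
    show "(indicator (bad_event N \<zeta> J t) (merge I J (x, y)) :: ennreal) \<le> (\<Prod>i\<in>S. indicator Z (x i)) * (\<Prod>j\<in>J. indicator (T x) (y j))"
    proof (cases "merge I J (x, y) \<in> bad_event N \<zeta> J t")
      case True
      let ?z = "merge I J (x, y)"
      have nz: "nrm n (\<phi> (?z i)) \<noteq> 0" if "i \<in> S" for i using True that by (simp add: bad_event_def S_def)
      have tr: "t * nrm n (?v ?z) < \<bar>inner_n n (?v ?z) (\<phi> (?z j))\<bar>" if "j \<in> J" for j
        using True that by (simp add: bad_event_def)
      have "x i \<in> Z" if i: "i \<in> S" for i
      proof -
        have "i \<in> I" using i SI by auto
        then show ?thesis using nz[OF i] x by (auto simp: Z_def merge_def space_PiM PiE_iff)
      qed
      moreover have "y j \<in> T x" if j: "j \<in> J" for j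
      proof -
        have "?z j = y j" using j IJ by (auto simp: merge_def)
        then show ?thesis using tr[OF j, unfolded vm] j y by (auto simp: T_def space_PiM PiE_iff)
      qed
      ultimately have "(\<Prod>i\<in>S. indicator Z (x i) :: ennreal) = 1" "(\<Prod>j\<in>J. indicator (T x) (y j) :: ennreal) = 1"
        by (auto intro!: prod.neutral)
      then show ?thesis by (simp add: indicator_def)
    qed simp
  qed
  also have "\<dots> = (\<integral>\<^sup>+ x. (\<Prod>i\<in>S. indicator Z (x i)) * (\<Prod>j\<in>J. emeasure \<mu> (T x)) \<partial>PiM I (\<lambda>_. \<mu>))"
  proof (intro nn_integral_cong)
    fix x
    have m: "(\<lambda>y. \<Prod>j\<in>J. indicator (T x) (y j) :: ennreal) \<in> borel_measurable (PiM J (\<lambda>_. \<mu>))"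
      by (intro borel_measurable_prod_ennreal) measurable
    have "(\<integral>\<^sup>+ y. (\<Prod>i\<in>S. indicator Z (x i)) * (\<Prod>j\<in>J. indicator (T x) (y j)) \<partial>PiM J (\<lambda>_. \<mu>))
      = (\<Prod>i\<in>S. indicator Z (x i)) * (\<integral>\<^sup>+ y. (\<Prod>j\<in>J. indicator (T x) (y j)) \<partial>PiM J (\<lambda>_. \<mu>))"
      by (rule nn_integral_cmult[OF m])
    also have "(\<integral>\<^sup>+ y. (\<Prod>j\<in>J. indicator (T x) (y j)) \<partial>PiM J (\<lambda>_. \<mu>)) = (\<Prod>j\<in>J. \<integral>\<^sup>+ y. indicator (T x) y \<partial>\<mu>)"
      by (rule PS.product_nn_integral_prod[OF fin(2)]) measurable
    finally show "(\<integral>\<^sup>+ y. (\<Prod>i\<in>S. indicator Z (x i)) * (\<Prod>j\<in>J. indicator (T x) (y j)) \<partial>PiM J (\<lambda>_. \<mu>))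
      = (\<Prod>i\<in>S. indicator Z (x i)) * (\<Prod>j\<in>J. emeasure \<mu> (T x))" by simp
  qed
  also have "\<dots> \<le> (\<integral>\<^sup>+ x. ennreal ((t powr (-p)) ^ card J) * (\<Prod>i\<in>I. if i \<in> S then indicator Z (x i) else 1) \<partial>PiM I (\<lambda>_. \<mu>))"
  proof (intro nn_integral_mono)
    fix x
    have "(\<Prod>j\<in>J. emeasure \<mu> (T x)) \<le> (\<Prod>j\<in>J. ennreal (t powr (-p)))"
      unfolding T_def by (intro prod_mono_ennreal tail t)
    then have 1: "(\<Prod>j\<in>J. emeasure \<mu> (T x)) \<le> ennreal ((t powr (-p)) ^ card J)" by (simp add: ennreal_power)
    have 2: "(\<Prod>i\<in>I. if i \<in> S then indicator Z (x i) else 1) = (\<Prod>i\<in>S. indicator Z (x i) :: ennreal)"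
      using fin SI by (subst prod.inter_restrict[symmetric]) (auto simp: Int_absorb1)
    show "(\<Prod>i\<in>S. indicator Z (x i)) * (\<Prod>j\<in>J. emeasure \<mu> (T x))
      \<le> ennreal ((t powr (-p)) ^ card J) * (\<Prod>i\<in>I. if i \<in> S then indicator Z (x i) else 1)"
      unfolding 2 using 1 by (subst mult.commute) (intro mult_right_mono, auto)
  qed
  also have "\<dots> = ennreal ((t powr (-p)) ^ card J) * (\<Prod>i\<in>I. \<integral>\<^sup>+ y. (if i \<in> S then indicator Z y else 1) \<partial>\<mu>)"
  proof -
    have m: "(\<lambda>x. \<Prod>i\<in>I. if i \<in> S then indicator Z (x i) else 1 :: ennreal) \<in> borel_measurable (PiM I (\<lambda>_. \<mu>))"
      by (intro borel_measurable_prod_ennreal) measurable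
    have "(\<integral>\<^sup>+ x. (\<Prod>i\<in>I. if i \<in> S then indicator Z (x i) else 1) \<partial>PiM I (\<lambda>_. \<mu>)) = (\<Prod>i\<in>I. \<integral>\<^sup>+ y. (if i \<in> S then indicator Z y else 1) \<partial>\<mu>)"
      by (rule PS.product_nn_integral_prod[OF fin(1), where f="\<lambda>i y. if i \<in> S then indicator Z y else 1"]) measurable
    then show ?thesis by (simp add: nn_integral_cmult[OF m])
  qed
  also have "(\<Prod>i\<in>I. \<integral>\<^sup>+ y. (if i \<in> S then indicator Z y else 1) \<partial>\<mu>) = (\<Prod>i\<in>I. if i \<in> S then emeasure \<mu> Z else 1)"
    by (intro prod.cong refl) (simp add: emeasure_space_1)
  also have "\<dots> = (\<Prod>i\<in>S. emeasure \<mu> Z)"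
    using fin SI by (subst prod.inter_restrict[symmetric]) (auto simp: Int_absorb1)
  also have "\<dots> \<le> (\<Prod>i\<in>S. ennreal \<pi>)" unfolding Z_def by (intro prod_mono_ennreal nonzero)
  also have "(\<Prod>i\<in>S. ennreal \<pi>) = ennreal (\<pi> ^ card S)" using \<pi>0 by (simp add: ennreal_power)
  finally have "emeasure (PiM {..<N} (\<lambda>_. \<mu>)) (bad_event N \<zeta> J t) \<le> ennreal ((t powr (-p)) ^ card J) * ennreal (\<pi> ^ card S)"
    by (simp add: mult_left_mono)
  then show ?thesis using \<pi>0 by (simp add: S_def ennreal_mult[symmetric] mult.commute)
qed

lemma measure_bad_event_le:
  assumes J: "J \<subseteq> {..<N}" "\<And>j. j \<in> J \<Longrightarrow> \<zeta> j = 0" and t: "t > 0"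
  shows "measure (PiM {..<N} (\<lambda>_. \<mu>)) (bad_event N \<zeta> J t) \<le> \<pi> ^ card {i. i < N \<and> \<zeta> i \<noteq> 0} * (t powr (-p)) ^ card J"
proof -
  have "enn2real (emeasure (PiM {..<N} (\<lambda>_. \<mu>)) (bad_event N \<zeta> J t))
     \<le> enn2real (ennreal (\<pi> ^ card {i. i < N \<and> \<zeta> i \<noteq> 0} * (t powr (-p)) ^ card J))"
    by (rule enn2real_mono[OF emeasure_bad_event_le[OF assms]]) (auto simp del: ennreal_mult)
  then show ?thesis using \<pi>0 by (simp add: measure_def)
qed

end

section \<open>Counting integer vectors and index sets\<close>

lemma sum_exp_neg_le:
  fixes r :: real
  assumes "r > 0"
  shows "(\<Sum>m=1..k. exp (- r * real m)) \<le> 1 / r"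
proof -
  define q where "q = exp (- r)"
  have q: "0 < q" "q < 1" using assms by (auto simp: q_def)
  have "(\<Sum>m\<in>insert 0 {1..k}. q ^ m) < 1 / (1 - q)" using q by (intro geometric_sum_less) auto
  then have "(\<Sum>m=1..k. q ^ m) < 1 / (1 - q) - 1" by simp
  also have "\<dots> = 1 / (exp r - 1)"
  proof -
    have "1 / (1 - 1 / E) - 1 = 1 / (E - 1)" if "E > 1" for E :: real using that by (simp add: field_simps)
    moreover have "q = 1 / exp r" by (simp add: q_def exp_minus inverse_eq_divide)
    ultimately show ?thesis using assms by simp
  qed
  also have "\<dots> \<le> 1 / r"
  proof (rule divide_left_mono)
    show "r \<le> exp r - 1" using exp_ge_add_one_self[of r] by linarith
  qed (use assms in auto)
  finally have "(\<Sum>m=1..k. q ^ m) \<le> 1 / r" by simp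
  moreover have "q ^ m = exp (- r * real m)" for m by (simp add: q_def mult.commute flip: exp_of_nat_mult)
  ultimately show ?thesis by simp
qed

definition int_vectors :: "nat \<Rightarrow> nat \<Rightarrow> nat \<Rightarrow> (nat \<Rightarrow> int) set" where
  "int_vectors N l K = {\<zeta> \<in> PiE {..<N} (\<lambda>_. {- int K..int K}).
     card {i. i < N \<and> \<zeta> i \<noteq> 0} \<le> l \<and> (\<Sum>i<N. \<bar>\<zeta> i\<bar>) \<le> int K}"

lemma finite_int_vectors [simp]: "finite (int_vectors N l K)"
proof -
  have "finite (PiE {..<N} (\<lambda>_. {- int K..int K}))" by (intro finite_PiE) auto
  then show ?thesis unfolding int_vectors_def by (rule rev_finite_subset) auto
qed

text \<open>Exponential tilting: the weight of a vector is compared with a product weight, whose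
  sum factorises over the coordinates.\<close>

lemma int_vectors_weighted_count:
  fixes c N0 \<pi> :: real
  assumes \<pi>: "\<pi> \<ge> 0" and N0: "N0 = \<pi> * real N" "N0 > 0" and c: "c \<ge> 1" and K: "real K \<le> c * N0"
    and l: "1 \<le> l" "l \<le> K"
  shows "(\<Sum>\<zeta>\<in>int_vectors N l K. \<pi> ^ card {i. i < N \<and> \<zeta> i \<noteq> 0}) \<le> (exp 2 * c * N0 / l) ^ (2 * l)"
proof -
  \<comment> \<open>\<open>exp (- r * K) = exp (- l)\<close> is the price for the bound on the sum
    of moduli. \<open>q\<close> is the price of a non-zero entry, chosen such that
    \<open>N0 * q / r \<le> l\<close>; the product weights then sum to at most
    \<open>exp (2 * l)\<close>.\<close>
  define r where "r = real l / real K"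
  define q where "q = (real l / (c * N0))\<^sup>2"
  have K0: "real K > 0" using l by simp
  have r: "r > 0" using l by (simp add: r_def)
  have cN: "c * N0 > 0" using c N0 by simp
  have lc: "real l \<le> c * N0" using l K by linarith
  have q: "0 < q" "q \<le> 1" using l lc cN by (auto simp: q_def power_le_one)
  define w where "w u = (if u = 0 then 1 else \<pi> * q) * exp (- r * \<bar>real_of_int u\<bar>)" for u :: int
  have w0: "w u \<ge> 0" for u using \<pi> q by (simp add: w_def)
  have le: "\<pi> ^ card {i. i < N \<and> \<zeta> i \<noteq> 0} \<le> exp l * (1 / q) ^ l * (\<Prod>i<N. w (\<zeta> i))"
    if "\<zeta> \<in> int_vectors N l K" for \<zeta>
  proof -
    define S where "S = card {i. i < N \<and> \<zeta> i \<noteq> 0}"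
    have S: "S \<le> l" and sK: "(\<Sum>i<N. \<bar>\<zeta> i\<bar>) \<le> int K" using that by (auto simp: int_vectors_def S_def)
    have "(\<Prod>i<N. w (\<zeta> i)) = (\<Prod>i<N. if \<zeta> i = 0 then 1 else \<pi> * q) * (\<Prod>i<N. exp (- r * \<bar>real_of_int (\<zeta> i)\<bar>))"
      by (simp add: w_def prod.distrib)
    also have "(\<Prod>i<N. if \<zeta> i = 0 then 1 else \<pi> * q) = (\<Prod>i\<in>{i. i < N \<and> \<zeta> i \<noteq> 0}. \<pi> * q)"
      by (rule prod.mono_neutral_cong_right) auto
    also have "\<dots> = (\<pi> * q) ^ S" by (simp add: S_def)
    also have "(\<Prod>i<N. exp (- r * \<bar>real_of_int (\<zeta> i)\<bar>)) = exp (- r * real_of_int (\<Sum>i<N. \<bar>\<zeta> i\<bar>))"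
      by (simp add: exp_sum[symmetric] sum_distrib_left)
    finally have w: "(\<Prod>i<N. w (\<zeta> i)) = (\<pi> * q) ^ S * exp (- r * real_of_int (\<Sum>i<N. \<bar>\<zeta> i\<bar>))" .
    have "real_of_int (\<Sum>i<N. \<bar>\<zeta> i\<bar>) \<le> real_of_int (int K)" using sK by (simp only: of_int_le_iff)
    then have "r * real_of_int (\<Sum>i<N. \<bar>\<zeta> i\<bar>) \<le> r * real K" using r by (intro mult_left_mono) auto
    then have e: "exp (- real l) \<le> exp (- r * real_of_int (\<Sum>i<N. \<bar>\<zeta> i\<bar>))" using K0 by (simp add: r_def)
    have "\<pi> ^ S * 1 = \<pi> ^ S * (exp l * (1 / q) ^ l * (q ^ l * exp (- real l)))"
      using q by (simp add: exp_minus power_one_over)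
    also have "\<dots> \<le> \<pi> ^ S * (exp l * (1 / q) ^ l * (q ^ S * exp (- r * real_of_int (\<Sum>i<N. \<bar>\<zeta> i\<bar>))))"
      using q e S \<pi> by (intro mult_left_mono mult_mono power_decreasing) auto
    also have "\<dots> = exp l * (1 / q) ^ l * (\<Prod>i<N. w (\<zeta> i))" by (simp add: w power_mult_distrib)
    finally show ?thesis by (simp add: S_def)
  qed
  have wsum: "(\<Sum>u\<in>{- int K..int K}. w u) \<le> 1 + 2 * \<pi> * q / r"
  proof -
    have un: "{- int K..int K} = insert 0 (int ` {1..K} \<union> (\<lambda>m. - int m) ` {1..K})"
    proof (intro equalityI subsetI)
      fix u assume u: "u \<in> {- int K..int K}"
      show "u \<in> insert 0 (int ` {1..K} \<union> (\<lambda>m. - int m) ` {1..K})"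
      proof (cases u "0::int" rule: linorder_cases)
        case less
        then show ?thesis using u by (intro insertI2 UnI2 image_eqI[of _ _ "nat (- u)"]) auto
      next
        case greater
        then show ?thesis using u by (intro insertI2 UnI1 image_eqI[of _ _ "nat u"]) auto
      qed simp
    qed auto
    have "(\<Sum>u\<in>{- int K..int K}. w u) = w 0 + ((\<Sum>u\<in>int ` {1..K}. w u) + (\<Sum>u\<in>(\<lambda>m. - int m) ` {1..K}. w u))"
      unfolding un by (subst sum.insert, auto, subst sum.union_disjoint) auto
    also have "(\<Sum>u\<in>int ` {1..K}. w u) = \<pi> * q * (\<Sum>m=1..K. exp (- r * real m))"
      by (subst sum.reindex) (auto simp: w_def sum_distrib_left inj_on_def)
    also have "(\<Sum>u\<in>(\<lambda>m. - int m) ` {1..K}. w u) = \<pi> * q * (\<Sum>m=1..K. exp (- r * real m))"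
      by (subst sum.reindex) (auto simp: w_def sum_distrib_left inj_on_def)
    finally have "(\<Sum>u\<in>{- int K..int K}. w u) = 1 + 2 * (\<pi> * q) * (\<Sum>m=1..K. exp (- r * real m))"
      by (simp add: w_def)
    also have "\<dots> \<le> 1 + 2 * (\<pi> * q) * (1 / r)"
      using sum_exp_neg_le[OF r, of K] \<pi> q by (intro add_left_mono mult_left_mono) auto
    finally show ?thesis by (simp add: mult_ac)
  qed
  have "(\<Sum>\<zeta>\<in>int_vectors N l K. \<pi> ^ card {i. i < N \<and> \<zeta> i \<noteq> 0})
     \<le> (\<Sum>\<zeta>\<in>int_vectors N l K. exp l * (1 / q) ^ l * (\<Prod>i<N. w (\<zeta> i)))"
    by (intro sum_mono le)
  also have "\<dots> \<le> (\<Sum>\<zeta>\<in>PiE {..<N} (\<lambda>_. {- int K..int K}). exp l * (1 / q) ^ l * (\<Prod>i<N. w (\<zeta> i)))"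
    using q w0 by (intro sum_mono2 finite_PiE mult_nonneg_nonneg prod_nonneg) (auto simp: int_vectors_def)
  also have "\<dots> = exp l * (1 / q) ^ l * (\<Prod>i<N. \<Sum>u\<in>{- int K..int K}. w u)"
    by (subst prod_sum_PiE) (auto simp: sum_distrib_left)
  also have "\<dots> \<le> exp l * (1 / q) ^ l * exp (2 * real l)"
  proof (intro mult_left_mono)
    have "(\<Prod>i<N. \<Sum>u\<in>{- int K..int K}. w u) = (\<Sum>u\<in>{- int K..int K}. w u) ^ N" by simp
    also have "\<dots> \<le> (exp (2 * \<pi> * q / r)) ^ N"
    proof (rule power_mono)
      show "(\<Sum>u\<in>{- int K..int K}. w u) \<le> exp (2 * \<pi> * q / r)"
        using wsum exp_ge_add_one_self[of "2 * \<pi> * q / r"] by linarith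
    qed (auto intro: sum_nonneg w0)
    also have "\<dots> = exp (2 * (N0 * q / r))" by (simp add: N0(1) mult_ac flip: exp_of_nat_mult)
    also have "\<dots> \<le> exp (2 * real l)"
    proof -
      have "N0 * q / r = real l * real K / (c\<^sup>2 * N0)"
        using N0(2) l K0 c by (simp add: q_def r_def power2_eq_square field_simps)
      also have "\<dots> \<le> real l * (c * N0) / (c\<^sup>2 * N0)" using K N0 c by (intro divide_right_mono mult_left_mono) auto
      also have "\<dots> = real l / c" using N0(2) c by (simp add: power2_eq_square)
      also have "\<dots> \<le> real l / 1" using c by (intro divide_left_mono) auto
      finally show ?thesis by simp
    qed
    finally show "(\<Prod>i<N. \<Sum>u\<in>{- int K..int K}. w u) \<le> exp (2 * real l)" .
  qed (use q in auto)
  also have "\<dots> = (exp 3 * (c * N0 / l)\<^sup>2) ^ l"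
  proof -
    have "exp l * exp (2 * real l) = exp (3::real) ^ l" by (simp flip: exp_add exp_of_nat_mult)
    moreover have "1 / q = (c * N0 / l)\<^sup>2" by (simp add: q_def power_divide)
    ultimately show ?thesis by (simp add: power_mult_distrib mult_ac)
  qed
  also have "\<dots> \<le> (exp 4 * (c * N0 / l)\<^sup>2) ^ l" by (intro power_mono mult_right_mono) auto
  also have "\<dots> = ((exp 2 * c * N0 / l)\<^sup>2) ^ l"
  proof -
    have "exp (4::real) = (exp 2)\<^sup>2" by (simp flip: exp_double)
    then show ?thesis by (simp add: power_mult_distrib power_divide)
  qed
  finally show ?thesis by (simp add: power_mult)
qed

lemma exp_ge_power_div_fact: "real h ^ h / fact h \<le> exp (real h)"
proof -
  have "(\<lambda>n. real h ^ n /\<^sub>R fact n) sums exp (real h)" by (rule exp_converges)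
  then have "(\<Sum>n\<in>{h}. real h ^ n /\<^sub>R fact n) \<le> exp (real h)"
    by (metis (no_types, lifting) sums_summable sums_unique sum_le_suminf finite.emptyI finite.insertI scaleR_nonneg_nonneg inverse_nonnegative_iff_nonnegative fact_ge_zero zero_le_power of_nat_0_le_iff)
  then show ?thesis by (simp add: divide_inverse mult.commute)
qed

lemma choose_le_exp_power:
  assumes "h \<ge> 1"
  shows "real (N choose h) \<le> (exp 1 * real N / real h) ^ h"
proof -
  have "real ((N choose h) * fact h) \<le> real (N ^ h)" using binomial_fact_pow by (simp only: of_nat_le_iff)
  then have "real (N choose h) \<le> real N ^ h / fact h" by (simp add: field_simps)
  also have "\<dots> = (real N / real h) ^ h * (real h ^ h / fact h)" using assms by (simp add: power_divide)
  also have "\<dots> \<le> (real N / real h) ^ h * exp (real h)" by (intro mult_left_mono exp_ge_power_div_fact) auto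
  also have "\<dots> = (exp 1 * real N / real h) ^ h" by (simp add: power_mult_distrib power_divide flip: exp_of_nat_mult)
  finally show ?thesis .
qed

text \<open>The entropy \<open>l * ln (\<Gamma> / l)\<close> increases in this range and equals
  \<open>ln \<Gamma>\<close> at \<open>l = 1\<close>; here this follows from
  \<open>ln l \<le> l - 1\<close>. The two bounds allow multiples of the entropy to pay for the
  factor \<open>1 / \<Gamma>\<^sup>2\<close> and for the summation over \<open>l\<close>.\<close>

lemma entropy_ge_ln:
  fixes \<Gamma> :: real
  assumes l: "1 \<le> l" and \<Gamma>: "exp 1 * real l \<le> \<Gamma>"
  shows "ln \<Gamma> \<le> real l * ln (\<Gamma> / real l)" "real l \<le> real l * ln (\<Gamma> / real l)"
proof -
  have "0 < exp 1 * real l" using l by simp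
  then have \<Gamma>0: "\<Gamma> > 0" using \<Gamma> by linarith
  have "ln (exp 1 * real l) \<le> ln \<Gamma>" using \<Gamma> \<Gamma>0 l by simp
  then have a: "1 + ln (real l) \<le> ln \<Gamma>" using l by (simp add: ln_mult)
  have "ln (real l) \<le> real l - 1" using l by (intro ln_le_minus_one) simp
  moreover have "(real l - 1) * (1 + ln (real l)) \<le> (real l - 1) * ln \<Gamma>" using a l by (intro mult_left_mono) auto
  ultimately show "ln \<Gamma> \<le> real l * ln (\<Gamma> / real l)" using l \<Gamma>0 by (simp add: ln_div algebra_simps)
  have "1 \<le> ln (\<Gamma> / real l)" using a l \<Gamma>0 by (simp add: ln_div)
  then have "real l * 1 \<le> real l * ln (\<Gamma> / real l)" by (intro mult_left_mono) auto
  then show "real l \<le> real l * ln (\<Gamma> / real l)" by simp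
qed

section \<open>Union bounds for the order statistics and for large correlations\<close>

context tail_vector begin

lemma bad_eventI:
  assumes xs: "xs \<in> space (PiM {..<N} (\<lambda>_. \<mu>))"
    and z: "card {i. i < N \<and> \<zeta> i \<noteq> 0} \<le> l" "(\<Sum>i<N. \<bar>\<zeta> i\<bar>) \<le> int K" and J: "J \<subseteq> {..<N}" "\<And>j. j \<in> J \<Longrightarrow> \<zeta> j = 0"
    and bad: "\<And>j. j \<in> J \<Longrightarrow> t * nrm n (lin N (\<lambda>i. \<phi> (xs i)) (\<lambda>i. real_of_int (\<zeta> i)))
        < \<bar>inner_n n (lin N (\<lambda>i. \<phi> (xs i)) (\<lambda>i. real_of_int (\<zeta> i))) (\<phi> (xs j))\<bar>"
  shows "\<exists>\<zeta>'\<in>int_vectors N l K. (\<forall>j\<in>J. \<zeta>' j = 0) \<and> xs \<in> bad_event N \<zeta>' J t"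
proof -
  \<comment> \<open>Deleting the coefficients of vectors of norm 0 changes neither the inner
    products nor the norm of the combination; \<open>restrict\<close> puts the result into the
    finite set \<open>int_vectors\<close>.\<close>
  define \<zeta>' where "\<zeta>' = restrict (\<lambda>i. if nrm n (\<phi> (xs i)) = 0 then 0 else \<zeta> i) {..<N}"
  let ?v = "\<lambda>\<zeta>. lin N (\<lambda>i. \<phi> (xs i)) (\<lambda>i. real_of_int (\<zeta> i))"
  have inn: "inner_n n (?v \<zeta>') b = inner_n n (?v \<zeta>) b" for b
    unfolding inner_n_lin
  proof (intro sum.cong refl)
    fix i assume i: "i \<in> {..<N}"
    show "real_of_int (\<zeta>' i) * inner_n n (\<phi> (xs i)) b = real_of_int (\<zeta> i) * inner_n n (\<phi> (xs i)) b"
    proof (cases "nrm n (\<phi> (xs i)) = 0")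
      case True
      then have "inner_n n (\<phi> (xs i)) b = 0" using inner_n_CS[of n "\<phi> (xs i)" b] by simp
      then show ?thesis by simp
    qed (use i in \<open>simp add: \<zeta>'_def\<close>)
  qed
  have "(nrm n (?v \<zeta>'))\<^sup>2 = (nrm n (?v \<zeta>))\<^sup>2"
    by (metis inn inner_n_comm inner_n_self)
  then have nr: "nrm n (?v \<zeta>') = nrm n (?v \<zeta>)" by simp
  have sub: "{i. i < N \<and> \<zeta>' i \<noteq> 0} \<subseteq> {i. i < N \<and> \<zeta> i \<noteq> 0}" by (auto simp: \<zeta>'_def)
  have "card {i. i < N \<and> \<zeta>' i \<noteq> 0} \<le> card {i. i < N \<and> \<zeta> i \<noteq> 0}" by (rule card_mono[OF _ sub]) auto
  moreover have s': "(\<Sum>i<N. \<bar>\<zeta>' i\<bar>) \<le> int K"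
  proof -
    have "(\<Sum>i<N. \<bar>\<zeta>' i\<bar>) \<le> (\<Sum>i<N. \<bar>\<zeta> i\<bar>)" by (intro sum_mono) (auto simp: \<zeta>'_def)
    then show ?thesis using z by linarith
  qed
  moreover have "\<bar>\<zeta>' i\<bar> \<le> int K" if "i < N" for i
  proof -
    have "\<bar>\<zeta>' i\<bar> \<le> (\<Sum>i<N. \<bar>\<zeta>' i\<bar>)" using that by (intro member_le_sum[where f="\<lambda>i. \<bar>\<zeta>' i\<bar>"]) auto
    then show ?thesis using s' by linarith
  qed
  then have "\<zeta>' i \<in> {- int K..int K}" if "i < N" for i using that by fastforce
  then have "\<zeta>' \<in> PiE {..<N} (\<lambda>_. {- int K..int K})" by (auto simp: PiE_iff) (simp add: \<zeta>'_def)
  ultimately have "\<zeta>' \<in> int_vectors N l K" using z by (simp add: int_vectors_def)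
  moreover have "\<forall>j\<in>J. \<zeta>' j = 0" using J by (auto simp: \<zeta>'_def)
  moreover have "xs \<in> bad_event N \<zeta>' J t"
  proof -
    have "nrm n (\<phi> (xs i)) \<noteq> 0" if "\<zeta>' i \<noteq> 0" "i < N" for i using that by (auto simp: \<zeta>'_def split: if_splits)
    then show ?thesis unfolding bad_event_def using xs bad by (auto simp: inn nr)
  qed
  ultimately show ?thesis by blast
qed

text \<open>With \<open>E = l * ln (\<Gamma> / l)\<close>, the weighted number of vectors is at most
  \<open>exp (2 * E)\<close>, while index sets and tails together give \<open>exp (- 7 * h)\<close>.
  Since \<open>E \<le> h\<close>, \<open>ln \<Gamma> \<le> E\<close> and \<open>l \<le> E\<close>,
  the product is at most \<open>exp (- 2 * ln \<Gamma> - l - h)\<close>, and the last two terms make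
  the sum over \<open>l\<close> and \<open>h\<close> converge.\<close>

lemma order_event_prob:
  assumes N0: "N0 = \<pi> * real N" "N0 > 0" and c: "c \<ge> 1" and K: "real K \<le> c * N0" and \<Gamma>: "\<Gamma> = exp 2 * c * N0"
  shows "\<exists>F\<in>sets (PiM {..<N} (\<lambda>_. \<mu>)). measure (PiM {..<N} (\<lambda>_. \<mu>)) F \<le> 1 / \<Gamma>\<^sup>2 \<and>
    (\<forall>xs\<in>space (PiM {..<N} (\<lambda>_. \<mu>)) - F. order_event n N (\<lambda>i. \<phi> (xs i)) p \<Gamma> K)"
proof -
  interpret P: prob_space "PiM {..<N} (\<lambda>_. \<mu>)" by (intro prob_space_PiM prob_space_axioms)
  let ?P = "PiM {..<N} (\<lambda>_. \<mu>)"
  have \<Gamma>0: "\<Gamma> > 0" using \<Gamma> N0 c by simp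
  have Npos: "real N > 0" using N0 \<pi>0 by (simp add: zero_less_mult_iff)
  define idx where "idx = {(l, h). l \<in> {1..K} \<and> h \<in> {1..N} \<and> real l * ln (\<Gamma> / real l) \<le> real h}"
  define JJ where "JJ \<zeta> h = {J. J \<subseteq> {..<N} \<and> card J = h \<and> (\<forall>j\<in>J. \<zeta> j = 0)}" for \<zeta> :: "nat \<Rightarrow> int" and h
  define F where "F = (\<Union>(l, h)\<in>idx. \<Union>\<zeta>\<in>int_vectors N l K. \<Union>J\<in>JJ \<zeta> h. bad_event N \<zeta> J (thr p N h))"
  have fin: "finite idx" "finite (JJ \<zeta> h)" for \<zeta> h
    by (rule finite_subset[of _ "{1..K} \<times> {1..N}"]) (auto simp: idx_def JJ_def)
  have J_bad: "bad_event N \<zeta> J t \<in> sets ?P" if "J \<in> JJ \<zeta> h" for \<zeta> h J t using that by (auto simp: JJ_def)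
  have term_le: "measure ?P (\<Union>\<zeta>\<in>int_vectors N l K. \<Union>J\<in>JJ \<zeta> h. bad_event N \<zeta> J (thr p N h)) \<le> (1 / \<Gamma>\<^sup>2) * (exp (- 1 * real l) * exp (- 1 * real h))"
    if lh: "(l, h) \<in> idx" for l h
  proof -
    have l: "1 \<le> l" "l \<le> K" and h: "1 \<le> h" "h \<le> N" and ent: "real l * ln (\<Gamma> / real l) \<le> real h" using lh by (auto simp: idx_def)
    have el: "exp 1 * real l \<le> \<Gamma>"
    proof -
      have "exp 1 * real l \<le> exp 2 * real l" by (intro mult_right_mono) auto
      also have "\<dots> \<le> exp 2 * (c * N0)" using l K by (intro mult_left_mono) auto
      finally show ?thesis by (simp add: \<Gamma> mult_ac)
    qed
    have thr0: "thr p N h > 0" using Npos h by (simp add: thr_def)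
    have thrp: "thr p N h powr (-p) = real h / (exp 8 * real N)"
      using p2 Npos h by (simp add: thr_def powr_powr powr_minus_divide)
    have "measure ?P (\<Union>\<zeta>\<in>int_vectors N l K. \<Union>J\<in>JJ \<zeta> h. bad_event N \<zeta> J (thr p N h))
       \<le> (\<Sum>\<zeta>\<in>int_vectors N l K. measure ?P (\<Union>J\<in>JJ \<zeta> h. bad_event N \<zeta> J (thr p N h)))"
      using fin J_bad by (intro P.finite_measure_subadditive_finite) (auto intro!: sets.finite_UN)
    also have "\<dots> \<le> (\<Sum>\<zeta>\<in>int_vectors N l K. \<Sum>J\<in>JJ \<zeta> h. measure ?P (bad_event N \<zeta> J (thr p N h)))"
      using fin J_bad by (intro sum_mono P.finite_measure_subadditive_finite) auto
    also have "\<dots> \<le> (\<Sum>\<zeta>\<in>int_vectors N l K. \<Sum>J\<in>JJ \<zeta> h. \<pi> ^ card {i. i < N \<and> \<zeta> i \<noteq> 0} * (thr p N h powr (-p)) ^ h)"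
    proof (intro sum_mono)
      fix \<zeta> J assume "J \<in> JJ \<zeta> h"
      then show "measure ?P (bad_event N \<zeta> J (thr p N h)) \<le> \<pi> ^ card {i. i < N \<and> \<zeta> i \<noteq> 0} * (thr p N h powr (-p)) ^ h"
        using measure_bad_event_le[of J N \<zeta> "thr p N h"] thr0 by (auto simp: JJ_def)
    qed
    also have "\<dots> \<le> (\<Sum>\<zeta>\<in>int_vectors N l K. real (N choose h) * (\<pi> ^ card {i. i < N \<and> \<zeta> i \<noteq> 0} * (thr p N h powr (-p)) ^ h))"
    proof (intro sum_mono)
      fix \<zeta> :: "nat \<Rightarrow> int"
      have "card (JJ \<zeta> h) \<le> card {J. J \<subseteq> {..<N} \<and> card J = h}" by (intro card_mono) (auto simp: JJ_def)
      also have "\<dots> = N choose h" by (simp add: n_subsets)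
      finally have "real (card (JJ \<zeta> h)) \<le> real (N choose h)" by simp
      then show "(\<Sum>J\<in>JJ \<zeta> h. \<pi> ^ card {i. i < N \<and> \<zeta> i \<noteq> 0} * (thr p N h powr (-p)) ^ h) \<le> real (N choose h) * (\<pi> ^ card {i. i < N \<and> \<zeta> i \<noteq> 0} * (thr p N h powr (-p)) ^ h)"
        using \<pi>0 by (simp add: mult_right_mono)
    qed
    also have "\<dots> = (\<Sum>\<zeta>\<in>int_vectors N l K. \<pi> ^ card {i. i < N \<and> \<zeta> i \<noteq> 0}) * (real (N choose h) * (thr p N h powr (-p)) ^ h)"
      by (simp add: sum_distrib_left sum_distrib_right mult_ac)
    also have "\<dots> \<le> (\<Gamma> / l) ^ (2 * l) * ((exp 1 * real N / real h) ^ h * (real h / (exp 8 * real N)) ^ h)"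
      unfolding thrp \<Gamma>
      by (intro mult_mono int_vectors_weighted_count[OF \<pi>0 N0 c K l] choose_le_exp_power[OF h(1)] order_refl) (auto intro!: sum_nonneg mult_nonneg_nonneg simp: \<pi>0 N0(2) less_imp_le c order_trans[OF zero_le_one c])
    also have "(exp 1 * real N / real h) ^ h * (real h / (exp 8 * real N)) ^ h = exp (- 7 * real h)"
    proof -
      have "(exp 1 * real N / real h) * (real h / (exp 8 * real N)) = exp 1 / exp (8::real)" using Npos h by simp
      also have "\<dots> = exp (- 7)" by (simp flip: exp_diff)
      finally show ?thesis by (simp add: mult.commute flip: power_mult_distrib exp_of_nat_mult)
    qed
    also have "(\<Gamma> / l) ^ (2 * l) = exp (2 * (real l * ln (\<Gamma> / l)))"
    proof -
      have "\<Gamma> / l = exp (ln (\<Gamma> / l))" using \<Gamma>0 l by simp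
      then have "(\<Gamma> / l) ^ (2 * l) = exp (ln (\<Gamma> / l)) ^ (2 * l)" by simp
      then show ?thesis by (simp add: mult_ac flip: exp_of_nat_mult)
    qed
    also have "exp (2 * (real l * ln (\<Gamma> / l))) * exp (- 7 * real h) \<le> exp (- 2 * ln \<Gamma> + (- 1 * real l + - 1 * real h))"
      unfolding exp_add[symmetric] using ent entropy_ge_ln[OF l(1) el] by simp
    also have "\<dots> = (1 / \<Gamma>\<^sup>2) * (exp (- 1 * real l) * exp (- 1 * real h))"
    proof -
      have "exp (- 2 * ln \<Gamma>) = 1 / (exp (ln \<Gamma>))\<^sup>2" by (simp add: exp_minus inverse_eq_divide exp_double)
      then show ?thesis using \<Gamma>0 by (simp only: exp_add exp_ln)
    qed
    finally show ?thesis .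
  qed
  have F: "F \<in> sets ?P" unfolding F_def using fin J_bad by (auto intro!: sets.finite_UN)
  have "measure ?P F \<le> (\<Sum>lh\<in>idx. measure ?P (case lh of (l, h) \<Rightarrow> \<Union>\<zeta>\<in>int_vectors N l K. \<Union>J\<in>JJ \<zeta> h. bad_event N \<zeta> J (thr p N h)))"
    unfolding F_def using fin J_bad by (intro P.finite_measure_subadditive_finite) (auto intro!: sets.finite_UN)
  also have "\<dots> \<le> (\<Sum>(l, h)\<in>idx. (1 / \<Gamma>\<^sup>2) * (exp (- 1 * real l) * exp (- 1 * real h)))"
    using term_le by (intro sum_mono) auto
  also have "\<dots> \<le> (\<Sum>(l, h)\<in>{1..K} \<times> {1..N}. (1 / \<Gamma>\<^sup>2) * (exp (- 1 * real l) * exp (- 1 * real h)))"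
    by (intro sum_mono2) (auto simp: idx_def)
  also have "\<dots> = (1 / \<Gamma>\<^sup>2) * ((\<Sum>l=1..K. exp (- 1 * real l)) * (\<Sum>h=1..N. exp (- 1 * real h)))"
    by (simp only: sum.cartesian_product[symmetric] sum_distrib_left[symmetric] sum_distrib_right[symmetric])
  also have "\<dots> \<le> (1 / \<Gamma>\<^sup>2) * ((1 / 1) * (1 / 1))"
    by (intro mult_left_mono mult_mono sum_exp_neg_le) (auto intro!: sum_nonneg)
  finally have "measure ?P F \<le> 1 / \<Gamma>\<^sup>2" by simp
  moreover have "order_event n N (\<lambda>i. \<phi> (xs i)) p \<Gamma> K" if xs: "xs \<in> space ?P - F" for xs
    unfolding order_event_def
  proof (intro allI impI, rule ccontr)
    fix l h :: nat and \<zeta> :: "nat \<Rightarrow> int" and J :: "nat set"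
    assume l: "1 \<le> l" "l \<le> K" and h: "1 \<le> h" and ent: "real l * ln (\<Gamma> / real l) \<le> real h"
      and z: "card {i. i < N \<and> \<zeta> i \<noteq> 0} \<le> l" "(\<Sum>i<N. \<bar>\<zeta> i\<bar>) \<le> int K"
      and J: "J \<subseteq> {..<N}" "card J = h" "\<forall>j\<in>J. \<zeta> j = 0"
      and n: "\<not> (\<exists>j\<in>J. \<bar>inner_n n (lin N (\<lambda>i. \<phi> (xs i)) (\<lambda>i. real_of_int (\<zeta> i))) (\<phi> (xs j))\<bar>
              \<le> thr p N h * nrm n (lin N (\<lambda>i. \<phi> (xs i)) (\<lambda>i. real_of_int (\<zeta> i))))"
    have "\<exists>\<zeta>'\<in>int_vectors N l K. (\<forall>j\<in>J. \<zeta>' j = 0) \<and> xs \<in> bad_event N \<zeta>' J (thr p N h)"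
      using xs n J by (intro bad_eventI[OF _ z]) (auto simp: not_le)
    then obtain \<zeta>' where "\<zeta>' \<in> int_vectors N l K" "J \<in> JJ \<zeta>' h" "xs \<in> bad_event N \<zeta>' J (thr p N h)"
      using J by (auto simp: JJ_def)
    moreover have "(l, h) \<in> idx"
      using l h ent J card_mono[OF _ J(1)] by (auto simp: idx_def)
    ultimately have "xs \<in> F" unfolding F_def by blast
    then show False using xs by simp
  qed
  ultimately show ?thesis using F by blast
qed

text \<open>A union bound over a single vector and a set of \<open>D\<close> other indices. Once
  \<open>\<eta>\<close> exceeds \<open>N powr (1/p)\<close> by a small power, a fixed number
  \<open>D\<close> makes the last factor as small as needed; hence a vector has only boundedly many
  exceptional correlations, which is the degree bound for long vectors.\<close>

lemma large_correlation_prob: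
  assumes \<eta>: "\<eta> > 0" and D: "D \<ge> 1"
  shows "\<exists>F\<in>sets (PiM {..<N} (\<lambda>_. \<mu>)). measure (PiM {..<N} (\<lambda>_. \<mu>)) F \<le> real N * \<pi> * (real N * \<eta> powr (-p)) ^ D \<and>
    (\<forall>xs\<in>space (PiM {..<N} (\<lambda>_. \<mu>)) - F. \<forall>j<N.
       card {i. i < N \<and> i \<noteq> j \<and> \<eta> * nrm n (\<phi> (xs j)) < \<bar>inner_n n (\<phi> (xs j)) (\<phi> (xs i))\<bar>} < D)"
proof -
  interpret P: prob_space "PiM {..<N} (\<lambda>_. \<mu>)" by (intro prob_space_PiM prob_space_axioms)
  let ?P = "PiM {..<N} (\<lambda>_. \<mu>)"
  define z where "z j = (\<lambda>i::nat. if i = j then 1 else 0 :: int)" for j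
  define JJ where "JJ j = {J. J \<subseteq> {..<N} \<and> card J = D \<and> j \<notin> J}" for j
  define F where "F = (\<Union>j\<in>{..<N}. \<Union>J\<in>JJ j. bad_event N (z j) J \<eta>)"
  have fin: "finite (JJ j)" for j by (rule finite_subset[of _ "Pow {..<N}"]) (auto simp: JJ_def)
  have J_bad: "bad_event N (z j) J \<eta> \<in> sets ?P" if "J \<in> JJ j" for j J using that by (auto simp: JJ_def)
  have F: "F \<in> sets ?P" unfolding F_def using fin J_bad by (auto intro!: sets.finite_UN)
  have supp: "{i. i < N \<and> z j i \<noteq> 0} = {j}" if "j < N" for j using that by (auto simp: z_def)
  have "measure ?P F \<le> (\<Sum>j<N. measure ?P (\<Union>J\<in>JJ j. bad_event N (z j) J \<eta>))"
    unfolding F_def using fin J_bad by (intro P.finite_measure_subadditive_finite) (auto intro!: sets.finite_UN)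
  also have "\<dots> \<le> (\<Sum>j<N. \<Sum>J\<in>JJ j. measure ?P (bad_event N (z j) J \<eta>))"
    using fin J_bad by (intro sum_mono P.finite_measure_subadditive_finite) auto
  also have "\<dots> \<le> (\<Sum>j<N. \<Sum>J\<in>JJ j. \<pi> * (\<eta> powr (-p)) ^ D)"
  proof (intro sum_mono)
    fix j J assume j: "j \<in> {..<N}" and J: "J \<in> JJ j"
    have "measure ?P (bad_event N (z j) J \<eta>) \<le> \<pi> ^ card {i. i < N \<and> z j i \<noteq> 0} * (\<eta> powr (-p)) ^ card J"
      using J \<eta> by (intro measure_bad_event_le) (auto simp: JJ_def z_def)
    then show "measure ?P (bad_event N (z j) J \<eta>) \<le> \<pi> * (\<eta> powr (-p)) ^ D"
      using j J supp[of j] by (simp add: JJ_def)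
  qed
  also have "\<dots> \<le> (\<Sum>j<N. real N ^ D * (\<pi> * (\<eta> powr (-p)) ^ D))"
  proof (intro sum_mono)
    fix j
    have "card (JJ j) \<le> card {J. J \<subseteq> {..<N} \<and> card J = D}" by (intro card_mono) (auto simp: JJ_def)
    also have "\<dots> = N choose D" by (simp add: n_subsets)
    also have "\<dots> * 1 \<le> (N choose D) * fact D" by (intro mult_left_mono) auto
    also have "\<dots> \<le> N ^ D" by (rule binomial_fact_pow)
    finally have "real (card (JJ j)) \<le> real (N ^ D)" by (simp only: of_nat_le_iff mult_1_right)
    then have "real (card (JJ j)) \<le> real N ^ D" by simp
    then show "(\<Sum>J\<in>JJ j. \<pi> * (\<eta> powr (-p)) ^ D) \<le> real N ^ D * (\<pi> * (\<eta> powr (-p)) ^ D)"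
      using \<pi>0 by (simp add: mult_right_mono)
  qed
  also have "\<dots> = real N * \<pi> * (real N * \<eta> powr (-p)) ^ D" by (simp add: power_mult_distrib mult_ac)
  finally have mF: "measure ?P F \<le> real N * \<pi> * (real N * \<eta> powr (-p)) ^ D" .
  have good: "card {i. i < N \<and> i \<noteq> j \<and> \<eta> * nrm n (\<phi> (xs j)) < \<bar>inner_n n (\<phi> (xs j)) (\<phi> (xs i))\<bar>} < D"
    if xs: "xs \<in> space ?P - F" and j: "j < N" for xs j
  proof (rule ccontr)
    let ?B = "{i. i < N \<and> i \<noteq> j \<and> \<eta> * nrm n (\<phi> (xs j)) < \<bar>inner_n n (\<phi> (xs j)) (\<phi> (xs i))\<bar>}"
    assume "\<not> card ?B < D"
    then obtain J where J: "J \<subseteq> ?B" "card J = D" using obtain_subset_with_card_n[of D ?B] by auto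
    have lin: "lin N (\<lambda>i. \<phi> (xs i)) (\<lambda>i. real_of_int (z j i)) = \<phi> (xs j)"
    proof
      fix d
      have "lin N (\<lambda>i. \<phi> (xs i)) (\<lambda>i. real_of_int (z j i)) d = (\<Sum>i<N. if i = j then \<phi> (xs i) d else 0)"
        unfolding lin_def by (intro sum.cong) (auto simp: z_def)
      then show "lin N (\<lambda>i. \<phi> (xs i)) (\<lambda>i. real_of_int (z j i)) d = \<phi> (xs j) d" using j by simp
    qed
    \<comment> \<open>\<open>D \<ge> 1\<close> provides an index, and the strict inequality there
      shows that the vector at \<open>j\<close> is non-zero, as \<open>bad_event\<close>
      demands.\<close>
    obtain i where "i \<in> J" using J D by fastforce
    then have "\<eta> * nrm n (\<phi> (xs j)) < \<bar>inner_n n (\<phi> (xs j)) (\<phi> (xs i))\<bar>" using J by auto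
    then have "nrm n (\<phi> (xs j)) \<noteq> 0" using inner_n_CS[of n "\<phi> (xs j)" "\<phi> (xs i)"] by auto
    then have "xs \<in> bad_event N (z j) J \<eta>"
      using xs J supp[OF j] by (auto simp: bad_event_def lin)
    moreover have "J \<in> JJ j" using J by (auto simp: JJ_def)
    ultimately have "xs \<in> F" using j by (auto simp: F_def)
    then show False using xs by simp
  qed
  show ?thesis using F mF good by blast
qed

end

section \<open>Sparse bounds with high probability\<close>

text \<open>The effective sample size \<open>\<pi> * N\<close> is at most
  \<open>\<kappa>\<^sup>2\<close>. This keeps \<open>ln \<Gamma>\<close> below a small power of
  \<open>\<kappa>\<close>, as \<open>heavy_sparse_bound\<close> requires, and limits the union over
  the vectors to a factor \<open>\<kappa>\<^sup>2\<close> in the estimate for large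
  correlations.\<close>

lemma heavy_sparse_prob:
  fixes \<gamma>0 c :: real
  assumes \<gamma>0: "\<gamma>0 > 0" and c: "c \<ge> 1"
  shows "\<exists>C>0. \<forall>p n N \<kappa> \<tau> \<pi> \<Gamma> (\<mu> :: 'a measure) \<phi>. tail_vector \<mu> \<phi> n p \<pi> \<longrightarrow> \<gamma>0 \<le> 1/2 - 1/p \<longrightarrow> 16 \<le> \<kappa> \<longrightarrow>
     1 \<le> n \<longrightarrow> n \<le> \<kappa> \<longrightarrow> 0 < \<pi> * real N \<longrightarrow> \<pi> * real N \<le> (real \<kappa>)\<^sup>2 \<longrightarrow> 1024 * real \<kappa> \<le> c * (\<pi> * real N) \<longrightarrow>
     \<Gamma> = exp 2 * c * (\<pi> * real N) \<longrightarrow>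
     real N powr (1/p) * real \<kappa> powr (1/2 - 1/p) * sqrt (ln (\<Gamma> / real \<kappa>)) \<le> \<tau> \<longrightarrow>
     (\<forall>x\<in>space \<mu>. nrm n (\<phi> x) \<le> \<tau>) \<longrightarrow>
     (\<exists>F\<in>sets (PiM {..<N} (\<lambda>_. \<mu>)). measure (PiM {..<N} (\<lambda>_. \<mu>)) F \<le> 1 / (8 * real n) \<and>
        (\<forall>xs\<in>space (PiM {..<N} (\<lambda>_. \<mu>)) - F. sparse_bound n N \<kappa> (\<lambda>i. \<phi> (xs i)) (C * \<tau>\<^sup>2)))"
proof -
  define \<delta> where "\<delta> = \<gamma>0 / 4"
  \<comment> \<open>Then \<open>\<delta> * p * D \<ge> 4\<close> for all \<open>p > 2\<close>, and
    the failure probability from \<open>large_correlation_prob\<close> is at most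
    \<open>\<kappa>\<^sup>2 * \<kappa> powr (-4)\<close>.\<close>
  define D where "D = nat \<lceil>2 / \<delta>\<rceil>"
  define CL where "CL = 2 + ln c + 64 / \<gamma>0"
  have \<delta>: "\<delta> > 0" using \<gamma>0 by (simp add: \<delta>_def)
  have D: "D \<ge> 1" "2 / \<delta> \<le> real D"
  proof -
    have "2 / \<delta> > 0" using \<delta> by simp
    then show "D \<ge> 1" "2 / \<delta> \<le> real D" unfolding D_def by linarith+
  qed
  have CL: "CL > 0" using c \<gamma>0 by (simp add: CL_def add_pos_pos add_pos_nonneg)
  obtain C where C: "C > 0" and heavy: "\<And>p n N x \<Gamma> \<kappa> \<tau>. p > 2 \<Longrightarrow> \<gamma>0 \<le> 1/2 - 1/p \<Longrightarrow> \<kappa> \<ge> 1 \<Longrightarrow> 64 * exp 1 * real \<kappa> \<le> \<Gamma> \<Longrightarrow>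
     ln \<Gamma> \<le> CL * real \<kappa> powr (\<gamma>0 / 32) \<Longrightarrow> order_event n N x p \<Gamma> (1024 * \<kappa>) \<Longrightarrow>
     real N powr (1/p) * real \<kappa> powr (1/2 - 1/p) * sqrt (ln (\<Gamma> / real \<kappa>)) \<le> \<tau> \<Longrightarrow>
     \<forall>i<N. nrm n (x i) \<le> \<tau> \<Longrightarrow>
     \<forall>i<N. card {j. j < N \<and> (i = j \<or> \<tau> * (real N powr (1/p) * real \<kappa> powr (\<gamma>0 / 4)) < \<bar>inner_n n (x i) (x j)\<bar>)} \<le> D \<Longrightarrow>
     sparse_bound n N \<kappa> x (C * \<tau>\<^sup>2)"
    using heavy_sparse_bound[OF \<gamma>0 CL D(1)] by blast
  show ?thesis
  proof (intro exI[of _ C] conjI allI impI)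
    show "C > 0" by (rule C)
    fix p :: real and n N \<kappa> :: nat and \<tau> \<pi> \<Gamma> :: real and \<mu> :: "'a measure" and \<phi> :: "'a \<Rightarrow> nat \<Rightarrow> real"
    assume tv: "tail_vector \<mu> \<phi> n p \<pi>" and g: "\<gamma>0 \<le> 1/2 - 1/p" and \<kappa>: "16 \<le> \<kappa>" and n: "1 \<le> n" "n \<le> \<kappa>"
      and N0: "0 < \<pi> * real N" "\<pi> * real N \<le> (real \<kappa>)\<^sup>2" and cN: "1024 * real \<kappa> \<le> c * (\<pi> * real N)"
      and \<Gamma>: "\<Gamma> = exp 2 * c * (\<pi> * real N)"
      and T\<tau>: "real N powr (1/p) * real \<kappa> powr (1/2 - 1/p) * sqrt (ln (\<Gamma> / real \<kappa>)) \<le> \<tau>"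
      and x: "\<forall>x\<in>space \<mu>. nrm n (\<phi> x) \<le> \<tau>"
    interpret tail_vector \<mu> \<phi> n p \<pi> by (rule tv)
    let ?P = "PiM {..<N} (\<lambda>_. \<mu>)"
    interpret P: prob_space ?P by (intro prob_space_PiM prob_space_axioms)
    define \<eta> where "\<eta> = real N powr (1/p) * real \<kappa> powr \<delta>"
    have Npos: "real N > 0" using N0 \<pi>0 by (simp add: zero_less_mult_iff)
    have \<kappa>1: "real \<kappa> \<ge> 16" using \<kappa> by simp
    have \<eta>0: "\<eta> > 0" using Npos \<kappa>1 by (simp add: \<eta>_def)
    have \<Gamma>\<kappa>: "64 * exp 1 * real \<kappa> \<le> \<Gamma>"
    proof -
      have "64 * exp 1 * real \<kappa> \<le> exp 2 * (1024 * real \<kappa>)"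
      proof -
        have "64 * exp 1 * real \<kappa> \<le> 1024 * exp 1 * real \<kappa>" by (intro mult_right_mono) auto
        also have "\<dots> \<le> 1024 * exp 2 * real \<kappa>" by (intro mult_right_mono mult_left_mono) auto
        finally show ?thesis by (simp add: mult_ac)
      qed
      also have "\<dots> \<le> exp 2 * (c * (\<pi> * real N))" using cN by (intro mult_left_mono) auto
      finally show ?thesis by (simp add: \<Gamma> mult_ac)
    qed
    have \<Gamma>1: "\<Gamma> \<ge> 16 * real n" "\<Gamma> \<ge> 1"
    proof -
      have "16 * real n \<le> 64 * exp 1 * real \<kappa>"
      proof -
        have "(1::real) \<le> exp 1" by simp
        then have "16 * 1 * real n \<le> 64 * exp 1 * real \<kappa>" using n by (intro mult_mono) auto
        then show ?thesis by simp
      qed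
      then show "\<Gamma> \<ge> 16 * real n" using \<Gamma>\<kappa> by linarith
      then show "\<Gamma> \<ge> 1" using n by linarith
    qed
    have lnG: "ln \<Gamma> \<le> CL * real \<kappa> powr (\<gamma>0 / 32)"
    proof -
      have "\<Gamma> \<le> exp 2 * c * (real \<kappa>)\<^sup>2" unfolding \<Gamma> using c N0 by (intro mult_left_mono) auto
      then have "ln \<Gamma> \<le> ln (exp 2 * c * (real \<kappa>)\<^sup>2)" using \<Gamma>1 c \<kappa>1 by (subst ln_le_cancel_iff) auto
      also have "\<dots> = 2 + ln c + 2 * ln (real \<kappa>)" using c \<kappa>1 by (simp add: ln_mult power2_eq_square)
      also have "\<dots> \<le> (2 + ln c) * real \<kappa> powr (\<gamma>0 / 32) + 2 * (real \<kappa> powr (\<gamma>0 / 32) / (\<gamma>0 / 32))"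
      proof (intro add_mono mult_left_mono)
        have "1 \<le> real \<kappa> powr (\<gamma>0 / 32)" using \<kappa>1 \<gamma>0 by (intro ge_one_powr_ge_zero) auto
        then have "(2 + ln c) * 1 \<le> (2 + ln c) * real \<kappa> powr (\<gamma>0 / 32)" using c by (intro mult_left_mono) auto
        then show "2 + ln c \<le> (2 + ln c) * real \<kappa> powr (\<gamma>0 / 32)" by simp
        show "ln (real \<kappa>) \<le> real \<kappa> powr (\<gamma>0 / 32) / (\<gamma>0 / 32)" using \<kappa>1 \<gamma>0 by (intro ln_powr_bound) auto
      qed auto
      also have "\<dots> = CL * real \<kappa> powr (\<gamma>0 / 32)" by (simp add: CL_def algebra_simps)
      finally show ?thesis .
    qed
    obtain F1 where F1: "F1 \<in> sets ?P" "P.prob F1 \<le> 1 / \<Gamma>\<^sup>2" "\<And>xs. xs \<in> space ?P - F1 \<Longrightarrow> order_event n N (\<lambda>i. \<phi> (xs i)) p \<Gamma> (1024 * \<kappa>)"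
      using order_event_prob[OF refl N0(1) c _ \<Gamma>, of "1024 * \<kappa>"] cN by auto
    obtain F2 where F2: "F2 \<in> sets ?P" "P.prob F2 \<le> real N * \<pi> * (real N * \<eta> powr (-p)) ^ D"
      "\<And>xs j. xs \<in> space ?P - F2 \<Longrightarrow> j < N \<Longrightarrow> card {i. i < N \<and> i \<noteq> j \<and> \<eta> * nrm n (\<phi> (xs j)) < \<bar>inner_n n (\<phi> (xs j)) (\<phi> (xs i))\<bar>} < D"
      using large_correlation_prob[OF \<eta>0 D(1), of N] by blast
    have pF1: "P.prob F1 \<le> 1 / (16 * real n)"
    proof -
      have "16 * real n * 1 \<le> \<Gamma> * \<Gamma>" using \<Gamma>1 by (intro mult_mono) auto
      then have "1 / \<Gamma>\<^sup>2 \<le> 1 / (16 * real n)" using n by (intro divide_left_mono) (auto simp: power2_eq_square)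
      then show ?thesis using F1 by linarith
    qed
    have pF2: "P.prob F2 \<le> 1 / (16 * real n)"
    proof -
      have "\<eta> powr (-p) = 1 / (real N * real \<kappa> powr (\<delta> * p))"
        using p2 Npos \<kappa>1 by (simp add: \<eta>_def powr_mult powr_powr powr_minus_divide)
      then have "(real N * \<eta> powr (-p)) ^ D = (real \<kappa> powr (- (\<delta> * p))) ^ D"
        using Npos by (simp add: powr_minus_divide)
      also have "\<dots> = real \<kappa> powr (- (\<delta> * p) * real D)"
        using \<kappa>1 by (subst powr_realpow[symmetric]) (auto simp: powr_powr)
      also have "\<dots> \<le> real \<kappa> powr (- 4)"
      proof (intro powr_mono)
        have "2 \<le> \<delta> * real D" using D(2) \<delta> by (simp add: field_simps)
        then have "2 * 2 \<le> (\<delta> * real D) * p" using p2 by (intro mult_mono) auto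
        then show "- (\<delta> * p) * real D \<le> - 4" by (simp add: mult_ac)
      qed (use \<kappa>1 in auto)
      also have "\<dots> = 1 / (real \<kappa>)\<^sup>2 / (real \<kappa>)\<^sup>2" using \<kappa>1 by (simp add: powr_minus_divide powr_numeral flip: power_add)
      finally have "real N * \<pi> * (real N * \<eta> powr (-p)) ^ D \<le> (real \<kappa>)\<^sup>2 * (1 / (real \<kappa>)\<^sup>2 / (real \<kappa>)\<^sup>2)"
        using N0 by (intro mult_mono) (auto simp: mult.commute)
      also have "\<dots> = 1 / (real \<kappa> * real \<kappa>)" using \<kappa>1 by (simp add: power2_eq_square)
      also have "\<dots> \<le> 1 / (16 * real n)" using \<kappa>1 n by (intro divide_left_mono mult_mono) auto
      finally show ?thesis using F2 by linarith
    qed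
    show "\<exists>F\<in>sets ?P. P.prob F \<le> 1 / (8 * real n) \<and> (\<forall>xs\<in>space ?P - F. sparse_bound n N \<kappa> (\<lambda>i. \<phi> (xs i)) (C * \<tau>\<^sup>2))"
    proof (intro bexI[of _ "F1 \<union> F2"] conjI ballI)
      have "P.prob (F1 \<union> F2) \<le> P.prob F1 + P.prob F2" using F1 F2 by (intro measure_Un_le) auto
      also have "\<dots> \<le> 1 / (16 * real n) + 1 / (16 * real n)" using pF1 pF2 by (rule add_mono)
      also have "\<dots> = 1 / (8 * real n)" by simp
      finally show "P.prob (F1 \<union> F2) \<le> 1 / (8 * real n)" .
      fix xs assume xs: "xs \<in> space ?P - (F1 \<union> F2)"
      have xsp: "xs i \<in> space \<mu>" if "i < N" for i using xs that by (auto simp: space_PiM PiE_iff)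
      show "sparse_bound n N \<kappa> (\<lambda>i. \<phi> (xs i)) (C * \<tau>\<^sup>2)"
      proof (rule heavy[OF p2 g _ \<Gamma>\<kappa> lnG _ T\<tau>])
        show "order_event n N (\<lambda>i. \<phi> (xs i)) p \<Gamma> (1024 * \<kappa>)" using F1(3) xs by auto
        show "\<forall>i<N. nrm n (\<phi> (xs i)) \<le> \<tau>" using x xsp by auto
        show "\<forall>i<N. card {j. j < N \<and> (i = j \<or> \<tau> * (real N powr (1/p) * real \<kappa> powr (\<gamma>0 / 4)) < \<bar>inner_n n (\<phi> (xs i)) (\<phi> (xs j))\<bar>)} \<le> D"
        proof (intro allI impI)
          fix i assume i: "i < N"
          let ?B = "{j. j < N \<and> j \<noteq> i \<and> \<eta> * nrm n (\<phi> (xs i)) < \<bar>inner_n n (\<phi> (xs i)) (\<phi> (xs j))\<bar>}"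
          have "\<eta> * nrm n (\<phi> (xs i)) \<le> \<tau> * \<eta>" using x xsp[OF i] \<eta>0 by (simp add: mult.commute)
          then have "{j. j < N \<and> (i = j \<or> \<tau> * \<eta> < \<bar>inner_n n (\<phi> (xs i)) (\<phi> (xs j))\<bar>)} \<subseteq> insert i ?B"
            by auto
          then have "{j. j < N \<and> (i = j \<or> \<tau> * (real N powr (1/p) * real \<kappa> powr (\<gamma>0 / 4)) < \<bar>inner_n n (\<phi> (xs i)) (\<phi> (xs j))\<bar>)} \<subseteq> insert i ?B"
            unfolding \<eta>_def \<delta>_def .
          then have "card {j. j < N \<and> (i = j \<or> \<tau> * (real N powr (1/p) * real \<kappa> powr (\<gamma>0 / 4)) < \<bar>inner_n n (\<phi> (xs i)) (\<phi> (xs j))\<bar>)} \<le> card (insert i ?B)"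
            by (intro card_mono) auto
          also have "\<dots> \<le> Suc (card ?B)" by (rule card_insert_le_m1) auto
          also have "\<dots> \<le> D" using F2(3)[of xs i] xs i by auto
          finally show "card {j. j < N \<and> (i = j \<or> \<tau> * (real N powr (1/p) * real \<kappa> powr (\<gamma>0 / 4)) < \<bar>inner_n n (\<phi> (xs i)) (\<phi> (xs j))\<bar>)} \<le> D" .
        qed
      qed (use \<kappa> in auto)
    qed (use F1 F2 in auto)
  qed
qed

lemma light_sparse_prob:
  fixes \<gamma>0 c :: real
  assumes \<gamma>0: "\<gamma>0 > 0" and c: "c \<ge> 1"
  shows "\<exists>C>0. \<forall>p n N \<kappa> T \<Gamma> (\<mu> :: 'a measure) \<phi>. tail_vector \<mu> \<phi> n p 1 \<longrightarrow> \<gamma>0 \<le> 1/2 - 1/p \<longrightarrow>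
     1 \<le> n \<longrightarrow> n \<le> \<kappa> \<longrightarrow> 0 < N \<longrightarrow> 1024 * real \<kappa> \<le> c * real N \<longrightarrow> \<Gamma> = exp 2 * c * real N \<longrightarrow>
     T = real N powr (1/p) * real \<kappa> powr (1/2 - 1/p) \<longrightarrow> (\<forall>x\<in>space \<mu>. nrm n (\<phi> x) \<le> T) \<longrightarrow>
     (\<exists>F\<in>sets (PiM {..<N} (\<lambda>_. \<mu>)). measure (PiM {..<N} (\<lambda>_. \<mu>)) F \<le> 1 / (8 * real n) \<and>
        (\<forall>xs\<in>space (PiM {..<N} (\<lambda>_. \<mu>)) - F. sparse_bound n N \<kappa> (\<lambda>i. \<phi> (xs i)) (C * (ln \<Gamma>) ^ 3 * T\<^sup>2)))"
proof -
  obtain C where C: "C > 0" and light: "\<And>p n N x \<Gamma> \<kappa> T. p > 2 \<Longrightarrow> \<gamma>0 \<le> 1/2 - 1/p \<Longrightarrow> \<kappa> \<ge> 1 \<Longrightarrow> 64 * exp 1 * real \<kappa> \<le> \<Gamma> \<Longrightarrow>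
     order_event n N x p \<Gamma> (1024 * \<kappa>) \<Longrightarrow> T = real N powr (1/p) * real \<kappa> powr (1/2 - 1/p) \<Longrightarrow>
     \<forall>i<N. nrm n (x i) \<le> T \<Longrightarrow> sparse_bound n N \<kappa> x (C * (ln \<Gamma>) ^ 3 * T\<^sup>2)"
    using light_sparse_bound[OF \<gamma>0] by blast
  show ?thesis
  proof (intro exI[of _ C] conjI allI impI)
    show "C > 0" by (rule C)
    fix p :: real and n N \<kappa> :: nat and T \<Gamma> :: real and \<mu> :: "'a measure" and \<phi> :: "'a \<Rightarrow> nat \<Rightarrow> real"
    assume tv: "tail_vector \<mu> \<phi> n p 1" and g: "\<gamma>0 \<le> 1/2 - 1/p" and n: "1 \<le> n" "n \<le> \<kappa>" and N: "0 < N"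
      and cN: "1024 * real \<kappa> \<le> c * real N" and \<Gamma>: "\<Gamma> = exp 2 * c * real N"
      and T: "T = real N powr (1/p) * real \<kappa> powr (1/2 - 1/p)" and x: "\<forall>x\<in>space \<mu>. nrm n (\<phi> x) \<le> T"
    interpret tail_vector \<mu> \<phi> n p 1 by (rule tv)
    let ?P = "PiM {..<N} (\<lambda>_. \<mu>)"
    interpret P: prob_space ?P by (intro prob_space_PiM prob_space_axioms)
    have e1: "(1::real) \<le> exp 1" by simp
    have "64 * exp 1 * real \<kappa> \<le> exp 2 * (1024 * real \<kappa>)"
    proof -
      have "64 * exp 1 * real \<kappa> \<le> 1024 * exp 1 * real \<kappa>" by (intro mult_right_mono) auto
      also have "\<dots> \<le> 1024 * exp 2 * real \<kappa>" by (intro mult_right_mono mult_left_mono) auto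
      finally show ?thesis by (simp add: mult_ac)
    qed
    also have "\<dots> \<le> exp 2 * (c * real N)" using cN by (intro mult_left_mono) auto
    finally have \<Gamma>\<kappa>: "64 * exp 1 * real \<kappa> \<le> \<Gamma>" by (simp add: \<Gamma> mult_ac)
    have "8 * 1 * real n \<le> 64 * exp 1 * real \<kappa>" using n e1 by (intro mult_mono) auto
    then have \<Gamma>1: "\<Gamma> \<ge> 8 * real n" "\<Gamma> \<ge> 1" using \<Gamma>\<kappa> n by linarith+
    obtain F where F: "F \<in> sets ?P" "P.prob F \<le> 1 / \<Gamma>\<^sup>2" "\<And>xs. xs \<in> space ?P - F \<Longrightarrow> order_event n N (\<lambda>i. \<phi> (xs i)) p \<Gamma> (1024 * \<kappa>)"
      using order_event_prob[of "real N" N c "1024 * \<kappa>" \<Gamma>] N c cN \<Gamma> by auto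
    show "\<exists>F\<in>sets ?P. P.prob F \<le> 1 / (8 * real n) \<and> (\<forall>xs\<in>space ?P - F. sparse_bound n N \<kappa> (\<lambda>i. \<phi> (xs i)) (C * (ln \<Gamma>) ^ 3 * T\<^sup>2))"
    proof (intro bexI[of _ F] conjI ballI)
      have "8 * real n * 1 \<le> \<Gamma> * \<Gamma>" using \<Gamma>1 by (intro mult_mono) auto
      then have "1 / \<Gamma>\<^sup>2 \<le> 1 / (8 * real n)" using n by (intro divide_left_mono) (auto simp: power2_eq_square)
      then show "P.prob F \<le> 1 / (8 * real n)" using F by linarith
      fix xs assume xs: "xs \<in> space ?P - F"
      have "nrm n (\<phi> (xs i)) \<le> T" if "i < N" for i using x xs that by (auto simp: space_PiM PiE_iff)
      then show "sparse_bound n N \<kappa> (\<lambda>i. \<phi> (xs i)) (C * (ln \<Gamma>) ^ 3 * T\<^sup>2)"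
        using n by (intro light[OF p2 g _ \<Gamma>\<kappa> F(3)[OF xs] T]) auto
    qed (rule F)
  qed
qed

lemma sparse_bound_add:
  assumes y: "sparse_bound n N \<kappa> y A1" and z: "sparse_bound n N \<kappa> z A2"
    and x: "\<And>i d. i < N \<Longrightarrow> d < n \<Longrightarrow> x i d = y i d + z i d"
  shows "sparse_bound n N \<kappa> x (2 * A1 + 2 * A2)"
  unfolding sparse_bound_def
proof (intro allI impI)
  fix c :: "nat \<Rightarrow> real" assume c: "card {i. i < N \<and> c i \<noteq> 0} \<le> \<kappa>"
  have "nrm n (lin N x c) = nrm n (\<lambda>d. lin N y c d + lin N z c d)"
    unfolding nrm_def lin_def using x by (intro L2_set_cong refl) (simp add: sum.distrib[symmetric] distrib_left)
  then have "nrm n (lin N x c) \<le> nrm n (lin N y c) + nrm n (lin N z c)" using nrm_triangle by simp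
  then have "(nrm n (lin N x c))\<^sup>2 \<le> (nrm n (lin N y c) + nrm n (lin N z c))\<^sup>2" by (intro power_mono) auto
  also have "\<dots> \<le> 2 * (nrm n (lin N y c))\<^sup>2 + 2 * (nrm n (lin N z c))\<^sup>2"
    using zero_le_power2[of "nrm n (lin N y c) - nrm n (lin N z c)"] by (simp add: power2_sum power2_diff)
  also have "\<dots> \<le> 2 * (A1 * (\<Sum>i<N. (c i)\<^sup>2)) + 2 * (A2 * (\<Sum>i<N. (c i)\<^sup>2))"
    using y z c unfolding sparse_bound_def by (intro add_mono mult_left_mono) auto
  finally show "(nrm n (lin N x c))\<^sup>2 \<le> (2 * A1 + 2 * A2) * (\<Sum>i<N. (c i)\<^sup>2)" by (simp add: algebra_simps)
qed

text \<open>The factors \<open>r i\<close> move into the coefficients, whose support does not grow.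
  It serves to undo a truncation of lengths.\<close>

lemma sparse_bound_rescale:
  assumes y: "sparse_bound n N \<kappa> y A" "A \<ge> 0" and x: "\<And>i d. i < N \<Longrightarrow> d < n \<Longrightarrow> x i d = r i * y i d"
    and r: "\<And>i. i < N \<Longrightarrow> (r i)\<^sup>2 \<le> R"
  shows "sparse_bound n N \<kappa> x (A * R)"
  unfolding sparse_bound_def
proof (intro allI impI)
  fix c :: "nat \<Rightarrow> real" assume c: "card {i. i < N \<and> c i \<noteq> 0} \<le> \<kappa>"
  have "nrm n (lin N x c) = nrm n (lin N y (\<lambda>i. c i * r i))"
    unfolding nrm_def lin_def using x by (intro L2_set_cong refl) (simp add: mult.assoc)
  moreover have "(nrm n (lin N y (\<lambda>i. c i * r i)))\<^sup>2 \<le> A * (\<Sum>i<N. (c i * r i)\<^sup>2)"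
  proof -
    have "card {i. i < N \<and> c i * r i \<noteq> 0} \<le> card {i. i < N \<and> c i \<noteq> 0}" by (intro card_mono) auto
    then show ?thesis using y c unfolding sparse_bound_def by auto
  qed
  moreover have "A * (\<Sum>i<N. (c i * r i)\<^sup>2) \<le> A * (\<Sum>i<N. (c i)\<^sup>2 * R)"
    using y(2) r by (intro mult_left_mono sum_mono) (auto simp: power_mult_distrib intro!: mult_left_mono)
  moreover have "A * (\<Sum>i<N. (c i)\<^sup>2 * R) = A * R * (\<Sum>i<N. (c i)\<^sup>2)"
    by (simp add: sum_distrib_right[symmetric])
  ultimately show "(nrm n (lin N x c))\<^sup>2 \<le> A * R * (\<Sum>i<N. (c i)\<^sup>2)" by simp
qed

lemma nrm_cong: "(\<And>d. d < n \<Longrightarrow> a d = b d) \<Longrightarrow> nrm n a = nrm n b"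
  unfolding nrm_def by (intro L2_set_cong) auto

text \<open>A factor between 0 and 1 can only diminish inner products, so the tail bound survives.
  This covers the restriction to short or to long vectors, where \<open>s\<close> is an indicator,
  as well as the truncation at a fixed length.\<close>

lemma (in tail_vector) scaled:
  assumes s[measurable]: "s \<in> borel_measurable \<mu>" and s01: "\<And>x. x \<in> space \<mu> \<Longrightarrow> 0 \<le> s x \<and> s x \<le> 1"
    and \<pi>': "emeasure \<mu> {x \<in> space \<mu>. s x \<noteq> 0} \<le> ennreal \<pi>'" "\<pi>' \<ge> 0"
  shows "tail_vector \<mu> (\<lambda>x d. s x * \<phi> x d) n p \<pi>'"
proof
  show "(\<lambda>x. s x * \<phi> x d) \<in> borel_measurable \<mu>" if "d < n" for d using meas[OF that] by measurable
  show "emeasure \<mu> {x \<in> space \<mu>. t * nrm n b < \<bar>inner_n n b (\<lambda>d. s x * \<phi> x d)\<bar>} \<le> ennreal (t powr - p)" if t: "t > 0" for t b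
  proof -
    have [measurable]: "(\<lambda>x. inner_n n b (\<phi> x)) \<in> borel_measurable \<mu>" unfolding inner_n_def by measurable
    have "emeasure \<mu> {x \<in> space \<mu>. t * nrm n b < \<bar>inner_n n b (\<lambda>d. s x * \<phi> x d)\<bar>} \<le> emeasure \<mu> {x \<in> space \<mu>. t * nrm n b < \<bar>inner_n n b (\<phi> x)\<bar>}"
    proof (intro emeasure_mono)
      show "{x \<in> space \<mu>. t * nrm n b < \<bar>inner_n n b (\<lambda>d. s x * \<phi> x d)\<bar>} \<subseteq> {x \<in> space \<mu>. t * nrm n b < \<bar>inner_n n b (\<phi> x)\<bar>}"
      proof safe
        fix x assume x: "x \<in> space \<mu>" "t * nrm n b < \<bar>inner_n n b (\<lambda>d. s x * \<phi> x d)\<bar>"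
        have "inner_n n b (\<lambda>d. s x * \<phi> x d) = s x * inner_n n b (\<phi> x)"
          by (simp add: inner_n_comm[of n b] inner_n_scale_left)
        moreover have "\<bar>s x * inner_n n b (\<phi> x)\<bar> \<le> 1 * \<bar>inner_n n b (\<phi> x)\<bar>"
          unfolding abs_mult using s01[OF x(1)] by (intro mult_right_mono) auto
        ultimately show "t * nrm n b < \<bar>inner_n n b (\<phi> x)\<bar>" using x by simp
      qed
    qed measurable
    also have "\<dots> \<le> ennreal (t powr - p)" by (rule tail[OF t])
    finally show ?thesis .
  qed
  have "emeasure \<mu> {x \<in> space \<mu>. nrm n (\<lambda>d. s x * \<phi> x d) \<noteq> 0} \<le> emeasure \<mu> {x \<in> space \<mu>. s x \<noteq> 0}"
    by (intro emeasure_mono) (auto simp: nrm_scale)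
  also have "\<dots> \<le> ennreal \<pi>'" by (rule \<pi>')
  finally show "emeasure \<mu> {x \<in> space \<mu>. nrm n (\<lambda>d. s x * \<phi> x d) \<noteq> 0} \<le> ennreal \<pi>'" .
qed (use \<pi>' p2 in auto)

text \<open>A vector longer than \<open>T\<close> has a coordinate larger than
  \<open>T / sqrt n\<close>; the tail bound is applied in the \<open>n\<close> coordinate
  directions.\<close>

lemma (in tail_vector) norm_tail:
  assumes T: "T > 0" and n: "n \<ge> 1"
  shows "emeasure \<mu> {x \<in> space \<mu>. T < nrm n (\<phi> x)} \<le> ennreal (real n * (T / sqrt n) powr (-p))"
proof -
  define e where "e d = (\<lambda>k::nat. if k = d then 1 else 0 :: real)" for d
  have inner_e: "inner_n n (e d) v = v d" if "d < n" for d v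
  proof -
    have "inner_n n (e d) v = (\<Sum>j<n. if j = d then v j else 0)" unfolding inner_n_def by (intro sum.cong) (auto simp: e_def)
    then show ?thesis using that by simp
  qed
  have nrm_e: "nrm n (e d) = 1" if "d < n" for d
  proof -
    have "(nrm n (e d))\<^sup>2 = 1" using inner_e[OF that, of "e d"] by (simp add: inner_n_self[symmetric] e_def)
    then show ?thesis by (simp add: power2_eq_1_iff) (metis nrm_nonneg neg_0_le_iff_le not_one_le_zero)
  qed
  let ?E = "\<lambda>d. {x \<in> space \<mu>. (T / sqrt n) * nrm n (e d) < \<bar>inner_n n (e d) (\<phi> x)\<bar>}"
  have E: "?E d \<in> sets \<mu>" for d unfolding inner_n_def by measurable
  have "{x \<in> space \<mu>. T < nrm n (\<phi> x)} \<subseteq> (\<Union>d\<in>{..<n}. ?E d)"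
  proof safe
    fix x assume x: "x \<in> space \<mu>" "T < nrm n (\<phi> x)"
    show "x \<in> (\<Union>d\<in>{..<n}. ?E d)"
    proof (rule ccontr)
      assume "\<not> ?thesis"
      then have a: "\<bar>\<phi> x d\<bar> \<le> T / sqrt n" if "d < n" for d
        using x that by (force simp: inner_e nrm_e not_less)
      have "(nrm n (\<phi> x))\<^sup>2 \<le> (\<Sum>d<n. (T / sqrt n)\<^sup>2)"
        unfolding nrm_sq
      proof (intro sum_mono)
        fix d assume "d \<in> {..<n}"
        then show "(\<phi> x d)\<^sup>2 \<le> (T / sqrt n)\<^sup>2" using power_mono[OF a, of d 2] by simp
      qed
      also have "\<dots> = T\<^sup>2" using n by (simp add: power_divide)
      finally have "nrm n (\<phi> x) \<le> T" using T by (simp add: power2_le_iff_abs_le)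
      then show False using x by simp
    qed
  qed
  then have "emeasure \<mu> {x \<in> space \<mu>. T < nrm n (\<phi> x)} \<le> emeasure \<mu> (\<Union>d\<in>{..<n}. ?E d)"
    using E by (intro emeasure_mono) auto
  also have "\<dots> \<le> (\<Sum>d<n. emeasure \<mu> (?E d))" using E by (intro emeasure_subadditive_finite) auto
  also have "\<dots> \<le> (\<Sum>d<n. ennreal ((T / sqrt n) powr (-p)))" using T n by (intro sum_mono tail) auto
  also have "\<dots> = ennreal (real n * (T / sqrt n) powr (-p))" by (simp add: ennreal_mult ennreal_of_nat_eq_real_of_nat)
  finally show ?thesis .
qed

text \<open>If \<open>N \<le> \<kappa>\<^sup>2\<close>, then \<open>ln N\<close> may be far larger
  than \<open>ln (N / n)\<close>, so all vectors are treated as long, with \<open>\<pi> = 1\<close>.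
  Otherwise \<open>ln N \<le> 2 * ln (N / n)\<close>, and the vectors are split at a length that is
  exceeded with probability at most \<open>\<kappa>\<^sup>2 / N\<close>. As long vectors have no
  deterministic length bound, they are shrunk to length \<open>\<tau>\<close>; \<open>M\<close>
  enters only when this is undone.\<close>

lemma sparse_bound_prob:
  fixes \<gamma>0 :: real and K0 :: nat
  assumes \<gamma>0: "\<gamma>0 > 0" and K0: "K0 \<ge> 16"
  shows "\<exists>C>0. \<forall>p n N (\<mu> :: 'a measure) \<psi>. tail_vector \<mu> \<psi> n p 1 \<longrightarrow> \<gamma>0 \<le> 1/2 - 1/p \<longrightarrow> 1 \<le> n \<longrightarrow> 2 * n \<le> N \<longrightarrow>
     (\<exists>F\<in>sets (PiM {..<N} (\<lambda>_. \<mu>)). measure (PiM {..<N} (\<lambda>_. \<mu>)) F \<le> 1 / (4 * real n) \<and>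
        (\<forall>xs\<in>space (PiM {..<N} (\<lambda>_. \<mu>)) - F. \<forall>M. (\<forall>i<N. (nrm n (\<psi> (xs i)))\<^sup>2 \<le> M) \<longrightarrow>
           sparse_bound n N (K0 * n) (\<lambda>i. \<psi> (xs i))
             (C * (M + real N powr (2/p) * real n powr (1 - 2/p) * (ln (real N / real n)) ^ 4))))"
proof -
  define c where "c = 1024 * real K0"
  have c1: "c \<ge> 1" using K0 by (simp add: c_def)
  obtain C1 where C1: "C1 > 0" and heavy: "\<And>p n N \<kappa> \<tau> \<pi> \<Gamma> (\<mu> :: 'a measure) \<phi>. tail_vector \<mu> \<phi> n p \<pi> \<Longrightarrow> \<gamma>0 \<le> 1/2 - 1/p \<Longrightarrow> 16 \<le> \<kappa> \<Longrightarrow>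
     1 \<le> n \<Longrightarrow> n \<le> \<kappa> \<Longrightarrow> 0 < \<pi> * real N \<Longrightarrow> \<pi> * real N \<le> (real \<kappa>)\<^sup>2 \<Longrightarrow> 1024 * real \<kappa> \<le> c * (\<pi> * real N) \<Longrightarrow>
     \<Gamma> = exp 2 * c * (\<pi> * real N) \<Longrightarrow>
     real N powr (1/p) * real \<kappa> powr (1/2 - 1/p) * sqrt (ln (\<Gamma> / real \<kappa>)) \<le> \<tau> \<Longrightarrow>
     \<forall>x\<in>space \<mu>. nrm n (\<phi> x) \<le> \<tau> \<Longrightarrow>
     \<exists>F\<in>sets (PiM {..<N} (\<lambda>_. \<mu>)). measure (PiM {..<N} (\<lambda>_. \<mu>)) F \<le> 1 / (8 * real n) \<and>
        (\<forall>xs\<in>space (PiM {..<N} (\<lambda>_. \<mu>)) - F. sparse_bound n N \<kappa> (\<lambda>i. \<phi> (xs i)) (C1 * \<tau>\<^sup>2))"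
    using heavy_sparse_prob[OF \<gamma>0 c1] by metis
  obtain C2 where C2: "C2 > 0" and light: "\<And>p n N \<kappa> T \<Gamma> (\<mu> :: 'a measure) \<phi>. tail_vector \<mu> \<phi> n p 1 \<Longrightarrow> \<gamma>0 \<le> 1/2 - 1/p \<Longrightarrow>
     1 \<le> n \<Longrightarrow> n \<le> \<kappa> \<Longrightarrow> 0 < N \<Longrightarrow> 1024 * real \<kappa> \<le> c * real N \<Longrightarrow> \<Gamma> = exp 2 * c * real N \<Longrightarrow>
     T = real N powr (1/p) * real \<kappa> powr (1/2 - 1/p) \<Longrightarrow> \<forall>x\<in>space \<mu>. nrm n (\<phi> x) \<le> T \<Longrightarrow>
     \<exists>F\<in>sets (PiM {..<N} (\<lambda>_. \<mu>)). measure (PiM {..<N} (\<lambda>_. \<mu>)) F \<le> 1 / (8 * real n) \<and>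
        (\<forall>xs\<in>space (PiM {..<N} (\<lambda>_. \<mu>)) - F. sparse_bound n N \<kappa> (\<lambda>i. \<phi> (xs i)) (C2 * (ln \<Gamma>) ^ 3 * T\<^sup>2))"
    using light_sparse_prob[OF \<gamma>0 c1] by metis
  define c3 where "c3 = 2 + (2 + ln c) * (3/2)"
  have c3: "c3 > 0" using c1 by (simp add: c3_def add_pos_nonneg)
  define C where "C = 2 * C1 * (1 + 64 * real K0) + 3 * C2 * c3 ^ 3 * real K0"
  show ?thesis
  proof (intro exI[of _ C] conjI allI impI)
    show "C > 0" using C1 C2 c3 K0 unfolding C_def by (intro add_pos_nonneg mult_pos_pos mult_nonneg_nonneg) auto
    fix p :: real and n N :: nat and \<mu> :: "'a measure" and \<psi> :: "'a \<Rightarrow> nat \<Rightarrow> real"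
    assume tv: "tail_vector \<mu> \<psi> n p 1" and g: "\<gamma>0 \<le> 1/2 - 1/p" and n: "1 \<le> n" and N: "2 * n \<le> N"
    interpret tail_vector \<mu> \<psi> n p 1 by (rule tv)
    let ?P = "PiM {..<N} (\<lambda>_. \<mu>)"
    interpret P: prob_space ?P by (intro prob_space_PiM prob_space_axioms)
    define \<kappa> where "\<kappa> = K0 * n"
    define L where "L = ln (real N / real n)"
    define \<gamma> where "\<gamma> = 1/2 - 1/p"
    define T where "T = real N powr (1/p) * real \<kappa> powr (1/2 - 1/p)"
    \<comment> \<open>In both cases the logarithm \<open>ln (\<Gamma> / \<kappa>)\<close> for the
      long vectors is at most \<open>9 + 2 * L\<close>, and \<open>L \<ge> 2/3\<close> makes this at
      most \<open>64 * L ^ 4\<close>, the square of \<open>8 * L\<^sup>2\<close>.\<close>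
    define \<tau> where "\<tau> = 8 * T * L\<^sup>2"
    define G where "G = real N powr (2/p) * real n powr (1 - 2/p)"
    have ip: "1/p > 0" using p2 by simp
    have \<gamma>: "0 < \<gamma>" "\<gamma> \<le> 1/2" unfolding \<gamma>_def using g \<gamma>0 ip by linarith+
    have nr: "real n \<ge> 1" "real N \<ge> 2 * real n" using n N by auto
    have \<kappa>: "16 \<le> \<kappa>" "n \<le> \<kappa>" "K0 \<le> \<kappa>"
    proof -
      have "K0 * 1 \<le> K0 * n" using n by (intro mult_left_mono) auto
      then show "16 \<le> \<kappa>" "K0 \<le> \<kappa>" using K0 unfolding \<kappa>_def by linarith+
      have "1 * n \<le> K0 * n" using K0 by (intro mult_right_mono) auto
      then show "n \<le> \<kappa>" by (simp add: \<kappa>_def)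
    qed
    have \<kappa>r: "real \<kappa> \<ge> 16" using \<kappa> by simp
    have L23: "L \<ge> 2/3"
    proof -
      have "ln 2 \<le> ln (real N / real n)" using nr by (subst ln_le_cancel_iff) (auto simp: field_simps)
      then show ?thesis using ln2_ge_two_thirds by (simp add: L_def)
    qed
    have T0: "T > 0" using nr \<kappa>r by (simp add: T_def)
    have \<tau>0: "\<tau> > 0" using T0 L23 by (simp add: \<tau>_def)
    have G0: "G \<ge> 0" by (simp add: G_def)
    have T2: "T\<^sup>2 \<le> real K0 * G"
    proof -
      have pw: "(a powr b)\<^sup>2 = a powr (2 * b)" for a b :: real
        by (simp only: power2_eq_square mult_2 powr_add)
      have "T\<^sup>2 = real N powr (2/p) * (real K0 powr (1 - 2/p) * real n powr (1 - 2/p))"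
        by (simp add: T_def power_mult_distrib pw \<kappa>_def powr_mult right_diff_distrib)
      also have "\<dots> \<le> real N powr (2/p) * (real K0 powr 1 * real n powr (1 - 2/p))"
        using K0 ip by (intro mult_left_mono mult_right_mono powr_mono) auto
      finally show ?thesis using K0 by (simp add: G_def mult_ac)
    qed
    have \<tau>2: "\<tau>\<^sup>2 \<le> 64 * real K0 * (G * L ^ 4)"
    proof -
      have "\<tau>\<^sup>2 = 64 * L ^ 4 * T\<^sup>2" by (simp add: \<tau>_def power_mult_distrib flip: power_mult)
      also have "\<dots> \<le> 64 * L ^ 4 * (real K0 * G)" using T2 by (intro mult_left_mono) auto
      finally show ?thesis by (simp add: mult_ac)
    qed
    have cN: "1024 * real \<kappa> \<le> c * real N" unfolding c_def \<kappa>_def using nr by (simp add: mult_left_mono)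
    have sqrt_le: "T * sqrt u \<le> \<tau>" if "u \<le> 9 + 2 * L" for u
    proof -
      have "u \<le> 64 * L ^ 4"
      proof -
        have "(2/3) ^ 3 \<le> L ^ 3" using L23 by (intro power_mono) auto
        then have "1/4 \<le> L ^ 3" by (simp add: power3_eq_cube)
        then have "L * (1/4) \<le> L * L ^ 3" using L23 by (intro mult_left_mono) auto
        then have "16 * L \<le> 64 * L ^ 4" by (simp add: power4_eq_xxxx power3_eq_cube)
        then show ?thesis using that L23 by linarith
      qed
      moreover have "64 * L ^ 4 = (8 * L\<^sup>2)\<^sup>2" by (simp add: power2_eq_square power4_eq_xxxx)
      ultimately have "u \<le> (8 * L\<^sup>2)\<^sup>2" by (simp only:)
      from real_sqrt_le_mono[OF this] have "sqrt u \<le> 8 * L\<^sup>2" by (simp only: real_sqrt_abs) simp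
      then have "T * sqrt u \<le> T * (8 * L\<^sup>2)" using T0 by (intro mult_left_mono) auto
      then show ?thesis by (simp add: \<tau>_def mult_ac)
    qed
    have [measurable]: "(\<lambda>x. nrm n (\<psi> x)) \<in> borel_measurable \<mu>" unfolding nrm_def L2_set_def by measurable
    have ln1024: "2 + ln 1024 \<le> (9::real)"
    proof -
      have "ln (1024::real) = ln (2 ^ 10)" by simp
      also have "\<dots> = 10 * ln 2" by (subst ln_realpow) auto
      finally show ?thesis using ln_2_less_1 ln2_le_25_over_36 by simp
    qed
    have heavy_part: "\<exists>F\<in>sets ?P. P.prob F \<le> 1 / (8 * real n) \<and>
        (\<forall>xs\<in>space ?P - F. \<forall>M. (\<forall>i<N. (nrm n (\<psi> (xs i)))\<^sup>2 \<le> M) \<longrightarrow>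
           sparse_bound n N \<kappa> (\<lambda>i d. h (xs i) * \<psi> (xs i) d) (C1 * (M + \<tau>\<^sup>2)))"
      if h: "h \<in> borel_measurable \<mu>" "\<And>x. h x = 0 \<or> h x = 1" and \<pi>: "emeasure \<mu> {x\<in>space \<mu>. h x \<noteq> 0} \<le> ennreal \<pi>" "\<pi> > 0"
        and \<pi>N: "\<pi> * real N \<le> (real \<kappa>)\<^sup>2" "1024 * real \<kappa> \<le> c * (\<pi> * real N)"
        and u: "ln (exp 2 * c * (\<pi> * real N) / real \<kappa>) \<le> 9 + 2 * L" for h :: "'a \<Rightarrow> real" and \<pi>
    proof -
      note h(1)[measurable]
      \<comment> \<open>Vectors longer than \<open>\<tau>\<close> are shrunk to length
        \<open>\<tau>\<close>. The factor is a function of the single vector, so the sample stays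
        independent and identically distributed.\<close>
      define s where "s x = h x * (if nrm n (\<psi> x) \<le> \<tau> then 1 else \<tau> / nrm n (\<psi> x))" for x
      have s_meas: "s \<in> borel_measurable \<mu>" unfolding s_def by measurable
      have s01: "0 \<le> s x \<and> s x \<le> 1" for x using h(2)[of x] \<tau>0 by (auto simp: s_def)
      have "emeasure \<mu> {x\<in>space \<mu>. s x \<noteq> 0} \<le> emeasure \<mu> {x\<in>space \<mu>. h x \<noteq> 0}"
        by (intro emeasure_mono) (auto simp: s_def)
      then have s\<pi>: "emeasure \<mu> {x\<in>space \<mu>. s x \<noteq> 0} \<le> ennreal \<pi>" using \<pi>(1) by (rule order_trans)
      have tvs: "tail_vector \<mu> (\<lambda>x d. s x * \<psi> x d) n p \<pi>"
        using s_meas s01 s\<pi> \<pi>(2) by (intro scaled) auto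
      have snorm: "\<forall>x\<in>space \<mu>. nrm n (\<lambda>d. s x * \<psi> x d) \<le> \<tau>"
      proof
        fix x
        show "nrm n (\<lambda>d. s x * \<psi> x d) \<le> \<tau>" using h(2)[of x] \<tau>0 by (auto simp: nrm_scale s_def)
      qed
      have "\<pi> * real N > 0" using \<pi> nr by simp
      then obtain F where F: "F \<in> sets ?P" "P.prob F \<le> 1 / (8 * real n)"
        "\<forall>xs\<in>space ?P - F. sparse_bound n N \<kappa> (\<lambda>i d. s (xs i) * \<psi> (xs i) d) (C1 * \<tau>\<^sup>2)"
        using heavy[OF tvs g \<kappa>(1) n \<kappa>(2) _ \<pi>N refl _ snorm] sqrt_le[OF u] by (auto simp: T_def)
      show ?thesis
      proof (intro bexI[OF _ F(1)] conjI F(2) ballI allI impI)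
        fix xs M assume xs: "xs \<in> space ?P - F" and M: "\<forall>i<N. (nrm n (\<psi> (xs i)))\<^sup>2 \<le> M"
        have N1: "0 < N" using nr by simp
        have M0: "M \<ge> 0" using M N1 by (meson order_trans zero_le_power2)
        \<comment> \<open>The inverse of the shrinking factor; its square is at most
          \<open>1 + M / \<tau>\<^sup>2\<close>, which turns \<open>\<tau>\<^sup>2\<close> into
          \<open>\<tau>\<^sup>2 + M\<close>.\<close>
        define r where "r i = (if nrm n (\<psi> (xs i)) \<le> \<tau> then 1 else nrm n (\<psi> (xs i)) / \<tau>)" for i
        have "sparse_bound n N \<kappa> (\<lambda>i d. h (xs i) * \<psi> (xs i) d) (C1 * \<tau>\<^sup>2 * (1 + M / \<tau>\<^sup>2))"
        proof (rule sparse_bound_rescale[where r=r])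
          show "sparse_bound n N \<kappa> (\<lambda>i d. s (xs i) * \<psi> (xs i) d) (C1 * \<tau>\<^sup>2)" using F xs by auto
          show "h (xs i) * \<psi> (xs i) d = r i * (s (xs i) * \<psi> (xs i) d)" for i d
            using \<tau>0 by (auto simp: r_def s_def)
          show "(r i)\<^sup>2 \<le> 1 + M / \<tau>\<^sup>2" if "i < N" for i
            using M that M0 \<tau>0 by (auto simp: r_def power_divide intro!: divide_right_mono add_increasing)
        qed (use C1 in auto)
        moreover have "C1 * \<tau>\<^sup>2 * (1 + M / \<tau>\<^sup>2) = C1 * (M + \<tau>\<^sup>2)" using \<tau>0 by (simp add: field_simps)
        ultimately show "sparse_bound n N \<kappa> (\<lambda>i d. h (xs i) * \<psi> (xs i) d) (C1 * (M + \<tau>\<^sup>2))" by simp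
      qed
    qed
    have heavy_le: "2 * (C1 * (M + \<tau>\<^sup>2)) \<le> 2 * C1 * (1 + 64 * real K0) * (M + G * L ^ 4)" if "M \<ge> 0" for M
    proof -
      have "0 \<le> real K0 * M" using that by simp
      moreover have "0 \<le> G * L ^ 4" using G0 by simp
      ultimately have "M + \<tau>\<^sup>2 \<le> (1 + 64 * real K0) * (M + G * L ^ 4)" using \<tau>2 by (simp add: algebra_simps)
      then have "2 * C1 * (M + \<tau>\<^sup>2) \<le> 2 * C1 * ((1 + 64 * real K0) * (M + G * L ^ 4))" using C1 by (intro mult_left_mono) auto
      then show ?thesis by (simp only: mult.assoc)
    qed
    have "\<exists>F\<in>sets ?P. P.prob F \<le> 1 / (4 * real n) \<and>
        (\<forall>xs\<in>space ?P - F. \<forall>M. (\<forall>i<N. (nrm n (\<psi> (xs i)))\<^sup>2 \<le> M) \<longrightarrow>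
           sparse_bound n N \<kappa> (\<lambda>i. \<psi> (xs i)) (C * (M + G * L ^ 4)))"
    proof (cases "real N \<le> (real \<kappa>)\<^sup>2")
      case True
      have u: "ln (exp 2 * c * (1 * real N) / real \<kappa>) \<le> 9 + 2 * L"
      proof -
        have "exp 2 * c * (1 * real N) / real \<kappa> = exp 2 * 1024 * (real N / real n)"
          using K0 nr by (simp add: c_def \<kappa>_def)
        then have "ln (exp 2 * c * (1 * real N) / real \<kappa>) = ln (exp 2 * 1024 * (real N / real n))" by (simp only:)
        also have "\<dots> = 2 + ln 1024 + ln (real N / real n)"
        proof -
          have "ln (exp 2 * 1024 * y) = 2 + ln 1024 + ln y" if "y > 0" for y :: real using that by (simp add: ln_mult)
          moreover have "real N / real n > 0" using nr by simp
          ultimately show ?thesis by blast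
        qed
        finally have "ln (exp 2 * c * (1 * real N) / real \<kappa>) = 2 + ln 1024 + L" by (simp only: L_def)
        then show ?thesis using ln1024 L23 by linarith
      qed
      obtain F where F: "F \<in> sets ?P" "P.prob F \<le> 1 / (8 * real n)"
        "\<forall>xs\<in>space ?P - F. \<forall>M. (\<forall>i<N. (nrm n (\<psi> (xs i)))\<^sup>2 \<le> M) \<longrightarrow>
           sparse_bound n N \<kappa> (\<lambda>i d. 1 * \<psi> (xs i) d) (C1 * (M + \<tau>\<^sup>2))"
        using heavy_part[of "\<lambda>_. 1" 1] True cN u by (auto simp: emeasure_space_1)
      show ?thesis
      proof (intro bexI[OF _ F(1)] conjI ballI allI impI)
        have "1 / (8 * real n) \<le> 1 / (4 * real n)" using nr by (intro divide_left_mono) auto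
        then show "P.prob F \<le> 1 / (4 * real n)" using F(2) by linarith
        fix xs M assume xs: "xs \<in> space ?P - F" and M: "\<forall>i<N. (nrm n (\<psi> (xs i)))\<^sup>2 \<le> M"
        have N1: "0 < N" using nr by simp
        have M0: "M \<ge> 0" using M N1 by (meson order_trans zero_le_power2)
        have sb: "sparse_bound n N \<kappa> (\<lambda>i. \<psi> (xs i)) (C1 * (M + \<tau>\<^sup>2))" using F(3) xs M by simp
        have "C1 * (M + \<tau>\<^sup>2) \<le> 2 * (C1 * (M + \<tau>\<^sup>2))" using C1 M0 by simp
        also have "\<dots> \<le> 2 * C1 * (1 + 64 * real K0) * (M + G * L ^ 4)" by (rule heavy_le[OF M0])
        also have "\<dots> \<le> C * (M + G * L ^ 4)" unfolding C_def using C2 c3 M0 G0 by (intro mult_right_mono) auto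
        finally show "sparse_bound n N \<kappa> (\<lambda>i. \<psi> (xs i)) (C * (M + G * L ^ 4))" by (rule sparse_bound_mono[OF sb])
      qed
    next
      case False
      then have big: "(real \<kappa>)\<^sup>2 < real N" by simp
      \<comment> \<open>This is what \<open>norm_tail\<close> yields at length \<open>T\<close>: the
        power of \<open>N\<close> contained in \<open>T\<close> gives exactly \<open>1 / N\<close>,
        and the powers of \<open>n\<close> and \<open>\<kappa>\<close> combine to at most
        \<open>\<kappa>\<^sup>2\<close>.\<close>
      define \<pi> where "\<pi> = (real \<kappa>)\<^sup>2 / real N"
      have \<pi>N: "\<pi> * real N = (real \<kappa>)\<^sup>2" using nr by (simp add: \<pi>_def)
      define h where "h x = (if nrm n (\<psi> x) \<le> T then 0 else 1 :: real)" for x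
      \<comment> \<open>Here \<open>n * \<kappa> \<le> \<kappa>\<^sup>2 < N\<close>, that is
        \<open>\<kappa> \<le> N / n\<close>, so that both logarithms are bounded by multiples of
        \<open>L\<close>.\<close>
      have \<kappa>L: "ln (real \<kappa>) \<le> L" "ln (real N) \<le> 2 * L"
      proof -
        have nk: "real n \<le> real \<kappa>" using \<kappa> by simp
        have "real n * real \<kappa> \<le> real \<kappa> * real \<kappa>" using nk by (intro mult_right_mono) auto
        then have "real \<kappa> \<le> real N / real n" using big nr by (simp add: field_simps power2_eq_square)
        then show 1: "ln (real \<kappa>) \<le> L" unfolding L_def using \<kappa>r nr by (subst ln_le_cancel_iff) auto
        have "ln (real n) \<le> ln (real \<kappa>)" using nk nr by simp
        moreover have "ln (real N) = L + ln (real n)" using nr by (simp add: L_def ln_div)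
        ultimately show "ln (real N) \<le> 2 * L" using 1 by linarith
      qed
      have h\<pi>: "emeasure \<mu> {x\<in>space \<mu>. h x \<noteq> 0} \<le> ennreal \<pi>"
      proof -
        have "{x\<in>space \<mu>. h x \<noteq> 0} = {x\<in>space \<mu>. T < nrm n (\<psi> x)}" by (auto simp: h_def not_le)
        then have "emeasure \<mu> {x\<in>space \<mu>. h x \<noteq> 0} \<le> ennreal (real n * (T / sqrt n) powr (-p))" using norm_tail[OF T0 n] by simp
        also have "\<dots> \<le> ennreal \<pi>"
        proof (rule ennreal_leI)
          have pp: "p * \<gamma> = p/2 - 1" using p2 by (simp add: \<gamma>_def right_diff_distrib)
          have "(T / sqrt n) powr (-p) = real n powr (p/2) / (real N * real \<kappa> powr (p/2 - 1))"
            using nr p2 \<kappa>r pp by (simp add: T_def powr_divide powr_mult powr_powr powr_minus_divide \<gamma>_def[symmetric] mult.commute[of \<gamma>] flip: powr_half_sqrt)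
          then have "real n * (T / sqrt n) powr (-p) = real n * (real n powr (p/2) / (real N * real \<kappa> powr (p/2 - 1)))" by simp
          also have "\<dots> \<le> real \<kappa> * (real \<kappa> powr (p/2) / (real N * real \<kappa> powr (p/2 - 1)))"
            using \<kappa> nr p2 by (intro mult_mono divide_right_mono powr_mono2) auto
          also have "\<dots> = real \<kappa> * (real \<kappa> powr (p/2) / real \<kappa> powr (p/2 - 1)) / real N" by simp
          also have "real \<kappa> powr (p/2) / real \<kappa> powr (p/2 - 1) = real \<kappa>" using \<kappa>r by (simp flip: powr_diff)
          finally show "real n * (T / sqrt n) powr (-p) \<le> \<pi>" by (simp add: \<pi>_def power2_eq_square)
        qed
        finally show ?thesis .
      qed
      have u: "ln (exp 2 * c * (\<pi> * real N) / real \<kappa>) \<le> 9 + 2 * L"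
      proof -
        have "exp 2 * c * (\<pi> * real N) / real \<kappa> = exp 2 * 1024 * real K0 * real \<kappa>"
          using \<kappa>r unfolding \<pi>N by (simp add: c_def power2_eq_square)
        then have "ln (exp 2 * c * (\<pi> * real N) / real \<kappa>) = 2 + ln 1024 + ln (real K0) + ln (real \<kappa>)" using \<kappa>r K0 by (simp add: ln_mult)
        moreover have "ln (real K0) \<le> ln (real \<kappa>)" using \<kappa> K0 by simp
        ultimately show ?thesis using ln1024 \<kappa>L by linarith
      qed
      have hm: "h \<in> borel_measurable \<mu>" unfolding h_def by measurable
      have c\<kappa>: "1024 * real \<kappa> \<le> c * (\<pi> * real N)"
      proof -
        have "1024 * 1 * (real \<kappa> * 1) \<le> 1024 * real K0 * (real \<kappa> * real \<kappa>)" using K0 \<kappa>r by (intro mult_mono) auto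
        then show ?thesis unfolding \<pi>N by (simp add: c_def power2_eq_square)
      qed
      have \<pi>0: "\<pi> > 0" unfolding \<pi>_def using nr \<kappa>r by (intro divide_pos_pos zero_less_power) linarith+
      have \<pi>N_le: "\<pi> * real N \<le> (real \<kappa>)\<^sup>2" by (simp only: \<pi>N)
      have h01: "h x = 0 \<or> h x = 1" for x by (simp add: h_def)
      obtain F where F: "F \<in> sets ?P" "P.prob F \<le> 1 / (8 * real n)"
        "\<forall>xs\<in>space ?P - F. \<forall>M. (\<forall>i<N. (nrm n (\<psi> (xs i)))\<^sup>2 \<le> M) \<longrightarrow>
           sparse_bound n N \<kappa> (\<lambda>i d. h (xs i) * \<psi> (xs i) d) (C1 * (M + \<tau>\<^sup>2))"
        using heavy_part[OF hm h01 h\<pi> \<pi>0 \<pi>N_le c\<kappa> u] by blast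
      define \<Gamma> where "\<Gamma> = exp 2 * c * real N"
      have tvl: "tail_vector \<mu> (\<lambda>x d. (1 - h x) * \<psi> x d) n p 1"
      proof (rule scaled)
        show "(\<lambda>x. 1 - h x) \<in> borel_measurable \<mu>" using hm by measurable
        show "0 \<le> 1 - h x \<and> 1 - h x \<le> 1" for x using h01[of x] by auto
      qed (auto intro: emeasure_le_1)
      have lnorm: "\<forall>x\<in>space \<mu>. nrm n (\<lambda>d. (1 - h x) * \<psi> x d) \<le> T"
        using T0 by (auto simp: nrm_scale h_def)
      have N1: "0 < N" using nr by simp
      obtain F' where F': "F' \<in> sets ?P" "P.prob F' \<le> 1 / (8 * real n)"
        "\<forall>xs\<in>space ?P - F'. sparse_bound n N \<kappa> (\<lambda>i d. (1 - h (xs i)) * \<psi> (xs i) d) (C2 * (ln \<Gamma>) ^ 3 * T\<^sup>2)"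
        using light[OF tvl g n \<kappa>(2) N1 cN \<Gamma>_def T_def lnorm] by blast
      have ln\<Gamma>: "2 * (C2 * (ln \<Gamma>) ^ 3 * T\<^sup>2) \<le> 3 * C2 * c3 ^ 3 * real K0 * (G * L ^ 4)"
      proof -
        have "ln \<Gamma> = 2 + ln c + ln (real N)" unfolding \<Gamma>_def using c1 nr by (simp add: ln_mult)
        also have "\<dots> \<le> (2 + ln c) * ((3/2) * L) + 2 * L"
        proof -
          have "(2 + ln c) * 1 \<le> (2 + ln c) * ((3/2) * L)" using L23 c1 by (intro mult_left_mono) auto
          then have "2 + ln c \<le> (2 + ln c) * ((3/2) * L)" by simp
          then show ?thesis using \<kappa>L(2) by (rule add_mono)
        qed
        also have "\<dots> = c3 * L" by (simp add: c3_def algebra_simps)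
        finally have le: "ln \<Gamma> \<le> c3 * L" .
        have "ln \<Gamma> \<ge> 0"
        proof (rule ln_ge_zero)
          have "(1::real) * 1 * 1 \<le> exp 2 * c * real N" using c1 nr by (intro mult_mono) auto
          then show "1 \<le> \<Gamma>" by (simp add: \<Gamma>_def)
        qed
        with le have "(ln \<Gamma>) ^ 3 \<le> (c3 * L) ^ 3" by (intro power_mono) auto
        also have "\<dots> = c3 ^ 3 * L ^ 3" by (simp add: power_mult_distrib)
        also have "\<dots> \<le> c3 ^ 3 * ((3/2) * L ^ 4)"
        proof (intro mult_left_mono)
          have "(2/3) * L ^ 3 \<le> L * L ^ 3" using L23 by (intro mult_right_mono) auto
          then show "L ^ 3 \<le> (3/2) * L ^ 4" by (simp add: power4_eq_xxxx power3_eq_cube)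
        qed (use c3 in auto)
        finally have "C2 * (ln \<Gamma>) ^ 3 * T\<^sup>2 \<le> C2 * (c3 ^ 3 * ((3/2) * L ^ 4)) * (real K0 * G)"
          using T2 C2 c3 \<open>0 \<le> ln \<Gamma>\<close> by (intro mult_mono mult_left_mono) auto
        then show ?thesis by (simp add: algebra_simps)
      qed
      show ?thesis
      proof (intro bexI[of _ "F \<union> F'"] conjI ballI allI impI)
        have "P.prob (F \<union> F') \<le> P.prob F + P.prob F'" using F F' by (intro measure_Un_le) auto
        also have "\<dots> \<le> 1 / (8 * real n) + 1 / (8 * real n)" using F(2) F'(2) by (rule add_mono)
        also have "\<dots> = 1 / (4 * real n)" by simp
        finally show "P.prob (F \<union> F') \<le> 1 / (4 * real n)" .
        fix xs M assume xs: "xs \<in> space ?P - (F \<union> F')" and M: "\<forall>i<N. (nrm n (\<psi> (xs i)))\<^sup>2 \<le> M"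
        have M0: "M \<ge> 0" using M N1 by (meson order_trans zero_le_power2)
        have sb: "sparse_bound n N \<kappa> (\<lambda>i. \<psi> (xs i)) (2 * (C1 * (M + \<tau>\<^sup>2)) + 2 * (C2 * (ln \<Gamma>) ^ 3 * T\<^sup>2))"
          by (rule sparse_bound_add[where y="\<lambda>i d. h (xs i) * \<psi> (xs i) d" and z="\<lambda>i d. (1 - h (xs i)) * \<psi> (xs i) d"]) (use F(3) F'(3) xs M in \<open>auto simp: left_diff_distrib\<close>)
        have "2 * (C1 * (M + \<tau>\<^sup>2)) + 2 * (C2 * (ln \<Gamma>) ^ 3 * T\<^sup>2) \<le> 2 * C1 * (1 + 64 * real K0) * (M + G * L ^ 4) + 3 * C2 * c3 ^ 3 * real K0 * (G * L ^ 4)"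
          using heavy_le[OF M0] ln\<Gamma> by (rule add_mono)
        also have "\<dots> \<le> 2 * C1 * (1 + 64 * real K0) * (M + G * L ^ 4) + 3 * C2 * c3 ^ 3 * real K0 * (M + G * L ^ 4)"
          using C2 c3 M0 by (intro add_left_mono mult_left_mono) auto
        also have "\<dots> = C * (M + G * L ^ 4)" by (simp add: C_def algebra_simps)
        finally show "sparse_bound n N \<kappa> (\<lambda>i. \<psi> (xs i)) (C * (M + G * L ^ 4))" by (rule sparse_bound_mono[OF sb])
      qed (use F F' in auto)
    qed
    then show "\<exists>F\<in>sets ?P. P.prob F \<le> 1 / (4 * real n) \<and>
        (\<forall>xs\<in>space ?P - F. \<forall>M. (\<forall>i<N. (nrm n (\<psi> (xs i)))\<^sup>2 \<le> M) \<longrightarrow>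
           sparse_bound n N (K0 * n) (\<lambda>i. \<psi> (xs i))
             (C * (M + real N powr (2/p) * real n powr (1 - 2/p) * (ln (real N / real n)) ^ 4)))"
      by (simp only: \<kappa>_def G_def L_def)
  qed
qed

section \<open>Concentration in a fixed direction and on a net\<close>

lemma (in prob_space) chernoff_product:
  fixes f :: "'a \<Rightarrow> real"
  assumes f[measurable]: "f \<in> borel_measurable M" and m: "(\<integral>\<^sup>+x. ennreal (exp (f x)) \<partial>M) \<le> ennreal (exp m)"
  shows "{xs \<in> space (PiM {..<N} (\<lambda>_. M)). s \<le> (\<Sum>k<N. f (xs k))} \<in> sets (PiM {..<N} (\<lambda>_. M))"
    and "measure (PiM {..<N} (\<lambda>_. M)) {xs \<in> space (PiM {..<N} (\<lambda>_. M)). s \<le> (\<Sum>k<N. f (xs k))} \<le> exp (real N * m - s)"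
proof -
  interpret PS: product_sigma_finite "\<lambda>_::nat. M" by standard
  let ?P = "PiM {..<N} (\<lambda>_. M)"
  interpret P: prob_space ?P by (intro prob_space_PiM prob_space_axioms)
  have fk[measurable]: "(\<lambda>xs. f (xs k)) \<in> borel_measurable ?P" if "k < N" for k
    using measurable_compose[of "\<lambda>xs. xs k" ?P M f borel] measurable_component_singleton[of k "{..<N}" "\<lambda>_. M"] f that
    by auto
  have S[measurable]: "(\<lambda>xs. \<Sum>k<N. f (xs k)) \<in> borel_measurable ?P" by (intro borel_measurable_sum fk) auto
  show sets: "{xs \<in> space ?P. s \<le> (\<Sum>k<N. f (xs k))} \<in> sets ?P" by measurable
  have "emeasure ?P {xs \<in> space ?P. s \<le> (\<Sum>k<N. f (xs k))} \<le> (\<integral>\<^sup>+ xs. ennreal (exp (- s)) * ennreal (exp (\<Sum>k<N. f (xs k))) \<partial>?P)"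
  proof -
    have "emeasure ?P {xs \<in> space ?P. s \<le> (\<Sum>k<N. f (xs k))} = (\<integral>\<^sup>+ xs. indicator {xs \<in> space ?P. s \<le> (\<Sum>k<N. f (xs k))} xs \<partial>?P)"
      using sets by simp
    also have "\<dots> \<le> (\<integral>\<^sup>+ xs. ennreal (exp (- s)) * ennreal (exp (\<Sum>k<N. f (xs k))) \<partial>?P)"
    proof (intro nn_integral_mono)
      fix xs
      show "(indicator {xs \<in> space ?P. s \<le> (\<Sum>k<N. f (xs k))} xs :: ennreal) \<le> ennreal (exp (- s)) * ennreal (exp (\<Sum>k<N. f (xs k)))"
      proof (cases "s \<le> (\<Sum>k<N. f (xs k))")
        case True
        have "1 \<le> exp (- s) * exp (\<Sum>k<N. f (xs k))" using True by (simp flip: exp_add)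
        then have "ennreal 1 \<le> ennreal (exp (- s) * exp (\<Sum>k<N. f (xs k)))" by (rule ennreal_leI)
        then show ?thesis by (auto simp: indicator_def ennreal_mult)
      qed (auto simp: indicator_def)
    qed
    finally show ?thesis .
  qed
  also have "\<dots> = ennreal (exp (- s)) * (\<integral>\<^sup>+ xs. (\<Prod>k<N. ennreal (exp (f (xs k)))) \<partial>?P)"
    by (simp add: nn_integral_cmult exp_sum prod_ennreal)
  also have "(\<integral>\<^sup>+ xs. (\<Prod>k<N. ennreal (exp (f (xs k)))) \<partial>?P) = (\<Prod>k<N. \<integral>\<^sup>+ x. ennreal (exp (f x)) \<partial>M)"
    by (rule PS.product_nn_integral_prod) auto
  also have "\<dots> \<le> (\<Prod>k<N. ennreal (exp m))" by (intro prod_mono_ennreal m)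
  also have "\<dots> = ennreal (exp (real N * m))" by (simp add: ennreal_power exp_of_nat_mult)
  finally have "emeasure ?P {xs \<in> space ?P. s \<le> (\<Sum>k<N. f (xs k))} \<le> ennreal (exp (- s)) * ennreal (exp (real N * m))"
    by (simp add: mult_left_mono)
  also have "\<dots> = ennreal (exp (real N * m - s))" by (simp add: ennreal_mult[symmetric] exp_diff exp_minus divide_inverse mult.commute)
  finally show "P.prob {xs \<in> space ?P. s \<le> (\<Sum>k<N. f (xs k))} \<le> exp (real N * m - s)"
    by (simp add: P.emeasure_eq_measure)
qed

text \<open>For negative \<open>u = - v\<close> the claim is inverted:
  \<open>1 - v + v\<^sup>2\<close> times the quadratic lower bound of \<open>exp v\<close> is at
  least 1.\<close>

lemma exp_le_quadratic: "u \<le> 1 \<Longrightarrow> exp u \<le> 1 + u + u\<^sup>2" for u :: real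
proof -
  assume u: "u \<le> 1"
  show ?thesis
  proof (cases "u \<ge> 0")
    case True then show ?thesis using u by (intro exp_bound) auto
  next
    case False
    define v where "v = - u"
    have v: "v \<ge> 0" using False by (simp add: v_def)
    have q: "1 + v + v\<^sup>2 / 2 \<le> exp v" using exp_lower_Taylor_quadratic[OF v] .
    have "1 + v + v\<^sup>2 / 2 > 0" using v by (simp add: add_pos_nonneg)
    have "1 \<le> (1 - v + v\<^sup>2) * (1 + v + v\<^sup>2 / 2)"
    proof -
      have "(1 - v + v\<^sup>2) * (1 + v + v\<^sup>2 / 2) = 1 + v\<^sup>2 / 2 + v ^ 3 / 2 + v ^ 4 / 2"
        by (simp add: field_simps power2_eq_square power3_eq_cube power4_eq_xxxx)
      then show ?thesis using v by simp
    qed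
    also have "\<dots> \<le> (1 - v + v\<^sup>2) * exp v"
    proof (intro mult_left_mono q)
      have "1 - v + v\<^sup>2 = (v - 1/2)\<^sup>2 + 3/4" by (simp add: power2_eq_square field_simps)
      then show "0 \<le> 1 - v + v\<^sup>2" by simp
    qed
    finally have "exp (- v) \<le> 1 - v + v\<^sup>2" by (simp add: exp_minus field_simps)
    then show ?thesis by (simp add: v_def)
  qed
qed

text \<open>Bernstein's estimate. Only an upper bound on the exponent is required, and it is at most
  \<open>r * \<tau> \<le> 1\<close> for both signs because \<open>W\<close> and its mean lie between
  0 and \<open>\<tau>\<close>. The linear term has mean zero, and the second moment of
  \<open>W\<close> dominates its variance.\<close>

lemma (in prob_space) truncated_mgf_le:
  fixes W :: "'a \<Rightarrow> real"
  assumes W[measurable]: "W \<in> borel_measurable M" and b: "\<And>x. 0 \<le> W x \<and> W x \<le> \<tau>" and V: "(\<integral>x. (W x)\<^sup>2 \<partial>M) \<le> V"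
    and r: "0 \<le> r" "r * \<tau> \<le> 1" and \<sigma>: "\<sigma> = 1 \<or> \<sigma> = -1"
  shows "(\<integral>\<^sup>+x. ennreal (exp (\<sigma> * r * (W x - expectation W))) \<partial>M) \<le> ennreal (exp (r\<^sup>2 * V))"
proof -
  have \<tau>0: "0 \<le> \<tau>" using b order_trans by blast
  have iW: "integrable M W" by (rule integrable_const_bound[where B=\<tau>]) (use b in auto)
  have iW2: "integrable M (\<lambda>x. (W x)\<^sup>2)"
    by (rule integrable_const_bound[where B="\<tau>\<^sup>2"]) (use b in \<open>auto intro!: power_mono\<close>)
  define E where "E = expectation W"
  have E: "0 \<le> E" "E \<le> \<tau>"
  proof -
    show "0 \<le> E" unfolding E_def using b by (intro integral_nonneg_AE) auto
    have "E \<le> expectation (\<lambda>_. \<tau>)" unfolding E_def using b iW by (intro integral_mono) auto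
    then show "E \<le> \<tau>" by (simp add: prob_space)
  qed
  define u where "u x = \<sigma> * r * (W x - E)" for x
  have u1: "u x \<le> 1" for x
  proof -
    have "u x \<le> r * \<tau>"
    proof (cases "\<sigma> = 1")
      case True
      have "r * (W x - E) \<le> r * \<tau>" using b[of x] E r by (intro mult_left_mono) auto
      then show ?thesis using True by (simp add: u_def)
    next
      case False
      then have "\<sigma> = -1" using \<sigma> by simp
      moreover have "r * (E - W x) \<le> r * \<tau>" using b[of x] E r by (intro mult_left_mono) auto
      ultimately show ?thesis by (simp add: u_def algebra_simps)
    qed
    then show ?thesis using r by linarith
  qed
  have u2: "(u x)\<^sup>2 = r\<^sup>2 * ((W x)\<^sup>2 - 2 * E * W x + E\<^sup>2)" for x
    using \<sigma> by (auto simp: u_def power2_eq_square algebra_simps)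
  have iu: "integrable M u" unfolding u_def using iW by simp
  have iu2: "integrable M (\<lambda>x. (u x)\<^sup>2)" unfolding u2 using iW iW2 by simp
  have Eu: "expectation u = 0" unfolding u_def using iW by (simp add: E_def prob_space)
  have Eu2: "expectation (\<lambda>x. (u x)\<^sup>2) \<le> r\<^sup>2 * V"
  proof -
    have "expectation (\<lambda>x. (u x)\<^sup>2) = r\<^sup>2 * (expectation (\<lambda>x. (W x)\<^sup>2) - 2 * E * E + E\<^sup>2)"
      unfolding u2 using iW iW2 by (simp add: E_def prob_space)
    also have "\<dots> = r\<^sup>2 * (expectation (\<lambda>x. (W x)\<^sup>2) - E\<^sup>2)" by (simp add: power2_eq_square)
    also have "\<dots> \<le> r\<^sup>2 * V"
    proof (rule mult_left_mono)
      show "expectation (\<lambda>x. (W x)\<^sup>2) - E\<^sup>2 \<le> V" using V zero_le_power2[of E] by linarith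
    qed simp
    finally show ?thesis .
  qed
  have "(\<integral>\<^sup>+x. ennreal (exp (u x)) \<partial>M) \<le> (\<integral>\<^sup>+x. ennreal (1 + u x + (u x)\<^sup>2) \<partial>M)"
    by (intro nn_integral_mono ennreal_leI exp_le_quadratic u1)
  also have "\<dots> = ennreal (expectation (\<lambda>x. 1 + u x + (u x)\<^sup>2))"
  proof (intro nn_integral_eq_integral AE_I2)
    show "integrable M (\<lambda>x. 1 + u x + (u x)\<^sup>2)" using iu iu2 by simp
    show "0 \<le> 1 + u x + (u x)\<^sup>2" for x using exp_le_quadratic[OF u1[of x]] exp_ge_zero[of "u x"] by linarith
  qed
  also have "expectation (\<lambda>x. 1 + u x + (u x)\<^sup>2) = 1 + expectation (\<lambda>x. (u x)\<^sup>2)" using iu iu2 Eu by (simp add: prob_space)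
  also have "ennreal \<dots> \<le> ennreal (exp (r\<^sup>2 * V))"
    using Eu2 exp_ge_add_one_self[of "r\<^sup>2 * V"] by (intro ennreal_leI) linarith
  finally show ?thesis by (simp add: u_def E_def)
qed

text \<open>The squares are capped at \<open>\<tau>\<close>. Three events are excluded: an upward or
  a downward deviation of the sum of the capped squares, and too many squares above
  \<open>\<tau>\<close>. The cap changes the mean by little, and the squares above it remain in the
  bound because moments alone do not control their sum well enough.\<close>

lemma (in prob_space) direction_concentration:
  fixes X :: "'a \<Rightarrow> real"
  assumes X[measurable]: "X \<in> borel_measurable M" and X2: "integrable M (\<lambda>x. (X x)\<^sup>2)" "expectation (\<lambda>x. (X x)\<^sup>2) = 1"
    and Xp: "(\<integral>\<^sup>+x. ennreal (\<bar>X x\<bar> powr p) \<partial>M) \<le> ennreal B" and p: "p > 2" and B: "B \<ge> 1"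
    and n: "1 \<le> n" "n \<le> N"
    and \<tau>: "\<tau> = (B * (real N / real n)) powr (2/p)"
    and U: "U = B powr (2/p) * ((real n / real N) powr (1 - 2/p) + (real n / real N) powr (1 - 2 / min p 4))"
  shows "\<exists>F\<in>sets (PiM {..<N} (\<lambda>_. M)). measure (PiM {..<N} (\<lambda>_. M)) F \<le> 3 * exp ((2 - real K) * real n) \<and>
    (\<forall>xs\<in>space (PiM {..<N} (\<lambda>_. M)) - F. card {k. k < N \<and> \<tau> < (X (xs k))\<^sup>2} \<le> K * n \<and>
       \<bar>(\<Sum>k<N. (X (xs k))\<^sup>2) - real N\<bar> \<le> (real K + 1) * (real N * U) + (\<Sum>k\<in>{k. k < N \<and> \<tau> < (X (xs k))\<^sup>2}. (X (xs k))\<^sup>2))"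
proof -
  let ?P = "PiM {..<N} (\<lambda>_. M)"
  interpret P: prob_space ?P by (intro prob_space_PiM prob_space_axioms)
  define w where "w = real N / real n"
  define q where "q = min p 4"
  have nN: "real n \<ge> 1" "real N \<ge> real n" using n by auto
  have w: "w \<ge> 1" using nN by (simp add: w_def)
  have q: "2 < q" "q \<le> p" "q \<le> 4" "q = p \<or> q = 4" using p by (auto simp: q_def)
  have \<tau>w: "\<tau> = B powr (2/p) * w powr (2/p)" using B w by (simp add: \<tau> w_def[symmetric] powr_mult)
  have \<tau>0: "\<tau> > 0" using B w by (simp add: \<tau>w)
  have nw: "real n / real N = 1 / w" by (simp add: w_def)
  \<comment> \<open>\<open>U1 = \<tau> * n / N\<close> measures the range of the capped squares and
    the loss in their mean, \<open>U2\<close> the variance. For \<open>p \<le> 4\<close> the two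
    coincide since then \<open>q = p\<close>.\<close>
  define U1 where "U1 = B powr (2/p) * w powr (2/p - 1)"
  define U2 where "U2 = B powr (2/p) * w powr (2/q - 1)"
  have U12: "U = U1 + U2"
  proof -
    have "(1 / w) powr (1 - e) = w powr (e - 1)" for e using w by (simp add: powr_divide powr_minus_divide[symmetric])
    then show ?thesis unfolding U nw U1_def U2_def q_def by (simp add: distrib_left)
  qed
  have U0: "U1 > 0" "U2 > 0" "U > 0" using B w by (auto simp: U1_def U2_def U12 intro!: add_pos_pos)
  have ip: "integrable M (\<lambda>x. \<bar>X x\<bar> powr p)"
    using Xp by (intro integrableI_nonneg) (auto simp: less_top[symmetric] top_unique)
  have Ep: "expectation (\<lambda>x. \<bar>X x\<bar> powr p) \<le> B"
  proof -
    have "ennreal (expectation (\<lambda>x. \<bar>X x\<bar> powr p)) = (\<integral>\<^sup>+x. ennreal (\<bar>X x\<bar> powr p) \<partial>M)"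
      using ip by (subst nn_integral_eq_integral) auto
    then have "ennreal (expectation (\<lambda>x. \<bar>X x\<bar> powr p)) \<le> ennreal B" using Xp by simp
    then show ?thesis using B by simp
  qed
  define W where "W x = min ((X x)\<^sup>2) \<tau>" for x
  have W[measurable]: "W \<in> borel_measurable M" unfolding W_def by measurable
  have Wb: "0 \<le> W x \<and> W x \<le> \<tau>" for x using \<tau>0 by (simp add: W_def)
  have iW: "integrable M W" by (rule integrable_const_bound[where B=\<tau>]) (use Wb in auto)
  have sqpow: "(X x)\<^sup>2 = \<bar>X x\<bar> powr 2" for x by (simp add: powr_numeral)
  have EW: "1 - expectation W \<le> U1" "expectation W \<le> 1"
  proof -
    have le: "(X x)\<^sup>2 - W x \<le> \<tau> powr (1 - p/2) * \<bar>X x\<bar> powr p" for x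
    proof (cases "\<tau> < (X x)\<^sup>2")
      case True
      then have X0: "\<bar>X x\<bar> > 0" using \<tau>0 by auto
      have "\<tau> powr (1/2) \<le> \<bar>X x\<bar>"
      proof -
        have "sqrt \<tau> \<le> sqrt ((X x)\<^sup>2)" using True by (intro real_sqrt_le_mono) simp
        then show ?thesis using \<tau>0 by (simp add: powr_half_sqrt)
      qed
      then have "(\<tau> powr (1/2)) powr (p - 2) \<le> \<bar>X x\<bar> powr (p - 2)" using p by (intro powr_mono2) auto
      then have "\<tau> powr (p/2 - 1) \<le> \<bar>X x\<bar> powr (p - 2)" by (simp add: powr_powr diff_divide_distrib)
      then have "\<tau> powr (1 - p/2) * (\<tau> powr (p/2 - 1) * (X x)\<^sup>2) \<le> \<tau> powr (1 - p/2) * (\<bar>X x\<bar> powr (p - 2) * (X x)\<^sup>2)"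
        by (intro mult_right_mono mult_left_mono) auto
      moreover have "\<tau> powr (1 - p/2) * (\<tau> powr (p/2 - 1) * (X x)\<^sup>2) = (X x)\<^sup>2"
        using \<tau>0 by (simp add: mult.assoc[symmetric] flip: powr_add)
      moreover have "\<bar>X x\<bar> powr (p - 2) * (X x)\<^sup>2 = \<bar>X x\<bar> powr p"
        unfolding sqpow powr_add[symmetric] by simp
      ultimately have "(X x)\<^sup>2 \<le> \<tau> powr (1 - p/2) * \<bar>X x\<bar> powr p" by (simp only:)
      then show ?thesis using Wb[of x] by linarith
    qed (auto simp: W_def)
    have "1 - expectation W = expectation (\<lambda>x. (X x)\<^sup>2 - W x)" using X2 iW by simp
    also have "\<dots> \<le> expectation (\<lambda>x. \<tau> powr (1 - p/2) * \<bar>X x\<bar> powr p)" using le X2 iW ip by (intro integral_mono) auto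
    also have "\<dots> \<le> \<tau> powr (1 - p/2) * B" using Ep by (simp add: mult_left_mono)
    also have "\<dots> = U1"
    proof -
      have e: "(2/p) * (1 - p/2) = 2/p - 1" using p by (simp add: field_simps)
      have "\<tau> powr (1 - p/2) = B powr (2/p - 1) * w powr (2/p - 1)"
        unfolding \<tau>w using B w by (simp only: powr_mult powr_ge_zero powr_powr e)
      moreover have "B powr (2/p - 1) * B = B powr (2/p)" using B powr_add[of B "2/p - 1" 1] by simp
      ultimately show ?thesis by (simp add: U1_def mult_ac)
    qed
    finally show "1 - expectation W \<le> U1" .
    have "expectation W \<le> expectation (\<lambda>x. (X x)\<^sup>2)" using X2 iW by (intro integral_mono) (auto simp: W_def)
    then show "expectation W \<le> 1" using X2 by simp
  qed
  define V where "V = 2 * B powr (4/p) * w powr ((4 - q) / p)"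
  have V: "expectation (\<lambda>x. (W x)\<^sup>2) \<le> V"
  proof -
    \<comment> \<open>Splitting at \<open>l\<close> bounds the q-th moment by
      \<open>2 * B powr (q / p)\<close> directly from the p-th moment, as
      \<open>q \<le> p\<close>.\<close>
    define l where "l = B powr (1/p)"
    have l0: "l > 0" using B by (simp add: l_def)
    have le: "(W x)\<^sup>2 \<le> \<tau> powr (2 - q/2) * (l powr q + l powr (q - p) * \<bar>X x\<bar> powr p)" for x
    proof (cases "X x = 0")
      case True
      then show ?thesis using \<tau>0 by (simp add: W_def)
    next
      case False
      have W0: "W x > 0" using False \<tau>0 by (simp add: W_def)
      have "(W x)\<^sup>2 = W x powr (2 - q/2) * W x powr (q/2)" using W0 by (simp add: powr_numeral flip: powr_add)
      also have "\<dots> \<le> \<tau> powr (2 - q/2) * ((X x)\<^sup>2) powr (q/2)"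
        using W0 Wb[of x] q by (intro mult_mono powr_mono2) (auto simp: W_def)
      also have "((X x)\<^sup>2) powr (q/2) = \<bar>X x\<bar> powr q" unfolding sqpow powr_powr by simp
      also have "\<bar>X x\<bar> powr q \<le> l powr q + l powr (q - p) * \<bar>X x\<bar> powr p"
      proof (cases "\<bar>X x\<bar> \<le> l")
        case True
        then have "\<bar>X x\<bar> powr q \<le> l powr q" using q by (intro powr_mono2) auto
        then show ?thesis by (simp add: add_increasing2)
      next
        case False
        have "\<bar>X x\<bar> powr (q - p) \<le> l powr (q - p)" using False l0 q by (intro powr_mono2') auto
        then have "\<bar>X x\<bar> powr (q - p) * \<bar>X x\<bar> powr p \<le> l powr (q - p) * \<bar>X x\<bar> powr p" by (intro mult_right_mono) auto
        moreover have "\<bar>X x\<bar> powr (q - p) * \<bar>X x\<bar> powr p = \<bar>X x\<bar> powr q" by (simp flip: powr_add)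
        ultimately show ?thesis by (simp add: add_increasing)
      qed
      finally show ?thesis by (simp add: mult_left_mono)
    qed
    have iW2: "integrable M (\<lambda>x. (W x)\<^sup>2)"
      by (rule integrable_const_bound[where B="\<tau>\<^sup>2"]) (use Wb in \<open>auto intro!: power_mono\<close>)
    have "expectation (\<lambda>x. (W x)\<^sup>2) \<le> expectation (\<lambda>x. \<tau> powr (2 - q/2) * (l powr q + l powr (q - p) * \<bar>X x\<bar> powr p))"
      using le ip iW2 by (intro integral_mono) auto
    also have "\<dots> = \<tau> powr (2 - q/2) * (l powr q + l powr (q - p) * expectation (\<lambda>x. \<bar>X x\<bar> powr p))"
      using ip by (simp add: prob_space)
    also have "\<dots> \<le> \<tau> powr (2 - q/2) * (l powr q + l powr (q - p) * B)" using Ep by (intro mult_left_mono add_left_mono) auto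
    also have "l powr (q - p) * B = l powr q"
    proof -
      have "l powr p = B" using B p by (simp add: l_def powr_powr)
      then show ?thesis by (metis diff_add_cancel powr_add)
    qed
    also have "\<tau> powr (2 - q/2) * (l powr q + l powr q) = V"
    proof -
      have e1: "(2/p) * (2 - q/2) = (4 - q)/p" using p by (simp add: field_simps)
      have "\<tau> powr (2 - q/2) = B powr ((4 - q)/p) * w powr ((4 - q)/p)" using B w unfolding \<tau>w by (simp only: powr_mult powr_ge_zero powr_powr e1)
      moreover have "l powr q = B powr (q/p)" by (simp add: l_def powr_powr)
      moreover have "B powr ((4 - q)/p) * B powr (q/p) = B powr (4/p)" by (simp flip: powr_add add_divide_distrib)
      ultimately show ?thesis by (simp add: V_def mult_ac)
    qed
    finally show ?thesis .
  qed
  \<comment> \<open>With this parameter the exponent \<open>s = K * n\<close> of the Chernoff bound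
    corresponds to a deviation of \<open>K * N * U\<close>. The conditions
    \<open>r * \<tau> \<le> 1\<close> and \<open>N * r\<^sup>2 * V \<le> 2 * n\<close> come from
    \<open>U1 \<le> U\<close> and \<open>U2 \<le> U\<close>.\<close>
  define r where "r = real n / (real N * U)"
  have r0: "r \<ge> 0" using U0 by (simp add: r_def)
  have w1: "w powr (e - 1) = w powr e / w" for e using w by (simp add: powr_diff)
  have r\<tau>: "r * \<tau> \<le> 1"
  proof -
    have "\<tau> / w = U1" by (simp add: \<tau>w U1_def w1)
    then have "\<tau> / w \<le> U" using U0 U12 by simp
    then have "\<tau> / w / U \<le> U / U" using U0 by (intro divide_right_mono) auto
    then have "\<tau> / w / U \<le> 1" using U0 by simp
    then show ?thesis by (simp add: r_def w_def mult_ac)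
  qed
  have NV: "real N * (r\<^sup>2 * V) \<le> 2 * real n"
  proof -
    have "V / w \<le> 2 * U\<^sup>2"
    proof -
      have "V / w = 2 * (B powr (2/p))\<^sup>2 * (w powr ((4 - q)/p) / w)"
        by (simp add: V_def power2_eq_square flip: powr_add)
      also have "w powr ((4 - q)/p) / w = (w powr (2/q - 1))\<^sup>2"
      proof -
        have "w powr ((4 - q)/p - 1) = w powr (2 * (2/q - 1))"
          using q(4) p by (auto simp: field_simps)
        then show ?thesis by (simp add: w1[symmetric] power2_eq_square flip: powr_add)
      qed
      also have "2 * (B powr (2/p))\<^sup>2 * (w powr (2/q - 1))\<^sup>2 = 2 * U2\<^sup>2" by (simp add: U2_def power_mult_distrib)
      also have "\<dots> \<le> 2 * U\<^sup>2" using U0 U12 by (intro mult_left_mono power_mono) auto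
      finally show ?thesis .
    qed
    then have "V / w / U\<^sup>2 \<le> 2 * U\<^sup>2 / U\<^sup>2" by (intro divide_right_mono) auto
    then have "V / w / U\<^sup>2 \<le> 2" using U0 by simp
    then have "real n * (V / w / U\<^sup>2) \<le> real n * 2" by (intro mult_left_mono) auto
    moreover have "real N * (r\<^sup>2 * V) = real n * (V / w / U\<^sup>2)"
      using nN U0 by (simp add: r_def w_def power2_eq_square field_simps)
    ultimately show ?thesis by simp
  qed
  define s where "s = real K * real n"
  define F1 where "F1 = {xs \<in> space ?P. s \<le> (\<Sum>k<N. 1 * r * (W (xs k) - expectation W))}"
  define F2 where "F2 = {xs \<in> space ?P. s \<le> (\<Sum>k<N. (-1) * r * (W (xs k) - expectation W))}"
  define c where "c x = (if \<tau> < (X x)\<^sup>2 then 1 else 0 :: real)" for x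
  have cm[measurable]: "c \<in> borel_measurable M" unfolding c_def by measurable
  define F3 where "F3 = {xs \<in> space ?P. s \<le> (\<Sum>k<N. c (xs k))}"
  have bound: "exp (real N * m - s) \<le> exp ((2 - real K) * real n)" if "real N * m \<le> 2 * real n" for m
    using that by (simp add: s_def algebra_simps)
  have F1: "F1 \<in> sets ?P" "P.prob F1 \<le> exp ((2 - real K) * real n)"
    unfolding F1_def using chernoff_product[OF _ truncated_mgf_le[OF W Wb V r0 r\<tau>, of 1], of N s] bound[OF NV]
    by (auto intro: order_trans)
  have F2: "F2 \<in> sets ?P" "P.prob F2 \<le> exp ((2 - real K) * real n)"
    unfolding F2_def using chernoff_product[OF _ truncated_mgf_le[OF W Wb V r0 r\<tau>, of "-1"], of N s] bound[OF NV]
    by (auto intro: order_trans)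
  have F3: "F3 \<in> sets ?P" "P.prob F3 \<le> exp ((2 - real K) * real n)"
  proof -
    define \<pi> where "\<pi> = real n / real N"
    \<comment> \<open>As \<open>c\<close> is 0 or 1 and \<open>exp 1 \<le> 3\<close>, the
      exponential is at most 1 plus twice the indicator of a large square, and Markov bounds the
      latter.\<close>
    have ex: "exp (c x) \<le> 1 + 2 * (\<tau> powr (- p/2) * \<bar>X x\<bar> powr p)" for x
    proof (cases "\<tau> < (X x)\<^sup>2")
      case True
      then have "\<tau> powr (p/2) \<le> ((X x)\<^sup>2) powr (p/2)" using \<tau>0 p by (intro powr_mono2) auto
      then have "\<tau> powr (p/2) \<le> \<bar>X x\<bar> powr p" unfolding sqpow powr_powr by simp
      then have "\<tau> powr (-p/2) * \<tau> powr (p/2) \<le> \<tau> powr (-p/2) * \<bar>X x\<bar> powr p" by (intro mult_left_mono) auto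
      moreover have "\<tau> powr (-p/2) * \<tau> powr (p/2) = 1" using \<tau>0 by (simp flip: powr_add)
      ultimately show ?thesis using True exp_le by (simp add: c_def)
    qed (simp add: c_def)
    have "(\<integral>\<^sup>+x. ennreal (exp (c x)) \<partial>M) \<le> (\<integral>\<^sup>+x. ennreal (1 + 2 * (\<tau> powr (- p/2) * \<bar>X x\<bar> powr p)) \<partial>M)"
      by (intro nn_integral_mono ennreal_leI ex)
    also have "\<dots> = ennreal (expectation (\<lambda>x. 1 + 2 * (\<tau> powr (- p/2) * \<bar>X x\<bar> powr p)))"
      using ip by (intro nn_integral_eq_integral) auto
    also have "expectation (\<lambda>x. 1 + 2 * (\<tau> powr (- p/2) * \<bar>X x\<bar> powr p)) = 1 + 2 * (\<tau> powr (- p/2) * expectation (\<lambda>x. \<bar>X x\<bar> powr p))"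
      using ip by (simp add: prob_space)
    also have "\<dots> \<le> 1 + 2 * (\<tau> powr (- p/2) * B)" using Ep by (intro add_left_mono mult_left_mono) auto
    also have "\<tau> powr (- p/2) * B = \<pi>"
    proof -
      have "\<tau> powr (- p/2) = (B * w) powr (- 1)" using p by (simp add: \<tau> w_def[symmetric] powr_powr)
      also have "\<dots> = 1 / (B * w)" using B w by (simp add: powr_minus_divide)
      finally show ?thesis using B by (simp add: \<pi>_def w_def)
    qed
    also have "1 + 2 * \<pi> \<le> exp (2 * \<pi>)" by (rule exp_ge_add_one_self)
    finally have "(\<integral>\<^sup>+x. ennreal (exp (c x)) \<partial>M) \<le> ennreal (exp (2 * \<pi>))" by (simp add: ennreal_leI)
    from chernoff_product[OF cm this, of N s] show "F3 \<in> sets ?P" "P.prob F3 \<le> exp ((2 - real K) * real n)"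
      unfolding F3_def using bound[of "2 * \<pi>"] nN by (auto simp: \<pi>_def intro: order_trans)
  qed
  show ?thesis
  proof (intro bexI[of _ "F1 \<union> F2 \<union> F3"] conjI ballI)
    have "P.prob (F1 \<union> F2 \<union> F3) \<le> P.prob (F1 \<union> F2) + P.prob F3" using F1 F2 F3 by (intro measure_Un_le) auto
    moreover have "P.prob (F1 \<union> F2) \<le> P.prob F1 + P.prob F2" using F1 F2 by (intro measure_Un_le) auto
    ultimately show "P.prob (F1 \<union> F2 \<union> F3) \<le> 3 * exp ((2 - real K) * real n)" using F1 F2 F3 by linarith
    fix xs assume xs: "xs \<in> space ?P - (F1 \<union> F2 \<union> F3)"
    let ?B = "{k. k < N \<and> \<tau> < (X (xs k))\<^sup>2}"
    have "(\<Sum>k<N. c (xs k)) < s" using xs by (auto simp: F3_def not_le)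
    moreover have "(\<Sum>k<N. c (xs k)) = (\<Sum>k\<in>?B. 1)"
      unfolding c_def by (rule sum.mono_neutral_cong_right) auto
    ultimately have "real (card ?B) < real (K * n)" by (simp add: s_def)
    then show "card ?B \<le> K * n" by linarith
    have a: "(\<Sum>k<N. r * (W (xs k) - expectation W)) < s" "(\<Sum>k<N. - (r * (W (xs k) - expectation W))) < s"
      using xs by (auto simp: F1_def F2_def not_le)
    define D where "D = (\<Sum>k<N. W (xs k)) - real N * expectation W"
    have "(\<Sum>k<N. r * (W (xs k) - expectation W)) = r * D"
      by (simp add: D_def sum_distrib_left[symmetric] sum_subtractf)
    then have "\<bar>r * D\<bar> < s" using a by (simp add: sum_negf)
    then have "r * \<bar>D\<bar> \<le> s" using r0 by (simp add: abs_mult)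
    then have D: "\<bar>D\<bar> \<le> real K * (real N * U)"
      using nN U0 by (simp add: r_def s_def field_simps)
    have "(\<Sum>k<N. (X (xs k))\<^sup>2 - W (xs k)) = (\<Sum>k\<in>?B. (X (xs k))\<^sup>2 - W (xs k))"
      by (rule sum.mono_neutral_right) (auto simp: W_def)
    then have d: "(\<Sum>k<N. (X (xs k))\<^sup>2) - (\<Sum>k<N. W (xs k)) = (\<Sum>k\<in>?B. (X (xs k))\<^sup>2 - W (xs k))" by (simp add: sum_subtractf)
    have d0: "0 \<le> (\<Sum>k\<in>?B. (X (xs k))\<^sup>2 - W (xs k))" by (intro sum_nonneg) (auto simp: W_def)
    have d1: "(\<Sum>k\<in>?B. (X (xs k))\<^sup>2 - W (xs k)) \<le> (\<Sum>k\<in>?B. (X (xs k))\<^sup>2)" using Wb by (intro sum_mono) auto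
    have "real N * (1 - expectation W) \<le> real N * U" using EW U0 U12 by (intro mult_left_mono) auto
    moreover have "0 \<le> real N * (1 - expectation W)" using EW by simp
    ultimately have e: "\<bar>real N * expectation W - real N\<bar> \<le> real N * U" by (simp add: algebra_simps)
    have "(\<Sum>k<N. (X (xs k))\<^sup>2) - real N = D + (\<Sum>k\<in>?B. (X (xs k))\<^sup>2 - W (xs k)) + (real N * expectation W - real N)"
      using d by (simp add: D_def)
    then have "\<bar>(\<Sum>k<N. (X (xs k))\<^sup>2) - real N\<bar> \<le> real K * (real N * U) + (\<Sum>k\<in>?B. (X (xs k))\<^sup>2) + real N * U"
      using D d0 d1 e by linarith
    then show "\<bar>(\<Sum>k<N. (X (xs k))\<^sup>2) - real N\<bar> \<le> (real K + 1) * (real N * U) + (\<Sum>k\<in>?B. (X (xs k))\<^sup>2)"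
      by (simp add: algebra_simps)
  qed (use F1 F2 F3 in auto)
qed

section \<open>Quadratic forms on a net and the isotropic case\<close>

text \<open>\<open>N\<close> times the quadratic form of the empirical covariance minus the
  identity.\<close>

definition quad_dev :: "nat \<Rightarrow> nat \<Rightarrow> (nat \<Rightarrow> nat \<Rightarrow> real) \<Rightarrow> (nat \<Rightarrow> real) \<Rightarrow> real" where
  "quad_dev n N x b = (\<Sum>k<N. (inner_n n b (x k))\<^sup>2) - real N * (nrm n b)\<^sup>2"

lemma quad_dev_scale: "quad_dev n N x (\<lambda>d. t * b d) = t\<^sup>2 * quad_dev n N x b"
  by (simp add: quad_dev_def inner_n_scale_left nrm_scale power_mult_distrib sum_distrib_left algebra_simps)

lemma quad_dev_zero:
  assumes "nrm n b = 0"
  shows "quad_dev n N x b = 0"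
proof -
  have "inner_n n b (x k) = 0" for k using inner_n_CS[of n b "x k"] assms by simp
  then show ?thesis using assms by (simp add: quad_dev_def)
qed

text \<open>Polarisation, with the two arguments of the bilinear form rescaled by 3 and 1/3 to balance
  their sizes.\<close>

lemma quad_dev_diff:
  "quad_dev n N x b - quad_dev n N x b' =
     (quad_dev n N x (\<lambda>d. 3 * (b d - b' d) + (b d + b' d) / 3) - quad_dev n N x (\<lambda>d. 3 * (b d - b' d) - (b d + b' d) / 3)) / 4"
proof -
  have sq: "r\<^sup>2 - r'\<^sup>2 = ((3 * (r - r') + (r + r') / 3)\<^sup>2 - (3 * (r - r') - (r + r') / 3)\<^sup>2) / 4" for r r' :: real
    by (simp add: power2_eq_square field_simps)
  have i: "inner_n n (\<lambda>d. 3 * (b d - b' d) + (b d + b' d) / 3) v = 3 * (inner_n n b v - inner_n n b' v) + (inner_n n b v + inner_n n b' v) / 3"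
    "inner_n n (\<lambda>d. 3 * (b d - b' d) - (b d + b' d) / 3) v = 3 * (inner_n n b v - inner_n n b' v) - (inner_n n b v + inner_n n b' v) / 3" for v
    unfolding inner_n_def sum_subtractf[symmetric] sum.distrib[symmetric] sum_distrib_left sum_divide_distrib
    by (auto intro!: sum.cong simp: field_simps)
  have s: "(\<Sum>k\<in>A. f k ^ 2) - (\<Sum>k\<in>A. g k ^ 2) = ((\<Sum>k\<in>A. (3 * (f k - g k) + (f k + g k) / 3)\<^sup>2) - (\<Sum>k\<in>A. (3 * (f k - g k) - (f k + g k) / 3)\<^sup>2)) / 4"
    for f g :: "nat \<Rightarrow> real" and A
    unfolding sum_subtractf[symmetric] sum_divide_distrib by (intro sum.cong refl sq)
  have "quad_dev n N x b - quad_dev n N x b' = ((\<Sum>k<N. (inner_n n b (x k))\<^sup>2) - (\<Sum>k<N. (inner_n n b' (x k))\<^sup>2))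
      - real N * ((\<Sum>d<n. (b d)\<^sup>2) - (\<Sum>d<n. (b' d)\<^sup>2))"
    by (simp add: quad_dev_def nrm_sq algebra_simps)
  also have "\<dots> = (quad_dev n N x (\<lambda>d. 3 * (b d - b' d) + (b d + b' d) / 3) - quad_dev n N x (\<lambda>d. 3 * (b d - b' d) - (b d + b' d) / 3)) / 4"
    unfolding s[of "\<lambda>k. inner_n n b (x k)"] s[of b] unfolding quad_dev_def i nrm_sq by (simp add: diff_divide_distrib right_diff_distrib)
  finally show ?thesis .
qed

text \<open>The supremum \<open>c0\<close> over the unit ball is compared with itself: rounding
  moves a vector by at most 1/4, the hypothesis covers the rounded vector, and polarisation bounds
  the difference through \<open>c0\<close> again. The result is
  \<open>c0 \<le> 25/16 * \<delta> + 9/16 * c0\<close>, and 25/7 is below 4.\<close>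

lemma quad_dev_net:
  assumes n: "n \<ge> 1" and \<delta>: "\<delta> \<ge> 0"
    and net: "\<And>z. z \<in> int_vectors n n (25 * n) \<Longrightarrow> \<bar>quad_dev n N x (\<lambda>d. real_of_int (z d))\<bar> \<le> \<delta> * (nrm n (\<lambda>d. real_of_int (z d)))\<^sup>2"
  shows "\<bar>quad_dev n N x b\<bar> \<le> 4 * \<delta> * (nrm n b)\<^sup>2"
proof -
  define Q where "Q = quad_dev n N x"
  define B1 where "B1 = {b. nrm n b \<le> 1}"
  define c0 where "c0 = (SUP b\<in>B1. \<bar>Q b\<bar>)"
  have bdd: "bdd_above ((\<lambda>b. \<bar>Q b\<bar>) ` B1)"
  proof (rule bdd_aboveI2)
    fix b assume b: "b \<in> B1"
    have "\<bar>Q b\<bar> \<le> \<bar>\<Sum>k<N. (inner_n n b (x k))\<^sup>2\<bar> + \<bar>real N * (nrm n b)\<^sup>2\<bar>" unfolding Q_def quad_dev_def by (rule abs_triangle_ineq4)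
    also have "\<dots> = (\<Sum>k<N. (inner_n n b (x k))\<^sup>2) + real N * (nrm n b)\<^sup>2" by (simp add: sum_nonneg)
    also have "\<dots> \<le> (\<Sum>k<N. (nrm n (x k))\<^sup>2) + real N * 1"
    proof (intro add_mono sum_mono mult_left_mono)
      fix k
      have "\<bar>inner_n n b (x k)\<bar> \<le> 1 * nrm n (x k)"
        using inner_n_CS[of n b "x k"] mult_right_mono[of "nrm n b" 1 "nrm n (x k)"] b by (auto simp: B1_def)
      then show "(inner_n n b (x k))\<^sup>2 \<le> (nrm n (x k))\<^sup>2" by (simp add: abs_le_square_iff[symmetric])
    next
      show "(nrm n b)\<^sup>2 \<le> 1" using b by (simp add: B1_def power_le_one)
    qed auto
    finally show "\<bar>Q b\<bar> \<le> (\<Sum>k<N. (nrm n (x k))\<^sup>2) + real N * 1" .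
  qed
  have ub: "\<bar>Q b\<bar> \<le> c0" if "nrm n b \<le> 1" for b
    unfolding c0_def using bdd that by (intro cSUP_upper) (auto simp: B1_def)
  have z0: "nrm n (\<lambda>_. 0) = 0" by (simp add: nrm_def L2_set_def)
  have c00: "c0 \<ge> 0" using ub[of "\<lambda>_. 0"] z0 by (simp add: order_trans[OF abs_ge_zero])
  have scaled: "\<bar>Q v\<bar> \<le> c0 * (nrm n v)\<^sup>2" for v
  proof (cases "nrm n v = 0")
    case True
    then show ?thesis by (simp add: Q_def quad_dev_zero)
  next
    case False
    then have v: "nrm n v > 0" using nrm_nonneg[of n v] by linarith
    have "nrm n (\<lambda>d. (1 / nrm n v) * v d) \<le> 1" using v by (simp only: nrm_scale) simp
    from ub[OF this] have "\<bar>(1 / nrm n v)\<^sup>2 * Q v\<bar> \<le> c0" by (simp only: Q_def quad_dev_scale)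
    then have "\<bar>Q v\<bar> / (nrm n v)\<^sup>2 \<le> c0" by (simp add: abs_mult power_divide)
    then show ?thesis using v by (simp add: field_simps)
  qed
  define c1 where "c1 = 25/16 * \<delta> + 9/16 * c0"
  have step: "\<bar>Q b\<bar> \<le> c1" if b: "nrm n b \<le> 1" for b
  proof -
    \<comment> \<open>At this scale the rounding error is at most \<open>sqrt n / m = 1/4\<close>.
      The rounded vector has norm at most 5/4, so \<open>z\<close> has squared norm at most 16 n *
      25/16 = 25 n, and for integers this bounds the sum of moduli as well.\<close>
    define m where "m = 4 * sqrt (real n)"
    have m: "m > 0" "m\<^sup>2 = 16 * real n" using n by (auto simp: m_def power_mult_distrib)
    define z where "z = restrict (\<lambda>d. \<lfloor>m * b d\<rfloor>) {..<n}"
    define b' where "b' d = real_of_int (z d) / m" for d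
    have zd: "\<bar>b d - b' d\<bar> \<le> 1 / m" if "d < n" for d
    proof -
      have "z d = \<lfloor>m * b d\<rfloor>" using that by (simp add: z_def)
      then have "\<bar>m * b d - real_of_int (z d)\<bar> \<le> 1" using floor_correct[of "m * b d"] by linarith
      moreover have "m * b d - real_of_int (z d) = m * (b d - b' d)" using m by (simp add: b'_def right_diff_distrib)
      ultimately have "m * \<bar>b d - b' d\<bar> \<le> 1" using m by (simp add: abs_mult)
      then show ?thesis using m by (simp add: field_simps)
    qed
    have a2: "(nrm n (\<lambda>d. b d - b' d))\<^sup>2 \<le> 1/16"
    proof -
      have "(nrm n (\<lambda>d. b d - b' d))\<^sup>2 \<le> (\<Sum>d<n. (1 / m)\<^sup>2)"
        unfolding nrm_sq
      proof (intro sum_mono)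
        fix d assume "d \<in> {..<n}"
        then show "(b d - b' d)\<^sup>2 \<le> (1 / m)\<^sup>2" using power_mono[OF zd, of d 2] by simp
      qed
      also have "\<dots> = 1/16" using m n by (simp add: power_divide)
      finally show ?thesis .
    qed
    have a: "nrm n (\<lambda>d. b d - b' d) \<le> 1/4"
    proof (rule power2_le_imp_le)
      show "(nrm n (\<lambda>d. b d - b' d))\<^sup>2 \<le> (1/4)\<^sup>2" using a2 by (simp add: power2_eq_square)
    qed simp
    have b'n: "nrm n b' \<le> 5/4"
    proof -
      have "nrm n b' = nrm n (\<lambda>d. b d + (-1) * (b d - b' d))" by simp
      also have "\<dots> \<le> nrm n b + nrm n (\<lambda>d. (-1) * (b d - b' d))" by (rule nrm_triangle)
      also have "nrm n (\<lambda>d. (-1) * (b d - b' d)) = nrm n (\<lambda>d. b d - b' d)" using nrm_scale[of n "-1" "\<lambda>d. b d - b' d"] by (simp only: abs_minus abs_one mult_1_left)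
      finally show ?thesis using a b by linarith
    qed
    have b'2: "(nrm n b')\<^sup>2 \<le> 25/16"
    proof -
      have "(nrm n b')\<^sup>2 \<le> (5/4)\<^sup>2" using b'n by (intro power_mono) auto
      then show ?thesis by (simp add: power2_eq_square)
    qed
    have zb: "(\<lambda>d. real_of_int (z d)) = (\<lambda>d. m * b' d)" using m by (simp add: b'_def)
    have nz: "(nrm n (\<lambda>d. real_of_int (z d)))\<^sup>2 = 16 * real n * (nrm n b')\<^sup>2" unfolding zb nrm_scale using m by (simp add: power_mult_distrib)
    have zin: "z \<in> int_vectors n n (25 * n)"
    proof -
      have "real_of_int (\<Sum>d<n. (z d)\<^sup>2) = 16 * real n * (nrm n b')\<^sup>2" using nz by (simp add: nrm_sq)
      also have "\<dots> \<le> 16 * real n * (25/16)" using b'2 by (intro mult_left_mono) auto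
      finally have "real_of_int (\<Sum>d<n. (z d)\<^sup>2) \<le> real_of_int (int (25 * n))" by simp
      then have z2: "(\<Sum>d<n. (z d)\<^sup>2) \<le> int (25 * n)" by (simp only: of_int_le_iff)
      have sq_ge: "\<bar>k\<bar> \<le> k\<^sup>2" for k :: int
      proof (cases "k = 0")
        case False
        then have "\<bar>k\<bar> * 1 \<le> \<bar>k\<bar> * \<bar>k\<bar>" by (intro mult_left_mono) auto
        then show ?thesis by (simp add: power2_eq_square flip: abs_mult)
      qed simp
      have "(\<Sum>d<n. \<bar>z d\<bar>) \<le> (\<Sum>d<n. (z d)\<^sup>2)" by (intro sum_mono sq_ge)
      then have z1: "(\<Sum>d<n. \<bar>z d\<bar>) \<le> int (25 * n)" using z2 by linarith
      have "\<bar>z d\<bar> \<le> int (25 * n)" if "d < n" for d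
      proof -
        have "\<bar>z d\<bar> \<le> (\<Sum>d<n. \<bar>z d\<bar>)" using that by (intro member_le_sum[where f="\<lambda>d. \<bar>z d\<bar>"]) auto
        then show ?thesis using z1 by linarith
      qed
      then have "z d \<in> {- int (25 * n)..int (25 * n)}" if "d < n" for d using that by fastforce
      moreover have "z \<in> extensional {..<n}" by (simp add: z_def)
      ultimately have "z \<in> PiE {..<n} (\<lambda>_. {- int (25 * n)..int (25 * n)})" by (auto simp: PiE_iff)
      moreover have "card {d. d < n \<and> z d \<noteq> 0} \<le> card {..<n}" by (intro card_mono) auto
      ultimately show ?thesis using z1 by (simp add: int_vectors_def)
    qed
    have Qb': "\<bar>Q b'\<bar> \<le> 25/16 * \<delta>"
    proof -
      have "m\<^sup>2 * \<bar>Q b'\<bar> \<le> \<delta> * (m\<^sup>2 * (nrm n b')\<^sup>2)"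
        using net[OF zin] unfolding zb quad_dev_scale nrm_scale by (simp add: Q_def abs_mult power_mult_distrib)
      then have "m\<^sup>2 * \<bar>Q b'\<bar> \<le> m\<^sup>2 * (\<delta> * (nrm n b')\<^sup>2)" by (simp add: mult_ac)
      then have "\<bar>Q b'\<bar> \<le> \<delta> * (nrm n b')\<^sup>2" using m(1) by (simp only: mult_le_cancel_left_pos zero_less_power)
      also have "\<dots> \<le> \<delta> * (25/16)" using b'2 \<delta> by (intro mult_left_mono) auto
      finally show ?thesis by simp
    qed
    \<comment> \<open>The weights give both vectors norm at most 3/4, namely 3 * 1/4 and (1 + 5/4) /
      3.\<close>
    define f g where "f d = 3 * (b d - b' d)" and "g d = (b d + b' d) / 3" for d
    have fg: "(nrm n (\<lambda>d. f d + g d))\<^sup>2 + (nrm n (\<lambda>d. f d - g d))\<^sup>2 = 2 * (nrm n f)\<^sup>2 + 2 * (nrm n g)\<^sup>2"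
      by (simp add: nrm_sq power2_sum power2_diff sum.distrib sum_subtractf sum_distrib_left)
    have f2: "(nrm n f)\<^sup>2 \<le> 9/16"
    proof -
      have "(nrm n f)\<^sup>2 = 9 * (nrm n (\<lambda>d. b d - b' d))\<^sup>2" unfolding f_def nrm_scale by (simp add: power_mult_distrib)
      then show ?thesis using a2 by simp
    qed
    have g2: "(nrm n g)\<^sup>2 \<le> 9/16"
    proof -
      have "g = (\<lambda>d. (1/3) * (b d + b' d))" by (simp add: g_def fun_eq_iff)
      then have "nrm n g = 1/3 * nrm n (\<lambda>d. b d + b' d)" using nrm_scale[of n "1/3" "\<lambda>d. b d + b' d"] by simp
      also have "\<dots> \<le> 1/3 * (1 + 5/4)" using nrm_triangle[of n b b'] b b'n by (intro mult_left_mono) auto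
      finally have "(nrm n g)\<^sup>2 \<le> (3/4)\<^sup>2" by (intro power_mono) auto
      then show ?thesis by (simp add: power2_eq_square)
    qed
    have quarter: "\<bar>(r - r') / 4\<bar> \<le> (\<bar>r\<bar> + \<bar>r'\<bar>) / 4" for r r' :: real using abs_triangle_ineq4[of r r'] by (simp add: divide_right_mono)
    have "\<bar>Q b - Q b'\<bar> \<le> (\<bar>Q (\<lambda>d. f d + g d)\<bar> + \<bar>Q (\<lambda>d. f d - g d)\<bar>) / 4"
      unfolding Q_def quad_dev_diff[of n N x b b'] f_def g_def by (rule quarter)
    also have "\<dots> \<le> (c0 * (nrm n (\<lambda>d. f d + g d))\<^sup>2 + c0 * (nrm n (\<lambda>d. f d - g d))\<^sup>2) / 4"
      using scaled by (intro divide_right_mono add_mono) auto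
    also have "\<dots> = c0 * (2 * (nrm n f)\<^sup>2 + 2 * (nrm n g)\<^sup>2) / 4" unfolding fg[symmetric] by (simp add: distrib_left)
    also have "\<dots> \<le> c0 * (2 * (9/16) + 2 * (9/16)) / 4" using f2 g2 c00 by (intro divide_right_mono mult_left_mono) auto
    finally show ?thesis using Qb' abs_triangle_ineq2[of "Q b" "Q b'"] unfolding c1_def by simp
  qed
  have "(\<lambda>_. 0) \<in> B1" using z0 by (simp add: B1_def)
  then have "c0 \<le> c1" unfolding c0_def using step by (intro cSUP_least) (auto simp: B1_def)
  then have "c0 \<le> 4 * \<delta>" using \<delta> unfolding c1_def by linarith
  then have "c0 * (nrm n b)\<^sup>2 \<le> 4 * \<delta> * (nrm n b)\<^sup>2" by (intro mult_right_mono) auto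
  then show ?thesis using scaled[of b] by (simp add: Q_def)
qed

definition isotropic_class :: "nat \<Rightarrow> real \<Rightarrow> real \<Rightarrow> 'a measure \<Rightarrow> ('a \<Rightarrow> nat \<Rightarrow> real) \<Rightarrow> bool" where
  "isotropic_class n p B \<mu> \<psi> \<longleftrightarrow> prob_space \<mu> \<and> (\<forall>d<n. (\<lambda>x. \<psi> x d) \<in> borel_measurable \<mu>) \<and>
     (\<forall>b. integrable \<mu> (\<lambda>x. (inner_n n b (\<psi> x))\<^sup>2) \<and> (\<integral>x. (inner_n n b (\<psi> x))\<^sup>2 \<partial>\<mu>) = (nrm n b)\<^sup>2) \<and>
     (\<forall>b. (\<integral>\<^sup>+x. ennreal (\<bar>inner_n n b (\<psi> x)\<bar> powr p) \<partial>\<mu>) \<le> ennreal (B * nrm n b powr p))"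

text \<open>Markov's inequality for the p-th moment. Division by \<open>B powr (1/p)\<close> removes
  \<open>B\<close>, which returns at the end as the factor \<open>B powr (2/p)\<close>.\<close>

lemma isotropic_class_tail:
  assumes iso: "isotropic_class n p B \<mu> \<psi>" and p: "p > 2" and B: "B \<ge> 1"
  shows "tail_vector \<mu> (\<lambda>x d. B powr (-1/p) * \<psi> x d) n p 1"
proof -
  interpret prob_space \<mu> using iso by (simp add: isotropic_class_def)
  have meas[measurable]: "(\<lambda>x. \<psi> x d) \<in> borel_measurable \<mu>" if "d < n" for d using iso that by (simp add: isotropic_class_def)
  have im[measurable]: "(\<lambda>x. inner_n n b (\<psi> x)) \<in> borel_measurable \<mu>" for b unfolding inner_n_def by measurable
  show ?thesis
  proof
    show "(\<lambda>x. B powr (-1/p) * \<psi> x d) \<in> borel_measurable \<mu>" if "d < n" for d using meas[OF that] by measurable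
    show "emeasure \<mu> {x \<in> space \<mu>. t * nrm n b < \<bar>inner_n n b (\<lambda>d. B powr (-1/p) * \<psi> x d)\<bar>} \<le> ennreal (t powr - p)" if t: "t > 0" for t b
    proof (cases "nrm n b = 0")
      case True
      have "inner_n n b v = 0" for v using inner_n_CS[of n b v] True by simp
      then show ?thesis using True by simp
    next
      case False
      then have b0: "nrm n b > 0" using nrm_nonneg[of n b] by linarith
      define w where "w = B * (t * nrm n b) powr p"
      have w0: "w > 0" using B t b0 by (simp add: w_def)
      have sub: "{x \<in> space \<mu>. t * nrm n b < \<bar>inner_n n b (\<lambda>d. B powr (-1/p) * \<psi> x d)\<bar>}
          \<subseteq> {x \<in> space \<mu>. 1 \<le> ennreal (1 / w) * ennreal (\<bar>inner_n n b (\<psi> x)\<bar> powr p)}"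
      proof safe
        fix x assume x: "t * nrm n b < \<bar>inner_n n b (\<lambda>d. B powr (-1/p) * \<psi> x d)\<bar>"
        have "inner_n n b (\<lambda>d. B powr (-1/p) * \<psi> x d) = B powr (-1/p) * inner_n n b (\<psi> x)"
          by (simp add: inner_n_comm[of n b] inner_n_scale_left)
        then have "t * nrm n b \<le> B powr (-1/p) * \<bar>inner_n n b (\<psi> x)\<bar>" using x by (simp add: abs_mult)
        then have "(t * nrm n b) powr p \<le> (B powr (-1/p) * \<bar>inner_n n b (\<psi> x)\<bar>) powr p" using t b0 p by (intro powr_mono2) auto
        also have "\<dots> = (B powr (-1/p)) powr p * \<bar>inner_n n b (\<psi> x)\<bar> powr p" by (rule powr_mult)
        also have "(B powr (-1/p)) powr p = B powr (-1)" using p by (simp add: powr_powr)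
        also have "\<dots> = 1 / B" using B by (simp add: powr_minus_divide)
        finally have "1 \<le> (1 / w) * \<bar>inner_n n b (\<psi> x)\<bar> powr p" using B w0 by (simp add: w_def field_simps)
        then have "ennreal 1 \<le> ennreal ((1 / w) * \<bar>inner_n n b (\<psi> x)\<bar> powr p)" by (rule ennreal_leI)
        then show "1 \<le> ennreal (1 / w) * ennreal (\<bar>inner_n n b (\<psi> x)\<bar> powr p)" using w0 by (simp only: ennreal_1 ennreal_mult less_imp_le divide_nonneg_nonneg zero_le_one powr_ge_zero)
      qed
      have "emeasure \<mu> {x \<in> space \<mu>. t * nrm n b < \<bar>inner_n n b (\<lambda>d. B powr (-1/p) * \<psi> x d)\<bar>}
         \<le> emeasure \<mu> {x \<in> space \<mu>. 1 \<le> ennreal (1 / w) * ennreal (\<bar>inner_n n b (\<psi> x)\<bar> powr p)}"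
        by (rule emeasure_mono[OF sub]) measurable
      also have "\<dots> \<le> ennreal (1 / w) * (\<integral>\<^sup>+x. ennreal (\<bar>inner_n n b (\<psi> x)\<bar> powr p) * indicator (space \<mu>) x \<partial>\<mu>)"
        by (rule nn_integral_Markov_inequality) measurable
      also have "(\<integral>\<^sup>+x. ennreal (\<bar>inner_n n b (\<psi> x)\<bar> powr p) * indicator (space \<mu>) x \<partial>\<mu>) = (\<integral>\<^sup>+x. ennreal (\<bar>inner_n n b (\<psi> x)\<bar> powr p) \<partial>\<mu>)"
        by (intro nn_integral_cong) simp
      also have "\<dots> \<le> ennreal (B * nrm n b powr p)" using iso by (simp add: isotropic_class_def)
      finally have "emeasure \<mu> {x \<in> space \<mu>. t * nrm n b < \<bar>inner_n n b (\<lambda>d. B powr (-1/p) * \<psi> x d)\<bar>} \<le> ennreal (1 / w) * ennreal (B * nrm n b powr p)"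
        by (simp add: mult_left_mono)
      also have "\<dots> = ennreal (1 / w * (B * nrm n b powr p))" using w0 B by (intro ennreal_mult[symmetric]) auto
      also have "1 / w * (B * nrm n b powr p) = t powr (-p)"
        using B t b0 by (simp add: w_def powr_mult powr_minus_divide)
      finally show ?thesis .
    qed
    show "emeasure \<mu> {x \<in> space \<mu>. nrm n (\<lambda>d. B powr (-1/p) * \<psi> x d) \<noteq> 0} \<le> ennreal 1" by (auto intro: emeasure_le_1)
  qed (use p in auto)
qed

text \<open>The weighted count with all weights 1, \<open>c = 25\<close> and \<open>l = n\<close>,
  together with \<open>25 \<le> exp 4\<close>.\<close>

lemma card_net_le:
  assumes "n \<ge> 1"
  shows "real (card (int_vectors n n (25 * n))) \<le> exp (12 * real n)"
proof -
  have "real (card (int_vectors n n (25 * n))) = (\<Sum>\<zeta>\<in>int_vectors n n (25 * n). 1 ^ card {i. i < n \<and> \<zeta> i \<noteq> 0})" by simp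
  also have "\<dots> \<le> (exp 2 * 25 * real n / real n) ^ (2 * n)"
    by (rule int_vectors_weighted_count) (use assms in auto)
  also have "\<dots> = (exp 2 * 25) ^ (2 * n)" using assms by simp
  also have "\<dots> \<le> (exp 2 * exp 4) ^ (2 * n)"
  proof (intro power_mono mult_left_mono)
    have e: "5/2 \<le> exp (1::real)" using exp_lower_Taylor_quadratic[of "1::real"] by simp
    have "25 \<le> (5/2 :: real) ^ 4" by (simp add: power4_eq_xxxx)
    also have "\<dots> \<le> exp 1 ^ 4" using e by (intro power_mono) auto
    also have "\<dots> = exp (4::real)" by (simp flip: exp_of_nat_mult)
    finally show "25 \<le> exp (4::real)" .
  qed auto
  also have "\<dots> = exp (12 * real n)" by (simp flip: exp_add exp_of_nat_mult)
  finally show ?thesis .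
qed

text \<open>The net costs \<open>exp (12 * n)\<close>, and 18 in place of \<open>K\<close> gives the
  tail \<open>3 * exp (- 16 * n)\<close> in each direction. At most \<open>18 * n\<close> squares
  are above the cap, so \<open>sparse_bound_dual\<close> bounds their sum. \<open>M\<close> is
  quantified after the exceptional set because it will be the maximum over the sample, a random
  quantity.\<close>

lemma isotropic_concentration:
  fixes \<gamma>0 :: real
  assumes \<gamma>0: "\<gamma>0 > 0"
  shows "\<exists>C>0. \<forall>p B n N (\<mu> :: 'a measure) \<psi>. p > 2 \<longrightarrow> \<gamma>0 \<le> 1/2 - 1/p \<longrightarrow> B \<ge> 1 \<longrightarrow> 1 \<le> n \<longrightarrow> 2 * n \<le> N \<longrightarrow> isotropic_class n p B \<mu> \<psi> \<longrightarrow>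
     (\<exists>F\<in>sets (PiM {..<N} (\<lambda>_. \<mu>)). measure (PiM {..<N} (\<lambda>_. \<mu>)) F \<le> 1 / real n \<and>
        (\<forall>xs\<in>space (PiM {..<N} (\<lambda>_. \<mu>)) - F. \<forall>M. (\<forall>i<N. (nrm n (\<psi> (xs i)))\<^sup>2 \<le> M) \<longrightarrow>
           (\<forall>b. \<bar>quad_dev n N (\<lambda>k. \<psi> (xs k)) b\<bar> \<le> C * (M + real N * (B powr (2/p) * (real n / real N) powr ((p - 2) / p) * (ln (real N / real n)) ^ 4
             + B powr (2/p) * (real n / real N) powr ((min p 4 - 2) / min p 4))) * (nrm n b)\<^sup>2)))"
proof -
  obtain C1 where C1: "C1 > 0" and sparse: "\<And>p n N (\<mu> :: 'a measure) \<psi>. tail_vector \<mu> \<psi> n p 1 \<Longrightarrow> \<gamma>0 \<le> 1/2 - 1/p \<Longrightarrow> 1 \<le> n \<Longrightarrow> 2 * n \<le> N \<Longrightarrow>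
     (\<exists>F\<in>sets (PiM {..<N} (\<lambda>_. \<mu>)). measure (PiM {..<N} (\<lambda>_. \<mu>)) F \<le> 1 / (4 * real n) \<and>
        (\<forall>xs\<in>space (PiM {..<N} (\<lambda>_. \<mu>)) - F. \<forall>M. (\<forall>i<N. (nrm n (\<psi> (xs i)))\<^sup>2 \<le> M) \<longrightarrow>
           sparse_bound n N (18 * n) (\<lambda>i. \<psi> (xs i))
             (C1 * (M + real N powr (2/p) * real n powr (1 - 2/p) * (ln (real N / real n)) ^ 4))))"
    using sparse_bound_prob[OF \<gamma>0, of 18] by auto
  define C where "C = 4 * (114 + C1)"
  show ?thesis
  proof (intro exI[of _ C] conjI allI impI)
    show "C > 0" using C1 by (simp add: C_def)
    fix p B :: real and n N :: nat and \<mu> :: "'a measure" and \<psi> :: "'a \<Rightarrow> nat \<Rightarrow> real"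
    assume p: "p > 2" and g: "\<gamma>0 \<le> 1/2 - 1/p" and B: "B \<ge> 1" and n: "1 \<le> n" and N: "2 * n \<le> N" and iso: "isotropic_class n p B \<mu> \<psi>"
    interpret prob_space \<mu> using iso by (simp add: isotropic_class_def)
    have meas[measurable]: "(\<lambda>x. \<psi> x d) \<in> borel_measurable \<mu>" if "d < n" for d using iso that by (simp add: isotropic_class_def)
    let ?P = "PiM {..<N} (\<lambda>_. \<mu>)"
    interpret P: prob_space ?P by (intro prob_space_PiM prob_space_axioms)
    define L where "L = ln (real N / real n)"
    define \<tau> where "\<tau> = (B * (real N / real n)) powr (2/p)"
    define U1 where "U1 = B powr (2/p) * (real n / real N) powr (1 - 2/p)"
    define U2 where "U2 = B powr (2/p) * (real n / real N) powr (1 - 2 / min p 4)"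
    define U where "U = U1 + U2"
    have nr: "real n \<ge> 1" "real N \<ge> 2 * real n" using n N by auto
    have L23: "L \<ge> 2/3"
    proof -
      have "ln 2 \<le> ln (real N / real n)" using nr by (subst ln_le_cancel_iff) (auto simp: field_simps)
      then show ?thesis using ln2_ge_two_thirds by (simp add: L_def)
    qed
    have U0: "U1 \<ge> 0" "U2 \<ge> 0" using B by (auto simp: U1_def U2_def)
    define s where "s = B powr (-1/p)"
    have s2: "s\<^sup>2 = 1 / B powr (2/p)" using B by (simp add: s_def power2_eq_square powr_minus_divide flip: powr_add)
    obtain F0 where F0: "F0 \<in> sets ?P" "P.prob F0 \<le> 1 / (4 * real n)"
      "\<And>xs M. xs \<in> space ?P - F0 \<Longrightarrow> (\<forall>i<N. (nrm n (\<lambda>d. s * \<psi> (xs i) d))\<^sup>2 \<le> M) \<Longrightarrow>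
         sparse_bound n N (18 * n) (\<lambda>i d. s * \<psi> (xs i) d) (C1 * (M + real N powr (2/p) * real n powr (1 - 2/p) * (ln (real N / real n)) ^ 4))"
      using sparse[OF isotropic_class_tail[OF iso p B] g n N] unfolding s_def by blast
    define Z where "Z = {z \<in> int_vectors n n (25 * n). nrm n (\<lambda>d. real_of_int (z d)) \<noteq> 0}"
    have finZ: "finite Z" by (simp add: Z_def)
    define v where "v z = (\<lambda>d. (1 / nrm n (\<lambda>d. real_of_int (z d))) * real_of_int (z d))" for z :: "nat \<Rightarrow> int"
    have vn: "nrm n (v z) = 1" if "z \<in> Z" for z
      unfolding v_def nrm_scale using that nrm_nonneg[of n "\<lambda>d. real_of_int (z d)"] by (simp add: Z_def)
    have "\<forall>z\<in>Z. \<exists>F\<in>sets ?P. P.prob F \<le> 3 * exp ((2 - real 18) * real n) \<and>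
      (\<forall>xs\<in>space ?P - F. card {k. k < N \<and> \<tau> < (inner_n n (v z) (\<psi> (xs k)))\<^sup>2} \<le> 18 * n \<and>
       \<bar>(\<Sum>k<N. (inner_n n (v z) (\<psi> (xs k)))\<^sup>2) - real N\<bar> \<le> (real 18 + 1) * (real N * U)
          + (\<Sum>k\<in>{k. k < N \<and> \<tau> < (inner_n n (v z) (\<psi> (xs k)))\<^sup>2}. (inner_n n (v z) (\<psi> (xs k)))\<^sup>2))"
    proof
      fix z assume z: "z \<in> Z"
      show "\<exists>F\<in>sets ?P. P.prob F \<le> 3 * exp ((2 - real 18) * real n) \<and>
      (\<forall>xs\<in>space ?P - F. card {k. k < N \<and> \<tau> < (inner_n n (v z) (\<psi> (xs k)))\<^sup>2} \<le> 18 * n \<and>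
       \<bar>(\<Sum>k<N. (inner_n n (v z) (\<psi> (xs k)))\<^sup>2) - real N\<bar> \<le> (real 18 + 1) * (real N * U)
          + (\<Sum>k\<in>{k. k < N \<and> \<tau> < (inner_n n (v z) (\<psi> (xs k)))\<^sup>2}. (inner_n n (v z) (\<psi> (xs k)))\<^sup>2))"
      proof (rule direction_concentration[OF _ _ _ _ p B n _ \<tau>_def])
        show "(\<lambda>x. inner_n n (v z) (\<psi> x)) \<in> borel_measurable \<mu>" unfolding inner_n_def by measurable
        show "integrable \<mu> (\<lambda>x. (inner_n n (v z) (\<psi> x))\<^sup>2)" "expectation (\<lambda>x. (inner_n n (v z) (\<psi> x))\<^sup>2) = 1"
          using iso vn[OF z] by (auto simp: isotropic_class_def)
        have "(\<integral>\<^sup>+x. ennreal (\<bar>inner_n n (v z) (\<psi> x)\<bar> powr p) \<partial>\<mu>) \<le> ennreal (B * nrm n (v z) powr p)"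
          using iso by (simp add: isotropic_class_def)
        then show "(\<integral>\<^sup>+x. ennreal (\<bar>inner_n n (v z) (\<psi> x)\<bar> powr p) \<partial>\<mu>) \<le> ennreal B" using vn[OF z] by simp
        show "U = B powr (2/p) * ((real n / real N) powr (1 - 2/p) + (real n / real N) powr (1 - 2 / min p 4))"
          by (simp add: U_def U1_def U2_def distrib_left)
        show "n \<le> N" using N by simp
      qed
    qed
    from bchoice[OF this[unfolded Bex_def]] obtain Fz where FZ: "\<forall>z\<in>Z. Fz z \<in> sets ?P \<and> P.prob (Fz z) \<le> 3 * exp ((2 - real 18) * real n) \<and>
      (\<forall>xs\<in>space ?P - Fz z. card {k. k < N \<and> \<tau> < (inner_n n (v z) (\<psi> (xs k)))\<^sup>2} \<le> 18 * n \<and>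
       \<bar>(\<Sum>k<N. (inner_n n (v z) (\<psi> (xs k)))\<^sup>2) - real N\<bar> \<le> (real 18 + 1) * (real N * U)
          + (\<Sum>k\<in>{k. k < N \<and> \<tau> < (inner_n n (v z) (\<psi> (xs k)))\<^sup>2}. (inner_n n (v z) (\<psi> (xs k)))\<^sup>2))" ..
    have Fz: "\<And>z. z \<in> Z \<Longrightarrow> Fz z \<in> sets ?P" "\<And>z. z \<in> Z \<Longrightarrow> P.prob (Fz z) \<le> 3 * exp ((2 - real 18) * real n)"
      "\<And>z xs. z \<in> Z \<Longrightarrow> xs \<in> space ?P - Fz z \<Longrightarrow> card {k. k < N \<and> \<tau> < (inner_n n (v z) (\<psi> (xs k)))\<^sup>2} \<le> 18 * n \<and>
       \<bar>(\<Sum>k<N. (inner_n n (v z) (\<psi> (xs k)))\<^sup>2) - real N\<bar> \<le> (real 18 + 1) * (real N * U)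
          + (\<Sum>k\<in>{k. k < N \<and> \<tau> < (inner_n n (v z) (\<psi> (xs k)))\<^sup>2}. (inner_n n (v z) (\<psi> (xs k)))\<^sup>2)"
      by (rule FZ[rule_format, THEN conjunct1], assumption) (rule FZ[rule_format, THEN conjunct2, THEN conjunct1], assumption, rule FZ[rule_format, THEN conjunct2, THEN conjunct2, rule_format], assumption+)
    define F where "F = F0 \<union> (\<Union>z\<in>Z. Fz z)"
    have UZ: "(\<Union>z\<in>Z. Fz z) \<in> sets ?P" using finZ Fz by (intro sets.finite_UN) auto
    have F: "F \<in> sets ?P" unfolding F_def using F0 UZ by auto
    have probF: "P.prob F \<le> 1 / real n"
    proof -
      have "P.prob (\<Union>z\<in>Z. Fz z) \<le> (\<Sum>z\<in>Z. P.prob (Fz z))" using finZ Fz by (intro P.finite_measure_subadditive_finite) auto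
      also have "\<dots> \<le> (\<Sum>z\<in>Z. 3 * exp ((2 - real 18) * real n))" by (intro sum_mono Fz)
      also have "\<dots> = real (card Z) * (3 * exp (- 16 * real n))" by simp
      also have "\<dots> \<le> exp (12 * real n) * (3 * exp (- 16 * real n))"
      proof (intro mult_right_mono)
        have "card Z \<le> card (int_vectors n n (25 * n))" by (intro card_mono) (auto simp: Z_def)
        then show "real (card Z) \<le> exp (12 * real n)" using card_net_le[OF n] by linarith
      qed simp
      also have "\<dots> = 3 / exp (4 * real n)" by (simp add: exp_minus exp_diff[symmetric] divide_inverse flip: exp_add exp_minus)
      also have "\<dots> \<le> 3 / (12 * real n)"
      proof (intro divide_left_mono)
        have "real n * 1 \<le> real n * real n" using nr by (intro mult_left_mono) auto
        then have "12 * real n \<le> 1 + 4 * real n + (4 * real n)\<^sup>2 / 2" by (simp add: power2_eq_square)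
        also have "\<dots> \<le> exp (4 * real n)" by (intro exp_lower_Taylor_quadratic) simp
        finally show "12 * real n \<le> exp (4 * real n)" .
      qed (use nr in auto)
      also have "\<dots> = 1 / (4 * real n)" by simp
      finally have "P.prob (\<Union>z\<in>Z. Fz z) \<le> 1 / (4 * real n)" .
      moreover have "P.prob F \<le> P.prob F0 + P.prob (\<Union>z\<in>Z. Fz z)" unfolding F_def using F0 UZ by (intro measure_Un_le) auto
      ultimately have "P.prob F \<le> 1 / (4 * real n) + 1 / (4 * real n)" using F0 by linarith
      also have "\<dots> \<le> 1 / real n" using nr by (simp add: field_simps)
      finally show ?thesis .
    qed
    show "\<exists>F\<in>sets ?P. P.prob F \<le> 1 / real n \<and>
        (\<forall>xs\<in>space ?P - F. \<forall>M. (\<forall>i<N. (nrm n (\<psi> (xs i)))\<^sup>2 \<le> M) \<longrightarrow>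
           (\<forall>b. \<bar>quad_dev n N (\<lambda>k. \<psi> (xs k)) b\<bar> \<le> C * (M + real N * (B powr (2/p) * (real n / real N) powr ((p - 2) / p) * (ln (real N / real n)) ^ 4
             + B powr (2/p) * (real n / real N) powr ((min p 4 - 2) / min p 4))) * (nrm n b)\<^sup>2))"
    proof (intro bexI[OF _ F] conjI probF ballI allI impI)
      fix xs M b assume xs: "xs \<in> space ?P - F" and M: "\<forall>i<N. (nrm n (\<psi> (xs i)))\<^sup>2 \<le> M"
      have M0: "M \<ge> 0" using M[rule_format, of 0] n N zero_le_power2[of "nrm n (\<psi> (xs 0))"] by linarith
      have e1: "(p - 2) / p = 1 - 2/p" "(min p 4 - 2) / min p 4 = 1 - 2 / min p 4" using p by (auto simp: diff_divide_distrib)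
      define R where "R = M + real N * (U1 * L ^ 4 + U2)"
      define \<delta> where "\<delta> = (114 + C1) * R"
      have UL: "0 \<le> U1 * L ^ 4" using U0 by simp
      have R0: "R \<ge> 0" using M0 U0 UL by (simp add: R_def)
      have G: "B powr (2/p) * (real N powr (2/p) * real n powr (1 - 2/p)) = real N * U1"
      proof -
        have "real N powr (2/p) = real N * (1 / real N powr (1 - 2/p))" using nr powr_add[of "real N" "2/p" "1 - 2/p"] by (simp add: field_simps)
        then show ?thesis by (simp add: U1_def powr_divide mult_ac)
      qed
      \<comment> \<open>The sparse bound concerns the sample scaled by \<open>s\<close>, so
        \<open>M\<close> appears with the factor \<open>s\<^sup>2\<close>; multiplication by
        \<open>B powr (2/p)\<close> undoes this in \<open>BA\<close>.\<close>
      define A where "A = C1 * (s\<^sup>2 * M + real N powr (2/p) * real n powr (1 - 2/p) * L ^ 4)"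
      have A0: "A \<ge> 0" using C1 M0 by (simp add: A_def)
      have sb: "sparse_bound n N (18 * n) (\<lambda>i d. s * \<psi> (xs i) d) A"
        unfolding A_def L_def
      proof (rule F0(3))
        show "xs \<in> space ?P - F0" using xs by (simp add: F_def)
        show "\<forall>i<N. (nrm n (\<lambda>d. s * \<psi> (xs i) d))\<^sup>2 \<le> s\<^sup>2 * M" using M by (auto simp: nrm_scale power_mult_distrib intro!: mult_left_mono)
      qed
      have BA: "B powr (2/p) * A = C1 * (M + real N * (U1 * L ^ 4))"
      proof -
        have "B powr (2/p) * A = C1 * (B powr (2/p) * s\<^sup>2 * M + B powr (2/p) * (real N powr (2/p) * real n powr (1 - 2/p)) * L ^ 4)"
          by (simp add: A_def algebra_simps)
        also have "B powr (2/p) * s\<^sup>2 = 1" using B s2 by simp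
        finally show ?thesis unfolding G by (simp add: mult.assoc)
      qed
      \<comment> \<open>\<open>L \<ge> 2/3\<close> and 6 * (2/3) ^ 4 is at least 1, so
        \<open>U1\<close> is absorbed by its product with the logarithm; 114 below is 19 *
        6.\<close>
      have L4: "U1 \<le> 6 * (U1 * L ^ 4)"
      proof -
        have "(2/3) ^ 4 \<le> L ^ 4" using L23 by (intro power_mono) auto
        then have "1 \<le> 6 * L ^ 4" by (simp add: power4_eq_xxxx)
        then have "U1 * 1 \<le> U1 * (6 * L ^ 4)" using U0 by (intro mult_left_mono) auto
        then show ?thesis by simp
      qed
      have dev: "\<bar>quad_dev n N (\<lambda>k. \<psi> (xs k)) (v z)\<bar> \<le> \<delta>" if z: "z \<in> Z" for z
      proof -
        let ?B = "{k. k < N \<and> \<tau> < (inner_n n (v z) (\<psi> (xs k)))\<^sup>2}"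
        have good: "card ?B \<le> 18 * n" "\<bar>(\<Sum>k<N. (inner_n n (v z) (\<psi> (xs k)))\<^sup>2) - real N\<bar> \<le> (real 18 + 1) * (real N * U)
          + (\<Sum>k\<in>?B. (inner_n n (v z) (\<psi> (xs k)))\<^sup>2)"
          using Fz(3)[OF z, of xs] xs z by (auto simp: F_def)
        have "(\<Sum>k\<in>?B. (inner_n n (\<lambda>d. s * \<psi> (xs k) d) (v z))\<^sup>2) \<le> A * (nrm n (v z))\<^sup>2"
          by (rule sparse_bound_dual[OF sb _ good(1) A0]) auto
        then have "(\<Sum>k\<in>?B. s\<^sup>2 * (inner_n n (v z) (\<psi> (xs k)))\<^sup>2) \<le> A"
          by (simp add: inner_n_scale_left inner_n_comm[of n _ "v z"] power_mult_distrib vn[OF z])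
        then have "s\<^sup>2 * (\<Sum>k\<in>?B. (inner_n n (v z) (\<psi> (xs k)))\<^sup>2) \<le> A" by (simp add: sum_distrib_left)
        then have "B powr (2/p) * (s\<^sup>2 * (\<Sum>k\<in>?B. (inner_n n (v z) (\<psi> (xs k)))\<^sup>2)) \<le> B powr (2/p) * A" by (intro mult_left_mono) auto
        moreover have "B powr (2/p) * (s\<^sup>2 * S) = S" for S using B s2 by simp
        ultimately have top: "(\<Sum>k\<in>?B. (inner_n n (v z) (\<psi> (xs k)))\<^sup>2) \<le> C1 * (M + real N * (U1 * L ^ 4))" unfolding BA by simp
        have "19 * (real N * U) \<le> 114 * (real N * (U1 * L ^ 4 + U2))"
        proof -
          have "19 * U1 \<le> 19 * (6 * (U1 * L ^ 4))" using L4 by (intro mult_left_mono) auto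
          moreover have "19 * (6 * (U1 * L ^ 4)) = 114 * (U1 * L ^ 4)" by simp
          moreover have "114 * (U1 * L ^ 4 + U2) = 114 * (U1 * L ^ 4) + 114 * U2" by (rule distrib_left)
          ultimately have "19 * U \<le> 114 * (U1 * L ^ 4 + U2)" using U0 unfolding U_def distrib_left by linarith
          then have "real N * (19 * U) \<le> real N * (114 * (U1 * L ^ 4 + U2))" by (intro mult_left_mono) auto
          then show ?thesis by (simp add: mult_ac)
        qed
        also have "\<dots> \<le> 114 * R" using M0 by (simp add: R_def)
        finally have t1: "19 * (real N * U) \<le> 114 * R" .
        have "C1 * (M + real N * (U1 * L ^ 4)) \<le> C1 * R" unfolding R_def using C1 U0 by (intro mult_left_mono add_left_mono) auto
        moreover have eq19: "real 18 + 1 = 19" by simp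
        ultimately have "\<bar>(\<Sum>k<N. (inner_n n (v z) (\<psi> (xs k)))\<^sup>2) - real N\<bar> \<le> 114 * R + C1 * R"
          using top t1 good(2)[unfolded eq19] by linarith
        then show ?thesis by (simp add: quad_dev_def vn[OF z] \<delta>_def distrib_right)
      qed
      have \<delta>0: "\<delta> \<ge> 0" using C1 R0 by (simp add: \<delta>_def)
      have "\<bar>quad_dev n N (\<lambda>k. \<psi> (xs k)) b\<bar> \<le> 4 * \<delta> * (nrm n b)\<^sup>2"
      proof (rule quad_dev_net[OF n \<delta>0])
        fix z assume z: "z \<in> int_vectors n n (25 * n)"
        define r where "r = nrm n (\<lambda>d. real_of_int (z d))"
        show "\<bar>quad_dev n N (\<lambda>k. \<psi> (xs k)) (\<lambda>d. real_of_int (z d))\<bar> \<le> \<delta> * (nrm n (\<lambda>d. real_of_int (z d)))\<^sup>2"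
        proof (cases "r = 0")
          case True
          then show ?thesis using \<delta>0 by (simp add: quad_dev_zero r_def)
        next
          case False
          then have zZ: "z \<in> Z" using z by (simp add: Z_def r_def)
          have "(\<lambda>d. real_of_int (z d)) = (\<lambda>d. r * v z d)" using False by (simp add: v_def r_def)
          then have "quad_dev n N (\<lambda>k. \<psi> (xs k)) (\<lambda>d. real_of_int (z d)) = r\<^sup>2 * quad_dev n N (\<lambda>k. \<psi> (xs k)) (v z)"
            by (simp only: quad_dev_scale)
          then have "\<bar>quad_dev n N (\<lambda>k. \<psi> (xs k)) (\<lambda>d. real_of_int (z d))\<bar> = r\<^sup>2 * \<bar>quad_dev n N (\<lambda>k. \<psi> (xs k)) (v z)\<bar>" by (simp add: abs_mult)
          also have "\<dots> \<le> r\<^sup>2 * \<delta>" using dev[OF zZ] by (intro mult_left_mono) auto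
          finally show ?thesis by (simp add: r_def mult.commute)
        qed
      qed
      also have "4 * \<delta> = C * R" by (simp add: \<delta>_def C_def)
      finally show "\<bar>quad_dev n N (\<lambda>k. \<psi> (xs k)) b\<bar> \<le> C * (M + real N * (B powr (2/p) * (real n / real N) powr ((p - 2) / p) * (ln (real N / real n)) ^ 4
             + B powr (2/p) * (real n / real N) powr ((min p 4 - 2) / min p 4))) * (nrm n b)\<^sup>2"
        unfolding e1 by (simp only: R_def U1_def U2_def L_def)
    qed
  qed
qed

section \<open>Whitening and the spectral norm\<close>

lemma inner_n_cong: "(\<And>d. d < n \<Longrightarrow> a d = a' d) \<Longrightarrow> (\<And>d. d < n \<Longrightarrow> b d = b' d) \<Longrightarrow> inner_n n a b = inner_n n a' b'"
  by (simp add: inner_n_def)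

lemma inner_n_mat_vec: "inner_n n x (mat_vec n A y) = (\<Sum>i<n. \<Sum>j<n. x i * A i j * y j)"
  by (simp add: inner_n_def mat_vec_def sum_distrib_left mult.assoc)

lemma inner_n_mat_vec_comm:
  assumes "\<And>i j. i < n \<Longrightarrow> j < n \<Longrightarrow> A i j = A j i"
  shows "inner_n n x (mat_vec n A y) = inner_n n y (mat_vec n A x)"
proof -
  have "(\<Sum>i<n. \<Sum>j<n. x i * A i j * y j) = (\<Sum>j<n. \<Sum>i<n. x i * A i j * y j)" by (rule sum.swap)
  also have "\<dots> = (\<Sum>j<n. \<Sum>i<n. y j * A j i * x i)" using assms by (intro sum.cong refl) (simp add: mult_ac)
  finally show ?thesis by (simp add: inner_n_mat_vec)
qed

lemma is_inverse_mat_sym: "is_inverse_mat n A T \<Longrightarrow> is_inverse_mat n T A"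
  by (simp add: is_inverse_mat_def)

lemma mat_vec_inverse:
  assumes "is_inverse_mat n A T" "i < n"
  shows "mat_vec n A (mat_vec n T v) i = v i"
proof -
  have "mat_vec n A (mat_vec n T v) i = (\<Sum>j<n. \<Sum>k<n. A i j * T j k * v k)"
    by (simp add: mat_vec_def sum_distrib_left mult.assoc)
  also have "\<dots> = (\<Sum>k<n. (\<Sum>j<n. A i j * T j k) * v k)" unfolding sum_distrib_right by (rule sum.swap)
  also have "\<dots> = (\<Sum>k<n. (if i = k then 1 else 0) * v k)" using assms by (intro sum.cong refl) (simp add: is_inverse_mat_def)
  also have "\<dots> = v i" using assms(2) by (simp add: if_distrib[where f="\<lambda>t. t * _"] cong: if_cong)
  finally show ?thesis .
qed

lemma inner_n_unit: "i < n \<Longrightarrow> inner_n n (\<lambda>d. if d = i then 1 else 0) v = v i"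
  by (simp add: inner_n_def if_distrib[where f="\<lambda>t. t * _"] cong: if_cong)

lemma mat_vec_unit: "j < n \<Longrightarrow> mat_vec n A (\<lambda>d. if d = j then 1 else 0) = (\<lambda>i. A i j)"
  by (simp add: mat_vec_def if_distrib[where f="\<lambda>t. _ * t"] fun_eq_iff cong: if_cong)

text \<open>Cholesky by induction: splitting off the last coordinate leaves the Schur complement
  \<open>A'\<close>. It is again positive semidefinite, since its form at \<open>x\<close> is a
  value of the given form with the last entry \<open>- S / a\<close>. If the pivot \<open>a\<close>
  is 0, then the last column vanishes (\<open>null\<close>), and division by zero yields
  \<open>A' = A\<close>.\<close>

lemma psd_factorization:
  assumes "\<And>i j. i < n \<Longrightarrow> j < n \<Longrightarrow> A i j = A j i" "\<And>x. 0 \<le> inner_n n x (mat_vec n A x)"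
  shows "\<exists>E. \<forall>i<n. \<forall>j<n. A i j = (\<Sum>k<n. E k i * E k j)"
  using assms
proof (induction n arbitrary: A)
  case 0
  then show ?case by simp
next
  case (Suc n)
  define a where "a = A n n"
  define A' where "A' i j = A i j - A i n * A j n / a" for i j
  have form: "inner_n (Suc n) x (mat_vec (Suc n) A x)
      = inner_n n x (mat_vec n A x) + 2 * x n * (\<Sum>i<n. A i n * x i) + a * (x n)\<^sup>2" for x
  proof -
    have s: "(\<Sum>j<n. x n * A n j * x j) = x n * (\<Sum>i<n. A i n * x i)"
      unfolding sum_distrib_left using Suc.prems(1) by (intro sum.cong refl) (simp add: mult_ac)
    have s': "(\<Sum>i<n. x i * A i n * x n) = x n * (\<Sum>i<n. A i n * x i)"
      unfolding sum_distrib_left by (intro sum.cong refl) (simp add: mult_ac)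
    show ?thesis by (simp add: inner_n_mat_vec sum.distrib s s' a_def power2_eq_square)
  qed
  have ext: "inner_n n (x(n := t)) (mat_vec n A (x(n := t))) = inner_n n x (mat_vec n A x)"
    "(\<Sum>i<n. A i n * (x(n := t)) i) = (\<Sum>i<n. A i n * x i)" for x t
    by (simp_all add: inner_n_mat_vec)
  have psd: "0 \<le> inner_n n x (mat_vec n A x) + 2 * t * (\<Sum>i<n. A i n * x i) + a * t\<^sup>2" for x t
    using Suc.prems(2)[of "x(n := t)"] unfolding form ext by simp
  have a0: "a \<ge> 0" using psd[of "\<lambda>_. 0" 1] by (simp add: inner_n_mat_vec)
  have null: "A i n = 0" if "a = 0" "i < n" for i
  proof (rule ccontr)
    assume ne: "A i n \<noteq> 0"
    let ?u = "\<lambda>d. if d = i then 1 else 0 :: real"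
    have "(\<Sum>j<n. A j n * ?u j) = A i n" using that by (simp add: if_distrib[where f="\<lambda>t. _ * t"] cong: if_cong)
    moreover have "inner_n n ?u (mat_vec n A ?u) = A i i" using that by (simp add: inner_n_unit mat_vec_unit)
    \<comment> \<open>With \<open>a = 0\<close> the form is affine in the last entry. Were the slope
      non-zero, the entry chosen here would make the value -1.\<close>
    ultimately have "0 \<le> A i i + 2 * (- (A i i + 1) / (2 * A i n)) * A i n" using psd[of ?u "- (A i i + 1) / (2 * A i n)"] that by simp
    also have "\<dots> = -1" using ne by (simp add: field_simps)
    finally show False by simp
  qed
  have "\<exists>E. \<forall>i<n. \<forall>j<n. A' i j = (\<Sum>k<n. E k i * E k j)"
  proof (rule Suc.IH)
    show "A' i j = A' j i" if "i < n" "j < n" for i j using that Suc.prems(1)[of i j] by (simp add: A'_def mult.commute)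
    fix x
    define S where "S = (\<Sum>i<n. A i n * x i)"
    have "(\<Sum>i<n. \<Sum>j<n. x i * (A i n * A j n / a) * x j) = (\<Sum>i<n. \<Sum>j<n. (A i n * x i) * (A j n * x j) / a)"
      by (intro sum.cong refl) (simp add: mult_ac)
    also have "\<dots> = S * S / a" unfolding S_def sum_product sum_divide_distrib ..
    finally have S2: "(\<Sum>i<n. \<Sum>j<n. x i * (A i n * A j n / a) * x j) = S * S / a" .
    have "inner_n n x (mat_vec n A' x) = (\<Sum>i<n. \<Sum>j<n. x i * A i j * x j - x i * (A i n * A j n / a) * x j)"
      unfolding inner_n_mat_vec A'_def by (intro sum.cong refl) (simp only: right_diff_distrib left_diff_distrib)
    also have "\<dots> = inner_n n x (mat_vec n A x) - S * S / a" unfolding sum_subtractf S2 inner_n_mat_vec ..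
    also have "\<dots> = inner_n n x (mat_vec n A x) + 2 * (- S / a) * S + a * (- S / a)\<^sup>2"
      by (cases "a = 0") (simp_all add: power2_eq_square)
    also have "\<dots> \<ge> 0" using psd[of x "- S / a"] by (simp add: S_def)
    finally show "0 \<le> inner_n n x (mat_vec n A' x)" .
  qed
  then obtain E where E: "\<And>i j. i < n \<Longrightarrow> j < n \<Longrightarrow> A' i j = (\<Sum>k<n. E k i * E k j)" by blast
  define E' where "E' k i = (if k = n then A i n / sqrt a else if i = n then 0 else E k i)" for k i
  have last: "E' n i * E' n j = A i n * A j n / a" for i j using a0 by (simp add: E'_def)
  have "A i j = (\<Sum>k<Suc n. E' k i * E' k j)" if "i < Suc n" "j < Suc n" for i j
  proof -
    have "(\<Sum>k<Suc n. E' k i * E' k j) = (\<Sum>k<n. E' k i * E' k j) + A i n * A j n / a" by (simp add: last)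
    also have "\<dots> = A i j"
    proof (cases "i = n \<or> j = n")
      case True
      then have "(\<Sum>k<n. E' k i * E' k j) = 0" by (intro sum.neutral) (auto simp: E'_def)
      moreover have "A i n * A j n / a = A i j"
      proof (cases "a = 0")
        case True
        have "A k n = 0" if "k < Suc n" for k using that null[OF True, of k] True by (cases "k = n") (auto simp: a_def)
        then show ?thesis using \<open>i = n \<or> j = n\<close> that True Suc.prems(1)[of i j] by auto
      next
        case False
        then show ?thesis using \<open>i = n \<or> j = n\<close> that Suc.prems(1)[of n j] by (auto simp: a_def)
      qed
      ultimately show ?thesis by simp
    next
      case False
      then have "(\<Sum>k<n. E' k i * E' k j) = (\<Sum>k<n. E k i * E k j)" by (intro sum.cong refl) (simp add: E'_def)
      also have "\<dots> = A' i j" using E[of i j] False that by simp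
      finally show ?thesis by (simp add: A'_def)
    qed
    finally show ?thesis by simp
  qed
  then show ?case by blast
qed

text \<open>A whitening of \<open>A\<close> from a factorisation \<open>T = E\<^sup>T E\<close> of its inverse. The matrix \<open>M = E A E\<^sup>T\<close> is symmetric,
  idempotent and of trace \<open>n\<close>, so that the squared Hilbert-Schmidt norm of \<open>I - M\<close> is the trace of \<open>I - M\<close>, that is 0.\<close>

lemma whitening:
  assumes sym: "\<And>i j. i < n \<Longrightarrow> j < n \<Longrightarrow> A i j = A j i" and psd: "\<And>x. 0 \<le> inner_n n x (mat_vec n A x)"
    and inv: "is_inverse_mat n A T"
  obtains E where "\<And>x y. (\<Sum>k<n. inner_n n (E k) x * inner_n n (E k) y) = inner_n n x (mat_vec n T y)"
    and "\<And>k l. k < n \<Longrightarrow> l < n \<Longrightarrow> inner_n n (E k) (mat_vec n A (E l)) = (if k = l then 1 else 0)"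
proof -
  note AT = mat_vec_inverse[OF inv] and TA = mat_vec_inverse[OF is_inverse_mat_sym[OF inv]]
  have cT: "inner_n n x (mat_vec n T y) = inner_n n (mat_vec n A (mat_vec n T x)) (mat_vec n T y)" for x y
    by (intro inner_n_cong) (simp_all add: AT)
  have cA: "inner_n n (mat_vec n A x) y = inner_n n (mat_vec n A y) x" for x y
    using inner_n_mat_vec_comm[of n A x y, OF sym] by (simp add: inner_n_comm[of n x] inner_n_comm[of n y])
  have bT: "inner_n n x (mat_vec n T y) = inner_n n y (mat_vec n T x)" for x y
    unfolding cT[of x] cT[of y] by (rule cA)
  have symT: "T i j = T j i" if "i < n" "j < n" for i j
    using bT[of "\<lambda>d. if d = i then 1 else 0" "\<lambda>d. if d = j then 1 else 0"] that by (simp add: inner_n_unit mat_vec_unit)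
  have psdT: "0 \<le> inner_n n x (mat_vec n T x)" for x
    unfolding cT[of x] using psd[of "mat_vec n T x"] by (simp add: inner_n_comm)
  obtain E where E: "\<And>i j. i < n \<Longrightarrow> j < n \<Longrightarrow> T i j = (\<Sum>k<n. E k i * E k j)" using psd_factorization[of n T, OF symT psdT] by blast
  have gram: "(\<Sum>k<n. inner_n n (E k) x * inner_n n (E k) y) = inner_n n x (mat_vec n T y)" for x y
  proof -
    have "inner_n n x (mat_vec n T y) = (\<Sum>i<n. \<Sum>j<n. \<Sum>k<n. E k i * x i * (E k j * y j))"
      unfolding inner_n_mat_vec by (intro sum.cong refl) (simp add: E sum_distrib_left sum_distrib_right mult_ac)
    also have "\<dots> = (\<Sum>i<n. \<Sum>k<n. \<Sum>j<n. E k i * x i * (E k j * y j))" by (intro sum.cong refl sum.swap)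
    also have "\<dots> = (\<Sum>k<n. \<Sum>i<n. \<Sum>j<n. E k i * x i * (E k j * y j))" by (rule sum.swap)
    also have "\<dots> = (\<Sum>k<n. inner_n n (E k) x * inner_n n (E k) y)" by (simp add: inner_n_def sum_product)
    finally show ?thesis ..
  qed
  define M where "M k l = inner_n n (E k) (mat_vec n A (E l))" for k l
  have symM: "M k l = M l k" for k l unfolding M_def by (rule inner_n_mat_vec_comm[OF sym])
  have sqM: "(\<Sum>l<n. (M k l)\<^sup>2) = M k k" for k
  proof -
    have "(\<Sum>l<n. (M k l)\<^sup>2) = (\<Sum>l<n. inner_n n (E l) (mat_vec n A (E k)) * inner_n n (E l) (mat_vec n A (E k)))"
      by (simp add: power2_eq_square symM[of k] M_def[symmetric])
    also have "\<dots> = inner_n n (mat_vec n A (E k)) (mat_vec n T (mat_vec n A (E k)))" by (rule gram)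
    also have "\<dots> = inner_n n (mat_vec n A (E k)) (E k)" by (intro inner_n_cong) (simp_all add: TA)
    finally show ?thesis by (simp add: M_def inner_n_comm)
  qed
  have trM: "(\<Sum>k<n. M k k) = real n"
  proof -
    have "(\<Sum>k<n. M k k) = (\<Sum>k<n. \<Sum>i<n. \<Sum>j<n. E k i * A i j * E k j)" by (simp add: M_def inner_n_mat_vec)
    also have "\<dots> = (\<Sum>i<n. \<Sum>k<n. \<Sum>j<n. E k i * A i j * E k j)" by (rule sum.swap)
    also have "\<dots> = (\<Sum>i<n. \<Sum>j<n. \<Sum>k<n. E k i * A i j * E k j)" by (intro sum.cong refl sum.swap)
    also have "\<dots> = (\<Sum>i<n. \<Sum>j<n. A i j * T j i)"
    proof (intro sum.cong refl)
      fix i j assume "i \<in> {..<n}" "j \<in> {..<n}"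
      then have "T j i = (\<Sum>k<n. E k j * E k i)" by (intro E) auto
      then show "(\<Sum>k<n. E k i * A i j * E k j) = A i j * T j i" by (simp add: sum_distrib_left mult_ac)
    qed
    also have "\<dots> = (\<Sum>i<n. 1)" using inv by (intro sum.cong refl) (simp add: is_inverse_mat_def)
    finally show ?thesis by simp
  qed
  have "(\<Sum>k<n. \<Sum>l<n. ((if k = l then 1 else 0) - M k l)\<^sup>2) = 0"
  proof -
    have "(\<Sum>k<n. \<Sum>l<n. ((if k = l then 1 else 0) - M k l)\<^sup>2) = (\<Sum>k<n. \<Sum>l<n. (if k = l then 1 - 2 * M k k else 0) + (M k l)\<^sup>2)"
      by (intro sum.cong refl) (auto simp: power2_diff)
    also have "\<dots> = (\<Sum>k<n. 1 - 2 * M k k + M k k)" by (intro sum.cong refl) (simp add: sum.distrib sqM)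
    also have "\<dots> = 0" using trM by (simp add: sum_subtractf)
    finally show ?thesis .
  qed
  then have "\<forall>k<n. \<forall>l<n. ((if k = l then 1 else 0) - M k l)\<^sup>2 = 0"
    by (simp add: sum_nonneg_eq_0_iff sum_nonneg)
  then have "inner_n n (E k) (mat_vec n A (E l)) = (if k = l then 1 else 0)" if "k < n" "l < n" for k l
    using that by (auto simp: M_def)
  with gram show ?thesis using that by blast
qed

lemma class_C_second_moment:
  assumes C: "class_C n p B \<mu>"
  shows "integrable \<mu> (\<lambda>x. (inner_n n a x)\<^sup>2)" and "(\<integral>x. (inner_n n a x)\<^sup>2 \<partial>\<mu>) = inner_n n a (mat_vec n (cov_mat \<mu>) a)"
    and "i < n \<Longrightarrow> (\<lambda>x. x i) \<in> borel_measurable \<mu>"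
proof -
  interpret prob_space \<mu> using C by (simp add: class_C_def)
  have sets[measurable_cong]: "sets \<mu> = sets (PiM {..<n} (\<lambda>_. borel :: real measure))" using C by (simp add: class_C_def vec_space_def)
  have meas: "(\<lambda>x. x i) \<in> borel_measurable \<mu>" if "i < n" for i
  proof -
    have "i \<in> {..<n}" using that by simp
    then show ?thesis by measurable
  qed
  then show "i < n \<Longrightarrow> (\<lambda>x. x i) \<in> borel_measurable \<mu>" by blast
  have int: "integrable \<mu> (\<lambda>x. x i * x j)" if "i < n" "j < n" for i j
  proof (rule Bochner_Integration.integrable_bound[of _ "\<lambda>x. (x i)\<^sup>2 + (x j)\<^sup>2"])
    show "integrable \<mu> (\<lambda>x. (x i)\<^sup>2 + (x j)\<^sup>2)" using C that by (simp add: class_C_def)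
    show "(\<lambda>x. x i * x j) \<in> borel_measurable \<mu>" using meas[OF that(1)] meas[OF that(2)] by measurable
    have "\<bar>u * v\<bar> \<le> u\<^sup>2 + v\<^sup>2" for u v :: real
    proof -
      have "2 * (\<bar>u\<bar> * \<bar>v\<bar>) \<le> u\<^sup>2 + v\<^sup>2" using sum_squares_bound[of "\<bar>u\<bar>" "\<bar>v\<bar>"] by (simp only: mult.assoc power2_abs)
      moreover have "0 \<le> \<bar>u\<bar> * \<bar>v\<bar>" by simp
      ultimately show ?thesis unfolding abs_mult by linarith
    qed
    then show "AE x in \<mu>. norm (x i * x j) \<le> norm ((x i)\<^sup>2 + (x j)\<^sup>2)" by simp
  qed
  have eq: "(\<lambda>x. (inner_n n a x)\<^sup>2) = (\<lambda>x. \<Sum>i<n. \<Sum>j<n. a i * a j * (x i * x j))"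
    by (simp add: inner_n_def power2_eq_square sum_product mult_ac)
  show "integrable \<mu> (\<lambda>x. (inner_n n a x)\<^sup>2)" unfolding eq using int by (intro Bochner_Integration.integrable_sum) simp
  have "(\<integral>x. (inner_n n a x)\<^sup>2 \<partial>\<mu>) = (\<Sum>i<n. \<Sum>j<n. a i * a j * (\<integral>x. x i * x j \<partial>\<mu>))"
    unfolding eq using int by (subst Bochner_Integration.integral_sum) (auto intro!: sum.cong Bochner_Integration.integrable_sum)
  then show "(\<integral>x. (inner_n n a x)\<^sup>2 \<partial>\<mu>) = inner_n n a (mat_vec n (cov_mat \<mu>) a)" by (simp add: inner_n_mat_vec cov_mat_def mult_ac)
qed

text \<open>The coordinates of the whitened vector are \<open>inner_n n (E k) x\<close>. For the
  last property take \<open>\<alpha> = \<psi> (mat_vec n (cov_mat \<mu>) a)\<close>: every direction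
  \<open>a\<close> of the sample becomes a direction \<open>\<alpha>\<close> of the whitened sample,
  with squared norm equal to the variance in direction \<open>a\<close>. Deviations can then be
  transferred without a square root of the covariance.\<close>

lemma class_C_whitening:
  assumes C: "class_C n p B \<mu>" and inv: "invertible_n n (cov_mat \<mu>)"
  obtains \<psi> where "isotropic_class n p B \<mu> \<psi>"
    and "\<And>x. (nrm n (\<psi> x))\<^sup>2 = inner_n n x (mat_vec n (inv_n n (cov_mat \<mu>)) x)"
    and "\<And>a. \<exists>\<alpha>. (\<forall>x. inner_n n \<alpha> (\<psi> x) = inner_n n a x) \<and> (nrm n \<alpha>)\<^sup>2 = inner_n n a (mat_vec n (cov_mat \<mu>) a)"
proof -
  let ?A = "cov_mat \<mu>" and ?T = "inv_n n (cov_mat \<mu>)"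
  have T: "is_inverse_mat n ?A ?T" using inv unfolding inv_n_def invertible_n_def by (rule someI_ex)
  have sym: "?A i j = ?A j i" for i j by (simp add: cov_mat_def mult.commute)
  have psd: "0 \<le> inner_n n x (mat_vec n ?A x)" for x
    unfolding class_C_second_moment(2)[OF C, symmetric] by simp
  obtain E where gram: "\<And>x y. (\<Sum>k<n. inner_n n (E k) x * inner_n n (E k) y) = inner_n n x (mat_vec n ?T y)"
    and orth: "\<And>k l. k < n \<Longrightarrow> l < n \<Longrightarrow> inner_n n (E k) (mat_vec n ?A (E l)) = (if k = l then 1 else 0)"
    using whitening[of n ?A ?T, OF sym psd T] by blast
  define \<psi> where "\<psi> x k = inner_n n (E k) x" for x k
  have tr: "inner_n n b (\<psi> x) = inner_n n (lin n E b) x" for b x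
    unfolding inner_n_lin by (simp add: inner_n_def[of n b] \<psi>_def)
  have var: "inner_n n (lin n E b) (mat_vec n ?A (lin n E b)) = (nrm n b)\<^sup>2" for b
  proof -
    have "inner_n n (lin n E b) (mat_vec n ?A (lin n E b)) = (\<Sum>k<n. b k * inner_n n (E k) (mat_vec n ?A (lin n E b)))" by (rule inner_n_lin)
    also have "\<dots> = (\<Sum>k<n. b k * inner_n n (lin n E b) (mat_vec n ?A (E k)))" by (simp only: inner_n_mat_vec_comm[of n ?A, OF sym, of _ "lin n E b"])
    also have "\<dots> = (\<Sum>k<n. b k * (\<Sum>l<n. b l * (if l = k then 1 else 0)))" unfolding inner_n_lin by (intro sum.cong refl) (simp add: orth)
    also have "\<dots> = (nrm n b)\<^sup>2" unfolding nrm_sq by (simp add: if_distrib[where f="\<lambda>t. _ * t"] power2_eq_square cong: if_cong)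
    finally show ?thesis .
  qed
  show ?thesis
  proof (rule that)
    show "isotropic_class n p B \<mu> \<psi>"
      unfolding isotropic_class_def
    proof (intro conjI allI impI)
      show "prob_space \<mu>" using C by (simp add: class_C_def)
      show "(\<lambda>x. \<psi> x d) \<in> borel_measurable \<mu>" for d unfolding \<psi>_def inner_n_def using class_C_second_moment(3)[OF C] by (intro borel_measurable_sum borel_measurable_times borel_measurable_const) auto
      fix b
      show "integrable \<mu> (\<lambda>x. (inner_n n b (\<psi> x))\<^sup>2)" unfolding tr by (rule class_C_second_moment(1)[OF C])
      show "(\<integral>x. (inner_n n b (\<psi> x))\<^sup>2 \<partial>\<mu>) = (nrm n b)\<^sup>2" unfolding tr class_C_second_moment(2)[OF C] by (rule var)
      have "(\<integral>\<^sup>+x. ennreal (\<bar>inner_n n b (\<psi> x)\<bar> powr p) \<partial>\<mu>) \<le> ennreal (B * ((nrm n b)\<^sup>2) powr (p / 2))"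
        using C unfolding class_C_def tr var[of b, symmetric] by blast
      also have "((nrm n b)\<^sup>2) powr (p / 2) = nrm n b powr p"
      proof (cases "nrm n b = 0")
        case False
        then have "(nrm n b)\<^sup>2 = nrm n b powr 2" using nrm_nonneg[of n b] by (simp add: powr_numeral)
        then show ?thesis by (simp only: powr_powr) simp
      qed simp
      finally show "(\<integral>\<^sup>+x. ennreal (\<bar>inner_n n b (\<psi> x)\<bar> powr p) \<partial>\<mu>) \<le> ennreal (B * nrm n b powr p)" .
    qed
    show gx: "(nrm n (\<psi> x))\<^sup>2 = inner_n n x (mat_vec n ?T x)" for x
      unfolding gram[symmetric] nrm_sq unfolding \<psi>_def power2_eq_square ..
    fix a
    let ?\<alpha> = "\<psi> (mat_vec n ?A a)"
    note TA = mat_vec_inverse[OF is_inverse_mat_sym[OF T]]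
    have i: "inner_n n ?\<alpha> (\<psi> x) = inner_n n a x" for x
    proof -
      have "inner_n n ?\<alpha> (\<psi> x) = inner_n n (\<psi> x) ?\<alpha>" by (rule inner_n_comm)
      also have "\<dots> = inner_n n x (mat_vec n ?T (mat_vec n ?A a))" unfolding gram[symmetric] by (simp add: inner_n_def[of n "\<psi> x"] \<psi>_def)
      also have "\<dots> = inner_n n x a" by (intro inner_n_cong) (simp_all add: TA)
      finally show ?thesis by (simp add: inner_n_comm)
    qed
    have "(nrm n ?\<alpha>)\<^sup>2 = inner_n n a (mat_vec n ?A a)" unfolding inner_n_self[symmetric] by (rule i)
    with i show "\<exists>\<alpha>. (\<forall>x. inner_n n \<alpha> (\<psi> x) = inner_n n a x) \<and> (nrm n \<alpha>)\<^sup>2 = inner_n n a (mat_vec n ?A a)" by blast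
  qed
qed

section \<open>The spectral norm: quadratic forms and measurability\<close>

lemma spec_norm_alt: "spec_norm n A = (SUP v\<in>{v. nrm n v \<le> 1}. nrm n (mat_vec n A v))"
proof -
  have "nrm n v \<le> 1 \<longleftrightarrow> (\<Sum>j<n. (v j)\<^sup>2) \<le> 1" for v
    unfolding nrm_sq[symmetric] using abs_square_le_1[of "nrm n v"] by simp
  then show ?thesis by (simp add: spec_norm_def nrm_def L2_set_def)
qed

lemma bdd_above_spec_norm: "bdd_above ((\<lambda>v. nrm n (mat_vec n A v)) ` {v. nrm n v \<le> 1})"
proof (rule bdd_aboveI2)
  fix v assume v: "v \<in> {v. nrm n v \<le> 1}"
  have "(nrm n (mat_vec n A v))\<^sup>2 \<le> (\<Sum>i<n. (nrm n (A i))\<^sup>2)"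
    unfolding nrm_sq[of n "mat_vec n A v"]
  proof (intro sum_mono)
    fix i
    have "mat_vec n A v i = inner_n n (A i) v" by (simp add: mat_vec_def inner_n_def)
    then have "\<bar>mat_vec n A v i\<bar> \<le> nrm n (A i) * nrm n v" using inner_n_CS[of n "A i" v] by simp
    also have "\<dots> \<le> nrm n (A i) * 1" using v by (intro mult_left_mono) auto
    finally have "\<bar>mat_vec n A v i\<bar> \<le> \<bar>nrm n (A i)\<bar>" by simp
    then show "(mat_vec n A v i)\<^sup>2 \<le> (nrm n (A i))\<^sup>2" by (simp only: abs_le_square_iff)
  qed
  then show "nrm n (mat_vec n A v) \<le> sqrt (\<Sum>i<n. (nrm n (A i))\<^sup>2)" by (rule real_le_rsqrt)
qed

lemma nrm_zero: "nrm n (\<lambda>_. 0) = 0"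
  by (simp add: nrm_def L2_set_def)

lemma mat_vec_add: "mat_vec n A (\<lambda>d. u d + v d) = (\<lambda>i. mat_vec n A u i + mat_vec n A v i)"
  by (simp add: mat_vec_def distrib_left sum.distrib)

lemma mat_vec_scale: "mat_vec n A (\<lambda>d. t * v d) = (\<lambda>i. t * mat_vec n A v i)"
  by (simp add: mat_vec_def sum_distrib_left mult_ac)

lemma nrm_eq_0_iff: "nrm n v = 0 \<longleftrightarrow> (\<forall>d<n. v d = 0)"
  by (auto simp: nrm_def L2_set_eq_0_iff)

lemma nrm_mat_vec_le: "nrm n (mat_vec n A v) \<le> spec_norm n A * nrm n v"
proof (cases "nrm n v = 0")
  case True
  then have "mat_vec n A v = (\<lambda>_. 0)" by (simp add: nrm_eq_0_iff mat_vec_def)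
  then show ?thesis using True by (simp add: nrm_zero)
next
  case False
  then have v: "nrm n v > 0" using nrm_nonneg[of n v] by linarith
  let ?u = "\<lambda>d. (1 / nrm n v) * v d"
  have "nrm n ?u \<le> 1" unfolding nrm_scale using v by simp
  then have "nrm n (mat_vec n A ?u) \<le> spec_norm n A"
    unfolding spec_norm_alt using bdd_above_spec_norm by (intro cSUP_upper) auto
  then show ?thesis unfolding mat_vec_scale nrm_scale using v by (simp add: field_simps)
qed

lemma spec_norm_leI:
  assumes "\<And>v. nrm n v \<le> 1 \<Longrightarrow> nrm n (mat_vec n A v) \<le> c"
  shows "spec_norm n A \<le> c"
proof -
  have "(\<lambda>_. 0) \<in> {v. nrm n v \<le> 1}" by (simp add: nrm_zero)
  then show ?thesis unfolding spec_norm_alt using assms by (intro cSUP_least) auto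
qed

lemma spec_norm_nonneg: "spec_norm n A \<ge> 0"
proof -
  have "nrm n (mat_vec n A (\<lambda>_. 0)) \<le> spec_norm n A"
    unfolding spec_norm_alt using bdd_above_spec_norm by (intro cSUP_upper) (auto simp: nrm_zero)
  then show ?thesis using nrm_nonneg[of n "mat_vec n A (\<lambda>_. 0)"] by linarith
qed

text \<open>For the unit vector \<open>u\<close> in the direction of \<open>mat_vec n A v\<close>,
  the norm of the latter is the bilinear form at \<open>u\<close> and \<open>v\<close>. Polarisation
  reduces it to the quadratic form at \<open>u + v\<close> and \<open>u - v\<close>, and the
  parallelogram law bounds their norms.\<close>

lemma spec_norm_le_quadratic_form:
  assumes sym: "\<And>i j. i < n \<Longrightarrow> j < n \<Longrightarrow> A i j = A j i"
    and q: "\<And>a. \<bar>inner_n n a (mat_vec n A a)\<bar> \<le> c * (nrm n a)\<^sup>2" and c: "c \<ge> 0"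
  shows "spec_norm n A \<le> c"
proof (rule spec_norm_leI)
  fix v assume v: "nrm n v \<le> 1"
  define w where "w = mat_vec n A v"
  show "nrm n (mat_vec n A v) \<le> c"
  proof (cases "nrm n w = 0")
    case True
    then show ?thesis using c by (simp add: w_def)
  next
    case False
    then have w: "nrm n w > 0" using nrm_nonneg[of n w] by linarith
    define u where "u d = (1 / nrm n w) * w d" for d
    have u: "nrm n u = 1" unfolding u_def nrm_scale using w by simp
    have "inner_n n u w = nrm n w" unfolding u_def inner_n_scale_left using w by (simp add: inner_n_self power2_eq_square)
    define Q where "Q x y = inner_n n x (mat_vec n A y)" for x y
    have Quv: "Q u v = nrm n w" "Q v u = nrm n w"
      using \<open>inner_n n u w = nrm n w\<close> inner_n_mat_vec_comm[of n A u v, OF sym] by (simp_all add: Q_def w_def)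
    have Qadd: "Q (\<lambda>d. x d + t * y d) (\<lambda>d. x d + t * y d) = Q x x + t * Q x y + t * Q y x + t * t * Q y y" for x y t
      unfolding Q_def mat_vec_add mat_vec_scale inner_n_add_left inner_n_scale_left
      by (simp add: inner_n_comm[of n x "\<lambda>i. _ i + _ * _ i"] inner_n_comm[of n y "\<lambda>i. _ i + _ * _ i"] inner_n_add_left inner_n_scale_left algebra_simps inner_n_comm)
    have Nadd: "(nrm n (\<lambda>d. u d + 1 * v d))\<^sup>2 + (nrm n (\<lambda>d. u d + (-1) * v d))\<^sup>2 = 2 * (nrm n u)\<^sup>2 + 2 * (nrm n v)\<^sup>2"
      by (simp add: nrm_sq power2_sum power2_diff sum.distrib sum_subtractf sum_distrib_left)
    have "4 * nrm n w = Q (\<lambda>d. u d + 1 * v d) (\<lambda>d. u d + 1 * v d) - Q (\<lambda>d. u d + (-1) * v d) (\<lambda>d. u d + (-1) * v d)"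
      unfolding Qadd Quv by simp
    also have "\<dots> \<le> c * (nrm n (\<lambda>d. u d + 1 * v d))\<^sup>2 + c * (nrm n (\<lambda>d. u d + (-1) * v d))\<^sup>2"
      using q[of "\<lambda>d. u d + 1 * v d"] q[of "\<lambda>d. u d + (-1) * v d"] unfolding Q_def abs_le_iff by linarith
    also have "\<dots> = c * (2 * (nrm n u)\<^sup>2 + 2 * (nrm n v)\<^sup>2)" unfolding Nadd[symmetric] by (rule distrib_left[symmetric])
    also have "\<dots> \<le> c * (2 * 1 + 2 * 1)" using u v c by (intro mult_left_mono add_mono) (auto simp: power_le_one)
    finally show ?thesis by (simp add: w_def)
  qed
qed

text \<open>The supremum is replaced by one over the countable set of rational vectors. Quotients of
  norms are used since rational vectors cannot be normalised within the set; a vector of norm 0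
  yields the quotient 0.\<close>

lemma borel_measurable_spec_norm:
  assumes A: "\<And>i j. i < n \<Longrightarrow> j < n \<Longrightarrow> (\<lambda>x. A x i j) \<in> borel_measurable M"
  shows "(\<lambda>x. spec_norm n (A x)) \<in> borel_measurable M"
proof -
  define D :: "(nat \<Rightarrow> real) set" where "D = PiE {..<n} (\<lambda>_. \<rat>)"
  have D: "countable D" unfolding D_def by (intro countable_PiE) (auto simp: countable_rat)
  have D0: "(\<lambda>d. if d < n then 0 else undefined) \<in> D" by (auto simp: D_def PiE_iff extensional_def)
  have le: "nrm n (mat_vec n A q) / nrm n q \<le> spec_norm n A" for A q
  proof (cases "nrm n q = 0")
    case False
    then have "nrm n q > 0" using nrm_nonneg[of n q] by linarith
    then show ?thesis using nrm_mat_vec_le[of n A q] by (simp add: pos_divide_le_eq)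
  qed (simp add: spec_norm_nonneg)
  have bdd: "bdd_above ((\<lambda>q. nrm n (mat_vec n A q) / nrm n q) ` D)" for A
    by (rule bdd_aboveI2[OF le])
  have eq: "spec_norm n A = (SUP q\<in>D. nrm n (mat_vec n A q) / nrm n q)" for A
  proof (rule antisym)
    show "(SUP q\<in>D. nrm n (mat_vec n A q) / nrm n q) \<le> spec_norm n A" using D0 le by (intro cSUP_least) auto
    define S where "S = (SUP q\<in>D. nrm n (mat_vec n A q) / nrm n q)"
    have ub: "nrm n (mat_vec n A q) / nrm n q \<le> S" if "q \<in> D" for q
      unfolding S_def by (rule cSUP_upper[OF that bdd])
    have ub': "nrm n (mat_vec n A q) \<le> S * nrm n q" if "q \<in> D" for q
    proof (cases "nrm n q = 0")
      case True
      then show ?thesis using nrm_mat_vec_le[of n A q] by simp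
    next
      case False
      then have "nrm n q > 0" using nrm_nonneg[of n q] by linarith
      then show ?thesis using ub[OF that] by (simp add: pos_divide_le_eq)
    qed
    have S0: "S \<ge> 0" using ub[OF D0] by (rule order_trans[rotated]) simp
    have "spec_norm n A \<le> S"
    proof (rule spec_norm_leI, rule field_le_epsilon)
      fix v and e :: real assume v: "nrm n v \<le> 1" and e: "0 < e"
      \<comment> \<open>Chosen such that an error of \<open>e / K\<close> in each of
        \<open>n\<close> coordinates, multiplied by \<open>S + spec_norm n A\<close>, costs at most
        \<open>e\<close>; the added ones keep it positive.\<close>
      define K where "K = (S + spec_norm n A + 1) * (real n + 1)"
      have K: "K > 0" using S0 spec_norm_nonneg[of n A] by (simp add: K_def)
      have "\<exists>r\<in>\<rat>. v d < r \<and> r < v d + e / K" for d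
        using Rats_dense_in_real[of "v d" "v d + e / K"] e K by auto
      then obtain r where r: "\<And>d. r d \<in> \<rat>" "\<And>d. v d < r d" "\<And>d. r d < v d + e / K" by metis
      define q where "q = restrict r {..<n}"
      have qD: "q \<in> D" using r by (auto simp: D_def q_def)
      define f where "f d = v d - q d" for d
      have f: "nrm n f \<le> real n * (e / K)"
      proof -
        have "nrm n f \<le> (\<Sum>d<n. \<bar>f d\<bar>)" unfolding nrm_def by (rule L2_set_le_sum_abs)
        also have "\<dots> \<le> (\<Sum>d<n. e / K)"
        proof (intro sum_mono)
          fix d assume "d \<in> {..<n}"
          then show "\<bar>f d\<bar> \<le> e / K" using r(2)[of d] r(3)[of d] by (simp add: f_def q_def)
        qed
        finally show ?thesis by simp
      qed
      have "mat_vec n A v = (\<lambda>i. mat_vec n A q i + mat_vec n A f i)" unfolding mat_vec_add[symmetric] by (simp add: f_def)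
      then have t: "nrm n (mat_vec n A v) \<le> nrm n (mat_vec n A q) + nrm n (mat_vec n A f)" by (simp add: nrm_triangle)
      have "q = (\<lambda>d. v d + (-1) * f d)" by (auto simp: f_def)
      then have "nrm n q \<le> nrm n v + nrm n (\<lambda>d. (-1) * f d)" using nrm_triangle[of n v "\<lambda>d. (-1) * f d"] by (simp only:)
      then have t': "nrm n q \<le> nrm n v + nrm n f" by (simp only: nrm_scale abs_minus abs_one mult_1_left)
      have "nrm n (mat_vec n A v) \<le> S * nrm n q + spec_norm n A * nrm n f"
        using t ub'[OF qD] nrm_mat_vec_le[of n A f] by linarith
      also have "\<dots> \<le> S * (1 + nrm n f) + spec_norm n A * nrm n f"
        using t' v S0 by (intro add_right_mono mult_left_mono) auto
      also have "\<dots> = S + (S + spec_norm n A) * nrm n f" by (simp add: algebra_simps)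
      also have "\<dots> \<le> S + (S + spec_norm n A + 1) * ((real n + 1) * (e / K))"
      proof (intro add_left_mono mult_mono)
        have "real n * (e / K) \<le> (real n + 1) * (e / K)" using e K by (intro mult_right_mono) auto
        then show "nrm n f \<le> (real n + 1) * (e / K)" using f by linarith
      qed (use S0 spec_norm_nonneg[of n A] in auto)
      also have "(S + spec_norm n A + 1) * ((real n + 1) * (e / K)) = K * (e / K)" by (simp only: K_def mult.assoc)
      also have "K * (e / K) = e" using K by simp
      finally show "nrm n (mat_vec n A v) \<le> S + e" .
    qed
    then show "spec_norm n A \<le> (SUP q\<in>D. nrm n (mat_vec n A q) / nrm n q)" by (simp add: S_def)
  qed
  show ?thesis
    unfolding eq
  proof (rule borel_measurable_cSUP[OF D])
    fix q
    show "(\<lambda>x. nrm n (mat_vec n (A x) q) / nrm n q) \<in> borel_measurable M"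
      unfolding nrm_def L2_set_def mat_vec_def using A
      by (intro borel_measurable_divide borel_measurable_const borel_measurable_sqrt borel_measurable_sum borel_measurable_power borel_measurable_times) auto
  qed (rule bdd)
qed

section \<open>The deviation bound for the class and the choice of \<nu>\<close>

lemma class_C_deviation:
  assumes \<gamma>0: "\<gamma>0 > 0"
  shows "\<exists>C>0. \<forall>p c B n N \<mu>. p > 2 \<longrightarrow> \<gamma>0 \<le> 1/2 - 1/p \<longrightarrow> c \<ge> C \<longrightarrow> B \<ge> 1 \<longrightarrow> n \<ge> 1 \<longrightarrow> N \<ge> 2 * n \<longrightarrow> class_C n p B \<mu> \<longrightarrow> invertible_n n (cov_mat \<mu>) \<longrightarrow>
       measure (PiM {..<N} (\<lambda>_. \<mu>))
         {xs \<in> space (PiM {..<N} (\<lambda>_. \<mu>)).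
            inverse c *
              (spec_norm n (\<lambda>i j. emp_cov N xs i j - cov_mat \<mu> i j) / spec_norm n (cov_mat \<mu>))
            \<le> (1 / real N) * (MAX k\<in>{..<N}. inner_n n (xs k) (mat_vec n (inv_n n (cov_mat \<mu>)) (xs k)))
              + B powr (2 / p) * (real n / real N) powr ((p - 2) / p) * (ln (real N / real n)) ^ 4
              + B powr (2 / p) * (real n / real N) powr ((min p 4 - 2) / min p 4)}
       \<ge> 1 - 1 / real n"
proof -
  obtain C where C: "C > 0" and conc: "\<forall>p B n N (\<mu> :: (nat \<Rightarrow> real) measure) \<psi>. p > 2 \<longrightarrow> \<gamma>0 \<le> 1/2 - 1/p \<longrightarrow> B \<ge> 1 \<longrightarrow> 1 \<le> n \<longrightarrow> 2 * n \<le> N \<longrightarrow> isotropic_class n p B \<mu> \<psi> \<longrightarrow>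
     (\<exists>F\<in>sets (PiM {..<N} (\<lambda>_. \<mu>)). measure (PiM {..<N} (\<lambda>_. \<mu>)) F \<le> 1 / real n \<and>
        (\<forall>xs\<in>space (PiM {..<N} (\<lambda>_. \<mu>)) - F. \<forall>M. (\<forall>i<N. (nrm n (\<psi> (xs i)))\<^sup>2 \<le> M) \<longrightarrow>
           (\<forall>b. \<bar>quad_dev n N (\<lambda>k. \<psi> (xs k)) b\<bar> \<le> C * (M + real N * (B powr (2/p) * (real n / real N) powr ((p - 2) / p) * (ln (real N / real n)) ^ 4
             + B powr (2/p) * (real n / real N) powr ((min p 4 - 2) / min p 4))) * (nrm n b)\<^sup>2)))"
    by (rule exE[OF isotropic_concentration[OF \<gamma>0]], erule conjE, rule that)
  show ?thesis
  proof (intro exI[of _ C] conjI C allI impI)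
    fix p c B :: real and n N :: nat and \<mu> :: "(nat \<Rightarrow> real) measure"
    assume p: "p > 2" and g: "\<gamma>0 \<le> 1/2 - 1/p" and c: "c \<ge> C" and B: "B \<ge> 1" and n: "n \<ge> 1" and N: "N \<ge> 2 * n" and cl: "class_C n p B \<mu>" and inv: "invertible_n n (cov_mat \<mu>)"
    let ?P = "PiM {..<N} (\<lambda>_. \<mu>)" and ?\<Sigma> = "cov_mat \<mu>" and ?T = "inv_n n (cov_mat \<mu>)"
    define D where "D xs = (\<lambda>i j. emp_cov N xs i j - ?\<Sigma> i j)" for xs
    define M where "M xs = (MAX k\<in>{..<N}. inner_n n (xs k) (mat_vec n ?T (xs k)))" for xs
    define t1 where "t1 = B powr (2 / p) * (real n / real N) powr ((p - 2) / p) * (ln (real N / real n)) ^ 4"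
    define t2 where "t2 = B powr (2 / p) * (real n / real N) powr ((min p 4 - 2) / min p 4)"
    define S where "S = {xs \<in> space ?P. inverse c * (spec_norm n (D xs) / spec_norm n ?\<Sigma>) \<le> (1 / real N) * M xs + t1 + t2}"
    interpret prob_space \<mu> using cl by (simp add: class_C_def)
    interpret P: prob_space ?P by (intro prob_space_PiM prob_space_axioms)
    have N0: "N > 0" "real N > 0" using n N by auto
    have c0: "c > 0" using C c by linarith
    have coord[measurable]: "(\<lambda>xs. xs k i) \<in> borel_measurable ?P" if "k < N" "i < n" for k i
      using class_C_second_moment(3)[OF cl that(2)] measurable_component_singleton[of k "{..<N}" "\<lambda>_. \<mu>"] that(1) by (auto intro: measurable_compose)
    have D_meas: "(\<lambda>xs. spec_norm n (D xs)) \<in> borel_measurable ?P"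
    proof (rule borel_measurable_spec_norm)
      show "(\<lambda>xs. D xs i j) \<in> borel_measurable ?P" if "i < n" "j < n" for i j
        unfolding D_def emp_cov_def using coord that
        by (intro borel_measurable_diff borel_measurable_const borel_measurable_times borel_measurable_sum) auto
    qed
    have M_meas: "M \<in> borel_measurable ?P"
      unfolding M_def
    proof (rule borel_measurable_Max)
      show "(\<lambda>xs. inner_n n (xs k) (mat_vec n ?T (xs k))) \<in> borel_measurable ?P" if "k \<in> {..<N}" for k
        unfolding inner_n_mat_vec using coord that
        by (intro borel_measurable_const borel_measurable_times borel_measurable_sum) auto
    qed simp
    \<comment> \<open>\<open>measure\<close> is 0 on non-measurable sets, so it is not enough that
      the event contains a likely one: it has to be measurable itself.\<close>
    have S_meas: "S \<in> sets ?P"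
      unfolding S_def using D_meas M_meas by measurable
    obtain \<psi> where iso: "isotropic_class n p B \<mu> \<psi>"
      and nrm_\<psi>: "\<And>x. (nrm n (\<psi> x))\<^sup>2 = inner_n n x (mat_vec n ?T x)"
      and dual: "\<And>a. \<exists>\<alpha>. (\<forall>x. inner_n n \<alpha> (\<psi> x) = inner_n n a x) \<and> (nrm n \<alpha>)\<^sup>2 = inner_n n a (mat_vec n ?\<Sigma> a)"
      using class_C_whitening[OF cl inv] by blast
    obtain F where F: "F \<in> sets ?P" "P.prob F \<le> 1 / real n"
      and good: "\<forall>xs\<in>space ?P - F. \<forall>M. (\<forall>i<N. (nrm n (\<psi> (xs i)))\<^sup>2 \<le> M) \<longrightarrow>
        (\<forall>b. \<bar>quad_dev n N (\<lambda>k. \<psi> (xs k)) b\<bar> \<le> C * (M + real N * (t1 + t2)) * (nrm n b)\<^sup>2)"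
      by (rule bexE[OF conc[rule_format, OF p g B n N iso, folded t1_def t2_def]], erule conjE, rule that)
    have sub: "space ?P - F \<subseteq> S"
    proof
      fix xs assume xs: "xs \<in> space ?P - F"
      define R where "R = M xs + real N * (t1 + t2)"
      have le_M: "(nrm n (\<psi> (xs k)))\<^sup>2 \<le> M xs" if "k < N" for k
        unfolding nrm_\<psi> M_def using that by (intro Max_ge) auto
      then have M0: "M xs \<ge> 0" using le_M[of 0] N0 zero_le_power2[of "nrm n (\<psi> (xs 0))"] by linarith
      have t0: "t1 \<ge> 0" "t2 \<ge> 0" using B n N by (auto simp: t1_def t2_def)
      have R0: "R \<ge> 0" using M0 t0 by (simp add: R_def)
      have "spec_norm n (D xs) \<le> C * R / real N * spec_norm n ?\<Sigma>"
      proof (rule spec_norm_le_quadratic_form)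
        show "D xs i j = D xs j i" for i j by (simp add: D_def emp_cov_def cov_mat_def mult.commute)
        show "C * R / real N * spec_norm n ?\<Sigma> \<ge> 0" using C R0 spec_norm_nonneg by simp
        fix a
        obtain \<alpha> where \<alpha>: "\<And>x. inner_n n \<alpha> (\<psi> x) = inner_n n a x" "(nrm n \<alpha>)\<^sup>2 = inner_n n a (mat_vec n ?\<Sigma> a)" using dual[of a] by blast
        have emp: "inner_n n a (mat_vec n (emp_cov N xs) a) = (\<Sum>k<N. (inner_n n a (xs k))\<^sup>2) / real N"
        proof -
          have "(\<Sum>k<N. (inner_n n a (xs k))\<^sup>2) = (\<Sum>k<N. \<Sum>i<n. \<Sum>j<n. a i * xs k i * (a j * xs k j))"
            by (simp add: inner_n_def power2_eq_square sum_product)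
          also have "\<dots> = (\<Sum>i<n. \<Sum>k<N. \<Sum>j<n. a i * xs k i * (a j * xs k j))" by (rule sum.swap)
          also have "\<dots> = (\<Sum>i<n. \<Sum>j<n. \<Sum>k<N. a i * xs k i * (a j * xs k j))" by (intro sum.cong refl sum.swap)
          also have "\<dots> / real N = inner_n n a (mat_vec n (emp_cov N xs) a)"
            unfolding inner_n_mat_vec emp_cov_def sum_divide_distrib by (intro sum.cong refl) (simp add: sum_distrib_left sum_distrib_right sum_divide_distrib mult_ac)
          finally show ?thesis ..
        qed
        have "inner_n n a (mat_vec n (D xs) a) = inner_n n a (mat_vec n (emp_cov N xs) a) - inner_n n a (mat_vec n ?\<Sigma> a)"
          unfolding inner_n_mat_vec D_def sum_subtractf[symmetric] by (intro sum.cong refl) (simp add: algebra_simps)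
        also have "\<dots> = quad_dev n N (\<lambda>k. \<psi> (xs k)) \<alpha> / real N"
          unfolding emp quad_dev_def \<alpha> using N0 by (simp add: field_simps)
        finally have "\<bar>inner_n n a (mat_vec n (D xs) a)\<bar> = \<bar>quad_dev n N (\<lambda>k. \<psi> (xs k)) \<alpha>\<bar> / real N" by simp
        also have "\<dots> \<le> C * R * (nrm n \<alpha>)\<^sup>2 / real N"
          unfolding R_def using le_M N0 by (intro divide_right_mono good[rule_format, OF xs]) auto
        also have "\<dots> = C * R / real N * inner_n n a (mat_vec n ?\<Sigma> a)" unfolding \<alpha>(2) by simp
        also have "\<dots> \<le> C * R / real N * (spec_norm n ?\<Sigma> * (nrm n a)\<^sup>2)"
        proof (intro mult_left_mono)
          have "inner_n n a (mat_vec n ?\<Sigma> a) \<le> nrm n a * nrm n (mat_vec n ?\<Sigma> a)" using inner_n_CS[of n a "mat_vec n ?\<Sigma> a"] by linarith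
          also have "\<dots> \<le> nrm n a * (spec_norm n ?\<Sigma> * nrm n a)" by (intro mult_left_mono nrm_mat_vec_le) auto
          finally show "inner_n n a (mat_vec n ?\<Sigma> a) \<le> spec_norm n ?\<Sigma> * (nrm n a)\<^sup>2" by (simp add: power2_eq_square mult_ac)
        qed (use C R0 in auto)
        finally show "\<bar>inner_n n a (mat_vec n (D xs) a)\<bar> \<le> C * R / real N * spec_norm n ?\<Sigma> * (nrm n a)\<^sup>2" by (simp add: mult.assoc)
      qed
      note bound = this
      have "spec_norm n (D xs) / spec_norm n ?\<Sigma> \<le> C * R / real N"
      proof (cases "spec_norm n ?\<Sigma> = 0")
        case True
        then show ?thesis using C R0 by simp
      next
        case False
        then have "spec_norm n ?\<Sigma> > 0" using spec_norm_nonneg[of n ?\<Sigma>] by linarith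
        then show ?thesis using bound by (simp only: pos_divide_le_eq)
      qed
      also have "\<dots> \<le> c * R / real N" using c R0 by (intro divide_right_mono mult_right_mono) auto
      finally have "inverse c * (spec_norm n (D xs) / spec_norm n ?\<Sigma>) \<le> inverse c * (c * R / real N)" using c0 by (intro mult_left_mono) auto
      also have "\<dots> = R / real N" using c0 by simp
      also have "\<dots> = (1 / real N) * M xs + t1 + t2" using N0 by (simp add: R_def add_divide_distrib)
      finally show "xs \<in> S" using xs by (simp add: S_def)
    qed
    have "P.prob (space ?P - F) \<le> P.prob S" by (rule P.finite_measure_mono[OF sub S_meas])
    moreover have "P.prob (space ?P - F) = 1 - P.prob F" using F(1) by (rule P.prob_compl)
    ultimately have "1 - 1 / real n \<le> P.prob S" using F(2) by linarith
    then show "1 - 1 / real n \<le> P.prob {xs \<in> space ?P.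
            inverse c * (spec_norm n (\<lambda>i j. emp_cov N xs i j - cov_mat \<mu> i j) / spec_norm n (cov_mat \<mu>))
            \<le> (1 / real N) * (MAX k\<in>{..<N}. inner_n n (xs k) (mat_vec n (inv_n n (cov_mat \<mu>)) (xs k)))
              + B powr (2 / p) * (real n / real N) powr ((p - 2) / p) * (ln (real N / real n)) ^ 4
              + B powr (2 / p) * (real n / real N) powr ((min p 4 - 2) / min p 4)}"
      unfolding S_def D_def M_def t1_def t2_def .
  qed
qed

theorem theorem1p1:
  shows "\<exists>\<nu> :: real \<Rightarrow> real.
    (\<forall>x y. 2 < x \<longrightarrow> x \<le> y \<longrightarrow> \<nu> y \<le> \<nu> x) \<and> (\<forall>x>2. \<nu> x > 0) \<and>
    (\<forall>p B (n::nat) (N::nat) \<mu>.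
       p > 2 \<longrightarrow> B \<ge> 1 \<longrightarrow> n \<ge> 1 \<longrightarrow> N \<ge> 2 * n \<longrightarrow>
       class_C n p B \<mu> \<longrightarrow> invertible_n n (cov_mat \<mu>) \<longrightarrow>
       measure (PiM {..<N} (\<lambda>_. \<mu>))
         {xs \<in> space (PiM {..<N} (\<lambda>_. \<mu>)).
            inverse (\<nu> p) *
              (spec_norm n (\<lambda>i j. emp_cov N xs i j - cov_mat \<mu> i j) / spec_norm n (cov_mat \<mu>))
            \<le> (1 / real N) * (MAX k\<in>{..<N}. inner_n n (xs k) (mat_vec n (inv_n n (cov_mat \<mu>)) (xs k)))
              + B powr (2 / p) * (real n / real N) powr ((p - 2) / p) * (ln (real N / real n)) ^ 4
              + B powr (2 / p) * (real n / real N) powr ((min p 4 - 2) / min p 4)}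
       \<ge> 1 - 1 / real n)"
proof -
  define event :: "real \<Rightarrow> real \<Rightarrow> real \<Rightarrow> nat \<Rightarrow> nat \<Rightarrow> (nat \<Rightarrow> real) measure \<Rightarrow> real" where "event p c B n N \<mu> =
       measure (PiM {..<N} (\<lambda>_. \<mu>))
         {xs \<in> space (PiM {..<N} (\<lambda>_. \<mu>)).
            inverse c *
              (spec_norm n (\<lambda>i j. emp_cov N xs i j - cov_mat \<mu> i j) / spec_norm n (cov_mat \<mu>))
            \<le> (1 / real N) * (MAX k\<in>{..<N}. inner_n n (xs k) (mat_vec n (inv_n n (cov_mat \<mu>)) (xs k)))
              + B powr (2 / p) * (real n / real N) powr ((p - 2) / p) * (ln (real N / real n)) ^ 4
              + B powr (2 / p) * (real n / real N) powr ((min p 4 - 2) / min p 4)}" for p c B n N \<mu>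
  define good where "good p c \<longleftrightarrow> (\<forall>B (n::nat) (N::nat) \<mu>. B \<ge> 1 \<longrightarrow> n \<ge> 1 \<longrightarrow> N \<ge> 2 * n \<longrightarrow>
       class_C n p B \<mu> \<longrightarrow> invertible_n n (cov_mat \<mu>) \<longrightarrow> event p c B n N \<mu> \<ge> 1 - 1 / real n)" for p c
  \<comment> \<open>Constants that work for all exponents from \<open>x\<close> on. These sets grow
    with \<open>x\<close>, so their infima do not increase.\<close>
  define V where "V x = {C. C > 0 \<and> (\<forall>p\<ge>x. \<forall>c\<ge>C. good p c)}" for x
  \<comment> \<open>The added 1 makes the value positive and leaves a member of \<open>V x\<close>
    strictly below it, whether or not the infimum is attained.\<close>
  define \<nu> where "\<nu> x = Inf (V x) + 1" for x
  have V: "V x \<noteq> {}" if x: "x > 2" for x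
  proof -
    have g0: "1/2 - 1/x > 0" using x by (simp add: field_simps)
    obtain C where C: "C > 0" and *: "\<forall>p c B n N \<mu>. p > 2 \<longrightarrow> 1/2 - 1/x \<le> 1/2 - 1/p \<longrightarrow> c \<ge> C \<longrightarrow> B \<ge> 1 \<longrightarrow> n \<ge> 1 \<longrightarrow> N \<ge> 2 * n \<longrightarrow> class_C n p B \<mu> \<longrightarrow> invertible_n n (cov_mat \<mu>) \<longrightarrow>
       event p c B n N \<mu> \<ge> 1 - 1 / real n"
      by (rule exE[OF class_C_deviation[OF g0, folded event_def]], erule conjE, rule that)
    have "good p c" if "p \<ge> x" "c \<ge> C" for p c unfolding good_def
    proof (intro allI impI)
      fix B :: real and n N :: nat and \<mu>
      assume "B \<ge> 1" "n \<ge> 1" "N \<ge> 2 * n" "class_C n p B \<mu>" "invertible_n n (cov_mat \<mu>)"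
      moreover have "p > 2" "1/2 - 1/x \<le> 1/2 - 1/p" using that x by (auto intro!: divide_left_mono)
      ultimately show "event p c B n N \<mu> \<ge> 1 - 1 / real n" using *[rule_format, of p c] that(2) by simp
    qed
    then show ?thesis using C by (auto simp: V_def)
  qed
  have bdd: "bdd_below (V x)" for x by (intro bdd_belowI[of _ 0]) (auto simp: V_def)
  have pos: "\<nu> x > 0" if "x > 2" for x
  proof -
    have "0 \<le> Inf (V x)" by (rule cInf_greatest[OF V[OF that]]) (auto simp: V_def)
    then show ?thesis by (simp add: \<nu>_def)
  qed
  have mono: "\<nu> y \<le> \<nu> x" if "2 < x" "x \<le> y" for x y
  proof -
    have "V x \<subseteq> V y" using that by (auto simp: V_def)
    then show ?thesis using cInf_superset_mono[OF V[OF that(1)] bdd[of y]] by (simp add: \<nu>_def)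
  qed
  have "good p (\<nu> p)" if p: "p > 2" for p
  proof -
    have "Inf (V p) < \<nu> p" by (simp add: \<nu>_def)
    then obtain C where "C \<in> V p" "C < \<nu> p" using cInf_lessD[OF V[OF p]] by blast
    then show ?thesis by (auto simp: V_def)
  qed
  then show ?thesis using mono pos unfolding good_def event_def by (intro exI[of _ \<nu>]) blast
qed

end
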